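(* Let $d\geq 2$, $0<p<p_c(d)$ and $\mathbf{x}=(x_1,x_2,x_3)\in X_3'$. For any $\varepsilon\in(0,\frac12)$ and any $\beta\in(0,\frac12)$ there exists a constant $c''>0$ such that for all sufficiently large integers $N$ and all $k_1,k_2\in\mathbb{Z}^d$ satisfying $\xi_p(k_1-Nx_0(\mathbf{x}))\leq N^{\frac12+\varepsilon}$, $\xi_p(k_2-Nx_0(\mathbf{x}))\leq N^{\frac12+\varepsilon}$ and $\|k_1-k_2\|>N^\beta$, $$\mathbb{P}_p\left[F(k_1;[N\mathbf{x}])\cap F(k_2;[N\mathbf{x}])\right]\leq e^{-N\varphi_{p,\mathbf{x}}(x_0(\mathbf{x}))-c''N^{\beta\wedge 2\varepsilon}}.$$
   Context: Bernoulli bond percolation on $\mathbb{Z}^d$ (nearest-neighbour bonds), with law $\mathbb{P}_p$: each bond is open independently with probability $p$; $p_c(d)$ is the critical probability. $(\cdot,\cdot)$ is the Euclidean scalar product and $\|\cdot\|$ the Euclidean norm. $k\leftrightarrow n$ means that there is a path of open bonds from $k$ to $n$. For $x\in\mathbb{R}^d$, $[x]$ is the componentwise integer part, and $[N\mathbf{x}]=([Nx_1],[Nx_2],[Nx_3])$ for $\mathbf{x}=(x_1,x_2,x_3)\in(\mathbb{R}^d)^3$. $a\wedge b=\min(a,b)$. The inverse connection length is $\xi_p(x):=-\lim_{N\uparrow\infty}\frac1N\log\mathbb{P}_p\{0\leftrightarrow[Nx]\}$. For $0<p<p_c(d)$ it is a norm on $\mathbb{R}^d$ (finite, convex, homogeneous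 of order one, equivalent to the Euclidean norm) and is real analytic away from the origin (known). Let $\mathbf{K}^p:=\bigcap_{\|x\|=1}\{t\in\mathbb{R}^d:(t,x)\leq\xi_p(x)\}$. Let $X_3:=\{(x_1,x_2,x_3)\in\mathbb{R}^{3d}: x_i\neq x_j \text{ if } i\neq j\}$, and let $X_3'$ be the set of $\mathbf{x}\in X_3$ such that $\sum_{j\neq i}\nabla\xi_p(x_j-x_i)\notin\mathbf{K}^p$ for every $i=1,2,3$. For $\mathbf{x}\in X_3'$ put $\varphi_{p,\mathbf{x}}(x):=\sum_{i=1}^3\xi_p(x-x_i)$, a convex function with a unique minimizer, denoted $x_0(\mathbf{x})$, which does not coincide with any $x_i$. For three distinct vertices $\mathbf{n}=(n_1,n_2,n_3)$ of $\mathbb{Z}^d$ and $k\in\mathbb{Z}^d$, $F(k;\mathbf{n})$ is the event that $k$ is connected to $n_1,n_2,n_3$ respectively by three self-avoiding open paths $\gamma_1,\gamma_2,\gamma_3$ which are disjoint (i.e. pairwise share only the vertex $k$). *)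

theory Defs
  imports "HOL-Probability.Probability"
begin

section \<open>Bernoulli bond percolation on the cubic lattice\<close>

text \<open>The dimension \<open>d\<close> is \<open>CARD('d)\<close>; vertices have type \<^typ>\<open>int ^ 'd\<close>.\<close>

definition vec_of_int :: "int ^ 'd \<Rightarrow> real ^ 'd" where
  "vec_of_int k = (\<chi> i. real_of_int (k $ i))"

definition int_part :: "real ^ 'd \<Rightarrow> int ^ 'd" where
  "int_part x = (\<chi> i. \<lfloor>x $ i\<rfloor>)"

definition bonds :: "(int ^ 'd::finite) set set" where
  "bonds = {{u, v} | u v. norm (vec_of_int u - vec_of_int v) = 1}"

text \<open>In a configuration \<open>\<omega>\<close>, the bond \<open>b\<close> is open iff \<open>\<omega> b\<close> holds.\<close>

definition percolation :: "real \<Rightarrow> ((int ^ 'd::finite) set \<Rightarrow> bool) measure" where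
  "percolation p = (\<Pi>\<^sub>M b\<in>bonds. measure_pmf (bernoulli_pmf p))"

definition open_path ::
    "((int ^ 'd::finite) set \<Rightarrow> bool) \<Rightarrow> int ^ 'd \<Rightarrow> int ^ 'd \<Rightarrow> (int ^ 'd) list \<Rightarrow> bool" where
  "open_path \<omega> k n \<gamma> \<longleftrightarrow>
     \<gamma> \<noteq> [] \<and> hd \<gamma> = k \<and> last \<gamma> = n \<and>
     successively (\<lambda>u v. {u, v} \<in> bonds \<and> \<omega> {u, v}) \<gamma>"

definition connected_in ::
    "((int ^ 'd::finite) set \<Rightarrow> bool) \<Rightarrow> int ^ 'd \<Rightarrow> int ^ 'd \<Rightarrow> bool" where
  "connected_in \<omega> k n \<longleftrightarrow> (\<exists>\<gamma>. open_path \<omega> k n \<gamma>)"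

definition connection_prob :: "real \<Rightarrow> int ^ 'd::finite \<Rightarrow> int ^ 'd \<Rightarrow> real" where
  "connection_prob p k n =
     measure (percolation p) {\<omega> \<in> space (percolation p). connected_in \<omega> k n}"

definition percolation_prob :: "'d::finite itself \<Rightarrow> real \<Rightarrow> real" where
  "percolation_prob _ p =
     measure (percolation p)
       {\<omega> \<in> space (percolation p). infinite {n :: int ^ 'd. connected_in \<omega> 0 n}}"

definition critical_prob :: "'d::finite itself \<Rightarrow> real" where
  "critical_prob D = Sup {p \<in> {0..1}. percolation_prob D p = 0}"


section \<open>Inverse connection length\<close>

text \<open>If the limit does not exist, the value is unspecified; for
  \<open>0 < p < critical_prob TYPE('d)\<close> it exists for every \<open>x\<close> by subadditivity.\<close>

definition inv_conn_length :: "real \<Rightarrow> real ^ 'd::finite \<Rightarrow> real" where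
  "inv_conn_length p x =
     - lim (\<lambda>N::nat. 1 / real N * ln (connection_prob p 0 (int_part (real N *\<^sub>R x))))"

definition gradient :: "('a::real_inner \<Rightarrow> real) \<Rightarrow> 'a \<Rightarrow> 'a" where
  "gradient f x = (THE D. GDERIV f x :> D)"

definition K_set :: "real \<Rightarrow> (real ^ 'd::finite) set" where
  "K_set p = (\<Inter>x\<in>sphere 0 1. {t. t \<bullet> x \<le> inv_conn_length p x})"


section \<open>Triples of points\<close>

definition X3 :: "((real ^ 'd) ^ 3) set" where
  "X3 = {x. \<forall>i j. i \<noteq> j \<longrightarrow> x $ i \<noteq> x $ j}"

definition X3' :: "real \<Rightarrow> ((real ^ 'd::finite) ^ 3) set" where
  "X3' p = {x \<in> X3. \<forall>i.
     (\<Sum>j\<in>UNIV - {i}. gradient (inv_conn_length p) (x $ j - x $ i)) \<notin> K_set p}"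

definition phi :: "real \<Rightarrow> (real ^ 'd::finite) ^ 3 \<Rightarrow> real ^ 'd \<Rightarrow> real" where
  "phi p x y = (\<Sum>i\<in>UNIV. inv_conn_length p (y - x $ i))"

definition minimizer :: "real \<Rightarrow> (real ^ 'd::finite) ^ 3 \<Rightarrow> real ^ 'd" where
  "minimizer p x = (THE y. is_arg_min (phi p x) (\<lambda>_. True) y)"

definition int_part3 :: "(real ^ 'd) ^ 3 \<Rightarrow> (int ^ 'd) ^ 3" where
  "int_part3 x = (\<chi> i. int_part (x $ i))"

definition F_event ::
    "real \<Rightarrow> int ^ 'd::finite \<Rightarrow> (int ^ 'd) ^ 3 \<Rightarrow> ((int ^ 'd) set \<Rightarrow> bool) set" where
  "F_event p k n = {\<omega> \<in> space (percolation p).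
     \<exists>\<gamma> :: 3 \<Rightarrow> (int ^ 'd) list.
       (\<forall>i. open_path \<omega> k (n $ i) (\<gamma> i) \<and> distinct (\<gamma> i)) \<and>
       (\<forall>i j. i \<noteq> j \<longrightarrow> set (\<gamma> i) \<inter> set (\<gamma> j) = {k})}"

end

(* Let xi be the inverse connection length. A pair of tripods with different centres k1, k2 cannot be
   separated by a single bond, so (Menger) two edge-disjoint open paths join k1 to k2, and one of them
   contains a piece of displacement at least |k1 - k2| / 2 whose removal leaves n1, n2, n3 connected.
   By the BK inequality the probability is at most a polynomial in N times
   exp (- min_w (xi (w - n1) + xi (w - n2) + xi (w - n3)) - c |k1 - k2|).

   That the minimizer of phi is unique rests on the strict triangle inequality for xi. If xi were additive
   on two directions a, b, let s be a supporting functional of xi at a + b and let Z n be the sum of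
   exp (s . x) P(0 <-> x) over the points x of an integer level n. BK gives Z (n + m) <= Z n * Z m, and a
   second moment estimate with tree diagrams gives Z (n + m) >= c * Z n * Z m, also for tilted s; hence Z is
   bounded, whereas placing a domain wall between the two extreme slopes in M positions produces
   M disjoint contributions to Z n, each bounded below.

   Exponential decay below the critical point follows Duminil-Copin and Tassion. *)
theory Submission
  imports Defs "HOL-Real_Asymp.Real_Asymp"
begin


text \<open>\<open>minimizer\<close> is a definite description, so the exponent of the estimate is
  meaningful only after uniqueness has been shown; hence the long analysis of the faces of the norm.
  Three obstacles shape that analysis. A path must not skip a level although s is real: levels are
  read from the integer form \<open>L\<close> built from the signs of s, which changes by at most 1
  along a bond and, thanks to lattice reflections, is positive on the face. In the second moment,
  pairs of nearby points may outweigh the first moment: the set of intermediate points is therefore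
  cut into R-separated classes, where the pair sum carries exp (- ka R), and this beats the
  polynomial number of classes. The growth rate of the tilted sums may have a corner at tilt 0:
  slopes are therefore infima of rate divided by tilt, and mass is located with tilts of order 1/n,
  whose weights stay of order one at distance of order n. For this, one prefactor
  \<open>exp c\<close> must serve all small tilts, which is why \<open>Z_ratio\<close> and
  \<open>QM\<close> are uniform in h.\<close>

section \<open>Expectations over random subsets of a finite set\<close>

text \<open>Expectation of \<open>f\<close> at a random subset of \<open>F\<close> that contains
  each element independently with probability \<open>p\<close>. It is a polynomial in
  \<open>p\<close>, defined for every real \<open>p\<close>, so it can be differentiated without
  leaving the interval [0, 1] being an issue.\<close>

definition bE :: "real \<Rightarrow> 'b set \<Rightarrow> ('b set \<Rightarrow> real) \<Rightarrow> real" where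
  "bE p F f = (\<Sum>A\<in>Pow F. p ^ card A * (1 - p) ^ card (F - A) * f A)"

lemma bE_empty [simp]: "bE p {} f = f {}"
  by (simp add: bE_def)

text \<open>Conditioning on the state of the single element \<open>e\<close>; this recursion drives
  the inductions on \<open>F\<close> below.\<close>

lemma bE_insert:
  assumes "finite F" "e \<notin> F"
  shows "bE p (insert e F) f = p * bE p F (\<lambda>A. f (insert e A)) + (1 - p) * bE p F f"
proof -
  have fin: "finite (Pow F)" using assms by simp
  have inj: "inj_on (insert e) (Pow F)"
    using assms(2) by (auto simp: inj_on_def)
  have d: "Pow F \<inter> insert e ` Pow F = {}" using assms by auto
  have "bE p (insert e F) f
      = (\<Sum>A\<in>Pow F. p ^ card A * (1 - p) ^ card (insert e F - A) * f A)
        + (\<Sum>A\<in>insert e ` Pow F. p ^ card A * (1 - p) ^ card (insert e F - A) * f A)"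
    unfolding bE_def Pow_insert by (rule sum.union_disjoint) (use fin d in auto)
  also have "(\<Sum>A\<in>Pow F. p ^ card A * (1 - p) ^ card (insert e F - A) * f A) = (1 - p) * bE p F f"
    unfolding bE_def sum_distrib_left
  proof (rule sum.cong[OF refl])
    fix A assume A: "A \<in> Pow F"
    have "insert e F - A = insert e (F - A)" using A assms by auto
    moreover have "card (insert e (F - A)) = Suc (card (F - A))" using assms by (auto simp: card_insert_if)
    ultimately show "p ^ card A * (1 - p) ^ card (insert e F - A) * f A = (1 - p) * (p ^ card A * (1 - p) ^ card (F - A) * f A)"
      by simp
  qed
  also have "(\<Sum>A\<in>insert e ` Pow F. p ^ card A * (1 - p) ^ card (insert e F - A) * f A) = p * bE p F (\<lambda>A. f (insert e A))"
    unfolding bE_def sum_distrib_left sum.reindex[OF inj] o_def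
  proof (rule sum.cong[OF refl])
    fix A assume A: "A \<in> Pow F"
    have "insert e F - insert e A = F - A" using A assms by auto
    moreover have "card (insert e A) = Suc (card A)"
      using assms A finite_subset by (metis PowD card_insert_disjoint subsetD)
    ultimately show "p ^ card (insert e A) * (1 - p) ^ card (insert e F - insert e A) * f (insert e A) = p * (p ^ card A * (1 - p) ^ card (F - A) * f (insert e A))"
      by simp
  qed
  finally show ?thesis by simp
qed

lemma bE_add: "bE p F (\<lambda>A. f A + g A) = bE p F f + bE p F g"
  by (simp add: bE_def sum.distrib algebra_simps)

lemma bE_cmult: "bE p F (\<lambda>A. c * f A) = c * bE p F f"
  by (simp add: bE_def sum_distrib_left algebra_simps)

lemma bE_diff: "bE p F (\<lambda>A. f A - g A) = bE p F f - bE p F g"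
  by (simp add: bE_def sum_subtractf algebra_simps)

lemma bE_sum: "bE p F (\<lambda>A. \<Sum>i\<in>I. f i A) = (\<Sum>i\<in>I. bE p F (f i))"
  unfolding bE_def sum_distrib_left by (rule sum.swap)

lemma bE_const: "finite F \<Longrightarrow> bE p F (\<lambda>_. c) = c"
  by (induction F rule: finite_induct) (simp_all add: bE_insert algebra_simps)

lemma bE_mono:
  assumes "0 \<le> p" "p \<le> 1" "\<And>A. A \<subseteq> F \<Longrightarrow> f A \<le> g A"
  shows "bE p F f \<le> bE p F g"
  unfolding bE_def by (intro sum_mono mult_left_mono) (use assms in auto)

lemma bE_cong: "(\<And>A. A \<subseteq> F \<Longrightarrow> f A = g A) \<Longrightarrow> bE p F f = bE p F g"
  unfolding bE_def by (intro sum.cong) auto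

lemma bE_nonneg: "0 \<le> p \<Longrightarrow> p \<le> 1 \<Longrightarrow> (\<And>A. A \<subseteq> F \<Longrightarrow> 0 \<le> f A) \<Longrightarrow> 0 \<le> bE p F f"
  unfolding bE_def by (intro sum_nonneg mult_nonneg_nonneg) auto

lemma bE_union:
  assumes "finite F" "finite G" "F \<inter> G = {}"
  shows "bE p (F \<union> G) f = bE p F (\<lambda>A. bE p G (\<lambda>B. f (A \<union> B)))"
  using assms
proof (induction F arbitrary: f rule: finite_induct)
  case (insert e F)
  have "bE p (insert e F \<union> G) f = p * bE p (F \<union> G) (\<lambda>A. f (insert e A)) + (1 - p) * bE p (F \<union> G) f"
    using insert by (subst Un_insert_left, subst bE_insert) auto
  with insert show ?case by (simp add: bE_insert)
qed simp

lemma bE_irrelevant: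
  assumes "finite F" "G \<subseteq> F" "\<And>A. A \<subseteq> F \<Longrightarrow> f A = f (A \<inter> G)"
  shows "bE p F f = bE p G f"
proof -
  have F: "F = G \<union> (F - G)" using assms by auto
  have "finite G" using assms finite_subset by auto
  then have "bE p F f = bE p G (\<lambda>A. bE p (F - G) (\<lambda>B. f (A \<union> B)))"
    by (subst F) (rule bE_union, use assms in auto)
  also have "\<dots> = bE p G (\<lambda>A. bE p (F - G) (\<lambda>B. f A))"
  proof (intro bE_cong)
    fix A B assume "A \<subseteq> G" "B \<subseteq> F - G"
    then have "A \<union> B \<subseteq> F" and "(A \<union> B) \<inter> G = A" using assms(2) by auto
    then have "f (A \<union> B) = f A" using assms(3)[of "A \<union> B"] by simp
    then show "f (A \<union> B) = f A" by simp
  qed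
  also have "\<dots> = bE p G f" using assms by (simp add: bE_const)
  finally show ?thesis .
qed

text \<open>Fubini over the splitting of \<open>F\<close> into \<open>F \<inter> G\<close> and
  \<open>F - G\<close>: \<open>f\<close> sees only the first part and \<open>g\<close> only the
  second.\<close>

lemma bE_indep:
  assumes "finite F" "\<And>A. A \<subseteq> F \<Longrightarrow> f A = f (A \<inter> G)" "\<And>A. A \<subseteq> F \<Longrightarrow> g A = g (A - G)"
  shows "bE p F (\<lambda>A. f A * g A) = bE p F f * bE p F g"
proof -
  let ?G = "F \<inter> G" and ?H = "F - G"
  have F: "F = ?G \<union> ?H" by auto
  have fin: "finite ?G" "finite ?H" using assms by auto
  have u: "bE p F h = bE p ?G (\<lambda>A. bE p ?H (\<lambda>B. h (A \<union> B)))" for h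
    by (subst F) (rule bE_union, use fin in auto)
  have fA: "f (A \<union> B) = f A" and gB: "g (A \<union> B) = g B" if "A \<subseteq> ?G" "B \<subseteq> ?H" for A B
  proof -
    have "(A \<union> B) \<inter> G = A" "(A \<union> B) - G = B" "A \<union> B \<subseteq> F" using that by auto
    then show "f (A \<union> B) = f A" "g (A \<union> B) = g B" using assms(2)[of "A \<union> B"] assms(3)[of "A \<union> B"] by auto
  qed
  have "bE p F (\<lambda>A. f A * g A) = bE p ?G (\<lambda>A. bE p ?H (\<lambda>B. f A * g B))"
    unfolding u by (intro bE_cong) (simp add: fA gB)
  also have "\<dots> = bE p ?G f * bE p ?H g"
    by (simp add: bE_cmult mult.commute[of _ "bE p ?H g"])
  also have "bE p ?G f = bE p F f"
  proof -
    have "bE p F f = bE p ?G (\<lambda>A. bE p ?H (\<lambda>_. f A))"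
      unfolding u[of f] by (intro bE_cong) (simp add: fA)
    then show ?thesis using fin by (simp add: bE_const)
  qed
  also have "bE p ?H g = bE p F g"
  proof -
    have "bE p F g = bE p ?G (\<lambda>A. bE p ?H g)"
      unfolding u[of g] by (intro bE_cong) (simp add: gB)
    then show ?thesis using fin by (simp add: bE_const)
  qed
  finally show ?thesis .
qed

definition bP :: "real \<Rightarrow> 'b set \<Rightarrow> ('b set \<Rightarrow> bool) \<Rightarrow> real" where
  "bP p F Q = bE p F (\<lambda>A. of_bool (Q A))"

lemma bP_empty [simp]: "bP p {} Q = of_bool (Q {})"
  by (simp add: bP_def)

lemma bP_insert:
  "finite F \<Longrightarrow> e \<notin> F \<Longrightarrow> bP p (insert e F) Q = p * bP p F (\<lambda>A. Q (insert e A)) + (1 - p) * bP p F Q"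
  unfolding bP_def by (rule bE_insert)

lemma bP_mono: "0 \<le> p \<Longrightarrow> p \<le> 1 \<Longrightarrow> (\<And>A. A \<subseteq> F \<Longrightarrow> Q A \<Longrightarrow> R A) \<Longrightarrow> bP p F Q \<le> bP p F R"
  unfolding bP_def by (intro bE_mono) auto

lemma bP_nonneg: "0 \<le> p \<Longrightarrow> p \<le> 1 \<Longrightarrow> 0 \<le> bP p F Q"
  unfolding bP_def by (rule bE_nonneg) auto

lemma bP_reindex:
  assumes "inj_on g F"
  shows "bP p F (\<lambda>A. Q (g ` A)) = bP p (g ` F) Q"
proof -
  have inj: "inj_on ((`) g) (Pow F)" using assms by (rule inj_on_image_Pow)
  have "bP p (g ` F) Q = (\<Sum>A\<in>(`) g ` Pow F. p ^ card A * (1 - p) ^ card (g ` F - A) * of_bool (Q A))"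
    by (simp add: bP_def bE_def image_Pow_surj)
  also have "\<dots> = (\<Sum>A\<in>Pow F. p ^ card (g ` A) * (1 - p) ^ card (g ` F - g ` A) * of_bool (Q (g ` A)))"
    by (subst sum.reindex[OF inj]) simp
  also have "\<dots> = bP p F (\<lambda>A. Q (g ` A))"
    unfolding bP_def bE_def
  proof (intro sum.cong refl)
    fix A assume "A \<in> Pow F"
    then have A: "A \<subseteq> F" by auto
    have 1: "card (g ` A) = card A" using A assms by (meson card_image inj_on_subset)
    have "g ` F - g ` A = g ` (F - A)" using A assms by (simp add: inj_on_image_set_diff)
    then have 2: "card (g ` F - g ` A) = card (F - A)"
      using assms by (metis Diff_subset card_image inj_on_subset)
    show "p ^ card (g ` A) * (1 - p) ^ card (g ` F - g ` A) * of_bool (Q (g ` A)) =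
      p ^ card A * (1 - p) ^ card (F - A) * of_bool (Q (g ` A))" unfolding 1 2 ..
  qed
  finally show ?thesis by simp
qed

section \<open>Correlation inequalities and Russo's formula\<close>

definition incr :: "('b set \<Rightarrow> bool) \<Rightarrow> bool" where
  "incr Q \<longleftrightarrow> (\<forall>A B. A \<subseteq> B \<longrightarrow> Q A \<longrightarrow> Q B)"

lemma incrD: "incr Q \<Longrightarrow> Q A \<Longrightarrow> A \<subseteq> B \<Longrightarrow> Q B"
  by (auto simp: incr_def)

lemma incr_insert: "incr Q \<Longrightarrow> incr (\<lambda>A. Q (insert e A))"
  unfolding incr_def
proof (intro allI impI)
  fix A B assume *: "\<forall>A B. A \<subseteq> B \<longrightarrow> Q A \<longrightarrow> Q B" "A \<subseteq> B" "Q (insert e A)"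
  then have "insert e A \<subseteq> insert e B" by auto
  with * show "Q (insert e B)" by blast
qed

text \<open>Harris inequality. Both probabilities are larger when \<open>e\<close> is present, so
  their covariance over the state of \<open>e\<close>, which is p (1 - p) (q1 - q0) (r1 - r0), is
  nonnegative; the induction hypothesis treats each state separately.\<close>

lemma bP_FKG:
  assumes "finite F" "incr Q" "incr R" and p: "0 \<le> p" "p \<le> 1"
  shows "bP p F Q * bP p F R \<le> bP p F (\<lambda>A. Q A \<and> R A)"
  using assms(1-3)
proof (induction F arbitrary: Q R rule: finite_induct)
  case (insert e F)
  let ?Q = "\<lambda>A. Q (insert e A)" and ?R = "\<lambda>A. R (insert e A)"
  have i: "incr ?Q" "incr ?R" using insert.prems by (auto intro: incr_insert)
  define q0 q1 r0 r1 where "q0 = bP p F Q" and "q1 = bP p F ?Q" and "r0 = bP p F R" and "r1 = bP p F ?R"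
  have le: "q0 \<le> q1" "r0 \<le> r1" unfolding q0_def q1_def r0_def r1_def
    using insert.prems p by (auto intro!: bP_mono elim: incrD)
  have "p * (1 - p) * ((q1 - q0) * (r1 - r0)) \<ge> 0"
    using le p by simp
  then have "(p * q1 + (1 - p) * q0) * (p * r1 + (1 - p) * r0) \<le> p * (q1 * r1) + (1 - p) * (q0 * r0)"
    by (simp add: algebra_simps)
  also have "\<dots> \<le> p * bP p F (\<lambda>A. ?Q A \<and> ?R A) + (1 - p) * bP p F (\<lambda>A. Q A \<and> R A)"
    unfolding q0_def q1_def r0_def r1_def
    using insert.IH[OF i] insert.IH[OF insert.prems] p by (intro add_mono mult_left_mono) auto
  finally show ?case
    using insert.hyps by (simp add: bP_insert q0_def q1_def r0_def r1_def)
qed auto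

text \<open>Disjoint occurrence. For increasing events the second witness may be enlarged to the
  whole rest \<open>A - B\<close>, so only one witness set has to be named; \<open>djI\<close>
  recovers the form with two disjoint witnesses.\<close>

definition dj :: "('b set \<Rightarrow> bool) \<Rightarrow> ('b set \<Rightarrow> bool) \<Rightarrow> 'b set \<Rightarrow> bool" where
  "dj Q R A \<longleftrightarrow> (\<exists>B\<subseteq>A. Q B \<and> R (A - B))"

lemma incr_dj: assumes "incr Q" "incr R" shows "incr (dj Q R)"
  unfolding incr_def dj_def
proof (intro allI impI, elim exE conjE)
  fix A A' B assume "A \<subseteq> A'" "B \<subseteq> A" "Q B" "R (A - B)"
  then show "\<exists>B\<subseteq>A'. Q B \<and> R (A' - B)"
    using incrD[OF assms(2), of "A - B" "A' - B"] by (intro exI[of _ B]) auto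
qed

lemma dj_mono: assumes "dj Q R A" "\<And>B. Q B \<Longrightarrow> Q' B" "\<And>B. R B \<Longrightarrow> R' B" shows "dj Q' R' A"
  using assms unfolding dj_def by blast

lemma djI: "incr Q \<Longrightarrow> incr R \<Longrightarrow> B \<subseteq> A \<Longrightarrow> C \<subseteq> A \<Longrightarrow> B \<inter> C = {} \<Longrightarrow> Q B \<Longrightarrow> R C \<Longrightarrow> dj Q R A"
  unfolding dj_def by (rule exI[of _ B]) (auto elim!: incrD)

text \<open>The new element can be given to only one of the two witnesses.\<close>

lemma dj_insert:
  assumes "incr Q" "incr R" "e \<notin> A"
  shows "dj Q R (insert e A) \<longleftrightarrow> dj (\<lambda>B. Q (insert e B)) R A \<or> dj Q (\<lambda>B. R (insert e B)) A"
proof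
  assume "dj Q R (insert e A)"
  then obtain B where B: "B \<subseteq> insert e A" "Q B" "R (insert e A - B)" by (auto simp: dj_def)
  show "dj (\<lambda>B. Q (insert e B)) R A \<or> dj Q (\<lambda>B. R (insert e B)) A"
  proof (cases "e \<in> B")
    case True
    then have "insert e (B - {e}) = B" "insert e A - B = A - (B - {e})" "B - {e} \<subseteq> A" using B assms by auto
    with B show ?thesis unfolding dj_def by metis
  next
    case False
    then have "insert e A - B = insert e (A - B)" "B \<subseteq> A" using B by auto
    with B show ?thesis unfolding dj_def by metis
  qed
next
  assume "dj (\<lambda>B. Q (insert e B)) R A \<or> dj Q (\<lambda>B. R (insert e B)) A"
  then show "dj Q R (insert e A)"
  proof
    assume "dj (\<lambda>B. Q (insert e B)) R A"
    then obtain B where B: "B \<subseteq> A" "Q (insert e B)" "R (A - B)" by (auto simp: dj_def)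
    have "insert e A - insert e B = A - B" using assms by auto
    with B show ?thesis unfolding dj_def by (intro exI[of _ "insert e B"]) auto
  next
    assume "dj Q (\<lambda>B. R (insert e B)) A"
    then obtain B where B: "B \<subseteq> A" "Q B" "R (insert e (A - B))" by (auto simp: dj_def)
    have "insert e A - B = insert e (A - B)" using assms B by auto
    with B show ?thesis unfolding dj_def by (intro exI[of _ B]) auto
  qed
qed

lemma bP_disj_conj: "bP p F (\<lambda>A. Q A \<or> R A) + bP p F (\<lambda>A. Q A \<and> R A) = bP p F Q + bP p F R"
  unfolding bP_def bE_add[symmetric] by (rule bE_cong) auto

text \<open>Induction on one element. With \<open>m\<close> and \<open>q\<close> the probabilities
  of disjoint occurrence with and without \<open>e\<close>, three bounds are available:
  \<open>q \<le> x1 * x2\<close>, \<open>m \<le> y1 * y2\<close> and the joint bound on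
  \<open>m + q\<close>. A suitable convex combination of them gives the claim.\<close>

lemma bP_BK:
  assumes "finite F" "incr Q" "incr R" and p: "0 \<le> p" "p \<le> 1"
  shows "bP p F (dj Q R) \<le> bP p F Q * bP p F R"
  using assms(1-3)
proof (induction F arbitrary: Q R rule: finite_induct)
  case empty
  then show ?case by (auto simp: dj_def)
next
  case (insert e F)
  let ?Q = "\<lambda>A. Q (insert e A)" and ?R = "\<lambda>A. R (insert e A)"
  have i: "incr ?Q" "incr ?R" using insert.prems by (auto intro: incr_insert)
  define x1 y1 x2 y2 where "x1 = bP p F Q" and "y1 = bP p F ?Q" and "x2 = bP p F R" and "y2 = bP p F ?R"
  define m where "m = bP p F (\<lambda>A. dj ?Q R A \<or> dj Q ?R A)"
  define q where "q = bP p F (dj Q R)"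
  have sub: "Q A \<Longrightarrow> ?Q A" "R A \<Longrightarrow> ?R A" for A
    using insert.prems by (auto elim: incrD)
  have le: "x1 \<le> y1" "x2 \<le> y2" "0 \<le> x1" "0 \<le> x2" unfolding x1_def y1_def x2_def y2_def
    using sub p by (auto intro!: bP_mono bP_nonneg)
  have q: "q \<le> x1 * x2" unfolding q_def x1_def x2_def by (rule insert.IH) (use insert.prems in auto)
  have m1: "m \<le> y1 * y2"
  proof -
    have "m \<le> bP p F (dj ?Q ?R)" unfolding m_def
      by (rule bP_mono[OF p]) (use sub in \<open>auto elim!: dj_mono\<close>)
    also have "\<dots> \<le> y1 * y2" unfolding y1_def y2_def by (rule insert.IH[OF i])
    finally show ?thesis .
  qed
  \<comment> \<open>By \<open>dj_insert\<close>, \<open>m\<close> is the probability of a union of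
    two events. Disjoint occurrence without \<open>e\<close> implies both of them, so
    inclusion-exclusion bounds \<open>m + q\<close> by the sum of their probabilities.\<close>
  have m2: "m + q \<le> y1 * x2 + x1 * y2"
  proof -
    have "q \<le> bP p F (\<lambda>A. dj ?Q R A \<and> dj Q ?R A)" unfolding q_def
      by (rule bP_mono[OF p]) (use sub in \<open>auto elim!: dj_mono\<close>)
    then have "m + q \<le> bP p F (dj ?Q R) + bP p F (dj Q ?R)"
      using bP_disj_conj[of p F "dj ?Q R" "dj Q ?R"] unfolding m_def by linarith
    also have "\<dots> \<le> y1 * x2 + x1 * y2" unfolding x1_def y1_def x2_def y2_def
      using insert.IH[OF i(1) insert.prems(2)] insert.IH[OF insert.prems(1) i(2)] by linarith
    finally show ?thesis .
  qed
  have "p * m + (1 - p) * q \<le> (p * y1 + (1 - p) * x1) * (p * y2 + (1 - p) * x2)"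
  \<comment> \<open>The bound on \<open>m + q\<close> is used with weight min p (1 - p); the rest of
    the weight falls on \<open>q\<close> if p is small and on \<open>m\<close> if p is
    large.\<close>
  proof (cases "p \<le> 1/2")
    case True
    have "p * m + (1 - p) * q = p * (m + q) + (1 - 2 * p) * q" by (simp add: algebra_simps)
    also have "\<dots> \<le> p * (y1 * x2 + x1 * y2) + (1 - 2 * p) * (x1 * x2)"
      using mult_left_mono[OF m2, of p] mult_left_mono[OF q, of "1 - 2 * p"] True p by linarith
    also have "\<dots> = (p * y1 + (1 - p) * x1) * (p * y2 + (1 - p) * x2) - p^2 * ((y1 - x1) * (y2 - x2))"
      by (simp add: algebra_simps power2_eq_square)
    also have "\<dots> \<le> (p * y1 + (1 - p) * x1) * (p * y2 + (1 - p) * x2)" using le by simp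
    finally show ?thesis .
  next
    case False
    have "p * m + (1 - p) * q = (1 - p) * (m + q) + (2 * p - 1) * m" by (simp add: algebra_simps)
    also have "\<dots> \<le> (1 - p) * (y1 * x2 + x1 * y2) + (2 * p - 1) * (y1 * y2)"
      using mult_left_mono[OF m2, of "1 - p"] mult_left_mono[OF m1, of "2 * p - 1"] False p by linarith
    also have "\<dots> = (p * y1 + (1 - p) * x1) * (p * y2 + (1 - p) * x2) - (1-p)^2 * ((y1 - x1) * (y2 - x2))"
      by (simp add: algebra_simps power2_eq_square)
    also have "\<dots> \<le> (p * y1 + (1 - p) * x1) * (p * y2 + (1 - p) * x2)" using le by simp
    finally show ?thesis .
  qed
  moreover have "bP p F (\<lambda>A. dj Q R (insert e A)) = m" unfolding m_def bP_def
    by (intro bE_cong) (use insert.hyps insert.prems in \<open>subst dj_insert, auto\<close>)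
  ultimately show ?case
    using insert.hyps by (simp add: bP_insert m_def q_def x1_def y1_def x2_def y2_def)
qed

text \<open>Russo's formula for arbitrary \<open>f\<close>. For the indicator of an increasing event
  the summand is the indicator that \<open>e\<close> is pivotal.\<close>

lemma bE_has_derivative:
  assumes "finite F"
  shows "((\<lambda>p. bE p F f) has_real_derivative
           (\<Sum>e\<in>F. bE p F (\<lambda>A. f (insert e A) - f (A - {e})))) (at p)"
  using assms
proof (induction F arbitrary: f rule: finite_induct)
  case (insert e F)
  let ?f = "\<lambda>A. f (insert e A)"
  have d: "((\<lambda>p. p * bE p F ?f + (1 - p) * bE p F f) has_real_derivative
      (bE p F ?f - bE p F f + p * (\<Sum>b\<in>F. bE p F (\<lambda>A. ?f (insert b A) - ?f (A - {b})))
         + (1 - p) * (\<Sum>b\<in>F. bE p F (\<lambda>A. f (insert b A) - f (A - {b}))))) (at p)"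
    by (rule derivative_eq_intros insert.IH refl)+ (simp add: algebra_simps)
  have 1: "bE p (insert e F) (\<lambda>A. f (insert e A) - f (A - {e})) = bE p F ?f - bE p F f"
  proof -
    have "bE p F (\<lambda>A. f (insert e (insert e A)) - f (insert e A - {e})) = bE p F ?f - bE p F f"
      unfolding bE_diff[symmetric]
    proof (rule bE_cong)
      fix A assume "A \<subseteq> F"
      then have "insert e A - {e} = A" using insert.hyps by auto
      then show "f (insert e (insert e A)) - f (insert e A - {e}) = f (insert e A) - f A" by simp
    qed
    moreover have "bE p F (\<lambda>A. f (insert e A) - f (A - {e})) = bE p F ?f - bE p F f"
      unfolding bE_diff[symmetric]
    proof (rule bE_cong)
      fix A assume "A \<subseteq> F"
      then have "A - {e} = A" using insert.hyps by auto
      then show "f (insert e A) - f (A - {e}) = f (insert e A) - f A" by simp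
    qed
    ultimately show ?thesis using insert.hyps by (simp add: bE_insert algebra_simps)
  qed
  have 2: "bE p (insert e F) (\<lambda>A. f (insert b A) - f (A - {b})) =
     p * bE p F (\<lambda>A. ?f (insert b A) - ?f (A - {b})) + (1 - p) * bE p F (\<lambda>A. f (insert b A) - f (A - {b}))"
    if "b \<in> F" for b
  proof -
    have "b \<noteq> e" using that insert.hyps by auto
    then have "insert b (insert e A) = insert e (insert b A)" "insert e A - {b} = insert e (A - {b})" for A
      by auto
    then show ?thesis using insert.hyps by (simp add: bE_insert)
  qed
  have "(\<Sum>b\<in>insert e F. bE p (insert e F) (\<lambda>A. f (insert b A) - f (A - {b}))) =
      bE p F ?f - bE p F f + p * (\<Sum>b\<in>F. bE p F (\<lambda>A. ?f (insert b A) - ?f (A - {b})))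
         + (1 - p) * (\<Sum>b\<in>F. bE p F (\<lambda>A. f (insert b A) - f (A - {b})))"
    using insert.hyps by (simp add: 1 2 sum.distrib sum_distrib_left)
  with d show ?case using insert.hyps by (simp add: bE_insert)
qed simp


section \<open>Finitary increasing events\<close>

text \<open>Increasing events with a finite witness. They are exactly the increasing limits of
  events on finitely many bonds, so they are measurable and inherit the finite inequalities;
  connection events and their disjoint occurrences are of this kind.\<close>

definition fin_incr :: "('b set \<Rightarrow> bool) \<Rightarrow> bool" where
  "fin_incr Q \<longleftrightarrow> (\<forall>A. Q A \<longleftrightarrow> (\<exists>B\<subseteq>A. finite B \<and> Q B))"

lemma fin_incr_incr: "fin_incr Q \<Longrightarrow> incr Q"
  unfolding fin_incr_def incr_def
proof (intro allI impI)
  fix A B assume *: "\<forall>A. Q A = (\<exists>B\<subseteq>A. finite B \<and> Q B)" "A \<subseteq> B" "Q A"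
  from spec[OF *(1), of A] *(3) obtain C where "C \<subseteq> A" "finite C" "Q C" by auto
  with *(2) have "\<exists>C\<subseteq>B. finite C \<and> Q C" by blast
  with spec[OF *(1), of B] show "Q B" by simp
qed

lemma fin_incrI:
  assumes "incr Q" "\<And>A. Q A \<Longrightarrow> \<exists>B\<subseteq>A. finite B \<and> Q B"
  shows "fin_incr Q"
  unfolding fin_incr_def
proof (intro allI iffI)
  fix A assume "\<exists>B\<subseteq>A. finite B \<and> Q B"
  then obtain B where "B \<subseteq> A" "Q B" by auto
  then show "Q A" using incrD[OF assms(1), of B A] by simp
qed (rule assms(2))

lemma fin_incrD: assumes "fin_incr Q" "Q A" shows "\<exists>B\<subseteq>A. finite B \<and> Q B"
  using assms(2) spec[OF assms(1)[unfolded fin_incr_def], of A] by (rule rev_iffD1)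

lemma fin_incr_conj:
  assumes "fin_incr Q" "fin_incr R" shows "fin_incr (\<lambda>A. Q A \<and> R A)"
proof (rule fin_incrI)
  have i: "incr Q" "incr R" using assms by (auto intro: fin_incr_incr)
  show "incr (\<lambda>A. Q A \<and> R A)" using i unfolding incr_def by blast
  fix A assume "Q A \<and> R A"
  then obtain B C where "B \<subseteq> A" "finite B" "Q B" "C \<subseteq> A" "finite C" "R C"
    using fin_incrD[OF assms(1), of A] fin_incrD[OF assms(2), of A] by auto
  then show "\<exists>B\<subseteq>A. finite B \<and> Q B \<and> R B"
    using i by (intro exI[of _ "B \<union> C"]) (auto elim: incrD)
qed

lemma fin_incr_Ex:
  assumes "\<And>x. fin_incr (Q x)" shows "fin_incr (\<lambda>A. \<exists>x. Q x A)"
proof (rule fin_incrI)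
  have i: "incr (Q x)" for x using assms by (rule fin_incr_incr)
  then show "incr (\<lambda>A. \<exists>x. Q x A)" unfolding incr_def by blast
  fix A assume "\<exists>x. Q x A"
  then obtain x where "Q x A" ..
  then obtain B where "B \<subseteq> A" "finite B" "Q x B" using fin_incrD[OF assms] by blast
  then show "\<exists>B\<subseteq>A. finite B \<and> (\<exists>x. Q x B)" by blast
qed

lemma fin_incr_const: "fin_incr (\<lambda>A. c)"
  by (rule fin_incrI) (auto simp: incr_def)

lemma fin_incr_conj_const: "fin_incr Q \<Longrightarrow> fin_incr (\<lambda>A. c \<and> Q A)"
  by (intro fin_incr_conj fin_incr_const)

lemma fin_incr_dj:
  assumes "fin_incr Q" "fin_incr R" shows "fin_incr (dj Q R)"
proof (rule fin_incrI)
  have i: "incr Q" "incr R" using assms by (auto intro: fin_incr_incr)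
  show "incr (dj Q R)" using i by (rule incr_dj)
  fix A assume "dj Q R A"
  then obtain B where B: "B \<subseteq> A" "Q B" "R (A - B)" by (auto simp: dj_def)
  then obtain C D where "C \<subseteq> B" "finite C" "Q C" "D \<subseteq> A - B" "finite D" "R D"
    using fin_incrD[OF assms(1), of B] fin_incrD[OF assms(2), of "A - B"] by auto
  then show "\<exists>B\<subseteq>A. finite B \<and> dj Q R B"
    using B i by (intro exI[of _ "C \<union> D"] conjI djI[of Q R C _ D]) auto
qed

section \<open>The percolation measure\<close>

text \<open>Points of the product space take the value \<open>undefined\<close> off
  \<open>bonds\<close>, hence the restriction to bonds.\<close>

definition opn :: "((int ^ 'd::finite) set \<Rightarrow> bool) \<Rightarrow> (int ^ 'd) set set" where
  "opn \<omega> = {b \<in> bonds. \<omega> b}"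

lemma space_percolation: "space (percolation p :: ((int ^ 'd::finite) set \<Rightarrow> bool) measure) = PiE bonds (\<lambda>_. UNIV)"
  by (simp add: percolation_def space_PiM)

lemma prob_space_percolation: "prob_space (percolation p)"
  unfolding percolation_def by (intro prob_space_PiM measure_pmf.prob_space_axioms)

lemma countable_bonds: "countable (bonds :: (int ^ 'd::finite) set set)"
proof -
  have "(bonds :: (int ^ 'd) set set) \<subseteq> (\<lambda>(u, v). {u, v}) ` UNIV" by (auto simp: bonds_def)
  then show ?thesis by (rule countable_subset) simp
qed

lemma sets_open_bond [measurable]:
  "b \<in> bonds \<Longrightarrow> {\<omega> \<in> space (percolation p). \<omega> b} \<in> sets (percolation p)"
  unfolding percolation_def
  using sets_Collect_single'[of b bonds "\<lambda>_. measure_pmf (bernoulli_pmf p)" "\<lambda>x. x"] by simp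

lemma sets_opn_eq:
  fixes F :: "(int ^ 'd::finite) set set"
  assumes "finite F" "F \<subseteq> bonds"
  shows "{\<omega> \<in> space (percolation p). opn \<omega> \<inter> F = A} \<in> sets (percolation p)"
proof (cases "A \<subseteq> F")
  case True
  have 1: "{\<omega> \<in> space (percolation p). \<omega> b = (b \<in> A)} \<in> sets (percolation p)" if "b \<in> F" for b
  proof (cases "b \<in> A")
    case False
    have "{\<omega> \<in> space (percolation p). \<not> \<omega> b} = space (percolation p) - {\<omega> \<in> space (percolation p). \<omega> b}" by auto
    also have "\<dots> \<in> sets (percolation p)" using sets_open_bond that assms by blast
    finally show ?thesis using False by simp
  qed (use sets_open_bond that assms in \<open>simp add: subset_iff\<close>)
  have "{\<omega> \<in> space (percolation p). \<forall>b\<in>F. \<omega> b = (b \<in> A)} \<in> sets (percolation p)"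
    by (rule sets.sets_Collect_finite_All) (use assms 1 in auto)
  also have "{\<omega> \<in> space (percolation p). \<forall>b\<in>F. \<omega> b = (b \<in> A)} = {\<omega> \<in> space (percolation p). opn \<omega> \<inter> F = A}"
    using True assms by (auto simp: opn_def)
  finally show ?thesis .
next
  case False
  then have "{\<omega> \<in> space (percolation p). opn \<omega> \<inter> F = A} = {}" by auto
  then show ?thesis by (simp only: sets.empty_sets)
qed

lemma measure_opn_eq:
  fixes F :: "(int ^ 'd::finite) set set"
  assumes F: "finite F" "F \<subseteq> bonds" and A: "A \<subseteq> F" and p: "0 \<le> p" "p \<le> 1"
  shows "measure (percolation p) {\<omega> \<in> space (percolation p). opn \<omega> \<inter> F = A} = p ^ card A * (1 - p) ^ card (F - A)"
proof -
  interpret product_prob_space "\<lambda>_. measure_pmf (bernoulli_pmf p)" "bonds :: (int ^ 'd) set set" ..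
  let ?X = "\<lambda>b. {b \<in> A}"
  have "{\<omega> \<in> space (percolation p). opn \<omega> \<inter> F = A} = prod_emb bonds (\<lambda>_. measure_pmf (bernoulli_pmf p)) F (Pi\<^sub>E F ?X)"
    using F A by (auto simp: prod_emb_def space_percolation opn_def restrict_PiE_iff space_PiM Pi_iff)
  then have "measure (percolation p) {\<omega> \<in> space (percolation p). opn \<omega> \<inter> F = A} = (\<Prod>b\<in>F. measure (measure_pmf (bernoulli_pmf p)) {b \<in> A})"
    unfolding percolation_def using F by (simp add: measure_PiM_emb)
  also have "\<dots> = (\<Prod>b\<in>F. if b \<in> A then p else 1 - p)"
    using p by (intro prod.cong) (auto simp: measure_pmf_single)
  also have "\<dots> = p ^ card A * (1 - p) ^ card (F - A)"
  proof -
    have "F \<inter> {b. b \<in> A} = A" "F \<inter> - {b. b \<in> A} = F - A" using A by auto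
    then show ?thesis using F by (simp add: prod.If_cases)
  qed
  finally show ?thesis .
qed

text \<open>The link between the infinite product measure and the finite calculus of
  \<open>bE\<close> and \<open>bP\<close>.\<close>

lemma measure_cylinder:
  fixes F :: "(int ^ 'd::finite) set set"
  assumes F: "finite F" "F \<subseteq> bonds" and p: "0 \<le> p" "p \<le> 1"
  shows "{\<omega> \<in> space (percolation p). Q (opn \<omega> \<inter> F)} \<in> sets (percolation p)"
    and "measure (percolation p) {\<omega> \<in> space (percolation p). Q (opn \<omega> \<inter> F)} = bP p F Q"
proof -
  interpret prob_space "percolation p :: ((int ^ 'd) set \<Rightarrow> bool) measure" by (rule prob_space_percolation)
  let ?E = "\<lambda>A. {\<omega> \<in> space (percolation p). opn \<omega> \<inter> F = A}"
  have eq: "{\<omega> \<in> space (percolation p). Q (opn \<omega> \<inter> F)} = (\<Union>A\<in>{A \<in> Pow F. Q A}. ?E A)" by auto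
  show "{\<omega> \<in> space (percolation p). Q (opn \<omega> \<inter> F)} \<in> sets (percolation p)"
    unfolding eq using F sets_opn_eq[OF F] by auto
  have "measure (percolation p) {\<omega> \<in> space (percolation p). Q (opn \<omega> \<inter> F)} = (\<Sum>A\<in>{A \<in> Pow F. Q A}. measure (percolation p) (?E A))"
    unfolding eq using F sets_opn_eq[OF F]
    by (intro finite_measure_finite_Union) (auto simp: disjoint_family_on_def)
  also have "\<dots> = (\<Sum>A\<in>{A \<in> Pow F. Q A}. p ^ card A * (1 - p) ^ card (F - A))"
    using F p by (intro sum.cong) (auto simp: measure_opn_eq)
  also have "\<dots> = bP p F Q"
    unfolding bP_def bE_def using F by (intro sum.mono_neutral_cong_left) auto
  finally show "measure (percolation p) {\<omega> \<in> space (percolation p). Q (opn \<omega> \<inter> F)} = bP p F Q" .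
qed

text \<open>An exhaustion of the countable set of bonds by finite sets, taken from an enumeration;
  its geometry does not matter.\<close>

definition bseq :: "nat \<Rightarrow> (int ^ 'd::finite) set set" where
  "bseq n = {b \<in> bonds. to_nat_on bonds b < n}"

lemma bseq: "finite (bseq n)" "bseq n \<subseteq> bonds" "incseq bseq" "finite B \<Longrightarrow> B \<subseteq> bonds \<Longrightarrow> \<exists>n. B \<subseteq> bseq n"
proof -
  show "finite (bseq n)"
    unfolding bseq_def
    by (rule inj_on_finite[of "to_nat_on bonds" _ "{..<n}"])
      (use inj_on_to_nat_on[OF countable_bonds] in \<open>auto intro: inj_on_subset\<close>)
  show "bseq n \<subseteq> bonds" "incseq bseq" by (auto simp: bseq_def incseq_def)
  show "\<exists>n. B \<subseteq> bseq n" if "finite B" "B \<subseteq> bonds"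
  proof (intro exI subsetI)
    fix b assume "b \<in> B"
    then show "b \<in> bseq (Suc (Max (to_nat_on bonds ` B)))"
      using that by (auto simp: bseq_def less_Suc_eq_le)
  qed
qed

definition ev :: "real \<Rightarrow> ((int ^ 'd::finite) set set \<Rightarrow> bool) \<Rightarrow> ((int ^ 'd) set \<Rightarrow> bool) set" where
  "ev p Q = {\<omega> \<in> space (percolation p). Q (opn \<omega>)}"

definition PP :: "real \<Rightarrow> ((int ^ 'd::finite) set set \<Rightarrow> bool) \<Rightarrow> real" where
  "PP p Q = measure (percolation p) (ev p Q)"

lemma ev_eq_UN:
  fixes Q :: "(int ^ 'd::finite) set set \<Rightarrow> bool"
  assumes "fin_incr Q"
  shows "ev p Q = (\<Union>n. {\<omega> \<in> space (percolation p). Q (opn \<omega> \<inter> bseq n)})"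
proof -
  have "Q (opn \<omega>) \<longleftrightarrow> (\<exists>n. Q (opn \<omega> \<inter> bseq n))" for \<omega> :: "(int ^ 'd) set \<Rightarrow> bool"
  proof
    assume "Q (opn \<omega>)"
    then obtain B where B: "B \<subseteq> opn \<omega>" "finite B" "Q B" using fin_incrD[OF assms] by blast
    moreover have "B \<subseteq> bonds" using B by (auto simp: opn_def)
    ultimately obtain n where "B \<subseteq> bseq n" using bseq(4) by blast
    then show "\<exists>n. Q (opn \<omega> \<inter> bseq n)" using B fin_incr_incr[OF assms] by (meson incrD le_inf_iff)
  next
    assume "\<exists>n. Q (opn \<omega> \<inter> bseq n)"
    then show "Q (opn \<omega>)" using fin_incr_incr[OF assms] by (meson incrD inf_le1)
  qed
  then show ?thesis by (auto simp: ev_def)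
qed

lemma sets_ev [simp, intro]: "fin_incr Q \<Longrightarrow> 0 \<le> p \<Longrightarrow> p \<le> 1 \<Longrightarrow> ev p Q \<in> sets (percolation p)"
  unfolding ev_eq_UN by (intro sets.countable_UN) (use measure_cylinder(1)[OF bseq(1,2)] in auto)

text \<open>Continuity from below along the exhaustion. FKG, BK and all comparisons pass from finite
  sets to the lattice through this limit.\<close>

lemma PP_tendsto:
  fixes Q :: "(int ^ 'd::finite) set set \<Rightarrow> bool"
  assumes "fin_incr Q" and p: "0 \<le> p" "p \<le> 1"
  shows "(\<lambda>n. bP p (bseq n) Q) \<longlonglongrightarrow> PP p Q"
proof -
  interpret prob_space "percolation p :: ((int ^ 'd) set \<Rightarrow> bool) measure" by (rule prob_space_percolation)
  have "(\<lambda>n. measure (percolation p) {\<omega> \<in> space (percolation p). Q (opn \<omega> \<inter> bseq n)}) \<longlonglongrightarrow> PP p Q"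
    unfolding PP_def ev_eq_UN[OF assms(1)]
  proof (rule finite_Lim_measure_incseq)
    show "range (\<lambda>n. {\<omega> \<in> space (percolation p). Q (opn \<omega> \<inter> bseq n)}) \<subseteq> events"
      using measure_cylinder(1)[OF bseq(1,2) p] by auto
    show "incseq (\<lambda>n. {\<omega> \<in> space (percolation p). Q (opn \<omega> \<inter> bseq n)})"
    proof (rule incseq_SucI, safe)
      fix n \<omega> assume "Q (opn \<omega> \<inter> bseq n)"
      moreover have "(bseq n :: (int ^ 'd) set set) \<subseteq> bseq (Suc n)" using bseq(3) by (rule incseq_SucD)
      ultimately show "Q (opn \<omega> \<inter> bseq (Suc n))" using fin_incr_incr[OF assms(1)] by (auto elim!: incrD)
    qed
  qed
  then show ?thesis by (simp add: measure_cylinder(2)[OF bseq(1,2) p])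
qed

lemma bP_le_PP:
  fixes Q :: "(int ^ 'd::finite) set set \<Rightarrow> bool"
  assumes "fin_incr Q" and p: "0 \<le> p" "p \<le> 1" and F: "finite F" "F \<subseteq> bonds"
  shows "bP p F Q \<le> PP p Q"
proof -
  interpret prob_space "percolation p :: ((int ^ 'd) set \<Rightarrow> bool) measure" by (rule prob_space_percolation)
  have "measure (percolation p) {\<omega> \<in> space (percolation p). Q (opn \<omega> \<inter> F)} \<le> PP p Q"
    unfolding PP_def
    by (rule finite_measure_mono)
      (use assms fin_incr_incr[OF assms(1)] in \<open>auto simp: ev_def intro: sets_ev[unfolded ev_def] elim!: incrD\<close>)
  then show ?thesis using measure_cylinder(2)[OF F p] by simp
qed

lemma PP_leI:
  assumes "fin_incr Q" "0 \<le> p" "p \<le> 1" "\<And>F. finite F \<Longrightarrow> F \<subseteq> bonds \<Longrightarrow> bP p F Q \<le> c"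
  shows "PP p Q \<le> c"
  by (rule LIMSEQ_le_const2[OF PP_tendsto[OF assms(1-3)]]) (use assms(4)[OF bseq(1,2)] in auto)

lemma PP_nonneg: "0 \<le> PP p Q" by (simp add: PP_def)

lemma PP_le_1: "PP p Q \<le> 1"
  unfolding PP_def by (rule prob_space.prob_le_1[OF prob_space_percolation])

lemma PP_mono:
  assumes "fin_incr R" "0 \<le> p" "p \<le> 1" "\<And>A. A \<subseteq> bonds \<Longrightarrow> Q A \<Longrightarrow> R A"
  shows "PP p Q \<le> PP p R"
  unfolding PP_def
  by (rule finite_measure.finite_measure_mono)
    (use assms prob_space_percolation in \<open>auto simp: ev_def opn_def intro: prob_space.finite_measure sets_ev[unfolded ev_def opn_def]\<close>)

lemma PP_FKG:
  assumes "fin_incr Q" "fin_incr R" and p: "0 \<le> p" "p \<le> 1"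
  shows "PP p Q * PP p R \<le> PP p (\<lambda>A. Q A \<and> R A)"
  by (rule LIMSEQ_le[OF tendsto_mult[OF PP_tendsto PP_tendsto] PP_tendsto])
    (use assms in \<open>auto intro!: fin_incr_conj bP_FKG bseq fin_incr_incr exI[of _ 0]\<close>)

lemma PP_BK:
  assumes "fin_incr Q" "fin_incr R" and p: "0 \<le> p" "p \<le> 1"
  shows "PP p (dj Q R) \<le> PP p Q * PP p R"
  by (rule LIMSEQ_le[OF PP_tendsto tendsto_mult[OF PP_tendsto PP_tendsto]])
    (use assms in \<open>auto intro!: fin_incr_dj bP_BK bseq fin_incr_incr exI[of _ 0]\<close>)

lemma PP_reindex_le:
  fixes Q :: "(int ^ 'd::finite) set set \<Rightarrow> bool" and g :: "(int ^ 'd) set \<Rightarrow> (int ^ 'd) set"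
  assumes "fin_incr Q" and p: "0 \<le> p" "p \<le> 1" and g: "inj_on g bonds" "g ` bonds \<subseteq> bonds"
    and Q: "fin_incr (\<lambda>A. Q (g ` A))"
  shows "PP p (\<lambda>A. Q (g ` A)) \<le> PP p Q"
proof (rule PP_leI[OF Q p])
  fix F :: "(int ^ 'd) set set" assume F: "finite F" "F \<subseteq> bonds"
  then have "bP p F (\<lambda>A. Q (g ` A)) = bP p (g ` F) Q"
    using g by (intro bP_reindex) (auto intro: inj_on_subset)
  also have "\<dots> \<le> PP p Q" using F g assms by (intro bP_le_PP) auto
  finally show "bP p F (\<lambda>A. Q (g ` A)) \<le> PP p Q" .
qed


section \<open>Connectivity and simple paths\<close>

definition conn :: "'v set set \<Rightarrow> 'v \<Rightarrow> 'v \<Rightarrow> bool" where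
  "conn A u v \<longleftrightarrow> (u, v) \<in> {(x, y). {x, y} \<in> A}\<^sup>*"

lemma conn_refl [simp, intro]: "conn A u u" by (simp add: conn_def)

lemma conn_edge: "{u, v} \<in> A \<Longrightarrow> conn A u v" by (auto simp: conn_def)

lemma conn_trans: "conn A u v \<Longrightarrow> conn A v w \<Longrightarrow> conn A u w"
  unfolding conn_def by (rule rtrancl_trans)

lemma conn_sym: "conn A u v \<Longrightarrow> conn A v u"
  unfolding conn_def
proof -
  assume "(u, v) \<in> {(x, y). {x, y} \<in> A}\<^sup>*"
  moreover have "sym {(x, y). {x, y} \<in> A}" by (auto simp: sym_def insert_commute)
  ultimately show "(v, u) \<in> {(x, y). {x, y} \<in> A}\<^sup>*" using sym_rtrancl by (metis symD)
qed

lemma conn_commute: "conn A u v = conn A v u" using conn_sym by metis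

lemma conn_mono: "conn A u v \<Longrightarrow> A \<subseteq> B \<Longrightarrow> conn B u v"
proof -
  assume "A \<subseteq> B"
  then have "{(x, y). {x, y} \<in> A} \<subseteq> {(x, y). {x, y} \<in> B}" by auto
  then show "conn A u v \<Longrightarrow> conn B u v" unfolding conn_def using rtrancl_mono by blast
qed

fun pe :: "'v list \<Rightarrow> 'v set set" where
  "pe (x # y # zs) = insert {x, y} (pe (y # zs))"
| "pe _ = {}"

lemma pe_subset: "e \<in> pe \<gamma> \<Longrightarrow> e \<subseteq> set \<gamma>"
  by (induction \<gamma> rule: pe.induct) auto

lemma finite_pe [simp, intro]: "finite (pe \<gamma>)"
  by (induction \<gamma> rule: pe.induct) auto

lemma successively_pe: "successively (\<lambda>x y. {x, y} \<in> A) \<gamma> \<longleftrightarrow> pe \<gamma> \<subseteq> A"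
  by (induction \<gamma> rule: pe.induct) auto

lemma pe_append: "pe (\<gamma> @ x # \<delta>) = pe (\<gamma> @ [x]) \<union> pe (x # \<delta>)"
  by (induction \<gamma> rule: pe.induct) auto

lemma pe_rev: "pe (rev \<gamma>) = pe \<gamma>"
proof (induction \<gamma> rule: pe.induct)
  case (1 x y zs)
  have "pe (rev (x # y # zs)) = pe (rev zs @ y # [x])" by simp
  also have "\<dots> = pe (rev (y # zs)) \<union> pe [y, x]" by (subst pe_append) simp
  finally show ?case using 1 by (auto simp: insert_commute)
qed auto

lemma conn_pe: "\<gamma> \<noteq> [] \<Longrightarrow> x \<in> set \<gamma> \<Longrightarrow> conn (pe \<gamma>) (hd \<gamma>) x"
proof (induction \<gamma> rule: pe.induct)
  case (1 a b zs)
  show ?case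
  proof (cases "x = a")
    case False
    then have "conn (pe (b # zs)) b x" using 1 by auto
    then have "conn (pe (a # b # zs)) b x" by (rule conn_mono) auto
    moreover have "conn (pe (a # b # zs)) a b" by (rule conn_edge) auto
    ultimately show ?thesis using conn_trans by fastforce
  qed simp
qed auto

definition spath :: "'v \<Rightarrow> 'v \<Rightarrow> 'v list \<Rightarrow> bool" where
  "spath u v \<gamma> \<longleftrightarrow> \<gamma> \<noteq> [] \<and> hd \<gamma> = u \<and> last \<gamma> = v \<and> distinct \<gamma>"

lemma spath_conn: "spath u v \<gamma> \<Longrightarrow> x \<in> set \<gamma> \<Longrightarrow> conn (pe \<gamma>) u x"
  unfolding spath_def using conn_pe by auto

lemma spath_conn': "spath u v \<gamma> \<Longrightarrow> pe \<gamma> \<subseteq> A \<Longrightarrow> conn A u v"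
  using spath_conn[of u v \<gamma> v] conn_mono unfolding spath_def by fastforce

lemma spath_ends: "spath u v \<gamma> \<Longrightarrow> u \<in> set \<gamma> \<and> v \<in> set \<gamma>"
  unfolding spath_def by auto

lemma spath_rev: "spath u v \<gamma> \<Longrightarrow> spath v u (rev \<gamma>)"
  unfolding spath_def by (auto simp: hd_rev last_rev)

lemma spath_split:
  assumes "spath u v \<gamma>" "x \<in> set \<gamma>"
  obtains \<gamma>1 \<gamma>2 where "spath u x \<gamma>1" "spath x v \<gamma>2" "set \<gamma>1 \<inter> set \<gamma>2 = {x}" "set \<gamma> = set \<gamma>1 \<union> set \<gamma>2"
    "pe \<gamma> = pe \<gamma>1 \<union> pe \<gamma>2"
proof -
  obtain as bs where \<gamma>: "\<gamma> = as @ x # bs" using assms(2) by (meson split_list)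
  show ?thesis
  proof (rule that[of "as @ [x]" "x # bs"])
    show "spath u x (as @ [x])" using assms(1) unfolding \<gamma> spath_def by (cases as) auto
    show "spath x v (x # bs)" using assms(1) unfolding \<gamma> spath_def by auto
    show "set (as @ [x]) \<inter> set (x # bs) = {x}" using assms(1) unfolding \<gamma> spath_def by auto
    show "set \<gamma> = set (as @ [x]) \<union> set (x # bs)" unfolding \<gamma> by auto
    show "pe \<gamma> = pe (as @ [x]) \<union> pe (x # bs)" unfolding \<gamma> by (rule pe_append)
  qed
qed

lemma conn_spath:
  assumes "conn A u v"
  obtains \<gamma> where "spath u v \<gamma>" "pe \<gamma> \<subseteq> A"
proof -
  have "\<exists>\<gamma>. spath u v \<gamma> \<and> pe \<gamma> \<subseteq> A"
    using assms unfolding conn_def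
  proof (induction rule: converse_rtrancl_induct)
    case base
    show ?case by (intro exI[of _ "[v]"]) (auto simp: spath_def)
  next
    case (step x y)
    then obtain \<gamma> where \<gamma>: "spath y v \<gamma>" "pe \<gamma> \<subseteq> A" by auto
    show ?case
    proof (cases "x \<in> set \<gamma>")
      case True
      from spath_split[OF \<gamma>(1) True] \<gamma> show ?thesis by (metis le_sup_iff)
    next
      case False
      obtain zs where zs: "\<gamma> = y # zs" using \<gamma>(1) unfolding spath_def by (cases \<gamma>) auto
      have "spath x v (x # \<gamma>)" using \<gamma> False unfolding spath_def by auto
      moreover have "pe (x # \<gamma>) \<subseteq> A" using \<gamma>(2) step(1) unfolding zs by auto
      ultimately show ?thesis by blast
    qed
  qed
  then show ?thesis using that by blast
qed

text \<open>Stopping at the first vertex of \<open>S\<close> makes the path meet \<open>S\<close>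
  only at its end. Together with \<open>pe_disjoint\<close> this is how the edge-disjoint pieces
  below are produced.\<close>

lemma conn_hit:
  assumes "conn A u v" "v \<in> S"
  obtains w \<gamma> where "w \<in> S" "spath u w \<gamma>" "pe \<gamma> \<subseteq> A" "set \<gamma> \<inter> S = {w}"
proof -
  obtain \<gamma> where \<gamma>: "spath u v \<gamma>" "pe \<gamma> \<subseteq> A" using conn_spath[OF assms(1)] .
  have "\<exists>x\<in>set \<gamma>. x \<in> S" using spath_ends[OF \<gamma>(1)] assms(2) by auto
  then obtain as w bs where w: "\<gamma> = as @ w # bs" "w \<in> S" "\<forall>x\<in>set as. x \<notin> S"
    using split_list_first_prop[of \<gamma> "\<lambda>x. x \<in> S"] by auto
  show ?thesis
  proof (rule that[of w "as @ [w]"])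
    show "spath u w (as @ [w])" using \<gamma>(1) unfolding w spath_def by (cases as) auto
    show "pe (as @ [w]) \<subseteq> A" using \<gamma>(2) unfolding w pe_append[of as w bs] by auto
  qed (use w in auto)
qed

lemma pe_distinct_edge:
  "distinct \<gamma> \<Longrightarrow> e \<in> pe \<gamma> \<Longrightarrow> \<exists>x y. x \<noteq> y \<and> e = {x, y}"
  by (induction \<gamma> rule: pe.induct) auto

text \<open>An edge of a self-avoiding path has two distinct ends, so a path that shares at most one
  vertex with \<open>S\<close> has no edge inside \<open>S\<close>.\<close>

lemma pe_disjoint:
  assumes "distinct \<gamma>" "set \<gamma> \<inter> S \<subseteq> {x}" "\<And>e. e \<in> B \<Longrightarrow> e \<subseteq> S"
  shows "pe \<gamma> \<inter> B = {}"
proof (rule ccontr)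
  assume "pe \<gamma> \<inter> B \<noteq> {}"
  then obtain e where e: "e \<in> pe \<gamma>" "e \<in> B" by auto
  then have "e \<subseteq> {x}" using pe_subset[OF e(1)] assms(2) assms(3)[OF e(2)] by auto
  with pe_distinct_edge[OF assms(1) e(1)] show False by auto
qed

lemma pe_disjoint':
  assumes "distinct \<gamma>" "set \<gamma> \<inter> set \<delta> \<subseteq> {x}" shows "pe \<gamma> \<inter> pe \<delta> = {}"
  by (rule pe_disjoint[OF assms]) (rule pe_subset)

definition cn :: "'v \<Rightarrow> 'v \<Rightarrow> 'v set set \<Rightarrow> bool" where "cn u v A = conn A u v"

lemma incr_cn [simp]: "incr (cn u v)"
  unfolding incr_def cn_def by (intro allI impI, erule conn_mono)

lemma fin_incr_cn [simp]: "fin_incr (cn u v)"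
proof (rule fin_incrI)
  fix A assume "cn u v A"
  then obtain \<gamma> where "spath u v \<gamma>" "pe \<gamma> \<subseteq> A" using conn_spath[of A u v] unfolding cn_def by auto
  then show "\<exists>B\<subseteq>A. finite B \<and> cn u v B"
    using spath_conn'[of u v \<gamma> "pe \<gamma>"] unfolding cn_def by (intro exI[of _ "pe \<gamma>"]) auto
qed simp

lemma incr_dj_cn [simp]: "incr R \<Longrightarrow> incr (dj (cn u v) R)" by (intro incr_dj) auto
lemma fin_incr_dj_cn [simp]: "fin_incr R \<Longrightarrow> fin_incr (dj (cn u v) R)" by (intro fin_incr_dj) auto

lemma dj_cnI: "incr R \<Longrightarrow> spath u v \<gamma> \<Longrightarrow> pe \<gamma> \<subseteq> A \<Longrightarrow> R (A - pe \<gamma>) \<Longrightarrow> dj (cn u v) R A"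
  unfolding dj_def cn_def using spath_conn'[of u v \<gamma> "pe \<gamma>"] by auto

lemma cnI: "spath u v \<gamma> \<Longrightarrow> pe \<gamma> \<subseteq> A \<Longrightarrow> cn u v A"
  unfolding cn_def by (rule spath_conn')

section \<open>Edge-disjoint trees inside a connected set\<close>

text \<open>Fix a path from \<open>a\<close> to \<open>z\<close> and follow a path from
  \<open>x\<close> until it first meets it; the meeting point is the centre.\<close>

lemma conn_tripod:
  assumes "conn A a z" "conn A x a"
  shows "\<exists>w. dj (cn a w) (dj (cn w z) (cn x w)) A"
proof -
  obtain \<gamma> where \<gamma>: "spath a z \<gamma>" "pe \<gamma> \<subseteq> A" using conn_spath[OF assms(1)] .
  have "a \<in> set \<gamma>" using spath_ends[OF \<gamma>(1)] by auto
  from conn_hit[OF assms(2) this] obtain w \<delta> where \<delta>: "w \<in> set \<gamma>" "spath x w \<delta>" "pe \<delta> \<subseteq> A" "set \<delta> \<inter> set \<gamma> = {w}" .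
  obtain \<gamma>1 \<gamma>2 where s: "spath a w \<gamma>1" "spath w z \<gamma>2" "set \<gamma>1 \<inter> set \<gamma>2 = {w}" "set \<gamma> = set \<gamma>1 \<union> set \<gamma>2" "pe \<gamma> = pe \<gamma>1 \<union> pe \<gamma>2"
    using spath_split[OF \<gamma>(1) \<delta>(1)] .
  have d: "pe \<gamma>1 \<inter> pe \<gamma>2 = {}" "pe \<delta> \<inter> pe \<gamma>1 = {}" "pe \<delta> \<inter> pe \<gamma>2 = {}"
    by ((rule pe_disjoint'[of _ _ w]; use s \<delta> in \<open>auto simp: spath_def\<close>)+)
  have "dj (cn a w) (dj (cn w z) (cn x w)) A"
    using d s(5) \<gamma>(2) \<delta>(3)
    by (intro dj_cnI[OF _ s(1)] dj_cnI[OF _ s(2)] cnI[OF \<delta>(2)] incr_dj incr_cn) auto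
  then show ?thesis ..
qed

text \<open>A tree with leaves \<open>a\<close>, \<open>b\<close> at the branch point
  \<open>w1\<close> and leaves \<open>c\<close>, \<open>d\<close> at the branch point
  \<open>w2\<close>; nesting \<open>dj\<close> makes all five legs mutually edge-disjoint. Legs may
  be trivial.\<close>

definition tree4 :: "'v \<Rightarrow> 'v \<Rightarrow> 'v \<Rightarrow> 'v \<Rightarrow> 'v \<Rightarrow> 'v \<Rightarrow> 'v set set \<Rightarrow> bool" where
  "tree4 a b c d w1 w2 = dj (cn a w1) (dj (cn b w1) (dj (cn w1 w2) (dj (cn w2 c) (cn w2 d))))"

lemma fin_incr_tree4 [simp]: "fin_incr (tree4 a b c d w1 w2)"
  unfolding tree4_def by simp

lemma tree4I:
  assumes "spath a w1 \<gamma>1" "spath b w1 \<gamma>2" "spath w1 w2 \<gamma>3" "spath w2 c \<gamma>4" "spath w2 d \<gamma>5"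
    and "pe \<gamma>1 \<union> pe \<gamma>2 \<union> pe \<gamma>3 \<union> pe \<gamma>4 \<union> pe \<gamma>5 \<subseteq> A"
    and "pe \<gamma>1 \<inter> pe \<gamma>2 = {}" "pe \<gamma>1 \<inter> pe \<gamma>3 = {}" "pe \<gamma>1 \<inter> pe \<gamma>4 = {}" "pe \<gamma>1 \<inter> pe \<gamma>5 = {}"
    "pe \<gamma>2 \<inter> pe \<gamma>3 = {}" "pe \<gamma>2 \<inter> pe \<gamma>4 = {}" "pe \<gamma>2 \<inter> pe \<gamma>5 = {}"
    "pe \<gamma>3 \<inter> pe \<gamma>4 = {}" "pe \<gamma>3 \<inter> pe \<gamma>5 = {}" "pe \<gamma>4 \<inter> pe \<gamma>5 = {}"
  shows "tree4 a b c d w1 w2 A"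
  unfolding tree4_def
  using assms(6-)
  by (intro dj_cnI[OF _ assms(1)] dj_cnI[OF _ assms(2)] dj_cnI[OF _ assms(3)] dj_cnI[OF _ assms(4)] cnI[OF assms(5)] incr_dj incr_cn) auto

text \<open>Attach \<open>x\<close> to a path from \<open>a\<close> to \<open>z\<close>, then
  \<open>y\<close> to the resulting tripod. The three legs on which \<open>y\<close> can land give
  the three pairings of the leaves.\<close>

lemma conn_tree4:
  assumes "conn A a z" "conn A x a" "conn A y a"
  shows "\<exists>w1 w2. tree4 a x z y w1 w2 A \<or> tree4 a y z x w1 w2 A \<or> tree4 a z x y w1 w2 A"
proof -
  obtain \<gamma> where \<gamma>: "spath a z \<gamma>" "pe \<gamma> \<subseteq> A" using conn_spath[OF assms(1)] .
  have a: "a \<in> set \<gamma>" using spath_ends[OF \<gamma>(1)] by auto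
  from conn_hit[OF assms(2) this] obtain w \<delta> where \<delta>: "w \<in> set \<gamma>" "spath x w \<delta>" "pe \<delta> \<subseteq> A" "set \<delta> \<inter> set \<gamma> = {w}" .
  obtain \<gamma>1 \<gamma>2 where s: "spath a w \<gamma>1" "spath w z \<gamma>2" "set \<gamma>1 \<inter> set \<gamma>2 = {w}" "set \<gamma> = set \<gamma>1 \<union> set \<gamma>2" "pe \<gamma> = pe \<gamma>1 \<union> pe \<gamma>2"
    using spath_split[OF \<gamma>(1) \<delta>(1)] .
  have "a \<in> set \<gamma> \<union> set \<delta>" using a by auto
  from conn_hit[OF assms(3) this] obtain v \<eta> where \<eta>: "v \<in> set \<gamma> \<union> set \<delta>" "spath y v \<eta>" "pe \<eta> \<subseteq> A" "set \<eta> \<inter> (set \<gamma> \<union> set \<delta>) = {v}" .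
  have A: "pe \<gamma>1 \<subseteq> A" "pe \<gamma>2 \<subseteq> A" using s(5) \<gamma>(2) by auto
  have d: "pe \<gamma>1 \<inter> pe \<gamma>2 = {}" "pe \<delta> \<inter> pe \<gamma>1 = {}" "pe \<delta> \<inter> pe \<gamma>2 = {}"
    by ((rule pe_disjoint'[of _ _ w]; use s \<delta> in \<open>auto simp: spath_def\<close>)+)
  have e: "pe \<eta> \<inter> pe \<gamma>1 = {}" "pe \<eta> \<inter> pe \<gamma>2 = {}" "pe \<eta> \<inter> pe \<delta> = {}"
    by ((rule pe_disjoint'[of _ _ v]; use s \<delta> \<eta> in \<open>auto simp: spath_def\<close>)+)
  from \<eta>(1) s(4) consider "v \<in> set \<gamma>1" | "v \<in> set \<gamma>2" | "v \<in> set \<delta>" by auto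
  then show ?thesis
  proof cases
    case 1
    obtain \<alpha> \<beta> where t: "spath a v \<alpha>" "spath v w \<beta>" "set \<alpha> \<inter> set \<beta> = {v}" "pe \<gamma>1 = pe \<alpha> \<union> pe \<beta>"
      using spath_split[OF s(1) 1] by metis
    have "pe \<alpha> \<inter> pe \<beta> = {}" by ((rule pe_disjoint'[of _ _ v]; use t in \<open>auto simp: spath_def\<close>))
    then have "tree4 a y z x v w A"
      by (intro tree4I[OF t(1) \<eta>(2) t(2) s(2) spath_rev[OF \<delta>(2)]]) (use t A d e \<delta>(3) \<eta>(3) in \<open>auto simp: pe_rev\<close>)
    then show ?thesis by blast
  next
    case 2
    obtain \<alpha> \<beta> where t: "spath w v \<alpha>" "spath v z \<beta>" "set \<alpha> \<inter> set \<beta> = {v}" "pe \<gamma>2 = pe \<alpha> \<union> pe \<beta>"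
      using spath_split[OF s(2) 2] by metis
    have "pe \<alpha> \<inter> pe \<beta> = {}" by ((rule pe_disjoint'[of _ _ v]; use t in \<open>auto simp: spath_def\<close>))
    then have "tree4 a x z y w v A"
      by (intro tree4I[OF s(1) \<delta>(2) t(1,2) spath_rev[OF \<eta>(2)]]) (use t A d e \<delta>(3) \<eta>(3) in \<open>auto simp: pe_rev\<close>)
    then show ?thesis by blast
  next
    case 3
    obtain \<alpha> \<beta> where t: "spath x v \<alpha>" "spath v w \<beta>" "set \<alpha> \<inter> set \<beta> = {v}" "pe \<delta> = pe \<alpha> \<union> pe \<beta>"
      using spath_split[OF \<delta>(2) 3] by metis
    have "pe \<alpha> \<inter> pe \<beta> = {}" by ((rule pe_disjoint'[of _ _ v]; use t in \<open>auto simp: spath_def\<close>))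
    then have "tree4 a z x y w v A"
      by (intro tree4I[OF s(1) spath_rev[OF s(2)] spath_rev[OF t(2)] spath_rev[OF t(1)] spath_rev[OF \<eta>(2)]])
        (use t A d e \<delta>(3) \<eta>(3) in \<open>auto simp: pe_rev\<close>)
    then show ?thesis by blast
  qed
qed

text \<open>Discrete intermediate value theorem: \<open>L\<close> moves by at most 1 along an edge,
  so the path visits level \<open>n\<close>, and cutting it there gives two edge-disjoint
  pieces.\<close>

lemma conn_crossing:
  fixes L :: "'v \<Rightarrow> int"
  assumes "conn A u v" "L u \<le> n" "n \<le> L v" "\<And>x y. {x, y} \<in> A \<Longrightarrow> \<bar>L x - L y\<bar> \<le> 1"
  shows "\<exists>x. L x = n \<and> dj (cn u x) (cn x v) A"
proof -
  obtain \<gamma> where \<gamma>: "spath u v \<gamma>" "pe \<gamma> \<subseteq> A" using conn_spath[OF assms(1)] .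
  have "\<exists>x\<in>set \<gamma>. L x = n" if "\<gamma> \<noteq> []" "pe \<gamma> \<subseteq> A" "L (hd \<gamma>) \<le> n" "n \<le> L (last \<gamma>)" for \<gamma>
    using that
  proof (induction \<gamma> rule: pe.induct)
    case (1 x y zs)
    show ?case
    proof (cases "L x = n")
      case False
      then have "L x < n" using 1 by auto
      then have "L y \<le> n" using 1 assms(4)[of x y] by auto
      then show ?thesis using 1 by auto
    qed auto
  qed auto
  then obtain x where x: "x \<in> set \<gamma>" "L x = n" using \<gamma> assms unfolding spath_def by blast
  obtain \<alpha> \<beta> where t: "spath u x \<alpha>" "spath x v \<beta>" "set \<alpha> \<inter> set \<beta> = {x}" "pe \<gamma> = pe \<alpha> \<union> pe \<beta>"
    using spath_split[OF \<gamma>(1) x(1)] by metis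
  have "pe \<alpha> \<inter> pe \<beta> = {}" by ((rule pe_disjoint'[of _ _ x]; use t in \<open>auto simp: spath_def\<close>))
  then have "dj (cn u x) (cn x v) A"
    by (intro dj_cnI[OF _ t(1)] cnI[OF t(2)]) (use t \<gamma> in auto)
  with x show ?thesis by blast
qed

lemma conn_image_iff:
  assumes "inj g"
  shows "conn ((`) g ` A) (g u) (g v) \<longleftrightarrow> conn A u v"
proof
  assume "conn A u v"
  then show "conn ((`) g ` A) (g u) (g v)"
    unfolding conn_def
  proof (induction rule: rtrancl_induct)
    case (step y z)
    have "{g y, g z} = g ` {y, z}" by auto
    moreover have "{y, z} \<in> A" using step(2) by auto
    ultimately have "{g y, g z} \<in> (`) g ` A" by (rule rev_image_eqI[rotated])
    then show ?case using step by (auto intro: rtrancl_into_rtrancl)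
  qed auto
next
  assume "conn ((`) g ` A) (g u) (g v)"
  then have "\<exists>w. g v = g w \<and> conn A u w"
    unfolding conn_def[of "(`) g ` A"]
  proof (induction rule: rtrancl_induct)
    case (step y z)
    then obtain w where w: "y = g w" "conn A u w" by auto
    obtain e where e: "e \<in> A" "{y, z} = g ` e" using step(2) by auto
    then obtain w' where w': "z = g w'" "w' \<in> e" by (metis imageE insert_iff)
    have "g w \<in> g ` e" using e w by (metis insertI1)
    then have "w \<in> e" using assms by (simp add: inj_image_mem_iff)
    have "e = {w, w'}"
    proof (rule inj_image_eq_iff[OF assms, THEN iffD1])
      show "g ` e = g ` {w, w'}" using e w w' by auto
    qed
    then have "conn A w w'" using e by (auto intro: conn_edge)
    then show ?case using w w' conn_trans by metis
  qed auto
  then show "conn A u v" using assms by (metis injD)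
qed

section \<open>The two-point function\<close>

lemma vec_of_int_diff: "vec_of_int (u - v) = vec_of_int u - vec_of_int v"
  by (simp add: vec_of_int_def vec_eq_iff)
lemma vec_of_int_add: "vec_of_int (u + v) = vec_of_int u + vec_of_int v"
  by (simp add: vec_of_int_def vec_eq_iff)
lemma vec_of_int_minus: "vec_of_int (- v) = - vec_of_int v"
  by (simp add: vec_of_int_def vec_eq_iff)
lemma vec_of_int_0 [simp]: "vec_of_int 0 = 0"
  by (simp add: vec_of_int_def vec_eq_iff)
lemma vec_of_int_nth [simp]: "vec_of_int u $ i = real_of_int (u $ i)"
  by (simp add: vec_of_int_def)

definition vnorm :: "int ^ 'd::finite \<Rightarrow> real" where "vnorm x = norm (vec_of_int x)"

lemma vnorm_triangle: "vnorm (x + y) \<le> vnorm x + vnorm y"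
  by (simp add: vnorm_def vec_of_int_add norm_triangle_ineq)
lemma vnorm_minus [simp]: "vnorm (- x) = vnorm x"
  by (simp add: vnorm_def vec_of_int_minus)
lemma vnorm_nonneg [simp]: "0 \<le> vnorm x" by (simp add: vnorm_def)
lemma vnorm_0 [simp]: "vnorm 0 = 0" by (simp add: vnorm_def)

lemma bonds_iff: "{u, v} \<in> bonds \<longleftrightarrow> vnorm (u - v) = 1"
proof
  assume "{u, v} \<in> bonds"
  then obtain a b where "{u, v} = {a, b}" "vnorm (a - b) = 1"
    by (auto simp: bonds_def vnorm_def vec_of_int_diff)
  then show "vnorm (u - v) = 1" using vnorm_minus[of "u - v"] by (auto simp: doubleton_eq_iff)
qed (auto simp: bonds_def vnorm_def vec_of_int_diff)

lemma bond_card2: "b \<in> bonds \<Longrightarrow> \<exists>u v. u \<noteq> v \<and> b = {u, v} \<and> vnorm (u - v) = 1"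
proof -
  assume b: "b \<in> bonds"
  then obtain u v where uv: "b = {u, v}" by (auto simp: bonds_def)
  with b have "vnorm (u - v) = 1" using bonds_iff by auto
  moreover from this have "u \<noteq> v" by auto
  ultimately show ?thesis using uv by blast
qed

text \<open>For an integer k, |k| is at most k^2, so the l1 norm is at most 1. Thus a bond changes
  exactly one coordinate, by one.\<close>

lemma vnorm_unit_l1: "vnorm x = 1 \<Longrightarrow> (\<Sum>i\<in>UNIV. \<bar>x $ i\<bar>) = 1"
proof -
  assume "vnorm x = 1"
  then have "(\<Sum>i\<in>UNIV. (real_of_int (x $ i))\<^sup>2) = 1"
    by (simp add: vnorm_def norm_vec_def L2_set_def)
  then have s: "(\<Sum>i\<in>UNIV. (x $ i)\<^sup>2) = 1"
    by (metis (mono_tags, lifting) of_int_1 of_int_eq_iff of_int_power of_int_sum sum.cong)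
  have le: "\<bar>x $ i\<bar> \<le> (x $ i)\<^sup>2" for i
  proof (cases "x $ i = 0")
    case False
    then have "\<bar>x $ i\<bar> * 1 \<le> \<bar>x $ i\<bar> * \<bar>x $ i\<bar>" by (intro mult_left_mono) auto
    then show ?thesis by (simp add: power2_eq_square)
  qed simp
  have "(\<Sum>i\<in>UNIV. \<bar>x $ i\<bar>) \<le> (\<Sum>i\<in>UNIV. (x $ i)\<^sup>2)" by (intro sum_mono le)
  then have "(\<Sum>i\<in>UNIV. \<bar>x $ i\<bar>) \<le> 1" using s by simp
  moreover have "(\<Sum>i\<in>UNIV. \<bar>x $ i\<bar>) \<noteq> 0"
  proof
    assume "(\<Sum>i\<in>UNIV. \<bar>x $ i\<bar>) = 0"
    then have "\<forall>i. x $ i = 0" by (simp add: sum_nonneg_eq_0_iff)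
    then show False using s by simp
  qed
  moreover have "(\<Sum>i\<in>UNIV. \<bar>x $ i\<bar>) \<ge> 0" by (simp add: sum_nonneg)
  ultimately show ?thesis by linarith
qed

lemma vnorm_axis: "\<bar>s\<bar> = 1 \<Longrightarrow> vnorm (axis i s) = 1"
proof -
  assume s: "\<bar>s\<bar> = 1"
  have "vec_of_int (axis i s) = axis i (real_of_int s)" by (simp add: vec_of_int_def axis_def vec_eq_iff)
  then show ?thesis using s by (simp add: vnorm_def norm_eq_sqrt_inner inner_axis_axis flip: of_int_abs)
qed

definition tau :: "real \<Rightarrow> int ^ 'd::finite \<Rightarrow> int ^ 'd \<Rightarrow> real" where
  "tau p u v = PP p (cn u v)"

lemma connected_in_iff: "connected_in \<omega> k n \<longleftrightarrow> conn (opn \<omega>) k n"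
proof
  assume "connected_in \<omega> k n"
  then obtain \<gamma> where \<gamma>: "open_path \<omega> k n \<gamma>" unfolding connected_in_def ..
  then have "pe \<gamma> \<subseteq> opn \<omega>"
    unfolding open_path_def successively_pe[symmetric] by (simp add: opn_def)
  moreover have "conn (pe \<gamma>) k n" using conn_pe[of \<gamma> n] \<gamma> unfolding open_path_def by auto
  ultimately show "conn (opn \<omega>) k n" by (rule conn_mono[rotated])
next
  assume "conn (opn \<omega>) k n"
  then obtain \<gamma> where "spath k n \<gamma>" "pe \<gamma> \<subseteq> opn \<omega>" using conn_spath by metis
  then have "open_path \<omega> k n \<gamma>"
    unfolding open_path_def spath_def successively_pe[symmetric] by (simp add: opn_def)
  then show "connected_in \<omega> k n" unfolding connected_in_def ..
qed

lemma connection_prob_eq: "connection_prob p k n = tau p k n"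
  by (simp add: connection_prob_def tau_def PP_def ev_def cn_def connected_in_iff)

lemma tau_sym: "tau p u v = tau p v u"
  by (simp add: tau_def cn_def[abs_def] conn_commute)

lemma tau_nonneg: "0 \<le> tau p u v" by (simp add: tau_def PP_nonneg)
lemma tau_le_1: "tau p u v \<le> 1" by (simp add: tau_def PP_le_1)

lemma tau_refl: "tau p u u = 1"
proof -
  interpret prob_space "percolation p :: ((int ^ 'a) set \<Rightarrow> bool) measure" by (rule prob_space_percolation)
  show ?thesis by (simp add: tau_def PP_def ev_def cn_def prob_space)
qed

lemma tau_automorphism:
  fixes g :: "int ^ 'd::finite \<Rightarrow> int ^ 'd"
  assumes "0 \<le> p" "p \<le> 1" "inj g" "\<And>u v. vnorm (g u - g v) = vnorm (u - v)"
  shows "tau p u v \<le> tau p (g u) (g v)"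
proof -
  have eq: "(\<lambda>A. cn (g u) (g v) ((`) g ` A)) = cn u v"
    using conn_image_iff[OF assms(3)] by (auto simp: cn_def)
  have "PP p (\<lambda>A. cn (g u) (g v) ((`) g ` A)) \<le> PP p (cn (g u) (g v))"
  proof (rule PP_reindex_le[where Q = "cn (g u) (g v)" and g = "(`) g"])
    show "inj_on ((`) g) bonds" using assms(3) by (metis inj_image_eq_iff inj_onI)
    show "(`) g ` bonds \<subseteq> bonds"
    proof safe
      fix b :: "(int ^ 'd) set" assume "b \<in> bonds"
      then obtain x y where "b = {x, y}" "vnorm (x - y) = 1" using bond_card2 by blast
      then show "g ` b \<in> bonds" using bonds_iff[of "g x" "g y"] assms(4) by simp
    qed
  qed (use assms eq in auto)
  then show ?thesis by (simp add: eq tau_def)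
qed

lemma tau_translate:
  assumes "0 \<le> p" "p \<le> 1" shows "tau p (u + a) (v + a) = tau p u v"
proof (rule antisym)
  have *: "tau p u v \<le> tau p (u + a) (v + a)" for u v a :: "int ^ 'a"
    by (rule tau_automorphism[OF assms, of "\<lambda>x. x + a"]) (auto simp: inj_def)
  show "tau p u v \<le> tau p (u + a) (v + a)" by (rule *)
  show "tau p (u + a) (v + a) \<le> tau p u v" using *[of "u + a" "v + a" "- a"] by simp
qed

lemma tau_diff: "0 \<le> p \<Longrightarrow> p \<le> 1 \<Longrightarrow> tau p u v = tau p 0 (v - u)"
  using tau_translate[of p u "- u" v] by simp

lemma tau_FKG: "0 \<le> p \<Longrightarrow> p \<le> 1 \<Longrightarrow> tau p u v * tau p v w \<le> tau p u w"
proof -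
  assume p: "0 \<le> p" "p \<le> 1"
  have "tau p u v * tau p v w \<le> PP p (\<lambda>A. cn u v A \<and> cn v w A)"
    unfolding tau_def by (rule PP_FKG) (use p in auto)
  also have "\<dots> \<le> tau p u w" unfolding tau_def
    by (rule PP_mono) (use p in \<open>auto simp: cn_def intro: conn_trans\<close>)
  finally show ?thesis .
qed

lemma tau_bond: "0 \<le> p \<Longrightarrow> p \<le> 1 \<Longrightarrow> vnorm (u - v) = 1 \<Longrightarrow> p \<le> tau p u v"
proof -
  assume p: "0 \<le> p" "p \<le> 1" and "vnorm (u - v) = 1"
  then have b: "{u, v} \<in> bonds" by (simp add: bonds_iff)
  have "bP p {{u, v}} (cn u v) \<le> tau p u v"
    unfolding tau_def by (rule bP_le_PP) (use p b in auto)
  moreover have "cn u v {{u, v}}" by (simp add: cn_def conn_edge)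
  then have "p \<le> bP p {{u, v}} (cn u v)" using p by (simp add: bP_insert)
  ultimately show ?thesis by linarith
qed

definition l1 :: "int ^ 'd::finite \<Rightarrow> nat" where "l1 x = (\<Sum>i\<in>UNIV. nat \<bar>x $ i\<bar>)"

text \<open>Move a nonzero coordinate one unit towards 0 and use FKG: each of the
  \<open>l1 x\<close> bonds of a shortest path costs a factor \<open>p\<close>.\<close>

lemma tau_lower:
  assumes p: "0 \<le> p" "p \<le> 1" shows "p ^ l1 x \<le> tau p 0 x"
proof (induction "l1 x" arbitrary: x)
  case 0
  then have "x = 0" by (simp add: l1_def vec_eq_iff)
  then show ?case using 0 by (simp add: tau_refl)
next
  case (Suc n)
  then have "l1 x \<noteq> 0" by simp
  then obtain i where i: "x $ i \<noteq> 0" unfolding l1_def by (metis (mono_tags, lifting) abs_zero nat_0 sum.neutral)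
  let ?y = "x - axis i (sgn (x $ i))"
  have "l1 x = nat \<bar>x $ i\<bar> + (\<Sum>j\<in>UNIV - {i}. nat \<bar>x $ j\<bar>)"
    unfolding l1_def by (rule sum.remove) auto
  moreover have "l1 ?y = nat \<bar>?y $ i\<bar> + (\<Sum>j\<in>UNIV - {i}. nat \<bar>?y $ j\<bar>)"
    unfolding l1_def by (rule sum.remove) auto
  moreover have "(\<Sum>j\<in>UNIV - {i}. nat \<bar>?y $ j\<bar>) = (\<Sum>j\<in>UNIV - {i}. nat \<bar>x $ j\<bar>)"
    by (intro sum.cong) (auto simp: axis_def)
  moreover have "nat \<bar>x $ i\<bar> = Suc (nat \<bar>?y $ i\<bar>)" using i by (auto simp: axis_def sgn_if)
  ultimately have "l1 x = Suc (l1 ?y)" by simp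
  then have "l1 ?y = n" using Suc by simp
  then have IH: "p ^ l1 ?y \<le> tau p 0 ?y" using Suc by blast
  have "vnorm (axis i (sgn (x $ i)) :: int ^ 'a) = 1" by (rule vnorm_axis) (use i in \<open>simp add: sgn_if\<close>)
  moreover have "?y - x = - axis i (sgn (x $ i))" by simp
  ultimately have "vnorm (?y - x) = 1" by (simp only: vnorm_minus)
  then have "p \<le> tau p ?y x" by (rule tau_bond[OF p])
  then have "p ^ l1 ?y * p \<le> tau p 0 ?y * tau p ?y x" using IH p by (intro mult_mono) (auto simp: tau_nonneg)
  also have "\<dots> \<le> tau p 0 x" by (rule tau_FKG[OF p])
  finally show ?case using \<open>l1 x = Suc (l1 ?y)\<close> by (simp add: mult.commute)
qed

section \<open>Union bound\<close>

text \<open>Countable sums are kept as integrals against counting measure with values in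
  \<open>ennreal\<close>, so that sums can be exchanged without any convergence argument.\<close>

abbreviation lsum :: "('a \<Rightarrow> ennreal) \<Rightarrow> ennreal" where "lsum f \<equiv> (\<integral>\<^sup>+x. f x \<partial>count_space UNIV)"

lemma PP_ennreal: "ennreal (PP p Q) = emeasure (percolation p) (ev p Q)"
  unfolding PP_def using prob_space_percolation
  by (metis finite_measure.emeasure_eq_measure prob_space.finite_measure)

lemma PP_union:
  fixes R :: "'i::countable \<Rightarrow> (int ^ 'd::finite) set set \<Rightarrow> bool"
  assumes p: "0 \<le> p" "p \<le> 1" and Q: "fin_incr Q" and R: "\<And>x. fin_incr (R x)"
    and imp: "\<And>A. A \<subseteq> bonds \<Longrightarrow> Q A \<Longrightarrow> \<exists>x. R x A"
  shows "ennreal (PP p Q) \<le> lsum (\<lambda>x. ennreal (PP p (R x)))"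
proof -
  have "ennreal (PP p Q) = (\<integral>\<^sup>+\<omega>. indicator (ev p Q) \<omega> \<partial>percolation p)"
    using Q p by (simp add: PP_ennreal)
  also have "\<dots> \<le> (\<integral>\<^sup>+\<omega>. lsum (\<lambda>x. indicator (ev p (R x)) \<omega>) \<partial>percolation p)"
  proof (rule nn_integral_mono)
    fix \<omega> :: "(int ^ 'd) set \<Rightarrow> bool" assume \<omega>: "\<omega> \<in> space (percolation p)"
    show "indicator (ev p Q) \<omega> \<le> lsum (\<lambda>x. indicator (ev p (R x)) \<omega> :: ennreal)"
    proof (cases "\<omega> \<in> ev p Q")
      case True
      then obtain x where "R x (opn \<omega>)" using imp[of "opn \<omega>"] by (auto simp: ev_def opn_def)
      then have "\<omega> \<in> ev p (R x)" using \<omega> by (simp add: ev_def)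
      then have "1 \<le> lsum (\<lambda>x. indicator (ev p (R x)) \<omega> :: ennreal)"
        using nn_integral_ge_point[of x UNIV "\<lambda>x. indicator (ev p (R x)) \<omega> :: ennreal"] by simp
      then show ?thesis using True by simp
    qed simp
  qed
  also have "\<dots> = lsum (\<lambda>x. \<integral>\<^sup>+\<omega>. indicator (ev p (R x)) \<omega> \<partial>percolation p)"
    by (rule nn_integral_count_space_nn_integral) (use R p in \<open>auto intro!: borel_measurable_indicator sets_ev\<close>)
  also have "\<dots> = lsum (\<lambda>x. ennreal (PP p (R x)))"
    using R p by (simp add: PP_ennreal)
  finally show ?thesis .
qed


section \<open>Exponential decay of the two-point function\<close>

lemma bP_mono_p:
  assumes "finite F" "incr Q" "0 \<le> p" "p \<le> q" "q \<le> 1"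
  shows "bP p F Q \<le> bP q F Q"
  using assms(1,2)
proof (induction F arbitrary: Q rule: finite_induct)
  case (insert e F)
  have i: "incr (\<lambda>A. Q (insert e A))" using insert.prems by (rule incr_insert)
  have le: "bP q F Q \<le> bP q F (\<lambda>A. Q (insert e A))"
    using insert.prems assms by (intro bP_mono) (auto elim: incrD)
  have "p * bP p F (\<lambda>A. Q (insert e A)) + (1 - p) * bP p F Q \<le> p * bP q F (\<lambda>A. Q (insert e A)) + (1 - p) * bP q F Q"
    using insert.IH[OF i] insert.IH[OF insert.prems] assms by (intro add_mono mult_left_mono) auto
  also have "\<dots> = q * bP q F (\<lambda>A. Q (insert e A)) + (1 - q) * bP q F Q - (q - p) * (bP q F (\<lambda>A. Q (insert e A)) - bP q F Q)"
    by (simp add: algebra_simps)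
  also have "\<dots> \<le> q * bP q F (\<lambda>A. Q (insert e A)) + (1 - q) * bP q F Q"
    using le assms by simp
  finally show ?case using insert.hyps by (simp add: bP_insert)
qed simp

definition lbox :: "nat \<Rightarrow> (int ^ 'd::finite) set" where
  "lbox n = {x. \<forall>i. \<bar>x $ i\<bar> \<le> int n}"

lemma finite_lbox [simp]: "finite (lbox n :: (int ^ 'd::finite) set)"
proof -
  have "(lbox n :: (int ^ 'd) set) \<subseteq> (\<lambda>f. \<chi> i. f i) ` (UNIV \<rightarrow>\<^sub>E {- int n..int n})"
  proof
    fix x :: "int ^ 'd" assume "x \<in> lbox n"
    then have "\<And>i. x $ i \<in> {- int n..int n}" by (auto simp: lbox_def abs_le_iff minus_le_iff)
    then have "(\<lambda>i. x $ i) \<in> UNIV \<rightarrow>\<^sub>E {- int n..int n}" by auto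
    then show "x \<in> (\<lambda>f. \<chi> i. f i) ` (UNIV \<rightarrow>\<^sub>E {- int n..int n})" by (rule rev_image_eqI) (simp add: vec_eq_iff)
  qed
  moreover have "finite (UNIV \<rightarrow>\<^sub>E {- int n..int n} :: ('d \<Rightarrow> int) set)" by (intro finite_PiE) auto
  ultimately show ?thesis using finite_subset by blast
qed

lemma zero_in_lbox [simp]: "0 \<in> lbox n" by (simp add: lbox_def)

lemma lbox_mono: "m \<le> n \<Longrightarrow> lbox m \<subseteq> lbox n" 
proof
  fix x assume mn: "m \<le> n" and "x \<in> lbox m"
  then have "\<bar>x $ i\<bar> \<le> int n" for i using order_trans[of "\<bar>x $ i\<bar>" "int m" "int n"] by (simp add: lbox_def)
  then show "x \<in> lbox n" by (simp add: lbox_def)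
qed

lemma finite_subset_lbox: "finite S \<Longrightarrow> \<exists>n. S \<subseteq> lbox n"
proof (induction rule: finite_induct)
  case (insert x S)
  then obtain n where n: "S \<subseteq> lbox n" by auto
  define m where "m = (\<Sum>i\<in>UNIV. nat \<bar>x $ i\<bar>)"
  have "nat \<bar>x $ i\<bar> \<le> m" for i unfolding m_def by (rule member_le_sum) auto
  then have "\<bar>x $ i\<bar> \<le> int m" for i by (simp add: nat_le_iff)
  then have "x \<in> lbox m" by (simp add: lbox_def)
  then show ?case using n lbox_mono[of n "max m n"] lbox_mono[of m "max m n"] by (intro exI[of _ "max m n"]) auto
qed auto

lemma lbox_add: "x \<in> lbox m \<Longrightarrow> y \<in> lbox n \<Longrightarrow> x + y \<in> lbox (m + n)"
  unfolding lbox_def by (auto intro: order_trans[OF abs_triangle_ineq] add_mono)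

lemma vnorm_component: "\<bar>x $ i\<bar> \<le> vnorm x"
  using component_le_norm_cart[of "vec_of_int x" i] by (simp add: vnorm_def)

lemma unit_in_lbox: "vnorm x = 1 \<Longrightarrow> x \<in> lbox 1"
proof -
  assume "vnorm x = 1"
  then have "\<bar>x $ i\<bar> \<le> 1" for i using vnorm_component[of x i] by linarith
  then show ?thesis by (simp add: lbox_def)
qed

lemma lbox_vnorm: "x \<in> lbox n \<Longrightarrow> vnorm x \<le> CARD('d) * real n" for x :: "int ^ 'd::finite"
proof -
  assume x: "x \<in> lbox n"
  have "vnorm x \<le> (\<Sum>i\<in>UNIV. \<bar>vec_of_int x $ i\<bar>)" unfolding vnorm_def by (rule norm_le_l1_cart)
  also have "\<dots> \<le> (\<Sum>i\<in>(UNIV::'d set). real n)"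
  proof (rule sum_mono)
    fix i
    have "\<bar>x $ i\<bar> \<le> int n" using x by (simp add: lbox_def)
    then have "real_of_int \<bar>x $ i\<bar> \<le> real_of_int (int n)" by (simp only: of_int_le_iff)
    then show "\<bar>vec_of_int x $ i\<bar> \<le> real n" by simp
  qed
  finally show ?thesis by simp
qed

section \<open>A differential inequality for leaving a finite set\<close>

definition touching :: "(int ^ 'd::finite) set \<Rightarrow> (int ^ 'd) set set" where
  "touching \<Lambda> = {b \<in> bonds. b \<inter> \<Lambda> \<noteq> {}}"

definition inside :: "(int ^ 'd::finite) set \<Rightarrow> (int ^ 'd) set set" where
  "inside \<Lambda> = {b \<in> bonds. b \<subseteq> \<Lambda>}"

definition ebd :: "(int ^ 'd::finite) set \<Rightarrow> ((int ^ 'd) \<times> (int ^ 'd)) set" where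
  "ebd \<Lambda> = {(x, y). x \<in> \<Lambda> \<and> y \<notin> \<Lambda> \<and> {x, y} \<in> bonds}"

lemma finite_inside: "finite S \<Longrightarrow> finite (inside S)"
  by (rule finite_subset[of _ "Pow S"]) (auto simp: inside_def)

lemma finite_nbr: "finite \<Lambda> \<Longrightarrow> finite (\<Union>x\<in>\<Lambda>. \<Union>u\<in>lbox 1. {x + u})" by auto

lemma bond_nbr: "{x, y} \<in> bonds \<Longrightarrow> \<exists>u\<in>lbox 1. y = x + u"
  using unit_in_lbox[of "y - x"] bonds_iff[of y x] by (intro bexI[of _ "y - x"]) (auto simp: insert_commute)

lemma finite_ebd: "finite \<Lambda> \<Longrightarrow> finite (ebd \<Lambda>)"
proof (rule finite_subset[of _ "\<Lambda> \<times> (\<Union>x\<in>\<Lambda>. \<Union>u\<in>lbox 1. {x + u})"])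
  show "ebd \<Lambda> \<subseteq> \<Lambda> \<times> (\<Union>x\<in>\<Lambda>. \<Union>u\<in>lbox 1. {x + u})"
    using bond_nbr unfolding ebd_def by blast
qed (use finite_nbr in auto)

lemma finite_touching:
  assumes "finite \<Lambda>" shows "finite (touching \<Lambda>)"
proof (rule finite_subset)
  show "finite ((\<lambda>(x, y). {x, y}) ` (\<Lambda> \<times> (\<Union>x\<in>\<Lambda>. \<Union>u\<in>lbox 1. {x + u})))" using assms by auto
  show "touching \<Lambda> \<subseteq> (\<lambda>(x, y). {x, y}) ` (\<Lambda> \<times> (\<Union>x\<in>\<Lambda>. \<Union>u\<in>lbox 1. {x + u}))"
  proof
    fix b assume b: "b \<in> touching \<Lambda>"
    then obtain x where x: "x \<in> b" "x \<in> \<Lambda>" "b \<in> bonds" by (auto simp: touching_def)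
    then obtain y where y: "b = {x, y}" using bond_card2[of b] by auto
    then obtain u where "u \<in> lbox 1" "y = x + u" using bond_nbr x by blast
    then show "b \<in> (\<lambda>(x, y). {x, y}) ` (\<Lambda> \<times> (\<Union>x\<in>\<Lambda>. \<Union>u\<in>lbox 1. {x + u}))" using x y by auto
  qed
qed

definition exits :: "(int ^ 'd::finite) set \<Rightarrow> (int ^ 'd) set set \<Rightarrow> bool" where
  "exits \<Lambda> A \<longleftrightarrow> (\<exists>y. y \<notin> \<Lambda> \<and> cn 0 y A)"

lemma fin_incr_exits [simp]: "fin_incr (exits \<Lambda>)"
  unfolding exits_def[abs_def] by (intro fin_incr_Ex fin_incr_conj_const) simp

text \<open>The vertices of \<open>\<Lambda>\<close> that are cut off from its complement. If 0 does
  not exit, this random set contains 0 and is the set on which \<open>exits_derivative_bound\<close>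
  conditions.\<close>

definition bad :: "(int ^ 'd::finite) set \<Rightarrow> (int ^ 'd) set set \<Rightarrow> (int ^ 'd) set" where
  "bad \<Lambda> A = {x \<in> \<Lambda>. \<not> (\<exists>y. y \<notin> \<Lambda> \<and> conn A x y)}"

text \<open>A connection to the outside never visits \<open>S\<close>, so the bonds inside
  \<open>S\<close> have no influence on whether the cut-off set is \<open>S\<close>. This makes that
  event independent of the connections inside \<open>S\<close>.\<close>

lemma bad_iff:
  assumes "S \<subseteq> \<Lambda>"
  shows "bad \<Lambda> A = S \<longleftrightarrow> bad \<Lambda> (A - inside S) = S"
proof
  assume S: "bad \<Lambda> A = S"
  have "conn (A - inside S) x y" if "conn A x y" "y \<notin> \<Lambda>" for x y
    using that(1) unfolding conn_def
  proof (induction rule: converse_rtrancl_induct)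
    case (step x z)
    then have "conn A z y" by (simp add: conn_def)
    then have "z \<notin> S" using S that(2) by (auto simp: bad_def)
    then have "{x, z} \<in> A - inside S" using step by (auto simp: inside_def)
    with step show ?case by (auto intro: converse_rtrancl_into_rtrancl)
  qed simp
  moreover have "conn A x y" if "conn (A - inside S) x y" for x y using that by (rule conn_mono) auto
  ultimately have "bad \<Lambda> (A - inside S) = bad \<Lambda> A" by (auto simp: bad_def)
  then show "bad \<Lambda> (A - inside S) = S" using S by simp
next
  assume S: "bad \<Lambda> (A - inside S) = S"
  have out: "z \<notin> \<Lambda> \<or> (\<exists>y. y \<notin> \<Lambda> \<and> conn (A - inside S) z y)" if "z \<notin> S" for z
    using that S unfolding bad_def by blast
  have "y \<in> S" if "x \<in> S" "conn A x y" for x y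
    using that(2) unfolding conn_def
  proof (induction rule: rtrancl_induct)
    case (step y z)
    show ?case
    proof (rule ccontr)
      assume z: "z \<notin> S"
      then have "{y, z} \<in> A - inside S" using step by (auto simp: inside_def)
      then have yz: "conn (A - inside S) y z" by (rule conn_edge)
      then have "\<exists>w. w \<notin> \<Lambda> \<and> conn (A - inside S) y w" using out[OF z] conn_trans[OF yz] by auto
      then show False using step(3) S unfolding bad_def by blast
    qed
  qed (rule that(1))
  then have 1: "S \<subseteq> bad \<Lambda> A" using assms by (auto simp: bad_def)
  have "conn A x y" if "conn (A - inside S) x y" for x y using that by (rule conn_mono) auto
  then have "bad \<Lambda> A \<subseteq> bad \<Lambda> (A - inside S)" by (auto simp: bad_def)
  with 1 show "bad \<Lambda> A = S" using S by simp
qed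

text \<open>The boundary sum of Duminil-Copin and Tassion without its factor \<open>p\<close>; the
  factor appears in \<open>subcritical_psi\<close> and \<open>tau_exit_bound\<close>, while the
  derivative estimate uses the sum as it stands.\<close>

definition psi :: "real \<Rightarrow> (int ^ 'd::finite) set \<Rightarrow> real" where
  "psi p S = (\<Sum>(x, y)\<in>ebd S. bP p (inside S) (cn 0 x))"

lemma psi_mono: "finite S \<Longrightarrow> 0 \<le> p \<Longrightarrow> p \<le> q \<Longrightarrow> q \<le> 1 \<Longrightarrow> psi p S \<le> psi q S"
  unfolding psi_def by (intro sum_mono) (auto intro!: bP_mono_p finite_inside)

text \<open>A boundary bond of the cut-off set whose inner end is reached from 0 must be closed, and
  opening it lets 0 out. It has exactly one end in the set, so the ordered pairs on the left stand
  for distinct bonds.\<close>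

lemma pivotal_count:
  assumes "finite \<Lambda>" "0 \<in> \<Lambda>" "\<not> exits \<Lambda> A"
  shows "(\<Sum>(x, y)\<in>ebd (bad \<Lambda> A). of_bool (cn 0 x (A \<inter> inside (bad \<Lambda> A))))
         \<le> (\<Sum>e\<in>touching \<Lambda>. of_bool (e \<notin> A \<and> exits \<Lambda> (insert e A)) :: real)"
proof -
  let ?S = "bad \<Lambda> A"
  have S: "?S \<subseteq> \<Lambda>" "finite ?S" using assms(1) finite_subset by (auto simp: bad_def)
  have out: "z \<notin> \<Lambda> \<or> (\<exists>y. y \<notin> \<Lambda> \<and> conn A z y)" if "z \<notin> ?S" for z
    using that unfolding bad_def by blast
  let ?I = "{(x, y) \<in> ebd ?S. cn 0 x (A \<inter> inside ?S)}"
  have "(\<Sum>(x, y)\<in>ebd ?S. of_bool (cn 0 x (A \<inter> inside ?S))) = real (card ?I)"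
  proof -
    have "(\<Sum>(x, y)\<in>ebd ?S. of_bool (cn 0 x (A \<inter> inside ?S))) = (\<Sum>z\<in>ebd ?S. of_bool (z \<in> ?I) :: real)"
      by (intro sum.cong) auto
    also have "\<dots> = real (card (ebd ?S \<inter> {z. z \<in> ?I}))"
      using finite_ebd[OF S(2)] by (simp only: sum_of_bool_eq)
    also have "ebd ?S \<inter> {z. z \<in> ?I} = ?I" by auto
    finally show ?thesis .
  qed
  also have "card ?I = card ((\<lambda>(x, y). {x, y}) ` ?I)"
    by (rule card_image[symmetric]) (auto simp: inj_on_def ebd_def doubleton_eq_iff)
  also have "\<dots> \<le> card {e \<in> touching \<Lambda>. e \<notin> A \<and> exits \<Lambda> (insert e A)}"
  proof (rule card_mono)
    show "(\<lambda>(x, y). {x, y}) ` ?I \<subseteq> {e \<in> touching \<Lambda>. e \<notin> A \<and> exits \<Lambda> (insert e A)}"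
    proof clarsimp
      fix x y assume xy: "(x, y) \<in> ebd ?S" and "cn 0 x (A \<inter> inside ?S)"
      then have x: "conn A 0 x" by (auto simp: cn_def intro: conn_mono)
      have y: "x \<in> ?S" "y \<notin> ?S" "{x, y} \<in> bonds" using xy by (auto simp: ebd_def)
      have 1: "{x, y} \<in> touching \<Lambda>" using y S by (auto simp: touching_def)
      have 2: "{x, y} \<notin> A"
      proof
        assume "{x, y} \<in> A"
        then have xy: "conn A x y" by (rule conn_edge)
        then have "\<exists>w. w \<notin> \<Lambda> \<and> conn A x w" using out[OF y(2)] conn_trans[OF xy] by auto
        then show False using y(1) unfolding bad_def by blast
      qed
      let ?B = "insert {x, y} A"
      have "conn ?B 0 x" using x by (rule conn_mono) auto
      moreover have "conn ?B x y" by (rule conn_edge) auto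
      moreover obtain w where w: "w \<notin> \<Lambda>" "conn A y w" using out[OF y(2)] by auto
      moreover have "conn ?B y w" using w(2) by (rule conn_mono) auto
      ultimately have "exits \<Lambda> ?B" unfolding exits_def cn_def using conn_trans by metis
      with 1 2 show "{x, y} \<in> touching \<Lambda> \<and> {x, y} \<notin> A \<and> exits \<Lambda> ?B" by simp
    qed
  qed (use finite_touching[OF assms(1)] in auto)
  also have "real \<dots> = (\<Sum>e\<in>touching \<Lambda>. of_bool (e \<notin> A \<and> exits \<Lambda> (insert e A)) :: real)"
  proof -
    have "{e \<in> touching \<Lambda>. e \<notin> A \<and> exits \<Lambda> (insert e A)} = touching \<Lambda> \<inter> {e. e \<notin> A \<and> exits \<Lambda> (insert e A)}" by auto
    then show ?thesis using finite_touching[OF assms(1)] by (simp add: sum_of_bool_eq)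
  qed
  finally show ?thesis by simp
qed

text \<open>Condition on the cut-off set \<open>S\<close> containing 0. By independence, P(bad = S)
  times \<open>psi p S\<close> is the expected number of pairs in \<open>pivotal_count\<close> on
  that event, and \<open>psi \<ge> 1\<close> leaves at least P(0 is cut off). The right-hand side is
  the derivative given by Russo's formula.\<close>

lemma exits_derivative_bound:
  fixes \<Lambda> :: "(int ^ 'd::finite) set"
  assumes \<Lambda>: "finite \<Lambda>" "0 \<in> \<Lambda>" and p: "0 \<le> p" "p \<le> 1"
    and psi: "\<And>S :: (int ^ 'd) set. finite S \<Longrightarrow> 0 \<in> S \<Longrightarrow> 1 \<le> psi p S"
  shows "1 - bP p (touching \<Lambda>) (exits \<Lambda>) \<le>
    (\<Sum>e\<in>touching \<Lambda>. bE p (touching \<Lambda>) (\<lambda>A. of_bool (exits \<Lambda> (insert e A)) - of_bool (exits \<Lambda> (A - {e}))))"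
proof -
  let ?F = "touching \<Lambda>"
  let ?SS = "{S \<in> Pow \<Lambda>. 0 \<in> S}"
  have F: "finite ?F" by (rule finite_touching[OF \<Lambda>(1)])
  have SS: "finite ?SS" using \<Lambda> by auto
  have ex: "\<not> exits \<Lambda> A \<longleftrightarrow> 0 \<in> bad \<Lambda> A" for A using \<Lambda> by (auto simp: exits_def bad_def cn_def)
  have "1 - bP p ?F (exits \<Lambda>) = bE p ?F (\<lambda>A. 1 - of_bool (exits \<Lambda> A))"
    unfolding bP_def bE_diff using F by (simp add: bE_const)
  also have "\<dots> = bE p ?F (\<lambda>A. \<Sum>S\<in>?SS. of_bool (bad \<Lambda> A = S))"
  proof (rule bE_cong)
    fix A
    have "(\<Sum>S\<in>?SS. of_bool (bad \<Lambda> A = S) :: real) = (\<Sum>S\<in>?SS. if bad \<Lambda> A = S then 1 else 0)"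
      by (intro sum.cong) auto
    also have "\<dots> = (if bad \<Lambda> A \<in> ?SS then 1 else 0)"
      using SS by (simp add: sum.delta)
    also have "bad \<Lambda> A \<in> ?SS \<longleftrightarrow> \<not> exits \<Lambda> A" unfolding ex by (auto simp: bad_def)
    finally show "1 - of_bool (exits \<Lambda> A) = (\<Sum>S\<in>?SS. of_bool (bad \<Lambda> A = S) :: real)" by auto
  qed
  also have "\<dots> = (\<Sum>S\<in>?SS. bP p ?F (\<lambda>A. bad \<Lambda> A = S) * 1)"
    by (simp add: bE_sum bP_def)
  also have "\<dots> \<le> (\<Sum>S\<in>?SS. bP p ?F (\<lambda>A. bad \<Lambda> A = S) * psi p S)"
    using p \<Lambda> finite_subset by (intro sum_mono mult_left_mono psi bP_nonneg) auto
  also have "\<dots> = (\<Sum>S\<in>?SS. bE p ?F (\<lambda>A. of_bool (bad \<Lambda> A = S) * (\<Sum>(x, y)\<in>ebd S. of_bool (cn 0 x (A \<inter> inside S)))))"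
  proof (intro sum.cong refl)
    fix S assume S: "S \<in> ?SS"
    have sub: "inside S \<subseteq> ?F"
    proof
      fix b assume b: "b \<in> inside S"
      then have "b \<noteq> {}" using bond_card2[of b] by (auto simp: inside_def)
      with b S show "b \<in> ?F" by (auto simp: inside_def touching_def)
    qed
    have "psi p S = (\<Sum>(x, y)\<in>ebd S. bP p ?F (\<lambda>A. cn 0 x (A \<inter> inside S)))"
      unfolding psi_def
    proof (intro sum.cong refl, clarify)
      fix x :: "int ^ 'd"
      have "bP p ?F (\<lambda>A. cn 0 x (A \<inter> inside S)) = bE p (inside S) (\<lambda>A. of_bool (cn 0 x (A \<inter> inside S)))"
        unfolding bP_def by (rule bE_irrelevant[OF F sub]) (simp add: Int_assoc)
      also have "\<dots> = bP p (inside S) (cn 0 x)" unfolding bP_def by (intro bE_cong) (simp add: Int_absorb2)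
      finally show "bP p (inside S) (cn 0 x) = bP p ?F (\<lambda>A. cn 0 x (A \<inter> inside S))" ..
    qed
    then have "bP p ?F (\<lambda>A. bad \<Lambda> A = S) * psi p S
       = (\<Sum>(x, y)\<in>ebd S. bE p ?F (\<lambda>A. of_bool (cn 0 x (A \<inter> inside S))) * bE p ?F (\<lambda>A. of_bool (bad \<Lambda> A = S)))"
      by (simp add: sum_distrib_left bP_def mult.commute case_prod_unfold)
    also have "\<dots> = (\<Sum>(x, y)\<in>ebd S. bE p ?F (\<lambda>A. of_bool (cn 0 x (A \<inter> inside S)) * of_bool (bad \<Lambda> A = S)))"
    proof (intro sum.cong refl, clarify)
      fix x :: "int ^ 'd"
      show "bE p ?F (\<lambda>A. of_bool (cn 0 x (A \<inter> inside S))) * bE p ?F (\<lambda>A. of_bool (bad \<Lambda> A = S))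
        = bE p ?F (\<lambda>A. of_bool (cn 0 x (A \<inter> inside S)) * of_bool (bad \<Lambda> A = S))"
        by (rule bE_indep[OF F, symmetric, of _ "inside S"]) (use S bad_iff[of S \<Lambda>] in \<open>auto simp: Int_assoc\<close>)
    qed
    also have "\<dots> = bE p ?F (\<lambda>A. of_bool (bad \<Lambda> A = S) * (\<Sum>(x, y)\<in>ebd S. of_bool (cn 0 x (A \<inter> inside S))))"
      by (simp add: sum_distrib_left bE_sum[symmetric] case_prod_unfold mult.commute)
    finally show "bP p ?F (\<lambda>A. bad \<Lambda> A = S) * psi p S
      = bE p ?F (\<lambda>A. of_bool (bad \<Lambda> A = S) * (\<Sum>(x, y)\<in>ebd S. of_bool (cn 0 x (A \<inter> inside S))))" .
  qed
  also have "\<dots> = bE p ?F (\<lambda>A. \<Sum>S\<in>?SS. of_bool (bad \<Lambda> A = S) * (\<Sum>(x, y)\<in>ebd S. of_bool (cn 0 x (A \<inter> inside S))))"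
    by (rule bE_sum[symmetric])
  also have "\<dots> \<le> bE p ?F (\<lambda>A. \<Sum>e\<in>?F. of_bool (exits \<Lambda> (insert e A)) - of_bool (exits \<Lambda> (A - {e})))"
  proof (rule bE_mono[OF p])
    fix A
    have inc: "incr (exits \<Lambda>)" by (intro fin_incr_incr) simp
    have "(\<Sum>S\<in>?SS. of_bool (bad \<Lambda> A = S) * (\<Sum>(x, y)\<in>ebd S. of_bool (cn 0 x (A \<inter> inside S))))
      = (\<Sum>S\<in>?SS. if bad \<Lambda> A = S then (\<Sum>(x, y)\<in>ebd (bad \<Lambda> A). of_bool (cn 0 x (A \<inter> inside (bad \<Lambda> A)))) else 0 :: real)"
      by (intro sum.cong) auto
    also have "\<dots> = (if bad \<Lambda> A \<in> ?SS then (\<Sum>(x, y)\<in>ebd (bad \<Lambda> A). of_bool (cn 0 x (A \<inter> inside (bad \<Lambda> A)))) else 0)"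
      using SS by (simp add: sum.delta)
    also have "\<dots> \<le> (\<Sum>e\<in>?F. of_bool (exits \<Lambda> (insert e A)) - of_bool (exits \<Lambda> (A - {e})))"
    proof (cases "bad \<Lambda> A \<in> ?SS")
      case True
      then have "\<not> exits \<Lambda> A" by (simp add: ex)
      from pivotal_count[OF \<Lambda> this] True
      have "(if bad \<Lambda> A \<in> ?SS then (\<Sum>(x, y)\<in>ebd (bad \<Lambda> A). of_bool (cn 0 x (A \<inter> inside (bad \<Lambda> A)))) else 0)
         \<le> (\<Sum>e\<in>?F. of_bool (e \<notin> A \<and> exits \<Lambda> (insert e A)) :: real)" by simp
      also have "\<dots> \<le> (\<Sum>e\<in>?F. of_bool (exits \<Lambda> (insert e A)) - of_bool (exits \<Lambda> (A - {e})))"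
      proof (rule sum_mono)
        fix e
        have "\<not> exits \<Lambda> (A - {e})" using \<open>\<not> exits \<Lambda> A\<close> incrD[OF inc, of "A - {e}" A] by auto
        then show "of_bool (e \<notin> A \<and> exits \<Lambda> (insert e A)) \<le> of_bool (exits \<Lambda> (insert e A)) - (of_bool (exits \<Lambda> (A - {e})) :: real)"
          by simp
      qed
      finally show ?thesis .
    next
      case False
      have "0 \<le> (\<Sum>e\<in>?F. of_bool (exits \<Lambda> (insert e A)) - (of_bool (exits \<Lambda> (A - {e})) :: real))"
      proof (rule sum_nonneg)
        fix e
        have "exits \<Lambda> (A - {e}) \<Longrightarrow> exits \<Lambda> (insert e A)" using incrD[OF inc, of "A - {e}" "insert e A"] by auto
        then show "0 \<le> of_bool (exits \<Lambda> (insert e A)) - (of_bool (exits \<Lambda> (A - {e})) :: real)" by auto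
      qed
      then show ?thesis unfolding if_not_P[OF False] .
    qed
    finally show "(\<Sum>S\<in>?SS. of_bool (bad \<Lambda> A = S) * (\<Sum>(x, y)\<in>ebd S. of_bool (cn 0 x (A \<inter> inside S))))
      \<le> (\<Sum>e\<in>?F. of_bool (exits \<Lambda> (insert e A)) - (of_bool (exits \<Lambda> (A - {e})) :: real))" .
  qed
  finally show ?thesis by (simp add: bE_sum)
qed

text \<open>Write \<theta>(r) for the exit probability. The mean value theorem supplies an r where
  the derivative is at least 1 - \<theta>(r) \<ge> 1 - \<theta>(q), so (q - p) (1 - \<theta>(q))
  \<le> \<theta>(q). The resulting bound is the same for every \<open>\<Lambda>\<close>.\<close>

lemma exits_lower_bound:
  fixes \<Lambda> :: "(int ^ 'd::finite) set"
  assumes \<Lambda>: "finite \<Lambda>" "0 \<in> \<Lambda>" and p: "0 \<le> p" "p < q" "q \<le> 1"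
    and psi: "\<And>S :: (int ^ 'd) set. finite S \<Longrightarrow> 0 \<in> S \<Longrightarrow> 1 \<le> psi p S"
  shows "(q - p) / 2 \<le> PP q (exits \<Lambda>)"
proof -
  let ?F = "touching \<Lambda>" let ?t = "\<lambda>r. bP r ?F (exits \<Lambda>)"
  have F: "finite ?F" "?F \<subseteq> bonds" using finite_touching[OF \<Lambda>(1)] by (auto simp: touching_def)
  have inc: "incr (exits \<Lambda>)" by (intro fin_incr_incr) simp
  have "\<exists>r. p < r \<and> r < q \<and> ?t q - ?t p = (q - p) *
      (\<Sum>e\<in>?F. bE r ?F (\<lambda>A. of_bool (exits \<Lambda> (insert e A)) - of_bool (exits \<Lambda> (A - {e}))))"
    unfolding bP_def by (rule MVT2[OF p(2)]) (rule bE_has_derivative[OF F(1)])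
  then obtain r where r: "p < r" "r < q" and eq: "?t q - ?t p = (q - p) *
      (\<Sum>e\<in>?F. bE r ?F (\<lambda>A. of_bool (exits \<Lambda> (insert e A)) - of_bool (exits \<Lambda> (A - {e}))))" by auto
  have "1 \<le> psi r S" if "finite S" "0 \<in> S" for S :: "(int ^ 'd) set"
    using psi[OF that] psi_mono[OF that(1), of p r] p r by auto
  then have "1 - ?t r \<le> (\<Sum>e\<in>?F. bE r ?F (\<lambda>A. of_bool (exits \<Lambda> (insert e A)) - of_bool (exits \<Lambda> (A - {e}))))"
    by (intro exits_derivative_bound[OF \<Lambda>]) (use p r in auto)
  moreover have "?t r \<le> ?t q" by (rule bP_mono_p[OF F(1) inc]) (use p r in auto)
  ultimately have "(q - p) * (1 - ?t q) \<le> ?t q - ?t p"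
    unfolding eq using p by (intro mult_left_mono) auto
  moreover have "0 \<le> ?t p" by (rule bP_nonneg) (use p in auto)
  ultimately have "(q - p) \<le> ?t q * (1 + (q - p))" by (simp add: algebra_simps)
  also have "\<dots> \<le> ?t q * 2" using p by (intro mult_left_mono bP_nonneg) auto
  finally have "(q - p) / 2 \<le> ?t q" by simp
  also have "\<dots> \<le> PP q (exits \<Lambda>)" by (rule bP_le_PP) (use F p in auto)
  finally show ?thesis .
qed

text \<open>Boxes are finite and exhaust the lattice, so the cluster of 0 is infinite iff it leaves
  every box; continuity from above does the rest.\<close>

lemma percolation_prob_tendsto:
  assumes p: "0 \<le> p" "p \<le> 1"
  shows "(\<lambda>n. PP p (exits (lbox n :: (int ^ 'd::finite) set))) \<longlonglongrightarrow> percolation_prob TYPE('d) p"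
proof -
  interpret prob_space "percolation p :: ((int ^ 'd) set \<Rightarrow> bool) measure" by (rule prob_space_percolation)
  have eq: "{\<omega> \<in> space (percolation p). infinite {n :: int ^ 'd. connected_in \<omega> 0 n}} = (\<Inter>n. ev p (exits (lbox n)))"
  proof (intro equalityI subsetI)
    fix \<omega> assume \<omega>: "\<omega> \<in> {\<omega> \<in> space (percolation p). infinite {n :: int ^ 'd. connected_in \<omega> 0 n}}"
    have "exits (lbox n) (opn \<omega>)" for n
    proof (rule ccontr)
      assume "\<not> exits (lbox n) (opn \<omega>)"
      then have "{n. connected_in \<omega> 0 n} \<subseteq> lbox n" by (auto simp: exits_def cn_def connected_in_iff)
      then show False using \<omega> finite_lbox finite_subset by blast
    qed
    then show "\<omega> \<in> (\<Inter>n. ev p (exits (lbox n)))" using \<omega> by (auto simp: ev_def)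
  next
    fix \<omega> :: "(int ^ 'd) set \<Rightarrow> bool" assume \<omega>: "\<omega> \<in> (\<Inter>n. ev p (exits (lbox n)))"
    have "infinite {n. connected_in \<omega> 0 n}"
    proof
      assume "finite {n. connected_in \<omega> 0 n}"
      then obtain m where "{n. connected_in \<omega> 0 n} \<subseteq> lbox m" using finite_subset_lbox by blast
      moreover have "exits (lbox m) (opn \<omega>)" using \<omega> by (auto simp: ev_def)
      ultimately show False by (auto simp: exits_def cn_def connected_in_iff)
    qed
    then show "\<omega> \<in> {\<omega> \<in> space (percolation p). infinite {n :: int ^ 'd. connected_in \<omega> 0 n}}"
      using \<omega> by (auto simp: ev_def)
  qed
  show ?thesis
    unfolding PP_def percolation_prob_def eq
  proof (rule finite_Lim_measure_decseq)
    show "range (\<lambda>n. ev p (exits (lbox n :: (int ^ 'd) set))) \<subseteq> events" using p by auto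
    show "decseq (\<lambda>n. ev p (exits (lbox n :: (int ^ 'd) set)))"
      unfolding decseq_def ev_def exits_def using lbox_mono by blast
  qed
qed

lemma bE_0: "finite F \<Longrightarrow> bE 0 F f = f {}"
  by (induction F rule: finite_induct) (simp_all add: bE_insert)

text \<open>Needed so that the set whose supremum defines \<open>critical_prob\<close> is
  nonempty.\<close>

lemma percolation_prob_0: "percolation_prob TYPE('d::finite) 0 = 0"
proof -
  have "PP 0 (exits (lbox n :: (int ^ 'd) set)) \<le> 0" for n
  proof (rule PP_leI)
    fix F :: "(int ^ 'd) set set" assume "finite F"
    have "\<not> exits (lbox n :: (int ^ 'd) set) {}"
    proof
      assume "exits (lbox n :: (int ^ 'd) set) {}"
      then obtain y :: "int ^ 'd" where "y \<notin> lbox n" "conn {} 0 y" by (auto simp: exits_def cn_def)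
      then show False by (auto simp: conn_def)
    qed
    then show "bP 0 F (exits (lbox n)) \<le> 0" using \<open>finite F\<close> by (simp add: bP_def bE_0)
  qed auto
  then have "PP 0 (exits (lbox n :: (int ^ 'd) set)) = 0" for n using PP_nonneg antisym by blast
  then show ?thesis using percolation_prob_tendsto[where 'd = 'd, of 0] by (simp add: LIMSEQ_const_iff)
qed

text \<open>Some q > p has percolation probability 0. If no set satisfied the criterion,
  \<open>psi p S \<ge> 1\<close> would hold for all finite \<open>S\<close> containing 0, and every
  box would be left with probability at least (q - p) / 2 at q.\<close>

lemma subcritical_psi:
  assumes p: "0 < p" "p < critical_prob TYPE('d::finite)"
  shows "p < 1" "\<exists>S :: (int ^ 'd) set. finite S \<and> 0 \<in> S \<and> p * psi p S < 1"
proof -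
  let ?X = "{p \<in> {0..1}. percolation_prob TYPE('d) p = 0}"
  have "0 \<in> ?X" by (simp add: percolation_prob_0)
  moreover have "bdd_above ?X" by (rule bdd_aboveI[of _ 1]) auto
  ultimately obtain q where q: "q \<in> ?X" "p < q"
    using p(2) less_cSup_iff[of ?X p] unfolding critical_prob_def by blast
  then show "p < 1" by auto
  show "\<exists>S :: (int ^ 'd) set. finite S \<and> 0 \<in> S \<and> p * psi p S < 1"
  proof (rule ccontr)
    assume *: "\<not> ?thesis"
    have "1 \<le> psi p S" if "finite S" "0 \<in> S" for S :: "(int ^ 'd) set"
    proof -
      have "1 \<le> p * psi p S" using * that by force
      moreover have "0 \<le> psi p S" unfolding psi_def using p q by (intro sum_nonneg) (auto intro!: bP_nonneg)
      then have "p * psi p S \<le> 1 * psi p S" using p q by (intro mult_right_mono) auto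
      ultimately show ?thesis by simp
    qed
    then have "(q - p) / 2 \<le> PP q (exits (lbox n :: (int ^ 'd) set))" for n
      using p q by (intro exits_lower_bound) auto
    then have "(q - p) / 2 \<le> percolation_prob TYPE('d) q"
      by (intro LIMSEQ_le_const[OF percolation_prob_tendsto]) (use q in auto)
    then show False using q by simp
  qed
qed

lemma PP_union_finite:
  fixes R :: "'i \<Rightarrow> (int ^ 'd::finite) set set \<Rightarrow> bool"
  assumes p: "0 \<le> p" "p \<le> 1" and I: "finite I" and R: "\<And>x. fin_incr (R x)"
    and imp: "\<And>A. A \<subseteq> bonds \<Longrightarrow> Q A \<Longrightarrow> \<exists>x\<in>I. R x A"
  shows "PP p Q \<le> (\<Sum>x\<in>I. PP p (R x))"
proof -
  interpret prob_space "percolation p :: ((int ^ 'd) set \<Rightarrow> bool) measure" by (rule prob_space_percolation)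
  have "PP p Q \<le> measure (percolation p) (\<Union>x\<in>I. ev p (R x))"
    unfolding PP_def
  proof (rule finite_measure_mono)
    show "ev p Q \<subseteq> (\<Union>x\<in>I. ev p (R x))" using imp by (auto simp: ev_def opn_def)
    show "(\<Union>x\<in>I. ev p (R x)) \<in> events" using R p I by auto
  qed
  also have "\<dots> \<le> (\<Sum>x\<in>I. PP p (R x))"
    unfolding PP_def by (rule finite_measure_subadditive_finite) (use R p I in auto)
  finally show ?thesis .
qed

lemma PP_local:
  assumes "finite G" "G \<subseteq> bonds" "0 \<le> p" "p \<le> 1"
  shows "PP p (\<lambda>A. Q (A \<inter> G)) = bP p G Q"
  using measure_cylinder(2)[OF assms] by (simp add: PP_def ev_def)

lemma fin_incr_local:
  assumes "fin_incr Q" shows "fin_incr (\<lambda>A. Q (A \<inter> G))"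
proof (rule fin_incrI)
  have i: "incr Q" using assms by (rule fin_incr_incr)
  show "incr (\<lambda>A. Q (A \<inter> G))" unfolding incr_def
  proof (intro allI impI)
    fix A B :: "'a set" assume "A \<subseteq> B" "Q (A \<inter> G)"
    then show "Q (B \<inter> G)" using incrD[OF i, of "A \<inter> G" "B \<inter> G"] by auto
  qed
  fix A assume "Q (A \<inter> G)"
  from fin_incrD[OF assms this] obtain B where "B \<subseteq> A \<inter> G" "finite B" "Q B" by auto
  moreover from this have "B \<inter> G = B" by auto
  ultimately show "\<exists>B\<subseteq>A. finite B \<and> Q (B \<inter> G)" by (intro exI[of _ B]) auto
qed

lemma fin_incr_mem: "fin_incr (\<lambda>A. e \<in> A)"
proof (rule fin_incrI)
  fix A assume "e \<in> A"
  then show "\<exists>B\<subseteq>A. finite B \<and> e \<in> B" by (intro exI[of _ "{e}"]) auto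
qed (auto simp: incr_def)

section \<open>Exponential decay by iterating the exit from a finite set\<close>

text \<open>Cut an open path at its first vertex \<open>y\<close> outside \<open>S\<close>: the part
  before, the crossing bond and the part after use disjoint bonds, so BK factorises.\<close>

lemma tau_exit_bound:
  fixes z :: "int ^ 'd::finite"
  assumes p: "0 \<le> p" "p \<le> 1" and S: "finite S" "0 \<in> S" "z \<notin> S"
  shows "tau p 0 z \<le> (\<Sum>(x, y)\<in>ebd S. bP p (inside S) (cn 0 x) * (p * tau p y z))"
proof -
  let ?R = "\<lambda>xy. dj (\<lambda>A. cn 0 (fst xy) (A \<inter> inside S)) (dj (\<lambda>A. {fst xy, snd xy} \<in> A) (cn (snd xy) z))"
  have fi: "fin_incr (\<lambda>A. cn 0 x (A \<inter> inside S))" for x by (rule fin_incr_local) simp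
  have fi2: "fin_incr (dj (\<lambda>A. e \<in> A) (cn y z))" for e y by (intro fin_incr_dj fin_incr_mem) simp
  have "tau p 0 z \<le> (\<Sum>xy\<in>ebd S. PP p (?R xy))"
    unfolding tau_def
  proof (rule PP_union_finite[OF p finite_ebd[OF S(1)]])
    fix A :: "(int ^ 'd) set set" assume A: "A \<subseteq> bonds" and "cn 0 z A"
    then obtain \<gamma> where \<gamma>: "spath 0 z \<gamma>" "pe \<gamma> \<subseteq> A" using conn_spath unfolding cn_def by metis
    have "\<exists>x\<in>set \<gamma>. x \<notin> S" using spath_ends[OF \<gamma>(1)] S by auto
    then obtain as y bs where y: "\<gamma> = as @ y # bs" "y \<notin> S" "\<forall>x\<in>set as. \<not> x \<notin> S"
      using split_list_first_prop[of \<gamma> "\<lambda>x. x \<notin> S"] by auto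
    have "as \<noteq> []" using y \<gamma> S unfolding spath_def by auto
    then obtain cs x where x: "as = cs @ [x]" by (metis rev_exhaust)
    have d: "distinct \<gamma>" and hd: "hd \<gamma> = 0" and last: "last \<gamma> = z" using \<gamma>(1) by (auto simp: spath_def)
    have "\<gamma> = cs @ x # (y # bs)" using x y by simp
    then have pe: "pe \<gamma> = pe as \<union> insert {x, y} (pe (y # bs))"
      using pe_append[of cs x "y # bs"] x by simp
    have xS: "x \<in> S" using y x by auto
    have xy: "(x, y) \<in> ebd S" using xS y \<gamma>(2) A pe by (auto simp: ebd_def)
    have 1: "spath 0 x as" using \<gamma>(1) x unfolding spath_def y(1) by (cases cs) auto
    have 2: "spath y z (y # bs)" using \<gamma>(1) unfolding spath_def y(1) by auto
    have c1: "cn 0 x (pe as \<inter> inside S)"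
    proof -
      have "pe as \<subseteq> inside S" using pe_subset[of _ as] y(3) \<gamma>(2) A pe unfolding inside_def by auto
      then have "pe as \<inter> inside S = pe as" by auto
      then show ?thesis using cnI[OF 1] by simp
    qed
    have c2: "cn y z (pe (y # bs))" using cnI[OF 2] by simp
    have D1: "{x, y} \<notin> pe as" using pe_subset[of "{x, y}" as] y by auto
    have D2: "{x, y} \<notin> pe (y # bs)" using pe_subset[of "{x, y}" "y # bs"] d x y by auto
    have D3: "pe as \<inter> pe (y # bs) = {}"
      by (rule pe_disjoint'[of _ _ x]) (use d y in auto)
    have "?R (x, y) A"
    proof (rule djI[where B = "pe as" and C = "insert {x, y} (pe (y # bs))"])
      show "dj (\<lambda>A. {fst (x, y), snd (x, y)} \<in> A) (cn (snd (x, y)) z) (insert {x, y} (pe (y # bs)))"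
        by (rule djI[where B = "{{x, y}}" and C = "pe (y # bs)"])
          (use c2 D2 fin_incr_incr[OF fin_incr_mem, of "{x, y}"] in auto)
    qed (use c1 D1 D3 \<gamma>(2) pe fi fi2 in \<open>auto intro: fin_incr_incr\<close>)
    with xy show "\<exists>xy\<in>ebd S. ?R xy A" by blast
  qed (intro fin_incr_dj fi fi2)
  also have "\<dots> \<le> (\<Sum>xy\<in>ebd S. bP p (inside S) (cn 0 (fst xy)) * (p * tau p (snd xy) z))"
  proof (rule sum_mono)
    fix xy assume "xy \<in> ebd S"
    then have b: "{fst xy, snd xy} \<in> bonds" by (auto simp: ebd_def)
    have "PP p (?R xy) \<le> PP p (\<lambda>A. cn 0 (fst xy) (A \<inter> inside S)) * PP p (dj (\<lambda>A. {fst xy, snd xy} \<in> A) (cn (snd xy) z))"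
      by (rule PP_BK[OF fi fi2 p])
    also have "\<dots> \<le> bP p (inside S) (cn 0 (fst xy)) * (p * tau p (snd xy) z)"
    proof (rule mult_mono)
      show "PP p (\<lambda>A. cn 0 (fst xy) (A \<inter> inside S)) \<le> bP p (inside S) (cn 0 (fst xy))"
        using PP_local[OF finite_inside[OF S(1)] _ p] by (simp add: inside_def)
      have "PP p (\<lambda>A. {fst xy, snd xy} \<in> A) = bP p {{fst xy, snd xy}} (\<lambda>A. {fst xy, snd xy} \<in> A)"
        using PP_local[OF _ _ p, of "{{fst xy, snd xy}}" "\<lambda>A. {fst xy, snd xy} \<in> A"] b by simp
      then have "PP p (\<lambda>A. {fst xy, snd xy} \<in> A) = p" by (simp add: bP_insert)
      then show "PP p (dj (\<lambda>A. {fst xy, snd xy} \<in> A) (cn (snd xy) z)) \<le> p * tau p (snd xy) z"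
        using PP_BK[OF fin_incr_mem fin_incr_cn p, of "{fst xy, snd xy}" "snd xy" z] by (simp add: tau_def)
    qed (use p in \<open>auto intro: bP_nonneg PP_nonneg\<close>)
    finally show "PP p (?R xy) \<le> bP p (inside S) (cn 0 (fst xy)) * (p * tau p (snd xy) z)" .
  qed
  finally show ?thesis by (simp add: case_prod_unfold)
qed

text \<open>Each exit from a translate of \<open>S\<close> costs a factor \<open>r < 1\<close> and
  advances every coordinate by at most \<open>L\<close>, so a point outside
  \<open>lbox (k * L)\<close> pays at least k factors.\<close>

theorem tau_exponential_decay:
  assumes p: "0 < p" "p < critical_prob TYPE('d::finite)"
  shows "\<exists>C c. C > 0 \<and> c > 0 \<and> (\<forall>x :: int ^ 'd. tau p 0 x \<le> C * exp (- c * vnorm x))"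
proof -
  obtain S :: "(int ^ 'd) set" where S: "finite S" "0 \<in> S" "p * psi p S < 1" and p1: "p < 1"
    using subcritical_psi[OF p] by blast
  \<comment> \<open>The maximum with 1/2 keeps \<open>r\<close> positive, since \<open>ln r\<close>
    is used below.\<close>
  define r where "r = max (p * psi p S) (1/2)"
  have r: "0 < r" "r < 1" "p * psi p S \<le> r" using S by (auto simp: r_def)
  obtain L0 where L0: "S \<subseteq> lbox L0" using finite_subset_lbox[OF S(1)] by blast
  \<comment> \<open>One more than \<open>L0\<close> because the exit vertex lies one bond beyond
    \<open>S\<close>.\<close>
  define L where "L = Suc L0"
  have decay: "tau p 0 z \<le> r ^ k" if "z \<notin> lbox (k * L)" for z :: "int ^ 'd" and k
    using that
  proof (induction k arbitrary: z)
    case (Suc k)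
    have "z \<notin> S" using Suc.prems L0 lbox_mono[of L0 "Suc k * L"] by (auto simp: L_def)
    then have "tau p 0 z \<le> (\<Sum>(x, y)\<in>ebd S. bP p (inside S) (cn 0 x) * (p * tau p y z))"
      using S p p1 by (intro tau_exit_bound) auto
    also have "\<dots> \<le> (\<Sum>(x, y)\<in>ebd S. bP p (inside S) (cn 0 x) * (p * r ^ k))"
    proof (intro sum_mono, clarify)
      fix x y assume xy: "(x, y) \<in> ebd S"
      have "x \<in> lbox L0" using xy L0 by (auto simp: ebd_def)
      moreover obtain u where "u \<in> lbox 1" "y = x + u" using xy bond_nbr by (auto simp: ebd_def)
      ultimately have y: "y \<in> lbox L" using lbox_add[of x L0 u 1] by (simp add: L_def)
      have "z - y \<notin> lbox (k * L)"
      proof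
        assume "z - y \<in> lbox (k * L)"
        from lbox_add[OF y this] Suc.prems show False by simp
      qed
      then have "tau p 0 (z - y) \<le> r ^ k" by (rule Suc.IH)
      then have "tau p y z \<le> r ^ k" using tau_diff[of p y z] p p1 by simp
      then show "bP p (inside S) (cn 0 x) * (p * tau p y z) \<le> bP p (inside S) (cn 0 x) * (p * r ^ k)"
        using p p1 by (intro mult_left_mono bP_nonneg) auto
    qed
    also have "\<dots> = p * psi p S * r ^ k"
      by (simp add: psi_def sum_distrib_left sum_distrib_right case_prod_unfold mult_ac)
    also have "\<dots> \<le> r * r ^ k" using r by (intro mult_right_mono) auto
    finally show ?case by simp
  qed (simp add: tau_le_1)
  define D where "D = real CARD('d) * real L"
  have D: "D > 0" by (simp add: D_def L_def)
  define c where "c = - ln r / D"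
  have c: "c > 0" using r D by (simp add: c_def ln_less_zero divide_neg_pos)
  show ?thesis
  proof (intro exI conjI allI)
    show "1 / r > 0" "c > 0" using r c by auto
    fix x :: "int ^ 'd"
    \<comment> \<open>For \<open>x \<noteq> 0\<close> this is the largest k with k D < |x|; as
      \<open>lbox (k * L)\<close> lies in the ball of radius k D, \<open>x\<close> is outside that
      box when k is positive.\<close>
    define k where "k = nat (\<lceil>vnorm x / D\<rceil> - 1)"
    have k: "real k \<ge> vnorm x / D - 1" unfolding k_def by linarith
    have "tau p 0 x \<le> r ^ k"
    proof (cases "k = 0")
      case False
      then have "real k < vnorm x / D" unfolding k_def by linarith
      then have "real k * D < vnorm x" using D by (simp add: field_simps)
      then have "x \<notin> lbox (k * L)" using lbox_vnorm[of x "k * L"] by (auto simp: D_def mult_ac)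
      then show ?thesis by (rule decay)
    qed (simp add: tau_le_1)
    also have "\<dots> = exp (real k * ln r)" using r by (simp add: exp_of_nat_mult)
    also have "\<dots> \<le> exp ((vnorm x / D - 1) * ln r)"
      using k r by (simp add: mult_right_mono_neg)
    also have "\<dots> = 1 / r * exp (- c * vnorm x)"
    proof -
      have "(vnorm x / D - 1) * ln r = - c * vnorm x - ln r" using D by (simp add: c_def field_simps)
      then show ?thesis using r by (simp add: exp_diff)
    qed
    finally show "tau p 0 x \<le> 1 / r * exp (- c * vnorm x)" .
  qed
qed


section \<open>The inverse connection length is a norm\<close>

text \<open>The limit is the infimum of b n / n, hence a lower bound at every n and not only
  asymptotically; \<open>quasi_additive\<close> depends on this.\<close>

lemma fekete:
  fixes b :: "nat \<Rightarrow> real"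
  assumes sub: "\<And>m n. b (m + n) \<le> b m + b n" and low: "\<And>n. - B * real n \<le> b n"
  obtains L where "(\<lambda>n. b n / real n) \<longlonglongrightarrow> L" "\<And>n. real n * L \<le> b n"
proof
  define L where "L = (INF n\<in>{1..}. b n / real n)"
  have bdd: "bdd_below ((\<lambda>n. b n / real n) ` {1..})"
  proof (rule bdd_belowI2[of _ "- B"])
    fix n :: nat assume "n \<in> {1..}"
    then show "- B \<le> b n / real n" using low[of n] by (simp add: field_simps)
  qed
  have L: "L \<le> b n / real n" if "n \<ge> 1" for n
    unfolding L_def by (rule cINF_lower[OF bdd]) (use that in auto)
  have b0: "0 \<le> b 0" using sub[of 0 0] by simp
  show "real n * L \<le> b n" for n
    using L[of n] b0 by (cases "n = 0") (auto simp: field_simps)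
  have mult: "b (q * m + r) \<le> real q * b m + b r" for q m r
  proof (induction q)
    case (Suc q)
    have "b (Suc q * m + r) \<le> b m + b (q * m + r)" using sub[of m "q * m + r"] by (simp add: add.assoc)
    with Suc show ?case by (simp add: algebra_simps)
  qed simp
  show "(\<lambda>n. b n / real n) \<longlonglongrightarrow> L"
  proof (rule LIMSEQ_I)
    fix e :: real assume e: "0 < e"
    obtain m where m: "m \<ge> 1" "b m / real m < L + e / 2"
    proof -
      have "\<exists>x\<in>(\<lambda>n. b n / real n) ` {1..}. x < L + e / 2"
        using e bdd unfolding L_def by (subst cINF_less_iff[symmetric]) (auto simp: cInf_less_iff)
      then show ?thesis using that by auto
    qed
    define M where "M = (\<Sum>r<m. \<bar>b r\<bar>)"
    have M: "b r \<le> M" if "r < m" for r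
    proof -
      have "\<bar>b r\<bar> \<le> M" unfolding M_def by (rule member_le_sum) (use that in auto)
      then show ?thesis by simp
    qed
    obtain n0 where n0: "real n0 > (\<bar>b m\<bar> + M) * 2 / e" using reals_Archimedean2 by blast
    have "norm (b n / real n - L) < e" if n: "n \<ge> Suc n0" for n
    proof -
      have npos: "real n > 0" "n \<ge> 1" using n by auto
      let ?q = "n div m" and ?r = "n mod m"
      have "b n \<le> real ?q * b m + b ?r" using mult[of ?q m ?r] by simp
      also have "b ?r \<le> M" using m by (intro M) simp
      also have "real ?q * b m = (real n - real ?r) * (b m / real m)"
      proof -
        have "real n = real ?q * real m + real ?r" by (metis of_nat_add of_nat_mult div_mult_mod_eq)
        then show ?thesis using m by simp
      qed
      also have "\<dots> = real n * (b m / real m) - real ?r / real m * b m" by (simp add: algebra_simps)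
      finally have "b n \<le> real n * (b m / real m) - real ?r / real m * b m + M" by simp
      moreover have "- (real ?r / real m * b m) \<le> \<bar>b m\<bar>"
      proof -
        have "real ?r / real m \<le> 1" using m by simp
        then have "real ?r / real m * \<bar>b m\<bar> \<le> 1 * \<bar>b m\<bar>" by (intro mult_right_mono) auto
        moreover have "\<bar>real ?r / real m * b m\<bar> = real ?r / real m * \<bar>b m\<bar>" by (simp add: abs_mult)
        ultimately have "\<bar>real ?r / real m * b m\<bar> \<le> \<bar>b m\<bar>" by (simp only: mult_1)
        then show ?thesis by (rule order_trans[OF abs_ge_minus_self])
      qed
      ultimately have "b n \<le> real n * (b m / real m) + (\<bar>b m\<bar> + M)" by linarith
      then have "b n / real n \<le> b m / real m + (\<bar>b m\<bar> + M) / real n" using npos by (simp add: field_simps)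
      also have "(\<bar>b m\<bar> + M) / real n < e / 2"
      proof -
        have "(\<bar>b m\<bar> + M) * 2 / e < real n" using n0 n by linarith
        then show ?thesis using e npos by (simp add: field_simps)
      qed
      finally show ?thesis using m L[OF npos(2)] by simp
    qed
    then show "\<exists>n0. \<forall>n\<ge>n0. norm (b n / real n - L) < e" by blast
  qed
qed

lemma l1_int_part: "real (l1 (int_part u - int_part v)) \<le> (\<Sum>i\<in>UNIV. \<bar>u $ i - v $ i\<bar> + 1)"
  unfolding l1_def of_nat_sum
proof (rule sum_mono)
  fix i
  show "real (nat \<bar>(int_part u - int_part v) $ i\<bar>) \<le> \<bar>u $ i - v $ i\<bar> + 1"
    unfolding int_part_def by (simp) linarith
qed

lemma l1_minus [simp]: "l1 (- x) = l1 x" by (simp add: l1_def)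

lemma l1_bound: "real (l1 x) = (\<Sum>i\<in>UNIV. \<bar>real_of_int (x $ i)\<bar>)"
  by (simp add: l1_def)

lemma vnorm_le_l1: "vnorm x \<le> real (l1 x)"
  unfolding l1_bound vnorm_def using norm_le_l1_cart[of "vec_of_int x"] by simp

lemma vec_int_part: "norm (vec_of_int (int_part x) - x) \<le> real CARD('d)" for x :: "real ^ 'd::finite"
proof -
  have "norm (vec_of_int (int_part x) - x) \<le> (\<Sum>i\<in>UNIV. \<bar>(vec_of_int (int_part x) - x) $ i\<bar>)" by (rule norm_le_l1_cart)
  also have "\<dots> \<le> (\<Sum>i\<in>(UNIV :: 'd set). 1)"
    by (rule sum_mono) (simp add: int_part_def, linarith)
  finally show ?thesis by simp
qed

lemma int_part_vec_of_int [simp]: "int_part (vec_of_int k) = k"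
  by (simp add: int_part_def vec_eq_iff)

locale subcrit =
  fixes p :: real and dd :: "'d::finite itself"
  assumes p_pos: "0 < p" and p_less: "p < critical_prob TYPE('d)"
begin

abbreviation "xi \<equiv> inv_conn_length p :: real ^ 'd \<Rightarrow> real"

definition t :: "int ^ 'd \<Rightarrow> real" where "t x = tau p 0 x"
definition a :: "int ^ 'd \<Rightarrow> real" where "a x = - ln (t x)"

lemma p1: "p < 1" using subcritical_psi(1)[OF p_pos p_less] .
lemma p01: "0 \<le> p" "p \<le> 1" using p_pos p1 by auto

lemma t_pos: "0 < t x"
  using tau_lower[OF p01, of x] p_pos unfolding t_def by (meson less_le_trans zero_less_power)

lemma t_le_1: "t x \<le> 1" by (simp add: t_def tau_le_1)
lemma t_0 [simp]: "t 0 = 1" by (simp add: t_def tau_refl)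
lemma tau_t: "tau p u v = t (v - u)" unfolding t_def by (rule tau_diff[OF p01])
lemma t_minus [simp]: "t (- x) = t x" using tau_t[of x 0] tau_sym[of p x 0] by (simp add: t_def)
lemma t_mult: "t x * t y \<le> t (x + y)"
  using tau_FKG[OF p01, of 0 x "x + y"] by (simp add: tau_t)
lemma t_exp: "t x = exp (- a x)" using t_pos by (simp add: a_def)

lemma a_nonneg: "0 \<le> a x" using t_pos t_le_1 by (simp add: a_def)
lemma a_0 [simp]: "a 0 = 0" by (simp add: a_def)
lemma a_minus [simp]: "a (- x) = a x" by (simp add: a_def)
lemma a_add: "a (x + y) \<le> a x + a y"
proof -
  have "ln (t x * t y) \<le> ln (t (x + y))" using t_mult t_pos by (subst ln_le_cancel_iff) auto
  then show ?thesis using t_pos[of x] t_pos[of y] by (simp add: a_def ln_mult)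
qed

definition K where "K = - ln p"
lemma K_pos: "K > 0" using p_pos p1 by (simp add: K_def)

lemma a_le: "a x \<le> K * real (l1 x)"
proof -
  have "ln (p ^ l1 x) \<le> ln (t x)" using tau_lower[OF p01, of x] p_pos t_pos unfolding t_def by (subst ln_le_cancel_iff) auto
  then show ?thesis using p_pos by (simp add: a_def K_def ln_realpow mult.commute)
qed

lemma a_lipschitz: "\<bar>a x - a y\<bar> \<le> K * real (l1 (x - y))"
proof -
  have "a x \<le> a (x - y) + a y" "a y \<le> a (y - x) + a x" using a_add[of "x - y" y] a_add[of "y - x" x] by simp_all
  moreover have "a (y - x) = a (x - y)" using a_minus[of "x - y"] by simp
  ultimately show ?thesis using a_le[of "x - y"] by linarith
qed

text \<open>Turns the unspecified \<open>lim\<close> of the definition into a true limit. Rounding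
  is additive up to 2 in each coordinate, and adding the corresponding constant \<open>C\<close>
  makes the sequence exactly subadditive.\<close>

lemma xi_tendsto: "(\<lambda>N. a (int_part (real N *\<^sub>R x)) / real N) \<longlonglongrightarrow> xi x"
proof -
  let ?A = "\<lambda>N. a (int_part (real N *\<^sub>R x))"
  define C where "C = K * real CARD('d) * 2"
  have C: "C \<ge> 0" using K_pos by (simp add: C_def)
  have sub: "?A (m + n) \<le> ?A m + ?A n + C" for m n
  proof -
    let ?u = "int_part (real m *\<^sub>R x) + int_part (real n *\<^sub>R x)"
    have "real (l1 (int_part (real (m + n) *\<^sub>R x) - ?u)) \<le> (\<Sum>i\<in>(UNIV::'d set). 2)"
      unfolding l1_bound
    proof (rule sum_mono)
      fix i :: 'd
      show "\<bar>real_of_int ((int_part (real (m + n) *\<^sub>R x) - ?u) $ i)\<bar> \<le> 2"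
        by (simp add: int_part_def distrib_right) linarith
    qed
    then have "K * real (l1 (int_part (real (m + n) *\<^sub>R x) - ?u)) \<le> K * (real CARD('d) * 2)"
      using K_pos by (intro mult_left_mono) auto
    then have "?A (m + n) \<le> a ?u + C"
      using a_lipschitz[of "int_part (real (m + n) *\<^sub>R x)" ?u] by (simp add: C_def mult.assoc)
    with a_add[of "int_part (real m *\<^sub>R x)" "int_part (real n *\<^sub>R x)"] show ?thesis by linarith
  qed
  obtain L where L: "(\<lambda>N. (?A N + C) / real N) \<longlonglongrightarrow> L"
  proof (rule fekete[of "\<lambda>N. ?A N + C" 0])
    show "?A (m + n) + C \<le> ?A m + C + (?A n + C)" for m n using sub[of m n] by simp
    show "- 0 * real n \<le> ?A n + C" for n using a_nonneg C by simp
  qed (rule that)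
  have "(\<lambda>N. (?A N + C) / real N - C / real N) \<longlonglongrightarrow> L - 0"
    by (intro tendsto_diff L lim_const_over_n)
  then have lim: "(\<lambda>N. ?A N / real N) \<longlonglongrightarrow> L" by (simp add: add_divide_distrib)
  have "(\<lambda>N. 1 / real N * ln (connection_prob p 0 (int_part (real N *\<^sub>R x)))) = (\<lambda>N. - (?A N / real N))"
    by (simp add: connection_prob_eq a_def t_def)
  then have "xi x = - lim (\<lambda>N. - (?A N / real N))"
    unfolding inv_conn_length_def by simp
  also have "\<dots> = L" using limI[OF tendsto_minus[OF lim]] by simp
  finally show ?thesis using lim by simp
qed

text \<open>Bounded corrections of the lattice points disappear after division by N, so every later
  proof may round as is convenient.\<close>

lemma xi_tendsto':
  assumes "\<And>N. real (l1 (u N - int_part (real N *\<^sub>R x))) \<le> B"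
  shows "(\<lambda>N. a (u N) / real N) \<longlonglongrightarrow> xi x"
proof -
  have "(\<lambda>N. a (u N) / real N - a (int_part (real N *\<^sub>R x)) / real N) \<longlonglongrightarrow> 0"
  proof (rule Lim_null_comparison)
    show "\<forall>\<^sub>F N in sequentially. norm (a (u N) / real N - a (int_part (real N *\<^sub>R x)) / real N) \<le> K * B / real N"
    proof (intro always_eventually allI)
      fix N
      have "\<bar>a (u N) - a (int_part (real N *\<^sub>R x))\<bar> \<le> K * B"
        using a_lipschitz[of "u N" "int_part (real N *\<^sub>R x)"] mult_left_mono[OF assms[of N], of K] K_pos by linarith
      then show "norm (a (u N) / real N - a (int_part (real N *\<^sub>R x)) / real N) \<le> K * B / real N"
        by (simp add: divide_right_mono abs_divide flip: diff_divide_distrib)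
    qed
  qed (rule lim_const_over_n)
  from tendsto_add[OF this xi_tendsto[of x]] show ?thesis by simp
qed

text \<open>Subadditivity along the multiples of \<open>k\<close>. It yields
  \<open>t_le_exp_xi\<close>, an upper bound on the two-point function without any
  prefactor.\<close>

lemma xi_le_a: "xi (vec_of_int k) \<le> a k"
proof (rule LIMSEQ_le_const2[OF xi_tendsto])
  have *: "a (int_part (real N *\<^sub>R vec_of_int k)) \<le> real N * a k" for N
  proof (induction N)
    case 0
    have "int_part 0 = (0 :: int ^ 'd)" by (simp add: int_part_def vec_eq_iff)
    then show ?case by simp
  next
    case (Suc N)
    have eq: "int_part (real n *\<^sub>R vec_of_int k) = (\<chi> i. int n * k $ i)" for n
    proof -
      have "\<lfloor>real n * real_of_int (k $ i)\<rfloor> = int n * k $ i" for i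
        by (metis floor_of_int of_int_mult of_int_of_nat_eq)
      then show ?thesis by (simp add: int_part_def vec_eq_iff)
    qed
    have "(\<chi> i. int (Suc N) * k $ i) = (\<chi> i. int N * k $ i) + k" by (simp add: vec_eq_iff algebra_simps)
    then have "a (int_part (real (Suc N) *\<^sub>R vec_of_int k)) \<le> a (int_part (real N *\<^sub>R vec_of_int k)) + a k"
      unfolding eq using a_add[of "\<chi> i. int N * k $ i" k] by simp
    with Suc show ?case by (simp add: algebra_simps)
  qed
  have "a (int_part (real N *\<^sub>R vec_of_int k)) / real N \<le> a k" if "N \<ge> 1" for N
    using *[of N] that by (simp add: field_simps)
  then show "\<exists>N. \<forall>n\<ge>N. a (int_part (real n *\<^sub>R vec_of_int k)) / real n \<le> a k" by blast
qed

lemma t_le_exp_xi: "t k \<le> exp (- xi (vec_of_int k))"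
  using xi_le_a[of k] by (simp add: t_exp)

lemma xi_nonneg: "0 \<le> xi x"
  by (rule LIMSEQ_le_const[OF xi_tendsto]) (auto intro!: exI[of _ 0] divide_nonneg_nonneg a_nonneg)

lemma xi_triangle: "xi (x + y) \<le> xi x + xi y"
proof (rule LIMSEQ_le)
  let ?u = "\<lambda>N. int_part (real N *\<^sub>R x) + int_part (real N *\<^sub>R y)"
  show "(\<lambda>N. a (?u N) / real N) \<longlonglongrightarrow> xi (x + y)"
  proof (rule xi_tendsto')
    fix N
    have "real (l1 (?u N - int_part (real N *\<^sub>R (x + y)))) \<le> (\<Sum>i\<in>(UNIV::'d set). 2)"
      unfolding l1_bound
    proof (rule sum_mono)
      fix i :: 'd
      show "\<bar>real_of_int ((?u N - int_part (real N *\<^sub>R (x + y))) $ i)\<bar> \<le> 2"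
        by (simp add: int_part_def distrib_left) linarith
    qed
    then show "real (l1 (?u N - int_part (real N *\<^sub>R (x + y)))) \<le> real CARD('d) * 2" by simp
  qed
  show "(\<lambda>N. a (int_part (real N *\<^sub>R x)) / real N + a (int_part (real N *\<^sub>R y)) / real N) \<longlonglongrightarrow> xi x + xi y"
    by (intro tendsto_add xi_tendsto)
  show "\<exists>N. \<forall>n\<ge>N. a (?u n) / real n \<le> a (int_part (real n *\<^sub>R x)) / real n + a (int_part (real n *\<^sub>R y)) / real n"
    using a_add by (auto simp: divide_right_mono simp flip: add_divide_distrib)
qed

lemma xi_0 [simp]: "xi 0 = 0"
  using xi_le_a[of 0] xi_nonneg[of 0] by simp

text \<open>The points s N x are followed along the integer times M = floor (s N), and M / N tends
  to s.\<close>

lemma xi_scale: assumes "0 \<le> s" shows "xi (s *\<^sub>R x) = s * xi x"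
proof (cases "s = 0")
  case False
  then have s: "0 < s" using assms by simp
  let ?M = "\<lambda>N::nat. nat \<lfloor>s * real N\<rfloor>"
  let ?u = "\<lambda>N. int_part (real (?M N) *\<^sub>R x)"
  have Mb: "\<bar>real (?M N) - s * real N\<bar> \<le> 1" for N
  proof -
    have "0 \<le> \<lfloor>s * real N\<rfloor>" using s by simp
    then have "real (?M N) = real_of_int \<lfloor>s * real N\<rfloor>" by simp
    then show ?thesis by linarith
  qed
  have 1: "(\<lambda>N. a (?u N) / real N) \<longlonglongrightarrow> xi (s *\<^sub>R x)"
  proof (rule xi_tendsto')
    fix N
    have "real (l1 (?u N - int_part (real N *\<^sub>R s *\<^sub>R x))) \<le> (\<Sum>i\<in>UNIV. \<bar>(real (?M N) *\<^sub>R x) $ i - (real N *\<^sub>R s *\<^sub>R x) $ i\<bar> + 1)"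
      by (rule l1_int_part)
    also have "\<dots> \<le> (\<Sum>i\<in>UNIV. \<bar>x $ i\<bar> + 1)"
    proof (intro sum_mono add_mono order_refl)
      fix i
      have "\<bar>(real (?M N) *\<^sub>R x) $ i - (real N *\<^sub>R s *\<^sub>R x) $ i\<bar> = \<bar>real (?M N) - s * real N\<bar> * \<bar>x $ i\<bar>"
        by (simp add: algebra_simps flip: abs_mult)
      also have "\<dots> \<le> 1 * \<bar>x $ i\<bar>" by (rule mult_right_mono[OF Mb]) simp
      finally show "\<bar>(real (?M N) *\<^sub>R x) $ i - (real N *\<^sub>R s *\<^sub>R x) $ i\<bar> \<le> \<bar>x $ i\<bar>" by simp
    qed
    finally show "real (l1 (?u N - int_part (real N *\<^sub>R s *\<^sub>R x))) \<le> (\<Sum>i\<in>UNIV. \<bar>x $ i\<bar> + 1)" .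
  qed
  have r: "(\<lambda>N. real (?M N) / real N) \<longlonglongrightarrow> s"
  proof -
    have "(\<lambda>N. real (?M N) / real N - s) \<longlonglongrightarrow> 0"
    proof (rule Lim_null_comparison)
      show "\<forall>\<^sub>F N in sequentially. norm (real (?M N) / real N - s) \<le> 1 / real N"
        using eventually_gt_at_top[of 0]
      proof eventually_elim
        case (elim N)
        have "real (?M N) / real N - s = (real (?M N) - s * real N) / real N" using elim by (simp add: field_simps)
        then have "norm (real (?M N) / real N - s) = \<bar>real (?M N) - s * real N\<bar> / real N" by simp
        also have "\<dots> \<le> 1 / real N" by (rule divide_right_mono[OF Mb]) simp
        finally show ?case .
      qed
    qed (rule lim_const_over_n)
    then show ?thesis by (rule LIM_zero_cancel)
  qed
  have "filterlim (\<lambda>N. s * real N) at_top sequentially"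
    by (rule filterlim_tendsto_pos_mult_at_top[OF tendsto_const s filterlim_real_sequentially])
  then have fM: "filterlim ?M at_top sequentially"
    by (intro filterlim_compose[OF filterlim_nat_sequentially] filterlim_compose[OF filterlim_floor_sequentially])
  have "(\<lambda>N. a (?u N) / real (?M N) * (real (?M N) / real N)) \<longlonglongrightarrow> xi x * s"
    by (intro tendsto_mult r filterlim_compose[OF xi_tendsto fM])
  moreover have "\<forall>\<^sub>F N in sequentially. a (?u N) / real (?M N) * (real (?M N) / real N) = a (?u N) / real N"
    using eventually_compose_filterlim[OF eventually_gt_at_top[of 0] fM]
  proof (rule eventually_mono)
    fix N assume "0 < ?M N"
    then have "real (?M N) \<noteq> 0" by linarith
    have "y / m * (m / n) = y / n" if "m \<noteq> 0" for y m n :: real using that by simp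
    from this[OF \<open>real (?M N) \<noteq> 0\<close>]
    show "a (?u N) / real (?M N) * (real (?M N) / real N) = a (?u N) / real N" .
  qed
  ultimately have "(\<lambda>N. a (?u N) / real N) \<longlonglongrightarrow> xi x * s" by (rule Lim_transform_eventually)
  with 1 have "xi (s *\<^sub>R x) = xi x * s" by (rule LIMSEQ_unique)
  then show ?thesis by (simp add: mult.commute)
qed simp

text \<open>A lattice symmetry \<open>g\<close> that follows the map \<open>G\<close> up to a
  bounded error preserves the two-point function, hence the limit.\<close>

lemma xi_linear_image:
  assumes g: "inj g" "\<And>u v. vnorm (g u - g v) = vnorm (u - v)" "g 0 = 0"
    and G: "\<And>N x. real (l1 (g (int_part (real N *\<^sub>R x)) - int_part (real N *\<^sub>R G x))) \<le> B"
  shows "xi (G x) \<le> xi x"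
proof (rule LIMSEQ_le[OF xi_tendsto'[OF G] xi_tendsto])
  have "a (g u) \<le> a u" for u
    using tau_automorphism[OF p01 g(1,2), of 0 u] t_pos[of u] t_pos[of "g u"] g(3) by (simp add: a_def t_def)
  then show "\<exists>N. \<forall>n\<ge>N. a (g (int_part (real n *\<^sub>R x))) / real n \<le> a (int_part (real n *\<^sub>R x)) / real n"
    by (auto intro!: divide_right_mono)
qed

lemma xi_reflect:
  assumes \<sigma>: "\<And>i. \<sigma> i = 1 \<or> \<sigma> i = (-1 :: int)"
  shows "xi (\<chi> i. real_of_int (\<sigma> i) * x $ i) \<le> xi x"
proof (rule xi_linear_image[where g = "\<lambda>u. \<chi> i. \<sigma> i * u $ i" and B = "real CARD('d) * 2" and G = "\<lambda>x. \<chi> i. real_of_int (\<sigma> i) * x $ i"])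
  have nz: "\<sigma> i \<noteq> 0" for i using \<sigma>[of i] by auto
  show "inj (\<lambda>u :: int ^ 'd. \<chi> i. \<sigma> i * u $ i)" by (rule injI) (use nz in \<open>simp add: vec_eq_iff\<close>)
  show "vnorm ((\<chi> i. \<sigma> i * u $ i) - (\<chi> i. \<sigma> i * v $ i)) = vnorm (u - v)" for u v :: "int ^ 'd"
  proof -
    have "\<bar>real_of_int (\<sigma> i) * real_of_int (u $ i) - real_of_int (\<sigma> i) * real_of_int (v $ i)\<bar> = \<bar>real_of_int (u $ i) - real_of_int (v $ i)\<bar>" for i
      using \<sigma>[of i] by auto
    then show ?thesis by (simp add: vnorm_def norm_vec_def)
  qed
  show "(\<chi> i. \<sigma> i * (0 :: int ^ 'd) $ i) = 0" by (simp add: vec_eq_iff)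
  show "real (l1 ((\<chi> i. \<sigma> i * int_part (real N *\<^sub>R x) $ i) - int_part (real N *\<^sub>R (\<chi> i. real_of_int (\<sigma> i) * x $ i)))) \<le> real CARD('d) * 2" for N and x :: "real ^ 'd"
  proof -
    have "real (l1 ((\<chi> i. \<sigma> i * int_part (real N *\<^sub>R x) $ i) - int_part (real N *\<^sub>R (\<chi> i. real_of_int (\<sigma> i) * x $ i)))) \<le> (\<Sum>i\<in>(UNIV::'d set). 2)"
      unfolding l1_bound
    proof (rule sum_mono)
      fix i :: 'd
      show "\<bar>real_of_int (((\<chi> i. \<sigma> i * int_part (real N *\<^sub>R x) $ i) - int_part (real N *\<^sub>R (\<chi> i. real_of_int (\<sigma> i) * x $ i))) $ i)\<bar> \<le> 2"
        using \<sigma>[of i] by (auto simp: int_part_def) linarith+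
    qed
    then show ?thesis by simp
  qed
qed

lemma xi_minus [simp]: "xi (- x) = xi x"
proof -
  have *: "xi (- x) \<le> xi x" for x
    using xi_reflect[of "\<lambda>_. -1" x] by (simp add: vec_eq_iff[of "- x" "\<chi> i. - x $ i", THEN iffD2])
  from *[of x] *[of "- x"] show ?thesis by simp
qed

lemma xi_upper: "xi x \<le> K * real CARD('d) * norm x"
proof (rule LIMSEQ_le[OF xi_tendsto])
  show "(\<lambda>N. K * real CARD('d) * (norm x + 1 / real N)) \<longlonglongrightarrow> K * real CARD('d) * norm x"
    using tendsto_mult[OF tendsto_const[of "K * real CARD('d)"] tendsto_add[OF tendsto_const[of "norm x"] lim_const_over_n[of 1]]] by simp
  show "\<exists>N. \<forall>n\<ge>N. a (int_part (real n *\<^sub>R x)) / real n \<le> K * real CARD('d) * (norm x + 1 / real n)"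
  proof (intro exI[of _ 1] allI impI)
    fix n :: nat assume n: "1 \<le> n"
    have "real (l1 (int_part (real n *\<^sub>R x))) \<le> (\<Sum>i\<in>UNIV. \<bar>real n * x $ i\<bar> + 1)"
      using l1_int_part[of "real n *\<^sub>R x" 0] by (simp add: int_part_def zero_vec_def[symmetric])
    also have "\<dots> \<le> (\<Sum>i\<in>(UNIV::'d set). real n * norm x + 1)"
      by (intro sum_mono add_mono order_refl) (simp add: abs_mult component_le_norm_cart mult_left_mono)
    also have "\<dots> = real CARD('d) * (real n * norm x + 1)" by simp
    finally have "K * real (l1 (int_part (real n *\<^sub>R x))) \<le> K * (real CARD('d) * (real n * norm x + 1))"
      using K_pos by (intro mult_left_mono) auto
    with a_le[of "int_part (real n *\<^sub>R x)"] have "a (int_part (real n *\<^sub>R x)) \<le> K * (real CARD('d) * (real n * norm x + 1))" by linarith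
    then have "a (int_part (real n *\<^sub>R x)) / real n \<le> K * (real CARD('d) * (real n * norm x + 1)) / real n"
      by (rule divide_right_mono) simp
    also have "\<dots> = K * real CARD('d) * (norm x + 1 / real n)" using n by (simp add: field_simps)
    finally show "a (int_part (real n *\<^sub>R x)) / real n \<le> K * real CARD('d) * (norm x + 1 / real n)" .
  qed
qed

text \<open>This is where exponential decay enters: it makes \<open>xi\<close> positive
  definite.\<close>

lemma xi_lower: "\<exists>c>0. \<forall>x. c * norm x \<le> xi x"
proof -
  obtain C c where C: "C > 0" and c: "c > 0" and dec: "\<And>x :: int ^ 'd. tau p 0 x \<le> C * exp (- c * vnorm x)"
    using tau_exponential_decay[OF p_pos p_less] by blast
  have al: "a x \<ge> c * vnorm x - ln C" for x
  proof -
    have "ln (t x) \<le> ln (C * exp (- c * vnorm x))"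
      using dec[of x] t_pos[of x] C unfolding t_def by (subst ln_le_cancel_iff) auto
    then show ?thesis using C by (simp add: a_def ln_mult)
  qed
  have "c * norm x \<le> xi x" for x
  proof (rule LIMSEQ_le[OF _ xi_tendsto])
    show "(\<lambda>N. c * norm x - (c * real CARD('d) + \<bar>ln C\<bar>) / real N) \<longlonglongrightarrow> c * norm x"
      using tendsto_diff[OF tendsto_const[of "c * norm x"] lim_const_over_n[of "c * real CARD('d) + \<bar>ln C\<bar>"]] by simp
    show "\<exists>N. \<forall>n\<ge>N. c * norm x - (c * real CARD('d) + \<bar>ln C\<bar>) / real n \<le> a (int_part (real n *\<^sub>R x)) / real n"
    proof (intro exI[of _ 1] allI impI)
      fix n :: nat assume n: "1 \<le> n"
      have "norm (real n *\<^sub>R x) \<le> vnorm (int_part (real n *\<^sub>R x)) + real CARD('d)"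
        using vec_int_part[of "real n *\<^sub>R x"] norm_triangle_ineq2[of "real n *\<^sub>R x" "vec_of_int (int_part (real n *\<^sub>R x))"]
        by (simp add: vnorm_def norm_minus_commute)
      then have "c * (real n * norm x) \<le> c * (vnorm (int_part (real n *\<^sub>R x)) + real CARD('d))"
        using c by (intro mult_left_mono) auto
      with al[of "int_part (real n *\<^sub>R x)"]
      have "c * (real n * norm x) - (c * real CARD('d) + \<bar>ln C\<bar>) \<le> a (int_part (real n *\<^sub>R x))"
        by (simp add: distrib_left)
      then have "(c * (real n * norm x) - (c * real CARD('d) + \<bar>ln C\<bar>)) / real n \<le> a (int_part (real n *\<^sub>R x)) / real n"
        by (rule divide_right_mono) simp
      moreover have "(c * (real n * norm x) - (c * real CARD('d) + \<bar>ln C\<bar>)) / real n = c * norm x - (c * real CARD('d) + \<bar>ln C\<bar>) / real n"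
        using n by (simp add: diff_divide_distrib)
      ultimately show "c * norm x - (c * real CARD('d) + \<bar>ln C\<bar>) / real n \<le> a (int_part (real n *\<^sub>R x)) / real n" by simp
    qed
  qed
  then show ?thesis using c by blast
qed

lemma xi_lipschitz: "\<bar>xi x - xi y\<bar> \<le> K * real CARD('d) * norm (x - y)"
proof -
  have "xi x \<le> xi (x - y) + xi y" "xi y \<le> xi (y - x) + xi x"
    using xi_triangle[of "x - y" y] xi_triangle[of "y - x" x] by simp_all
  moreover have "xi (y - x) = xi (x - y)" using xi_minus[of "x - y"] by simp
  ultimately show ?thesis using xi_upper[of "x - y"] by linarith
qed

lemma continuous_on_xi [continuous_intros]: "continuous_on A xi"
proof (rule continuous_onI)
  fix x e assume "(0::real) < e"
  let ?C = "K * real CARD('d)"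
  have C: "?C > 0" using K_pos by simp
  show "\<exists>d>0. \<forall>x'\<in>A. dist x' x < d \<longrightarrow> dist (xi x') (xi x) \<le> e"
  proof (intro exI[of _ "e / ?C"] conjI ballI impI)
    fix x' assume "dist x' x < e / ?C"
    then have "?C * norm (x' - x) \<le> e" using C by (simp add: dist_norm field_simps)
    with xi_lipschitz[of x' x] show "dist (xi x') (xi x) \<le> e" by (simp add: dist_real_def)
  qed (use \<open>0 < e\<close> C in auto)
qed

end


section \<open>Sums over the lattice\<close>

lemma lsum_swap:
  fixes f :: "'a::countable \<Rightarrow> 'b::countable \<Rightarrow> ennreal"
  shows "lsum (\<lambda>x. lsum (\<lambda>y. f x y)) = lsum (\<lambda>y. lsum (\<lambda>x. f x y))"
  by (rule nn_integral_count_space_nn_integral) auto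

lemma lsum_eq_suminf:
  fixes f :: "'a::countable \<Rightarrow> ennreal"
  shows "lsum f = (\<Sum>n. f (from_nat n) * indicator (range (to_nat :: 'a \<Rightarrow> nat)) n)"
proof -
  have "bij_betw (from_nat :: nat \<Rightarrow> 'a) (range (to_nat :: 'a \<Rightarrow> nat)) UNIV"
    by (rule bij_betw_byWitness[of _ "to_nat :: 'a \<Rightarrow> nat"]) auto
  then have "lsum f = (\<integral>\<^sup>+n. f (from_nat n) \<partial>count_space (range (to_nat :: 'a \<Rightarrow> nat)))"
    by (rule nn_integral_bij_count_space[symmetric])
  also have "\<dots> = lsum (\<lambda>n. f (from_nat n) * indicator (range (to_nat :: 'a \<Rightarrow> nat)) n)"
    by (rule nn_integral_count_space_indicator) simp
  finally show ?thesis by (simp add: nn_integral_count_space_nat)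
qed

lemma lsum_measurable [measurable (raw)]:
  fixes f :: "'a::countable \<Rightarrow> 'b \<Rightarrow> ennreal"
  assumes [measurable]: "\<And>x. f x \<in> borel_measurable M"
  shows "(\<lambda>\<omega>. lsum (\<lambda>x. f x \<omega>)) \<in> borel_measurable M"
  unfolding lsum_eq_suminf by measurable

lemma lsum_cmult: "lsum (\<lambda>x. c * f x) = c * lsum f"
  by (rule nn_integral_cmult) auto

lemma lsum_multc: "lsum (\<lambda>x. f x * c) = lsum f * c"
  by (rule nn_integral_multc) auto

lemma lsum_add: "lsum (\<lambda>x. f x + g x) = lsum f + lsum g"
  by (rule nn_integral_add) auto

lemma lsum_mono: "(\<And>x. f x \<le> g x) \<Longrightarrow> lsum f \<le> lsum g"
  by (rule nn_integral_mono) auto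

lemma lsum_ge: "f x \<le> lsum f"
  by (rule nn_integral_ge_point) simp

lemma lsum_shift: "lsum (\<lambda>x. f (x + a)) = lsum f" for a :: "'a::group_add"
  by (rule nn_integral_bij_count_space) (rule bij_betw_byWitness[of _ "\<lambda>x. x - a"], auto)

lemma lsum_shift': "lsum (\<lambda>x. f (x - a)) = lsum f" for a :: "'a::group_add"
  by (rule nn_integral_bij_count_space) (rule bij_betw_byWitness[of _ "\<lambda>x. x + a"], auto)

lemma lsum_reflect: "lsum (\<lambda>x. f (a - x)) = lsum f" for a :: "'a::ab_group_add"
  by (rule nn_integral_bij_count_space) (rule bij_betw_byWitness[of _ "\<lambda>x. a - x"], auto)

lemma lsum_finite: "finite A \<Longrightarrow> lsum (\<lambda>x. f x * indicator A x) = sum f A"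
  by (subst nn_integral_count_space_indicator[symmetric]) (auto simp: nn_integral_count_space_finite)

lemma card_lbox: "card (lbox n :: (int ^ 'd::finite) set) \<le> (2 * n + 1) ^ CARD('d)"
proof -
  have "card (lbox n :: (int ^ 'd) set) \<le> card (UNIV \<rightarrow>\<^sub>E {- int n..int n} :: ('d \<Rightarrow> int) set)"
  proof (rule card_inj_on_le[of "\<lambda>x. \<lambda>i. x $ i"])
    show "inj_on (\<lambda>x i. x $ i) (lbox n :: (int ^ 'd) set)" by (rule inj_onI) (simp add: vec_eq_iff fun_eq_iff)
    show "(\<lambda>x i. x $ i) ` (lbox n :: (int ^ 'd) set) \<subseteq> UNIV \<rightarrow>\<^sub>E {- int n..int n}"
      by (auto simp: lbox_def abs_le_iff minus_le_iff)
    show "finite (UNIV \<rightarrow>\<^sub>E {- int n..int n} :: ('d \<Rightarrow> int) set)" by (intro finite_PiE) auto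
  qed
  also have "\<dots> = (2 * n + 1) ^ CARD('d)"
  proof -
    have "card {- int n..int n} = 2 * n + 1" by simp
    then show ?thesis by (simp only: card_PiE finite_UNIV prod_constant finite)
  qed
  finally show ?thesis .
qed

lemma lbox_of: "x \<in> lbox n \<Longrightarrow> x \<notin> lbox m \<Longrightarrow> real m < vnorm x" for x :: "int ^ 'd::finite"
proof -
  assume "x \<notin> lbox m"
  then obtain i where "\<bar>x $ i\<bar> > int m" by (auto simp: lbox_def not_le)
  then have "real m < \<bar>real_of_int (x $ i)\<bar>" by linarith
  with vnorm_component[of x i] show ?thesis by linarith
qed

text \<open>Charge each vertex to the smallest box containing it: box sizes grow polynomially while
  the weight decays exponentially.\<close>

lemma exp_sum_finite:
  assumes k: "k > 0"
  shows "lsum (\<lambda>x :: int ^ 'd::finite. ennreal (exp (- k * vnorm x))) < \<infinity>"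
proof -
  let ?d = "CARD('d)"
  define g where "g n = exp (- k * (real n - 1)) * real ((2 * n + 1) ^ ?d)" for n :: nat
  have d: "?d > 0" by simp
  have pw: "real ((2 * n + 1) ^ ?d) \<le> (4 * real ?d / k) ^ ?d * exp (k / 4 * (2 * real n + 1))" for n
  proof -
    have "(k / 4 * (2 * real n + 1) / real ?d) ^ ?d \<le> (1 + k / 4 * (2 * real n + 1) / real ?d) ^ ?d"
      using k by (intro power_mono) auto
    also have "\<dots> \<le> exp (k / 4 * (2 * real n + 1))"
      using k by (intro exp_ge_one_plus_x_over_n_power_n) (auto intro: order_trans[of _ 0])
    finally have "(4 * real ?d / k) ^ ?d * (k / 4 * (2 * real n + 1) / real ?d) ^ ?d \<le> (4 * real ?d / k) ^ ?d * exp (k / 4 * (2 * real n + 1))"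
      using k by (intro mult_left_mono) auto
    moreover have "(4 * real ?d / k) ^ ?d * (k / 4 * (2 * real n + 1) / real ?d) ^ ?d = (2 * real n + 1) ^ ?d"
      unfolding power_mult_distrib[symmetric] using k d by simp
    ultimately show ?thesis by (simp add: add.commute)
  qed
  have sg: "summable g"
  proof (rule summable_comparison_test')
    let ?C = "(4 * real ?d / k) ^ ?d * exp (k / 4 + k)"
    show "summable (\<lambda>n. ?C * exp (- k / 2) ^ n)" by (intro summable_mult summable_geometric) (use k in auto)
    fix n :: nat
    have "g n \<le> exp (- k * (real n - 1)) * ((4 * real ?d / k) ^ ?d * exp (k / 4 * (2 * real n + 1)))"
      unfolding g_def by (intro mult_left_mono pw) auto
    also have "\<dots> = ?C * exp (- k / 2) ^ n"
    proof -
      have "exp (- k * (real n - 1)) * exp (k / 4 * (2 * real n + 1)) = exp (k / 4 + k) * exp (- k / 2) ^ n"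
        unfolding exp_of_nat_mult[symmetric] exp_add[symmetric] by (simp add: algebra_simps)
      then show ?thesis by (simp add: mult_ac)
    qed
    finally show "norm (g n) \<le> ?C * exp (- k / 2) ^ n" by (simp add: g_def)
  qed
  have "lsum (\<lambda>x :: int ^ 'd. ennreal (exp (- k * vnorm x))) \<le> lsum (\<lambda>x :: int ^ 'd. lsum (\<lambda>n :: nat. ennreal (exp (- k * (real n - 1))) * indicator (lbox n) x))"
  proof (rule lsum_mono)
    fix x :: "int ^ 'd"
    define n where "n = (LEAST n. x \<in> lbox n)"
    have ex: "\<exists>n. x \<in> lbox n" using finite_subset_lbox[of "{x}"] by auto
    have n: "x \<in> lbox n" unfolding n_def using ex by (rule LeastI_ex)
    have v: "real n - 1 \<le> vnorm x"
    proof (cases n)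
      case (Suc m)
      then have "x \<notin> lbox m" using not_less_Least[of m "\<lambda>n. x \<in> lbox n"] n_def by simp
      then show ?thesis using lbox_of[OF n] Suc by fastforce
    qed (simp add: order_trans[of _ 0])
    have "ennreal (exp (- k * vnorm x)) \<le> ennreal (exp (- k * (real n - 1))) * indicator (lbox n) x"
      using v k n by (simp add: ennreal_leI)
    also have "\<dots> \<le> lsum (\<lambda>n :: nat. ennreal (exp (- k * (real n - 1))) * indicator (lbox n) x)"
      by (rule lsum_ge)
    finally show "ennreal (exp (- k * vnorm x)) \<le> lsum (\<lambda>n :: nat. ennreal (exp (- k * (real n - 1))) * indicator (lbox n) x)" .
  qed
  also have "\<dots> = lsum (\<lambda>n :: nat. lsum (\<lambda>x :: int ^ 'd. ennreal (exp (- k * (real n - 1))) * indicator (lbox n) x))"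
    by (rule lsum_swap)
  also have "\<dots> \<le> lsum (\<lambda>n :: nat. ennreal (g n))"
  proof (rule lsum_mono)
    fix n :: nat
    have "lsum (\<lambda>x :: int ^ 'd. ennreal (exp (- k * (real n - 1))) * indicator (lbox n) x) = of_nat (card (lbox n :: (int ^ 'd) set)) * ennreal (exp (- k * (real n - 1)))"
      by (subst lsum_finite) auto
    also have "\<dots> = ennreal (real (card (lbox n :: (int ^ 'd) set)) * exp (- k * (real n - 1)))"
      by (simp add: ennreal_mult'' ennreal_of_nat_eq_real_of_nat)
    also have "\<dots> \<le> ennreal (g n)"
      unfolding g_def mult.commute[of "real (card _)"]
      by (intro ennreal_leI mult_left_mono) (use card_lbox[of n, where 'd = 'd] in \<open>simp_all only: of_nat_le_iff exp_ge_zero\<close>)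
    finally show "lsum (\<lambda>x :: int ^ 'd. ennreal (exp (- k * (real n - 1))) * indicator (lbox n) x) \<le> ennreal (g n)" .
  qed
  also have "\<dots> = (\<Sum>n. ennreal (g n))" by (rule nn_integral_count_space_nat)
  also have "\<dots> < \<infinity>"
  proof -
    have "(\<Sum>n. ennreal (g n)) = ennreal (\<Sum>n. g n)" by (rule suminf_ennreal2[OF _ sg]) (simp add: g_def)
    then show ?thesis by simp
  qed
  finally show ?thesis .
qed

section \<open>Tilted level sums\<close>

text \<open>The functional \<open>s\<close> lies below \<open>xi\<close> and touches it at
  \<open>va\<close>. The directions where it touches form a face of the unit ball, and the aim of
  this locale is that this face is a single direction.\<close>

locale face = subcrit p dd for p and dd :: "'d::finite itself" +
  fixes s va :: "real ^ 'd"
  assumes s_le: "s \<bullet> x \<le> inv_conn_length p x"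
    and s_va: "s \<bullet> va = inv_conn_length p va" and va: "va \<noteq> 0"
begin

text \<open>Coefficients of an integer substitute for \<open>s\<close>. With values in {-1, 0, 1}
  the form \<open>L\<close> changes by at most 1 along a bond, and with the signs of
  \<open>s\<close> it is positive on the face (\<open>f_zero_LR\<close>).\<close>

definition sg :: "'d \<Rightarrow> int" where "sg i = (if s $ i > 0 then 1 else if s $ i < 0 then -1 else 0)"
definition L :: "int ^ 'd \<Rightarrow> int" where "L x = (\<Sum>i\<in>UNIV. sg i * x $ i)"
definition LR :: "real ^ 'd \<Rightarrow> real" where "LR y = (\<Sum>i\<in>UNIV. real_of_int (sg i) * y $ i)"
text \<open>The excess of \<open>xi\<close> over its supporting functional; the face is its zero
  set.\<close>

definition f :: "real ^ 'd \<Rightarrow> real" where "f y = xi y - s \<bullet> y"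

lemma L_add: "L (x + y) = L x + L y" by (simp add: L_def sum.distrib distrib_left)
lemma L_minus: "L (- x) = - L x" by (simp add: L_def sum_negf)
lemma L_diff: "L (x - y) = L x - L y" using L_add[of x "- y"] by (simp add: L_minus)
lemma L_0 [simp]: "L 0 = 0" by (simp add: L_def)
lemma LR_vec: "LR (vec_of_int x) = real_of_int (L x)" by (simp add: LR_def L_def)
lemma LR_scale: "LR (c *\<^sub>R y) = c * LR y" by (simp add: LR_def sum_distrib_left mult_ac)
lemma LR_diff: "LR (x - y) = LR x - LR y" by (simp add: LR_def sum_subtractf right_diff_distrib)


lemma LR_le: "\<bar>LR y\<bar> \<le> real CARD('d) * norm y"
proof -
  have "\<bar>LR y\<bar> \<le> (\<Sum>i\<in>UNIV. \<bar>real_of_int (sg i) * y $ i\<bar>)" unfolding LR_def by (rule sum_abs)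
  also have "\<dots> \<le> (\<Sum>i\<in>(UNIV::'d set). norm y)"
  proof (rule sum_mono)
    fix i
    have "\<bar>real_of_int (sg i) * y $ i\<bar> \<le> \<bar>y $ i\<bar>" by (simp add: sg_def abs_mult)
    then show "\<bar>real_of_int (sg i) * y $ i\<bar> \<le> norm y" using component_le_norm_cart[of y i] by linarith
  qed
  finally show ?thesis by simp
qed

lemma L_le: "\<bar>real_of_int (L x)\<bar> \<le> real CARD('d) * vnorm x"
  using LR_le[of "vec_of_int x"] by (simp add: LR_vec vnorm_def)

lemma L_step: "{x, y} \<in> bonds \<Longrightarrow> \<bar>L x - L y\<bar> \<le> 1"
proof -
  assume "{x, y} \<in> bonds"
  then have 1: "(\<Sum>i\<in>UNIV. \<bar>(x - y) $ i\<bar>) = 1" by (intro vnorm_unit_l1) (simp add: bonds_iff)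
  have "\<bar>L (x - y)\<bar> \<le> (\<Sum>i\<in>UNIV. \<bar>sg i * (x - y) $ i\<bar>)" unfolding L_def by (rule sum_abs)
  also have "\<dots> \<le> (\<Sum>i\<in>UNIV. \<bar>(x - y) $ i\<bar>)" by (rule sum_mono) (simp add: sg_def abs_mult)
  finally show ?thesis using 1 by (simp add: L_diff)
qed

lemma f_nonneg: "0 \<le> f y" using s_le[of y] by (simp add: f_def)

text \<open>If some s_i y_i were negative, reflecting coordinate i would increase the value of
  \<open>s\<close> without increasing \<open>xi\<close>, against the support property. So all terms
  of \<open>LR y\<close> are nonnegative, and if they all vanished then so would s . y = xi
  y.\<close>

lemma f_zero_LR:
  assumes "f y = 0" "y \<noteq> 0" shows "0 < LR y"
proof -
  have xy: "xi y = s \<bullet> y" using assms by (simp add: f_def)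
  have nn: "s $ i * y $ i \<ge> 0" for i
  proof (rule ccontr)
    assume neg: "\<not> s $ i * y $ i \<ge> 0"
    define \<sigma> :: "'d \<Rightarrow> int" where "\<sigma> j = (if j = i then -1 else 1)" for j
    let ?y = "\<chi> j. real_of_int (\<sigma> j) * y $ j"
    have "s \<bullet> ?y \<le> xi ?y" by (rule s_le)
    also have "\<dots> \<le> xi y" by (rule xi_reflect) (simp add: \<sigma>_def)
    finally have "s \<bullet> ?y \<le> s \<bullet> y" using xy by simp
    moreover have "s \<bullet> ?y = s $ i * - y $ i + (\<Sum>j\<in>UNIV - {i}. s $ j * y $ j)"
      unfolding inner_vec_def by (subst sum.remove[of _ i]) (auto simp: \<sigma>_def intro!: sum.cong)
    moreover have "s \<bullet> y = s $ i * y $ i + (\<Sum>j\<in>UNIV - {i}. s $ j * y $ j)"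
      unfolding inner_vec_def by (subst sum.remove[of _ i]) auto
    ultimately show False using neg by simp
  qed
  have terms: "real_of_int (sg i) * y $ i \<ge> 0" for i
    using nn[of i] by (auto simp: sg_def zero_le_mult_iff)
  have "LR y \<ge> 0" unfolding LR_def by (rule sum_nonneg) (rule terms)
  moreover have "LR y \<noteq> 0"
  proof
    assume "LR y = 0"
    then have z: "real_of_int (sg i) * y $ i = 0" for i
      unfolding LR_def using terms by (subst (asm) sum_nonneg_eq_0_iff) auto
    have "s $ i * y $ i = 0" for i
      using z[of i] by (auto simp: sg_def split: if_splits)
    then have "s \<bullet> y = 0" unfolding inner_vec_def inner_real_def  by (intro sum.neutral ballI)
    then have "xi y = 0" using xy by simp
    obtain c where "c > 0" "c * norm y \<le> xi y" using xi_lower by blast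
    then show False using \<open>xi y = 0\<close> assms(2) by (simp add: mult_le_0_iff)
  qed
  ultimately show ?thesis by simp
qed

lemma f_va: "f va = 0" using s_va by (simp add: f_def)
lemma LR_va: "0 < LR va" by (rule f_zero_LR[OF f_va va])

text \<open>By \<open>f_zero_LR\<close>, \<open>f\<close> and \<open>LR\<close> have no common zero
  on the unit sphere; compactness and homogeneity give the constant.\<close>

lemma coercive: "\<exists>c>0. \<forall>y. c * norm y \<le> f y + \<bar>LR y\<bar>"
proof -
  let ?g = "\<lambda>y. f y + \<bar>LR y\<bar>"
  have cont: "continuous_on (sphere 0 1) ?g"
    unfolding f_def LR_def by (intro continuous_intros)
  have ne: "sphere (0 :: real ^ 'd) 1 \<noteq> {}"
    using va by (auto intro!: exI[of _ "va /\<^sub>R norm va"])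
  obtain y where y: "y \<in> sphere 0 1" "\<And>z. z \<in> sphere 0 1 \<Longrightarrow> ?g y \<le> ?g z"
    using continuous_attains_inf[OF compact_sphere ne cont] by blast
  have "?g y > 0"
  proof (rule ccontr)
    assume "\<not> ?g y > 0"
    then have "f y = 0" "LR y = 0" using f_nonneg[of y] by linarith+
    moreover have "y \<noteq> 0" using y by auto
    ultimately show False using f_zero_LR[of y] by simp
  qed
  moreover have "?g y * norm z \<le> ?g z" for z
  proof (cases "z = 0")
    case False
    have "?g y \<le> ?g (z /\<^sub>R norm z)" by (rule y(2)) (use False in auto)
    also have "\<dots> = ?g z / norm z"
    proof -
      have "xi (z /\<^sub>R norm z) = inverse (norm z) * xi z" by (rule xi_scale) simp
      then show ?thesis by (simp add: f_def LR_scale abs_mult divide_inverse algebra_simps)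
    qed
    finally show ?thesis using False by (simp add: field_simps)
  qed (simp add: f_def LR_def)
  ultimately show ?thesis by blast
qed

definition c0 where "c0 = (SOME c. c > 0 \<and> (\<forall>y. c * norm y \<le> f y + \<bar>LR y\<bar>))"
definition c1 where "c1 = (SOME c. c > 0 \<and> (\<forall>y :: real ^ 'd. c * norm y \<le> xi y))"

lemma c0: "c0 > 0" "c0 * norm y \<le> f y + \<bar>LR y\<bar>"
  using someI_ex[of "\<lambda>c. c > 0 \<and> (\<forall>y. c * norm y \<le> f y + \<bar>LR y\<bar>)"] coercive unfolding c0_def by blast+
lemma c1: "c1 > 0" "c1 * norm y \<le> xi y"
  using someI_ex[of "\<lambda>c. c > 0 \<and> (\<forall>y :: real ^ 'd. c * norm y \<le> xi y)"] xi_lower unfolding c1_def by blast+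

lemma t_decay: "t x \<le> exp (- c1 * vnorm x)"
  using t_le_exp_xi[of x] c1(2)[of "vec_of_int x"] by (simp add: vnorm_def order_trans)

text \<open>The two-point function tilted by \<open>s + h\<close>. For h = 0 the tilt cancels the
  exponential decay along the face; varying \<open>h\<close> probes in which direction the mass of a
  level lies.\<close>

definition w :: "real ^ 'd \<Rightarrow> int ^ 'd \<Rightarrow> real" where
  "w h x = exp ((s + h) \<bullet> vec_of_int x) * t x"

lemma w_pos: "0 < w h x" using t_pos by (simp add: w_def)
lemma w_nonneg: "0 \<le> w h x" using w_pos[of h x] by simp

lemma w_mult: "w h x * w h y \<le> w h (x + y)"
proof -
  have "w h x * w h y = exp ((s + h) \<bullet> vec_of_int (x + y)) * (t x * t y)"
    by (simp add: w_def vec_of_int_add inner_add_right exp_add)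
  also have "\<dots> \<le> w h (x + y)" unfolding w_def by (intro mult_left_mono t_mult) auto
  finally show ?thesis .
qed

lemma w_le_f: "w h x \<le> exp (- f (vec_of_int x) + norm h * vnorm x)"
proof -
  have "w h x \<le> exp ((s + h) \<bullet> vec_of_int x) * exp (- xi (vec_of_int x))"
    unfolding w_def by (intro mult_left_mono t_le_exp_xi) auto
  also have "\<dots> = exp (- f (vec_of_int x) + h \<bullet> vec_of_int x)" by (simp add: f_def inner_add_left flip: exp_add)
  also have "\<dots> \<le> exp (- f (vec_of_int x) + norm h * vnorm x)"
    unfolding vnorm_def using norm_cauchy_schwarz[of h "vec_of_int x"] by simp
  finally show ?thesis .
qed

text \<open>Because \<open>f\<close> is nonnegative, the coercive bound may be weakened by a factor
  \<theta>. This trades spatial decay for a growth of only exp (\<theta> |l|) in the level, with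
  \<theta> as small as desired.\<close>

lemma f_lower: "0 \<le> \<theta> \<Longrightarrow> \<theta> \<le> 1 \<Longrightarrow> \<theta> * (c0 * vnorm x - \<bar>real_of_int (L x)\<bar>) \<le> f (vec_of_int x)"
proof -
  assume \<theta>: "0 \<le> \<theta>" "\<theta> \<le> 1"
  have "c0 * vnorm x - \<bar>real_of_int (L x)\<bar> \<le> f (vec_of_int x)"
    using c0(2)[of "vec_of_int x"] by (simp add: LR_vec vnorm_def)
  then have "\<theta> * (c0 * vnorm x - \<bar>real_of_int (L x)\<bar>) \<le> \<theta> * f (vec_of_int x)" using \<theta> by (intro mult_left_mono)
  also have "\<dots> \<le> 1 * f (vec_of_int x)" using \<theta> f_nonneg by (intro mult_right_mono)
  finally show ?thesis by simp
qed

definition mu :: "real ^ 'd \<Rightarrow> (int ^ 'd) set \<Rightarrow> ennreal" where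
  "mu h A = lsum (\<lambda>x. ennreal (w h x) * indicator A x)"

definition lev :: "int \<Rightarrow> (int ^ 'd) set" where "lev l = {x. L x = l}"
definition Z :: "real ^ 'd \<Rightarrow> int \<Rightarrow> ennreal" where "Z h l = mu h (lev l)"
definition EE :: "real \<Rightarrow> ennreal" where "EE k = lsum (\<lambda>x :: int ^ 'd. ennreal (exp (- k * vnorm x)))"

lemma EE_finite: "k > 0 \<Longrightarrow> EE k < \<infinity>" unfolding EE_def by (rule exp_sum_finite)

lemma mu_mono: "A \<subseteq> B \<Longrightarrow> mu h A \<le> mu h B"
  unfolding mu_def by (intro lsum_mono mult_left_mono) (auto simp: indicator_def)

lemma mu_point: "x \<in> A \<Longrightarrow> ennreal (w h x) \<le> mu h A"
  unfolding mu_def using lsum_ge[of "\<lambda>x. ennreal (w h x) * indicator A x" x] by simp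

lemma mu_UN_disjoint:
  assumes "finite I" "disjoint_family_on A I"
  shows "mu h (\<Union>i\<in>I. A i) = (\<Sum>i\<in>I. mu h (A i))"
proof -
  have "indicator (\<Union>i\<in>I. A i) x = (\<Sum>i\<in>I. indicator (A i) x :: ennreal)" for x
    using assms by (simp add: indicator_UN_disjoint)
  then have "mu h (\<Union>i\<in>I. A i) = lsum (\<lambda>x. \<Sum>i\<in>I. ennreal (w h x) * indicator (A i) x)"
    unfolding mu_def by (simp add: sum_distrib_left)
  also have "\<dots> = (\<Sum>i\<in>I. mu h (A i))" unfolding mu_def by (rule nn_integral_sum) auto
  finally show ?thesis .
qed

lemma Z_upper:
  assumes \<theta>: "0 < \<theta>" "\<theta> \<le> 1" and h: "norm h \<le> \<theta> * c0 / 2"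
  shows "Z h l \<le> ennreal (exp (\<theta> * \<bar>real_of_int l\<bar>)) * EE (\<theta> * c0 / 2)"
proof -
  have "Z h l \<le> lsum (\<lambda>x :: int ^ 'd. ennreal (exp (\<theta> * \<bar>real_of_int l\<bar>)) * ennreal (exp (- (\<theta> * c0 / 2) * vnorm x)))"
    unfolding Z_def mu_def
  proof (rule lsum_mono)
    fix x
    show "ennreal (w h x) * indicator (lev l) x \<le> ennreal (exp (\<theta> * \<bar>real_of_int l\<bar>)) * ennreal (exp (- (\<theta> * c0 / 2) * vnorm x))"
    proof (cases "L x = l")
      case True
      have "w h x \<le> exp (- f (vec_of_int x) + norm h * vnorm x)" by (rule w_le_f)
      also have "\<dots> \<le> exp (\<theta> * \<bar>real_of_int l\<bar> + (- (\<theta> * c0 / 2) * vnorm x))"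
      proof -
        have "norm h * vnorm x \<le> \<theta> * c0 / 2 * vnorm x" using h by (intro mult_right_mono) auto
        with f_lower[of \<theta> x] \<theta> True show ?thesis by (simp add: algebra_simps)
      qed
      finally have "w h x \<le> exp (\<theta> * \<bar>real_of_int l\<bar>) * exp (- (\<theta> * c0 / 2) * vnorm x)" unfolding exp_add .
      then have "ennreal (w h x) \<le> ennreal (exp (\<theta> * \<bar>real_of_int l\<bar>)) * ennreal (exp (- (\<theta> * c0 / 2) * vnorm x))"
        by (subst ennreal_mult'[symmetric]) (auto intro: ennreal_leI)
      then show ?thesis using True by (simp add: lev_def)
    qed (simp add: lev_def)
  qed
  also have "\<dots> = ennreal (exp (\<theta> * \<bar>real_of_int l\<bar>)) * EE (\<theta> * c0 / 2)"
    unfolding EE_def by (rule lsum_cmult)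
  finally show ?thesis .
qed

lemma Z_finite:
  assumes "norm h \<le> c0 / 2" shows "Z h l < \<infinity>"
proof -
  have "EE (c0 / 2) < \<infinity>" using c0(1) by (intro EE_finite) auto
  then have "ennreal (exp (1 * \<bar>real_of_int l\<bar>)) * EE (1 * c0 / 2) < \<infinity>" by (simp add: ennreal_mult_less_top)
  moreover have "Z h l \<le> ennreal (exp (1 * \<bar>real_of_int l\<bar>)) * EE (1 * c0 / 2)"
    by (rule Z_upper) (use assms in auto)
  ultimately show ?thesis by (rule le_less_trans[rotated])
qed

text \<open>Translation by \<open>v\<close> carries level n - L v into level n, at a cost controlled
  by the supermultiplicativity of \<open>w\<close>.\<close>

lemma Z_FKG: "ennreal (w h v) * Z h (n - L v) \<le> Z h n"
proof -
  have "ennreal (w h v) * Z h (n - L v) = lsum (\<lambda>x. ennreal (w h v) * (ennreal (w h x) * indicator (lev (n - L v)) x))"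
    unfolding Z_def mu_def by (rule lsum_cmult[symmetric])
  also have "\<dots> \<le> lsum (\<lambda>x. ennreal (w h (x + v)) * indicator (lev n) (x + v))"
  proof (rule lsum_mono)
    fix x
    have "ennreal (w h v) * ennreal (w h x) \<le> ennreal (w h (x + v))"
      using w_mult[of h v x] by (simp add: w_nonneg ennreal_leI add.commute flip: ennreal_mult)
    then show "ennreal (w h v) * (ennreal (w h x) * indicator (lev (n - L v)) x) \<le> ennreal (w h (x + v)) * indicator (lev n) (x + v)"
      by (auto simp: lev_def L_add indicator_def)
  qed
  also have "\<dots> = Z h n" unfolding Z_def mu_def by (rule lsum_shift)
  finally show ?thesis .
qed

lemma t_crossing:
  assumes "0 \<le> n" "n \<le> L z"
  shows "ennreal (t z) \<le> lsum (\<lambda>x. ennreal (t x * t (z - x)) * indicator (lev n) x)"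
proof -
  have "ennreal (t z) \<le> lsum (\<lambda>x. ennreal (PP p (\<lambda>A. L x = n \<and> dj (cn 0 x) (cn x z) A)))"
    unfolding t_def tau_def
  proof (rule PP_union[OF p01])
    fix A :: "(int ^ 'd) set set" assume "A \<subseteq> bonds" "cn 0 z A"
    then show "\<exists>x. L x = n \<and> dj (cn 0 x) (cn x z) A"
      using assms L_step by (intro conn_crossing) (auto simp: cn_def)
  qed (auto intro: fin_incr_conj_const)
  also have "\<dots> \<le> lsum (\<lambda>x. ennreal (t x * t (z - x)) * indicator (lev n) x)"
  proof (rule lsum_mono)
    fix x
    show "ennreal (PP p (\<lambda>A. L x = n \<and> dj (cn 0 x) (cn x z) A)) \<le> ennreal (t x * t (z - x)) * indicator (lev n) x"
    proof (cases "L x = n")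
      case True
      have "PP p (dj (cn 0 x) (cn x z)) \<le> tau p 0 x * tau p x z"
        unfolding tau_def by (rule PP_BK[OF _ _ p01]) auto
      then show ?thesis using True by (simp add: lev_def tau_t ennreal_leI)
    next
      case False
      have "PP p (\<lambda>A :: (int ^ 'd) set set. False) = 0" by (simp add: PP_def ev_def)
      with False show ?thesis by (simp add: lev_def)
    qed
  qed
  finally show ?thesis .
qed

lemma w_crossing:
  assumes "0 \<le> n" "n \<le> L z"
  shows "ennreal (w h z) \<le> lsum (\<lambda>x. ennreal (w h x * w h (z - x)) * indicator (lev n) x)"
proof -
  let ?e = "exp ((s + h) \<bullet> vec_of_int z)"
  have "ennreal (w h z) = ennreal ?e * ennreal (t z)" by (simp add: w_def ennreal_mult')
  also have "\<dots> \<le> ennreal ?e * lsum (\<lambda>x. ennreal (t x * t (z - x)) * indicator (lev n) x)"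
    by (intro mult_left_mono t_crossing assms) auto
  also have "\<dots> = lsum (\<lambda>x. ennreal (w h x * w h (z - x)) * indicator (lev n) x)"
    unfolding lsum_cmult[symmetric]
  proof (intro nn_integral_cong)
    fix x
    have "?e * (t x * t (z - x)) = w h x * w h (z - x)"
      by (simp add: w_def vec_of_int_diff inner_diff_right exp_diff)
    then show "ennreal ?e * (ennreal (t x * t (z - x)) * indicator (lev n) x) = ennreal (w h x * w h (z - x)) * indicator (lev n) x"
      by (simp add: ennreal_mult'[symmetric] mult.assoc[symmetric])
  qed
  finally show ?thesis .
qed

lemma sum_lev_shift: "lsum (\<lambda>z. ennreal (w h (z - x)) * indicator (lev l) z) = Z h (l - L x)"
proof -
  have "lsum (\<lambda>z. ennreal (w h (z - x)) * indicator (lev l) z) = lsum (\<lambda>z. (\<lambda>y. ennreal (w h y) * indicator (lev (l - L x)) y) (z - x))"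
    by (intro nn_integral_cong) (auto simp: lev_def L_diff indicator_def)
  also have "\<dots> = Z h (l - L x)" unfolding Z_def mu_def by (rule lsum_shift')
  finally show ?thesis .
qed

text \<open>A path to level n + m crosses level n; BK separates the two pieces and the exponential
  tilt factorises exactly.\<close>

lemma Z_submult:
  assumes "0 \<le> n" "0 \<le> m" shows "Z h (n + m) \<le> Z h n * Z h m"
proof -
  have "Z h (n + m) \<le> lsum (\<lambda>z. lsum (\<lambda>x. ennreal (w h x) * indicator (lev n) x * (ennreal (w h (z - x)) * indicator (lev (n + m)) z)))"
    unfolding Z_def mu_def
  proof (rule lsum_mono)
    fix z
    show "ennreal (w h z) * indicator (lev (n + m)) z \<le> lsum (\<lambda>x. ennreal (w h x) * indicator (lev n) x * (ennreal (w h (z - x)) * indicator (lev (n + m)) z))"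
    proof (cases "z \<in> lev (n + m)")
      case True
      then have "ennreal (w h z) \<le> lsum (\<lambda>x. ennreal (w h x * w h (z - x)) * indicator (lev n) x)"
        using assms by (intro w_crossing) (auto simp: lev_def)
      then show ?thesis using True by (simp add: ennreal_mult' w_nonneg mult_ac)
    qed simp
  qed
  also have "\<dots> = lsum (\<lambda>x. lsum (\<lambda>z. ennreal (w h x) * indicator (lev n) x * (ennreal (w h (z - x)) * indicator (lev (n + m)) z)))"
    by (rule lsum_swap)
  also have "\<dots> = lsum (\<lambda>x. ennreal (w h x) * indicator (lev n) x * Z h (n + m - L x))"
    unfolding lsum_cmult sum_lev_shift ..
  also have "\<dots> = lsum (\<lambda>x. ennreal (w h x) * indicator (lev n) x * Z h m)"
    by (intro nn_integral_cong) (auto simp: lev_def indicator_def)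
  also have "\<dots> = Z h n * Z h m" unfolding lsum_multc by (simp add: Z_def mu_def)
  finally show ?thesis .
qed

text \<open>Supplies at every level exactly one usable vertex near the ray through \<open>e\<close>,
  with subexponential loss of weight: round the right multiple of \<open>e\<close>, then correct the
  level along one coordinate.\<close>

lemma face_points:
  assumes e: "f e = 0" "e \<noteq> 0" and \<eta>: "0 < \<eta>"
  shows "\<exists>B C. 0 \<le> B \<and> 0 \<le> C \<and> (\<forall>k::nat. \<exists>v. L v = int k \<and> w 0 v \<ge> exp (- \<eta> * real k - C)
    \<and> norm (vec_of_int v - (real k / LR e) *\<^sub>R e) \<le> B)"
proof -
  have Le: "0 < LR e" by (rule f_zero_LR[OF e])
  have xe: "xi e = s \<bullet> e" using e by (simp add: f_def)
  obtain i0 where i0: "sg i0 \<noteq> 0"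
  proof -
    have "\<exists>i. sg i \<noteq> 0"
    proof (rule ccontr)
      assume "\<not> ?thesis"
      then have "LR e = 0" by (simp add: LR_def)
      then show False using Le by simp
    qed
    then show ?thesis using that by blast
  qed
  then have sq: "sg i0 * sg i0 = 1" by (auto simp: sg_def split: if_splits)
  define \<eta>' where "\<eta>' = \<eta> * LR e"
  have \<eta>': "\<eta>' > 0" using \<eta> Le by (simp add: \<eta>'_def)
  \<comment> \<open>The limit gives the bound for large M; the finitely many remaining values are
    absorbed by the constant.\<close>
  obtain C0 where C0: "\<And>M. a (int_part (real M *\<^sub>R e)) \<le> real M * (xi e + \<eta>') + C0" "C0 \<ge> 0"
  proof -
    have "\<forall>\<^sub>F M in sequentially. a (int_part (real M *\<^sub>R e)) / real M < xi e + \<eta>'"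
      by (rule order_tendstoD(2)[OF xi_tendsto]) (use \<eta>' in simp)
    then obtain M0 where M0: "\<And>M. M \<ge> M0 \<Longrightarrow> a (int_part (real M *\<^sub>R e)) / real M < xi e + \<eta>'"
      by (auto simp: eventually_sequentially)
    define C0 where "C0 = (\<Sum>M\<le>M0. a (int_part (real M *\<^sub>R e)))"
    have C0n: "C0 \<ge> 0" unfolding C0_def by (intro sum_nonneg a_nonneg)
    have nn: "0 \<le> real M * (xi e + \<eta>')" for M using xi_nonneg[of e] \<eta>' by simp
    show ?thesis
    proof (rule that[OF _ C0n])
      fix M
      show "a (int_part (real M *\<^sub>R e)) \<le> real M * (xi e + \<eta>') + C0"
      proof (cases "M \<le> M0")
        case True
        then have "a (int_part (real M *\<^sub>R e)) \<le> C0" unfolding C0_def by (intro member_le_sum) (auto intro: a_nonneg)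
        then show ?thesis using nn[of M] by linarith
      next
        case False
        then have "a (int_part (real M *\<^sub>R e)) \<le> real M * (xi e + \<eta>')" using M0[of M] by (simp add: field_simps)
        then show ?thesis using C0n by linarith
      qed
    qed
  qed
  \<comment> \<open>Bound on the level error: the first term comes from rounding M e to the lattice,
    the second from rounding k / LR e down to M.\<close>
  define J where "J = real CARD('d) * real CARD('d) + LR e"
  have J0: "J \<ge> 0" using Le by (simp add: J_def)
  define B where "B = real CARD('d) + J + norm e"
  define C where "C = C0 + K * J + norm s * (real CARD('d) + J)"
  show ?thesis
  proof (rule exI[of _ B], rule exI[of _ C], intro conjI allI)
    show "0 \<le> B" using J0 by (simp add: B_def)
    show "0 \<le> C" using J0 C0(2) K_pos by (simp add: C_def)
    fix k :: nat
    define M where "M = nat \<lfloor>real k / LR e\<rfloor>"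
    have kM: "real M \<le> real k / LR e" "real k / LR e - 1 \<le> real M"
    proof -
      have "0 \<le> \<lfloor>real k / LR e\<rfloor>" using Le by simp
      then have "real M = real_of_int \<lfloor>real k / LR e\<rfloor>" by (simp add: M_def)
      then show "real M \<le> real k / LR e" "real k / LR e - 1 \<le> real M" by linarith+
    qed
    let ?u = "int_part (real M *\<^sub>R e)"
    define j where "j = int k - L ?u"
    \<comment> \<open>Moving j units along a coordinate with nonzero sign brings the point exactly
      to level k.\<close>
    define v where "v = ?u + axis i0 (j * sg i0)"
    have Lax: "L (axis i0 (j * sg i0)) = j"
    proof -
      have "L (axis i0 (j * sg i0)) = (\<Sum>i\<in>UNIV. if i = i0 then sg i0 * (j * sg i0) else 0)"
        unfolding L_def by (intro sum.cong) (auto simp: axis_def)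
      also have "\<dots> = sg i0 * sg i0 * j" by (simp add: mult_ac)
      finally show ?thesis using sq by simp
    qed
    then have Lv: "L v = int k" by (simp add: v_def L_add j_def)
    have ue: "norm (vec_of_int ?u - real M *\<^sub>R e) \<le> real CARD('d)" by (rule vec_int_part)
    have jJ: "\<bar>real_of_int j\<bar> \<le> J"
    proof -
      have "\<bar>real_of_int (L ?u) - real M * LR e\<bar> = \<bar>LR (vec_of_int ?u - real M *\<^sub>R e)\<bar>"
        by (simp add: LR_diff LR_vec LR_scale)
      also have "\<dots> \<le> real CARD('d) * real CARD('d)" using LR_le[of "vec_of_int ?u - real M *\<^sub>R e"] ue mult_left_mono[OF ue, of "real CARD('d)"] by linarith
      finally have 1: "\<bar>real_of_int (L ?u) - real M * LR e\<bar> \<le> real CARD('d) * real CARD('d)" .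
      have "real M * LR e \<le> real k" "real k - LR e \<le> real M * LR e"
        using kM Le by (simp_all add: field_simps)
      with 1 show ?thesis unfolding j_def J_def by simp
    qed
    have l1ax: "real (l1 (axis i0 (j * sg i0))) \<le> J"
    proof -
      have "real (l1 (axis i0 (j * sg i0))) = (\<Sum>i\<in>UNIV. if i = i0 then \<bar>real_of_int (j * sg i0)\<bar> else 0)"
        unfolding l1_bound by (intro sum.cong) (auto simp: axis_def)
      also have "\<dots> = \<bar>real_of_int j\<bar> * \<bar>real_of_int (sg i0)\<bar>" by (simp add: abs_mult)
      also have "\<bar>real_of_int (sg i0)\<bar> = 1" using i0 by (auto simp: sg_def split: if_splits)
      finally show ?thesis using jJ by simp
    qed
    have vu: "norm (vec_of_int v - real M *\<^sub>R e) \<le> real CARD('d) + J"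
    proof -
      have "vec_of_int v - real M *\<^sub>R e = (vec_of_int ?u - real M *\<^sub>R e) + vec_of_int (axis i0 (j * sg i0))"
        by (simp add: v_def vec_of_int_add)
      then have "norm (vec_of_int v - real M *\<^sub>R e) \<le> norm (vec_of_int ?u - real M *\<^sub>R e) + norm (vec_of_int (axis i0 (j * sg i0)))"
        by (simp only: norm_triangle_ineq)
      moreover have "norm (vec_of_int (axis i0 (j * sg i0))) \<le> J"
        using vnorm_le_l1[of "axis i0 (j * sg i0)"] l1ax by (simp add: vnorm_def)
      ultimately show ?thesis using ue by linarith
    qed
    have near: "norm (vec_of_int v - (real k / LR e) *\<^sub>R e) \<le> B"
    proof -
      have "norm ((real M - real k / LR e) *\<^sub>R e) \<le> 1 * norm e"
        unfolding norm_scaleR using kM by (intro mult_right_mono) auto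
      moreover have "vec_of_int v - (real k / LR e) *\<^sub>R e = (vec_of_int v - real M *\<^sub>R e) + (real M - real k / LR e) *\<^sub>R e"
        by (simp add: algebra_simps)
      then have "norm (vec_of_int v - (real k / LR e) *\<^sub>R e) \<le> norm (vec_of_int v - real M *\<^sub>R e) + norm ((real M - real k / LR e) *\<^sub>R e)"
        by (simp only: norm_triangle_ineq)
      ultimately show ?thesis using vu unfolding B_def by linarith
    qed
    have "a v \<le> a ?u + a (axis i0 (j * sg i0))" unfolding v_def by (rule a_add)
    also have "\<dots> \<le> real M * (xi e + \<eta>') + C0 + K * J"
      using C0(1)[of M] a_le[of "axis i0 (j * sg i0)"] mult_left_mono[OF l1ax, of K] K_pos by linarith
    finally have av: "a v \<le> real M * (xi e + \<eta>') + C0 + K * J" .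
    have "\<bar>s \<bullet> (vec_of_int v - real M *\<^sub>R e)\<bar> \<le> norm s * norm (vec_of_int v - real M *\<^sub>R e)"
      by (rule Cauchy_Schwarz_ineq2)
    also have "\<dots> \<le> norm s * (real CARD('d) + J)" by (rule mult_left_mono[OF vu]) simp
    finally have "s \<bullet> vec_of_int v \<ge> real M * (s \<bullet> e) - norm s * (real CARD('d) + J)"
      by (simp add: inner_diff_right)
    moreover have "real M * \<eta>' \<le> \<eta> * real k"
      using kM(1) \<eta> Le by (simp add: \<eta>'_def field_simps)
    ultimately have "- \<eta> * real k - C \<le> s \<bullet> vec_of_int v - a v"
      using av xe by (simp add: C_def algebra_simps)
    then have "exp (- \<eta> * real k - C) \<le> w 0 v"
      by (simp add: w_def t_exp flip: exp_add)
    with Lv near show "\<exists>v. L v = int k \<and> w 0 v \<ge> exp (- \<eta> * real k - C) \<and> norm (vec_of_int v - (real k / LR e) *\<^sub>R e) \<le> B"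
      by blast
  qed
qed

text \<open>Neighbouring levels have comparable sums, uniformly in small tilts. Upwards this is
  \<open>Z_submult\<close> with \<open>Z_upper\<close>; downwards, \<open>Z_FKG\<close> with a
  vertex from \<open>face_points\<close> lifts level l to level n.\<close>

lemma Z_ratio:
  assumes \<eta>: "0 < \<eta>" "\<eta> \<le> 1"
  shows "\<exists>KK \<epsilon>. 1 \<le> KK \<and> 0 < \<epsilon> \<and> (\<forall>h n l. norm h \<le> \<epsilon> \<longrightarrow> 0 \<le> n \<longrightarrow>
     Z h l \<le> ennreal (KK * exp (\<eta> * \<bar>real_of_int (l - n)\<bar>)) * Z h n)"
proof -
  obtain B C where BC: "0 \<le> B" "0 \<le> C" and pts: "\<And>k::nat. \<exists>v. L v = int k \<and> w 0 v \<ge> exp (- (\<eta> / 2) * real k - C)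
    \<and> norm (vec_of_int v - (real k / LR va) *\<^sub>R va) \<le> B"
    using face_points[OF f_va va, of "\<eta> / 2"] \<eta> by auto
  define r where "r = norm va / LR va"
  have r: "r \<ge> 0" using LR_va by (simp add: r_def)
  have EEf: "EE (\<eta> * c0 / 2) < \<infinity>" using \<eta> c0(1) by (intro EE_finite) auto
  then obtain E where E: "EE (\<eta> * c0 / 2) = ennreal E" "E \<ge> 0" by (cases "EE (\<eta> * c0 / 2)") auto
  define KK where "KK = max (max 1 E) (exp (C + B))"
  \<comment> \<open>The vertex of level k has norm at most k r + B, so a tilt with
    \<open>\<epsilon> * r \<le> \<eta> / 2\<close> loses at most half of the allowed rate; the other
    half is the loss in \<open>face_points\<close>.\<close>
  define \<epsilon> where "\<epsilon> = min (min 1 (\<eta> * c0 / 2)) (\<eta> / (2 * (r + 1)))"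
  have \<epsilon>: "0 < \<epsilon>" "\<epsilon> \<le> 1" "\<epsilon> \<le> \<eta> * c0 / 2" "\<epsilon> * r \<le> \<eta> / 2"
  proof -
    show "0 < \<epsilon>" using \<eta> c0(1) r by (simp add: \<epsilon>_def)
    show "\<epsilon> \<le> 1" "\<epsilon> \<le> \<eta> * c0 / 2" unfolding \<epsilon>_def by linarith+
    have "\<epsilon> * (r + 1) \<le> \<eta> / (2 * (r + 1)) * (r + 1)" using r by (intro mult_right_mono) (auto simp: \<epsilon>_def)
    also have "\<dots> = \<eta> / 2" using r by (simp add: field_simps)
    finally show "\<epsilon> * r \<le> \<eta> / 2" using \<open>0 < \<epsilon>\<close> by (simp add: distrib_left)
  qed
  show ?thesis
  proof (rule exI[of _ KK], rule exI[of _ \<epsilon>], intro conjI allI impI)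
    show "1 \<le> KK" by (simp add: KK_def)
    show "0 < \<epsilon>" by (rule \<epsilon>)
    fix h :: "real ^ 'd" and n l :: int assume h: "norm h \<le> \<epsilon>" and n: "0 \<le> n"
    show "Z h l \<le> ennreal (KK * exp (\<eta> * \<bar>real_of_int (l - n)\<bar>)) * Z h n"
    proof (cases "n \<le> l")
      case True
      have "Z h l \<le> Z h n * Z h (l - n)" using True n Z_submult[of n "l - n" h] by simp
      also have "\<dots> \<le> Z h n * ennreal (KK * exp (\<eta> * \<bar>real_of_int (l - n)\<bar>))"
      proof (rule mult_left_mono)
        have "Z h (l - n) \<le> ennreal (exp (\<eta> * \<bar>real_of_int (l - n)\<bar>)) * ennreal E"
        unfolding E(1)[symmetric] by (rule Z_upper) (use \<eta> h \<epsilon> in auto)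
        also have "\<dots> \<le> ennreal (KK * exp (\<eta> * \<bar>real_of_int (l - n)\<bar>))"
        unfolding ennreal_mult[symmetric, OF exp_ge_zero E(2)]
        by (intro ennreal_leI) (simp add: KK_def mult.commute mult_left_mono)
        finally show "Z h (l - n) \<le> ennreal (KK * exp (\<eta> * \<bar>real_of_int (l - n)\<bar>))" .
      qed auto
      finally show ?thesis by (simp only: mult.commute)
    next
      case False
      define k where "k = nat (n - l)"
      have k: "int k = n - l" "real k = \<bar>real_of_int (l - n)\<bar>" using False by (auto simp: k_def)
      obtain v where v: "L v = int k" "w 0 v \<ge> exp (- (\<eta> / 2) * real k - C)" "norm (vec_of_int v - (real k / LR va) *\<^sub>R va) \<le> B"
        using pts by blast
      have "norm (vec_of_int v) \<le> norm ((real k / LR va) *\<^sub>R va) + B"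
        using v(3) norm_triangle_ineq2[of "vec_of_int v" "(real k / LR va) *\<^sub>R va"] by linarith
      then have nv: "norm (vec_of_int v) \<le> real k * r + B" using LR_va by (simp add: r_def)
      have "\<bar>h \<bullet> vec_of_int v\<bar> \<le> norm h * norm (vec_of_int v)" by (rule Cauchy_Schwarz_ineq2)
      also have "\<dots> \<le> \<epsilon> * (real k * r + B)" using h nv \<epsilon> r BC by (intro mult_mono) auto
      also have "\<dots> = \<epsilon> * r * real k + \<epsilon> * B" by (simp add: algebra_simps)
      also have "\<dots> \<le> \<eta> / 2 * real k + 1 * B" using \<epsilon> BC by (intro add_mono mult_right_mono) auto
      finally have hv: "h \<bullet> vec_of_int v \<ge> - (\<eta> / 2 * real k) - B" by linarith
      have "exp (- (\<eta> * real k) - (C + B)) = exp (- (\<eta> / 2 * real k) - B) * exp (- (\<eta> / 2) * real k - C)"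
        by (simp flip: exp_add)
      also have "\<dots> \<le> exp (h \<bullet> vec_of_int v) * w 0 v"
        using hv v(2) by (intro mult_mono) auto
      also have "\<dots> = w h v" by (simp add: w_def inner_add_left exp_add)
      finally have wv: "exp (- (\<eta> * real k) - (C + B)) \<le> w h v" .
      have "ennreal (exp (- (\<eta> * real k) - (C + B))) * Z h l \<le> ennreal (w h v) * Z h (n - L v)"
        using v(1) k(1) by (intro mult_mono ennreal_leI[OF wv]) auto
      also have "\<dots> \<le> Z h n" by (rule Z_FKG)
      finally have 1: "ennreal (exp (- (\<eta> * real k) - (C + B))) * Z h l \<le> Z h n" .
      have "Z h l = ennreal (exp (\<eta> * real k + (C + B)) * exp (- (\<eta> * real k) - (C + B))) * Z h l"
        by (simp flip: exp_add)
      also have "\<dots> = ennreal (exp (\<eta> * real k + (C + B))) * (ennreal (exp (- (\<eta> * real k) - (C + B))) * Z h l)"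
        by (simp add: ennreal_mult' mult.assoc)
      also have "\<dots> \<le> ennreal (exp (\<eta> * real k + (C + B))) * Z h n" by (intro mult_left_mono 1) auto
      also have "\<dots> \<le> ennreal (KK * exp (\<eta> * \<bar>real_of_int (l - n)\<bar>)) * Z h n"
        unfolding k(2)[symmetric] by (intro mult_right_mono ennreal_leI) (auto simp: KK_def exp_add mult.commute mult_left_mono)
      finally show ?thesis .
    qed
  qed
qed

end


section \<open>Quasi-multiplicativity of the level sums\<close>

text \<open>A nonempty set has at most one element more than it has ordered pairs of distinct
  elements; for infinite sets both sides are infinite.\<close>

lemma indicator_count_bound:
  fixes N :: "'i::countable set"
  assumes "N \<noteq> {} \<Longrightarrow> b = 1"
  shows "lsum (indicator N) \<le> b + lsum (\<lambda>x. lsum (\<lambda>y. indicator N x * (indicator N y * indicator {y. y \<noteq> x} y)) :: ennreal)"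
proof (cases "N = {}")
  case False
  then obtain x0 where x0: "x0 \<in> N" by auto
  have "lsum (indicator N) \<le> lsum (\<lambda>y. indicator {x0} y + indicator N x0 * (indicator N y * indicator {y. y \<noteq> x0} y) :: ennreal)"
    using x0 by (intro lsum_mono) (auto simp: indicator_def)
  also have "\<dots> = 1 + lsum (\<lambda>y. indicator N x0 * (indicator N y * indicator {y. y \<noteq> x0} y))"
    by (subst lsum_add) simp
  also have "\<dots> \<le> 1 + lsum (\<lambda>x. lsum (\<lambda>y. indicator N x * (indicator N y * indicator {y. y \<noteq> x} y)))"
    by (intro add_left_mono lsum_ge[of "\<lambda>x. lsum (\<lambda>y. indicator N x * (indicator N y * indicator {y. y \<noteq> x} y))"])
  finally show ?thesis using assms False by simp
qed simp

context subcrit begin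

definition T4 :: "int ^ 'd \<Rightarrow> int ^ 'd \<Rightarrow> int ^ 'd \<Rightarrow> int ^ 'd \<Rightarrow> int ^ 'd \<Rightarrow> int ^ 'd \<Rightarrow> real" where
  "T4 q b c e w1 w2 = t (w1 - q) * (t (w1 - b) * (t (w2 - w1) * (t (c - w2) * t (e - w2))))"

lemma PP_tree4: "PP p (tree4 q b c e w1 w2) \<le> T4 q b c e w1 w2"
proof -
  have *: "PP p (dj (cn u v) R) \<le> t (v - u) * r" if "PP p R \<le> r" "fin_incr R" for u v :: "int ^ 'd" and R r
  proof -
    have "PP p (dj (cn u v) R) \<le> PP p (cn u v) * PP p R" by (rule PP_BK) (use that p01 in auto)
    also have "\<dots> \<le> t (v - u) * r"
      using that(1) tau_t[of u v] t_pos[of "v - u"] by (intro mult_mono) (auto simp: tau_def PP_nonneg)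
    finally show ?thesis .
  qed
  have "PP p (cn w2 e) \<le> t (e - w2)" using tau_t[of w2 e] by (simp add: tau_def)
  then show ?thesis unfolding tree4_def T4_def by (intro *) auto
qed

lemma tree4_sum_bound:
  "ennreal (PP p (\<lambda>A. cn 0 x A \<and> cn 0 y A \<and> cn 0 z A)) \<le>
     lsum (\<lambda>w1. lsum (\<lambda>w2. ennreal (T4 0 x z y w1 w2) + (ennreal (T4 0 y z x w1 w2) + ennreal (T4 0 z x y w1 w2))))"
proof -
  let ?R = "\<lambda>w1 w2 A. tree4 0 x z y w1 w2 A \<or> tree4 0 y z x w1 w2 A \<or> tree4 0 z x y w1 w2 A"
  have fi: "fin_incr (?R w1 w2)" for w1 w2
  proof -
    have eq: "?R w1 w2 = (\<lambda>A. \<exists>i::nat. (if i = 0 then tree4 0 x z y w1 w2 else if i = 1 then tree4 0 y z x w1 w2 else tree4 0 z x y w1 w2) A)"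
    proof
      fix A show "?R w1 w2 A = (\<exists>i::nat. (if i = 0 then tree4 0 x z y w1 w2 else if i = 1 then tree4 0 y z x w1 w2 else tree4 0 z x y w1 w2) A)"
        by (auto intro: exI[of _ 0] exI[of _ 1] exI[of _ 2] split: if_splits)
    qed
    show ?thesis unfolding eq by (rule fin_incr_Ex) simp
  qed
  have R3: "ennreal (PP p (?R w1 w2)) \<le> ennreal (T4 0 x z y w1 w2) + (ennreal (T4 0 y z x w1 w2) + ennreal (T4 0 z x y w1 w2))" for w1 w2
  proof -
    have T0: "0 \<le> T4 q b c e u v" for q b c e u v unfolding T4_def using t_pos by (intro mult_nonneg_nonneg) (auto intro: less_imp_le)
    have "PP p (?R w1 w2) \<le> (\<Sum>i\<in>{0,1,2::nat}. PP p (if i = 0 then tree4 0 x z y w1 w2 else if i = 1 then tree4 0 y z x w1 w2 else tree4 0 z x y w1 w2))"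
      by (rule PP_union_finite[OF p01]) auto
    also have "\<dots> = PP p (tree4 0 x z y w1 w2) + (PP p (tree4 0 y z x w1 w2) + PP p (tree4 0 z x y w1 w2))" by simp
    also have "\<dots> \<le> T4 0 x z y w1 w2 + (T4 0 y z x w1 w2 + T4 0 z x y w1 w2)" by (intro add_mono PP_tree4)
    finally show ?thesis using T0 by (simp add: ennreal_leI flip: ennreal_plus)
  qed
  have "ennreal (PP p (\<lambda>A. cn 0 x A \<and> cn 0 y A \<and> cn 0 z A)) \<le> lsum (\<lambda>w1. ennreal (PP p (\<lambda>A. \<exists>w2. ?R w1 w2 A)))"
  proof (rule PP_union[OF p01])
    fix A :: "(int ^ 'd) set set" assume "cn 0 x A \<and> cn 0 y A \<and> cn 0 z A"
    then show "\<exists>w1 w2. ?R w1 w2 A"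
      using conn_tree4[of A 0 z x y] by (auto simp: cn_def conn_commute[of A 0])
  qed (auto intro!: fin_incr_conj fin_incr_Ex fi)
  also have "\<dots> \<le> lsum (\<lambda>w1. lsum (\<lambda>w2. ennreal (PP p (?R w1 w2))))"
    by (intro lsum_mono PP_union[OF p01] fin_incr_Ex fi)
  also have "\<dots> \<le> lsum (\<lambda>w1. lsum (\<lambda>w2. ennreal (T4 0 x z y w1 w2) + (ennreal (T4 0 y z x w1 w2) + ennreal (T4 0 z x y w1 w2))))"
    by (intro lsum_mono R3)
  finally show ?thesis .
qed

text \<open>By FKG the left side is at most the expected number of points of \<open>X\<close> joined
  to both 0 and \<open>z\<close>. Counting with one point plus ordered pairs turns it into t z plus
  a four-point sum. The factor for empty \<open>X\<close> later confines \<open>z\<close> to the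
  sumset.\<close>

lemma second_moment:
  fixes X :: "(int ^ 'd) set"
  shows "lsum (\<lambda>x. ennreal (t x * t (z - x)) * indicator X x) \<le> ennreal (t z) * (if X = {} then 0 else 1) +
     lsum (\<lambda>x. lsum (\<lambda>y. ennreal (PP p (\<lambda>A. cn 0 x A \<and> cn 0 y A \<and> cn 0 z A)) * (indicator X x * (indicator X y * indicator {y. y \<noteq> x} y))))"
proof -
  let ?M = "percolation p :: ((int ^ 'd) set \<Rightarrow> bool) measure"
  let ?E = "\<lambda>x. ev p (\<lambda>A. cn 0 x A \<and> cn x z A)"
  let ?G = "\<lambda>x y. ev p (\<lambda>A. cn 0 x A \<and> cn 0 y A \<and> cn 0 z A)"
  let ?N = "\<lambda>\<omega>. {x \<in> X. \<omega> \<in> ?E x}"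
  have mE: "?E x \<in> sets ?M" for x by (intro sets_ev fin_incr_conj p01) auto
  have mG: "?G x y \<in> sets ?M" for x y by (intro sets_ev fin_incr_conj p01) auto
  have mz: "ev p (cn 0 z) \<in> sets ?M" by (intro sets_ev p01) auto
  have [measurable]: "(\<lambda>\<omega>. indicator (?E x) \<omega> * (indicator X x :: ennreal)) \<in> borel_measurable ?M" for x
    using mE[of x] by measurable
  have [measurable]: "(\<lambda>\<omega>. indicator (?G x y) \<omega> * c) \<in> borel_measurable ?M" for x y and c :: ennreal
    using mG[of x y] by measurable
  have "lsum (\<lambda>x. ennreal (t x * t (z - x)) * indicator X x) \<le> lsum (\<lambda>x. emeasure ?M (?E x) * indicator X x)"
  proof (intro lsum_mono mult_right_mono)
    fix x
    have "t x * t (z - x) \<le> PP p (\<lambda>A. cn 0 x A \<and> cn x z A)"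
      using PP_FKG[of "cn 0 x" "cn x z" p] p01 tau_t[of 0 x] tau_t[of x z] by (simp add: tau_def)
    then show "ennreal (t x * t (z - x)) \<le> emeasure ?M (?E x)" by (simp add: ennreal_leI flip: PP_ennreal)
  qed auto
  also have "\<dots> = lsum (\<lambda>x. \<integral>\<^sup>+\<omega>. indicator (?E x) \<omega> * indicator X x \<partial>?M)"
    using mE by (simp add: nn_integral_multc)
  also have "\<dots> = (\<integral>\<^sup>+\<omega>. lsum (\<lambda>x. indicator (?E x) \<omega> * indicator X x) \<partial>?M)"
    by (rule nn_integral_count_space_nn_integral[symmetric]) auto
  also have "\<dots> \<le> (\<integral>\<^sup>+\<omega>. indicator (ev p (cn 0 z)) \<omega> * (if X = {} then 0 else 1) +
     lsum (\<lambda>x. lsum (\<lambda>y. indicator (?G x y) \<omega> * (indicator X x * (indicator X y * indicator {y. y \<noteq> x} y)))) \<partial>?M)"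
  proof (rule nn_integral_mono)
    fix \<omega>
    have "lsum (\<lambda>x. indicator (?E x) \<omega> * indicator X x) = lsum (indicator (?N \<omega>))"
      by (intro nn_integral_cong) (auto simp: indicator_def)
    also have "\<dots> \<le> indicator (ev p (cn 0 z)) \<omega> * (if X = {} then 0 else 1) + lsum (\<lambda>x. lsum (\<lambda>y. indicator (?N \<omega>) x * (indicator (?N \<omega>) y * indicator {y. y \<noteq> x} y)))"
    proof (rule indicator_count_bound)
      assume "?N \<omega> \<noteq> {}"
      then show "indicator (ev p (cn 0 z)) \<omega> * (if X = {} then 0 else 1) = (1 :: ennreal)"
        by (auto simp: ev_def cn_def indicator_def intro: conn_trans)
    qed
    also have "\<dots> \<le> indicator (ev p (cn 0 z)) \<omega> * (if X = {} then 0 else 1) + lsum (\<lambda>x. lsum (\<lambda>y. indicator (?G x y) \<omega> * (indicator X x * (indicator X y * indicator {y. y \<noteq> x} y))))"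
    proof (intro add_left_mono lsum_mono)
      fix x y
      show "indicator (?N \<omega>) x * (indicator (?N \<omega>) y * indicator {y. y \<noteq> x} y) \<le> indicator (?G x y) \<omega> * (indicator X x * (indicator X y * indicator {y. y \<noteq> x} y) :: ennreal)"
      proof (cases "x \<in> ?N \<omega> \<and> y \<in> ?N \<omega>")
        case True
        then have "\<omega> \<in> ?G x y" by (auto simp: ev_def cn_def intro: conn_trans)
        then show ?thesis using True by (simp add: indicator_def)
      qed (auto simp: indicator_def)
    qed
    finally show "lsum (\<lambda>x. indicator (?E x) \<omega> * indicator X x) \<le> indicator (ev p (cn 0 z)) \<omega> * (if X = {} then 0 else 1) +
     lsum (\<lambda>x. lsum (\<lambda>y. indicator (?G x y) \<omega> * (indicator X x * (indicator X y * indicator {y. y \<noteq> x} y))))" .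
  qed
  also have "\<dots> = (\<integral>\<^sup>+\<omega>. indicator (ev p (cn 0 z)) \<omega> * (if X = {} then 0 else 1) \<partial>?M) +
     (\<integral>\<^sup>+\<omega>. lsum (\<lambda>x. lsum (\<lambda>y. indicator (?G x y) \<omega> * (indicator X x * (indicator X y * indicator {y. y \<noteq> x} y)))) \<partial>?M)"
    by (rule nn_integral_add) (use mz in \<open>auto intro!: lsum_measurable\<close>)
  also have "(\<integral>\<^sup>+\<omega>. indicator (ev p (cn 0 z)) \<omega> * (if X = {} then 0 else 1) \<partial>?M) = ennreal (t z) * (if X = {} then 0 else 1)"
    using mz by (simp add: t_def tau_def PP_ennreal)
  also have "(\<integral>\<^sup>+\<omega>. lsum (\<lambda>x. lsum (\<lambda>y. indicator (?G x y) \<omega> * (indicator X x * (indicator X y * indicator {y. y \<noteq> x} y)))) \<partial>?M)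
    = lsum (\<lambda>x. lsum (\<lambda>y. \<integral>\<^sup>+\<omega>. indicator (?G x y) \<omega> * (indicator X x * (indicator X y * indicator {y. y \<noteq> x} y)) \<partial>?M))"
    by (subst nn_integral_count_space_nn_integral) (auto intro!: lsum_measurable nn_integral_cong nn_integral_count_space_nn_integral)
  also have "\<dots> = lsum (\<lambda>x. lsum (\<lambda>y. ennreal (PP p (\<lambda>A. cn 0 x A \<and> cn 0 y A \<and> cn 0 z A)) * (indicator X x * (indicator X y * indicator {y. y \<noteq> x} y))))"
    using mG by (simp add: nn_integral_multc PP_ennreal)
  finally show ?thesis .
qed

end


lemma power_exp_bound:
  assumes k: "0 < k" and d: "0 < d"
  shows "(2 * real n + 1) ^ d \<le> (4 * real d / k) ^ d * exp (k / 4 * (2 * real n + 1))"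
proof -
  have "(k / 4 * (2 * real n + 1) / real d) ^ d \<le> (1 + k / 4 * (2 * real n + 1) / real d) ^ d"
    using k by (intro power_mono) auto
  also have "\<dots> \<le> exp (k / 4 * (2 * real n + 1))"
    using k d by (intro exp_ge_one_plus_x_over_n_power_n) (auto intro: order_trans[of _ 0])
  finally have "(4 * real d / k) ^ d * (k / 4 * (2 * real n + 1) / real d) ^ d \<le> (4 * real d / k) ^ d * exp (k / 4 * (2 * real n + 1))"
    using k by (intro mult_left_mono) auto
  moreover have "(4 * real d / k) ^ d * (k / 4 * (2 * real n + 1) / real d) ^ d = (2 * real n + 1) ^ d"
    unfolding power_mult_distrib[symmetric] using k d by simp
  ultimately show ?thesis by simp
qed

text \<open>Moves \<open>z\<close> and \<open>y\<close> innermost: in the tree diagrams the sums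
  over the far endpoint and over one hanging leaf are done first.\<close>

lemma lsum_pull:
  fixes F :: "'a::countable \<Rightarrow> 'b::countable \<Rightarrow> 'c::countable \<Rightarrow> 'e::countable \<Rightarrow> 'f::countable \<Rightarrow> ennreal"
  shows "lsum (\<lambda>z. lsum (\<lambda>x. lsum (\<lambda>y. lsum (\<lambda>u. lsum (\<lambda>v. F z x y u v))))) =
    lsum (\<lambda>x. lsum (\<lambda>u. lsum (\<lambda>v. lsum (\<lambda>y. lsum (\<lambda>z. F z x y u v)))))"
proof -
  have "lsum (\<lambda>z. lsum (\<lambda>x. lsum (\<lambda>y. lsum (\<lambda>u. lsum (\<lambda>v. F z x y u v))))) =
      lsum (\<lambda>x. lsum (\<lambda>y. lsum (\<lambda>u. lsum (\<lambda>v. lsum (\<lambda>z. F z x y u v)))))"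
    by (rule trans[OF lsum_swap], rule nn_integral_cong, rule trans[OF lsum_swap], rule nn_integral_cong,
        rule trans[OF lsum_swap], rule nn_integral_cong, rule trans[OF lsum_swap], rule refl)
  also have "\<dots> = lsum (\<lambda>x. lsum (\<lambda>u. lsum (\<lambda>v. lsum (\<lambda>y. lsum (\<lambda>z. F z x y u v)))))"
    by (rule nn_integral_cong, rule trans[OF lsum_swap], rule nn_integral_cong, rule trans[OF lsum_swap], rule refl)
  finally show ?thesis .
qed

context face begin

text \<open>The level rate \<open>th\<close> is so small that the plain decay rate \<open>c1\<close>
  pays for exp (th |L|) with most of it left over; \<open>ka\<close> is a quarter of the remaining
  rates, small enough to be spent twice, once on summability and once on exp (- ka R).\<close>

definition th where "th = min 1 (c1 / (4 * real CARD('d)))"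
definition ka where "ka = min (c1 / 4) (th * c0 / 4)"

lemma th: "0 < th" "th \<le> 1" "th * real CARD('d) \<le> c1 / 4"
proof -
  show "0 < th" "th \<le> 1" using c1 by (simp_all add: th_def)
  have "th * real CARD('d) \<le> c1 / (4 * real CARD('d)) * real CARD('d)"
    unfolding th_def by (intro mult_right_mono) auto
  also have "\<dots> = c1 / 4" by simp
  finally show "th * real CARD('d) \<le> c1 / 4" .
qed

lemma ka: "0 < ka" "2 * ka \<le> c1 / 2" "2 * ka \<le> th * c0 / 2"
  using th c1(1) c0(1) by (auto simp: ka_def)

lemma thL: "th * \<bar>real_of_int (L X)\<bar> \<le> c1 / 4 * vnorm X"
proof -
  have "th * \<bar>real_of_int (L X)\<bar> \<le> th * (real CARD('d) * vnorm X)"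
    using L_le[of X] th by (intro mult_left_mono) auto
  also have "\<dots> = th * real CARD('d) * vnorm X" by simp
  also have "\<dots> \<le> c1 / 4 * vnorm X" using th(3) by (intro mult_right_mono) auto
  finally show ?thesis .
qed

text \<open>Budget for a tree whose middle leg V is on the tilted backbone while X and Y hang off
  it. V has decay only up to its level, which is at most |L X| + |L Y|, and the untilted legs pay
  for that. One share of \<open>ka\<close> gives exp (- ka R), the other stays for
  summation.\<close>

lemma exponent1:
  assumes h: "norm h \<le> th * c0 / 2" and LV: "\<bar>L V\<bar> \<le> \<bar>L X\<bar> + \<bar>L Y\<bar>"
    and R: "R \<le> vnorm X + vnorm V + vnorm Y"
  shows "t X * w h V * t Y * exp (th * \<bar>real_of_int (L Y)\<bar>)
    \<le> exp (- ka * R) * (exp (- ka * vnorm X) * exp (- ka * vnorm V) * exp (- ka * vnorm Y) * exp (- th * \<bar>real_of_int (L X)\<bar>))"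
proof -
  have "t X * w h V * t Y * exp (th * \<bar>real_of_int (L Y)\<bar>)
    \<le> exp (- c1 * vnorm X) * exp (- f (vec_of_int V) + norm h * vnorm V) * exp (- c1 * vnorm Y) * exp (th * \<bar>real_of_int (L Y)\<bar>)"
    using t_pos w_pos by (intro mult_mono t_decay w_le_f) (auto intro: less_imp_le mult_nonneg_nonneg)
  also have "\<dots> = exp (- c1 * vnorm X + (- f (vec_of_int V) + norm h * vnorm V) + - c1 * vnorm Y + th * \<bar>real_of_int (L Y)\<bar>)"
    by (simp only: exp_add)
  also have "\<dots> \<le> exp (- ka * R + (- ka * vnorm X + - ka * vnorm V + - ka * vnorm Y + - th * \<bar>real_of_int (L X)\<bar>))"
  proof -
    have f: "th * c0 * vnorm V - th * \<bar>real_of_int (L V)\<bar> \<le> f (vec_of_int V)"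
      using f_lower[of th V] th by (simp add: algebra_simps)
    have "\<bar>real_of_int (L V)\<bar> \<le> \<bar>real_of_int (L X)\<bar> + \<bar>real_of_int (L Y)\<bar>" using LV by linarith
    then have "th * \<bar>real_of_int (L V)\<bar> \<le> th * (\<bar>real_of_int (L X)\<bar> + \<bar>real_of_int (L Y)\<bar>)" using th by (intro mult_left_mono) auto
    then have 1: "th * \<bar>real_of_int (L V)\<bar> \<le> th * \<bar>real_of_int (L X)\<bar> + th * \<bar>real_of_int (L Y)\<bar>" by (simp add: distrib_left)
    have 2: "norm h * vnorm V \<le> th * c0 / 2 * vnorm V" using h by (intro mult_right_mono) auto
    have 3: "ka * R \<le> ka * vnorm X + ka * vnorm V + ka * vnorm Y" using mult_left_mono[OF R, of ka] ka by (simp add: distrib_left)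
    have 4: "2 * ka * vnorm X \<le> c1 / 2 * vnorm X" "2 * ka * vnorm Y \<le> c1 / 2 * vnorm Y" "2 * ka * vnorm V \<le> th * c0 / 2 * vnorm V"
      using ka by (intro mult_right_mono; simp)+
    show ?thesis using f 1 2 3 4 thL[of X] thL[of Y] by (simp add: algebra_simps)
  qed
  also have "\<dots> = exp (- ka * R) * (exp (- ka * vnorm X) * exp (- ka * vnorm V) * exp (- ka * vnorm Y) * exp (- th * \<bar>real_of_int (L X)\<bar>))"
    by (simp only: exp_add mult.assoc)
  finally show ?thesis .
qed

text \<open>Budget for a side branch U that splits into X and Y: all three legs are untilted, and U
  and X pay twice for the level displacement V, once for the factor on the left and once for the
  decay on the right.\<close>

lemma exponent2:
  assumes R: "R \<le> vnorm X + vnorm Y" and LV: "\<bar>L V\<bar> \<le> \<bar>L U\<bar> + \<bar>L X\<bar>"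
  shows "t U * t X * t Y * exp (th * \<bar>real_of_int (L V)\<bar>)
    \<le> exp (- ka * R) * (exp (- ka * vnorm U) * exp (- ka * vnorm X) * exp (- ka * vnorm Y) * exp (- th * \<bar>real_of_int (L V)\<bar>))"
proof -
  have "t U * t X * t Y * exp (th * \<bar>real_of_int (L V)\<bar>)
    \<le> exp (- c1 * vnorm U) * exp (- c1 * vnorm X) * exp (- c1 * vnorm Y) * exp (th * \<bar>real_of_int (L V)\<bar>)"
    using t_pos by (intro mult_mono t_decay) (auto intro: less_imp_le mult_nonneg_nonneg)
  also have "\<dots> = exp (- c1 * vnorm U + - c1 * vnorm X + - c1 * vnorm Y + th * \<bar>real_of_int (L V)\<bar>)"
    by (simp only: exp_add)
  also have "\<dots> \<le> exp (- ka * R + (- ka * vnorm U + - ka * vnorm X + - ka * vnorm Y + - th * \<bar>real_of_int (L V)\<bar>))"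
  proof -
    have "\<bar>real_of_int (L V)\<bar> \<le> \<bar>real_of_int (L U)\<bar> + \<bar>real_of_int (L X)\<bar>" using LV by linarith
    then have "th * \<bar>real_of_int (L V)\<bar> \<le> th * (\<bar>real_of_int (L U)\<bar> + \<bar>real_of_int (L X)\<bar>)" using th by (intro mult_left_mono) auto
    then have 1: "th * \<bar>real_of_int (L V)\<bar> \<le> th * \<bar>real_of_int (L U)\<bar> + th * \<bar>real_of_int (L X)\<bar>" by (simp add: distrib_left)
    have 3: "ka * R \<le> ka * vnorm X + ka * vnorm Y" using mult_left_mono[OF R, of ka] ka by (simp add: distrib_left)
    have 4: "2 * ka * vnorm U \<le> c1 / 2 * vnorm U" "2 * ka * vnorm X \<le> c1 / 2 * vnorm X" "2 * ka * vnorm Y \<le> c1 / 2 * vnorm Y"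
      using ka by (intro mult_right_mono; simp)+
    have 5: "0 \<le> ka * vnorm U" "0 \<le> c1 * vnorm Y" using ka c1 by simp_all
    show ?thesis using 1 3 4 5 thL[of U] thL[of X] by (simp add: algebra_simps)
  qed
  also have "\<dots> = exp (- ka * R) * (exp (- ka * vnorm U) * exp (- ka * vnorm X) * exp (- ka * vnorm Y) * exp (- th * \<bar>real_of_int (L V)\<bar>))"
    by (simp only: exp_add mult.assoc)
  finally show ?thesis .
qed

definition gg :: "int ^ 'd \<Rightarrow> ennreal" where "gg v = ennreal (exp (- ka * vnorm v))"
text \<open>Reserve that exactly cancels the loss exp (th |L v|) when the sum over a shifted level
  is compared with the original level.\<close>

definition ed :: "int ^ 'd \<Rightarrow> ennreal" where "ed v = ennreal (exp (- th * \<bar>real_of_int (L v)\<bar>))"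

lemma lsum_gg: "lsum (\<lambda>y. gg (y - x)) = EE ka" "lsum (\<lambda>y. gg (x - y)) = EE ka"
proof -
  have "lsum gg = EE ka" by (simp add: gg_def[abs_def] EE_def)
  then show "lsum (\<lambda>y. gg (y - x)) = EE ka" "lsum (\<lambda>y. gg (x - y)) = EE ka" by (simp_all add: lsum_shift' lsum_reflect)
qed

text \<open>Attaching a displacement to the points of a level moves the backbone vertex to another
  level: substitute x = v - u and sum over \<open>v\<close> for fixed \<open>u\<close>.\<close>

lemma conv:
  "lsum (\<lambda>x. lsum (\<lambda>v. indicator (lev n) x * (ennreal (w h v) * G (v - x)))) = lsum (\<lambda>v. G v * Z h (n + L v))"
proof -
  have "lsum (\<lambda>x. lsum (\<lambda>v. indicator (lev n) x * (ennreal (w h v) * G (v - x))))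
     = lsum (\<lambda>v. lsum (\<lambda>x. indicator (lev n) x * (ennreal (w h v) * G (v - x))))"
    by (rule lsum_swap)
  also have "\<dots> = lsum (\<lambda>v. lsum (\<lambda>u. indicator (lev n) (v - u) * (ennreal (w h v) * G (v - (v - u)))))"
    by (rule nn_integral_cong) (rule lsum_reflect[symmetric])
  also have "\<dots> = lsum (\<lambda>v. lsum (\<lambda>u. G u * (ennreal (w h v) * indicator (lev (n + L u)) v)))"
    by (intro nn_integral_cong) (auto simp: lev_def L_diff indicator_def mult_ac)
  also have "\<dots> = lsum (\<lambda>u. lsum (\<lambda>v. G u * (ennreal (w h v) * indicator (lev (n + L u)) v)))"
    by (rule lsum_swap)
  also have "\<dots> = lsum (\<lambda>u. G u * Z h (n + L u))"
    unfolding lsum_cmult by (simp add: Z_def mu_def)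
  finally show ?thesis .
qed

text \<open>The conclusion of \<open>Z_ratio\<close> at rate \<open>th\<close>, packaged with the
  smallness of \<open>h\<close>, so that the constants below depend on \<open>KK\<close> and not on
  \<open>h\<close>.\<close>

definition ratio :: "real \<Rightarrow> real ^ 'd \<Rightarrow> bool" where
  "ratio KK h \<longleftrightarrow> norm h \<le> th * c0 / 2 \<and> 1 \<le> KK \<and> (\<forall>n l. 0 \<le> n \<longrightarrow> Z h l \<le> ennreal (KK * exp (th * \<bar>real_of_int (l - n)\<bar>)) * Z h n)"

lemma ratioD: "ratio KK h \<Longrightarrow> 0 \<le> n \<Longrightarrow> Z h l \<le> ennreal KK * (ennreal (exp (th * \<bar>real_of_int (l - n)\<bar>)) * Z h n)"
  unfolding ratio_def by (metis (no_types, lifting) ennreal_mult'' exp_ge_zero mult.assoc)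

lemma ed_cancel: "ed v * ennreal (exp (th * \<bar>real_of_int (L v)\<bar>)) = 1"
  unfolding ed_def by (simp add: ennreal_mult'[symmetric] flip: exp_add)

lemma conv_bound:
  assumes r: "ratio KK h" and n: "0 \<le> n"
  shows "lsum (\<lambda>x. lsum (\<lambda>v. indicator (lev n) x * (ennreal (w h v) * (ed (v - x) * G (v - x))))) \<le> ennreal KK * Z h n * lsum G"
proof -
  have "lsum (\<lambda>x. lsum (\<lambda>v. indicator (lev n) x * (ennreal (w h v) * (ed (v - x) * G (v - x))))) = lsum (\<lambda>v. ed v * G v * Z h (n + L v))"
    by (rule conv)
  also have "\<dots> \<le> lsum (\<lambda>v. ennreal KK * Z h n * G v)"
  proof (rule lsum_mono)
    fix v
    have "ed v * G v * Z h (n + L v) \<le> ed v * G v * (ennreal KK * (ennreal (exp (th * \<bar>real_of_int (L v)\<bar>)) * Z h n))"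
      using ratioD[OF r n, of "n + L v"] by (intro mult_left_mono) auto
    also have "\<dots> = ed v * ennreal (exp (th * \<bar>real_of_int (L v)\<bar>)) * (ennreal KK * Z h n * G v)" by (simp add: mult_ac)
    finally show "ed v * G v * Z h (n + L v) \<le> ennreal KK * Z h n * G v" by (simp add: ed_cancel)
  qed
  also have "\<dots> = ennreal KK * Z h n * lsum G" by (rule lsum_cmult)
  finally show ?thesis .
qed

text \<open>Separation is what makes the pair sums small: two distinct points at distance at least R
  force legs of total length at least R.\<close>

definition sep :: "real \<Rightarrow> (int ^ 'd) set \<Rightarrow> bool" where
  "sep R A \<longleftrightarrow> (\<forall>x\<in>A. \<forall>y\<in>A. x \<noteq> y \<longrightarrow> R \<le> vnorm (x - y))"

definition tilt :: "real ^ 'd \<Rightarrow> int ^ 'd \<Rightarrow> real" where "tilt h z = exp ((s + h) \<bullet> vec_of_int z)"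

lemma w_tilt: "w h z = tilt h z * t z" by (simp add: w_def tilt_def)
lemma tilt_pos: "0 < tilt h z" by (simp add: tilt_def)

text \<open>The backbone 0, w1, w2, z carries the tilt; \<open>x\<close> hangs at w1 and
  \<open>y\<close> at w2.\<close>

lemma tilt_T4_1: "tilt h z * T4 0 x z y w1 w2 = w h w1 * (t (w1 - x) * w h (w2 - w1) * t (y - w2)) * w h (z - w2)"
proof -
  have "tilt h z = tilt h w1 * tilt h (w2 - w1) * tilt h (z - w2)"
    unfolding tilt_def exp_add[symmetric] inner_add_right[symmetric] vec_of_int_add[symmetric] by simp
  then show ?thesis by (simp add: T4_def w_tilt mult_ac)
qed

text \<open>Here the backbone is 0, w1, z; \<open>x\<close> and \<open>y\<close> share a side branch
  that forks at w2.\<close>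

lemma tilt_T4_3: "tilt h z * T4 0 z x y w1 w2 = w h w1 * (t (w2 - w1) * t (x - w2) * t (y - w2)) * w h (z - w1)"
proof -
  have "tilt h z = tilt h w1 * tilt h (z - w1)"
    unfolding tilt_def exp_add[symmetric] inner_add_right[symmetric] vec_of_int_add[symmetric] by simp
  moreover have "t (w1 - z) = t (z - w1)" using t_minus[of "z - w1"] by simp
  ultimately show ?thesis by (simp add: T4_def w_tilt mult_ac)
qed

text \<open>Sum over \<open>z\<close> to get a level sum, comparable with \<open>Z h m\<close> by
  \<open>ratio\<close>; distribute the exponents by \<open>exponent1\<close>; sum the two free legs;
  and finish with \<open>conv_bound\<close>, which returns \<open>Z h n\<close>.\<close>

lemma pairs_bound1:
  assumes r: "ratio KK h" and n: "0 \<le> n" "0 \<le> m" and A: "A \<subseteq> lev n" "sep R A"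
  shows "lsum (\<lambda>z. lsum (\<lambda>x. lsum (\<lambda>y. lsum (\<lambda>w1. lsum (\<lambda>w2.
       indicator (lev (n + m)) z * (indicator A x * (indicator A y * indicator {y. y \<noteq> x} y)) * ennreal (tilt h z * T4 0 x z y w1 w2))))))
    \<le> ennreal (KK\<^sup>2 * exp (- ka * R)) * EE ka ^ 3 * (Z h n * Z h m)" (is "?lhs \<le> _")
proof -
  have KK: "1 \<le> KK" and h: "norm h \<le> th * c0 / 2" using r by (auto simp: ratio_def)
  let ?I = "\<lambda>x y. indicator A x * (indicator A y * indicator {y. y \<noteq> x} y) :: ennreal"
  let ?c = "ennreal KK * ennreal (exp (- ka * R)) * Z h m"
  have "?lhs = lsum (\<lambda>x. lsum (\<lambda>w1. lsum (\<lambda>w2. lsum (\<lambda>y. lsum (\<lambda>z.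
       indicator (lev (n + m)) z * ?I x y * ennreal (tilt h z * T4 0 x z y w1 w2))))))"
    by (rule lsum_pull)
  also have "\<dots> = lsum (\<lambda>x. lsum (\<lambda>w1. lsum (\<lambda>w2. lsum (\<lambda>y.
       ?I x y * ennreal (w h w1 * (t (w1 - x) * w h (w2 - w1) * t (y - w2))) * Z h (n + m - L w2)))))"
  proof (intro nn_integral_cong)
    fix x w1 w2 y
    have nn: "0 \<le> w h w1 * (t (w1 - x) * w h (w2 - w1) * t (y - w2))"
      using w_pos t_pos by (intro mult_nonneg_nonneg) (auto intro: less_imp_le)
    have "lsum (\<lambda>z. indicator (lev (n + m)) z * ?I x y * ennreal (tilt h z * T4 0 x z y w1 w2))
      = lsum (\<lambda>z. ?I x y * ennreal (w h w1 * (t (w1 - x) * w h (w2 - w1) * t (y - w2))) * (ennreal (w h (z - w2)) * indicator (lev (n + m)) z))"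
      unfolding tilt_T4_1 ennreal_mult[OF nn w_nonneg] by (simp add: mult_ac)
    also have "\<dots> = ?I x y * ennreal (w h w1 * (t (w1 - x) * w h (w2 - w1) * t (y - w2))) * Z h (n + m - L w2)"
      by (simp only: lsum_cmult sum_lev_shift)
    finally show "lsum (\<lambda>z. indicator (lev (n + m)) z * ?I x y * ennreal (tilt h z * T4 0 x z y w1 w2))
      = ?I x y * ennreal (w h w1 * (t (w1 - x) * w h (w2 - w1) * t (y - w2))) * Z h (n + m - L w2)" .
  qed
  also have "\<dots> \<le> lsum (\<lambda>x. lsum (\<lambda>w1. lsum (\<lambda>w2. lsum (\<lambda>y.
       ?c * (indicator (lev n) x * (ennreal (w h w1) * (ed (w1 - x) * gg (w1 - x)))) * gg (w2 - w1) * gg (y - w2)))))"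
  proof (intro lsum_mono)
    fix x w1 w2 y
    show "?I x y * ennreal (w h w1 * (t (w1 - x) * w h (w2 - w1) * t (y - w2))) * Z h (n + m - L w2)
      \<le> ?c * (indicator (lev n) x * (ennreal (w h w1) * (ed (w1 - x) * gg (w1 - x)))) * gg (w2 - w1) * gg (y - w2)"
    proof (cases "x \<in> A \<and> y \<in> A \<and> y \<noteq> x")
      case True
      then have Lx: "L x = n" "L y = n" "R \<le> vnorm (x - y)" using A by (auto simp: lev_def sep_def)
      have R: "R \<le> vnorm (w1 - x) + vnorm (w2 - w1) + vnorm (y - w2)"
      proof -
        have "y - x = (w1 - x) + ((w2 - w1) + (y - w2))" by simp
        then have "vnorm (y - x) \<le> vnorm (w1 - x) + (vnorm (w2 - w1) + vnorm (y - w2))"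
          by (metis add_left_mono order_trans vnorm_triangle)
        moreover have "vnorm (x - y) = vnorm (y - x)" using vnorm_minus[of "y - x"] by simp
        ultimately show ?thesis using Lx by simp
      qed
      have P0: "0 \<le> t (w1 - x) * w h (w2 - w1) * t (y - w2)"
        using w_pos t_pos by (intro mult_nonneg_nonneg) (auto intro: less_imp_le)
      \<comment> \<open>Since x and y are on the same level, the level displacements of the three
        legs between them add up to 0.\<close>
      have LV: "\<bar>L (w2 - w1)\<bar> \<le> \<bar>L (w1 - x)\<bar> + \<bar>L (y - w2)\<bar>" using Lx by (simp add: L_diff)
      have "Z h (n + m - L w2) \<le> ennreal KK * (ennreal (exp (th * \<bar>real_of_int (L (y - w2))\<bar>)) * Z h m)"
        using ratioD[OF r n(2), of "n + m - L w2"] Lx by (simp add: L_diff)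
      then have "ennreal (w h w1 * (t (w1 - x) * w h (w2 - w1) * t (y - w2))) * Z h (n + m - L w2)
         \<le> ennreal (w h w1 * (t (w1 - x) * w h (w2 - w1) * t (y - w2))) * (ennreal KK * (ennreal (exp (th * \<bar>real_of_int (L (y - w2))\<bar>)) * Z h m))"
        by (intro mult_left_mono) auto
      also have "\<dots> = ennreal KK * Z h m * ennreal (w h w1) * ennreal (t (w1 - x) * w h (w2 - w1) * t (y - w2) * exp (th * \<bar>real_of_int (L (y - w2))\<bar>))"
        unfolding ennreal_mult[OF w_nonneg P0] ennreal_mult[OF P0 exp_ge_zero] by (simp only: mult_ac)
      also have "\<dots> \<le> ennreal KK * Z h m * ennreal (w h w1) * ennreal (exp (- ka * R) * (exp (- ka * vnorm (w1 - x)) * exp (- ka * vnorm (w2 - w1)) * exp (- ka * vnorm (y - w2)) * exp (- th * \<bar>real_of_int (L (w1 - x))\<bar>)))"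
        by (intro mult_left_mono ennreal_leI exponent1[OF h LV R]) auto
      also have "\<dots> = ?c * (ennreal (w h w1) * (ed (w1 - x) * gg (w1 - x))) * gg (w2 - w1) * gg (y - w2)"
        unfolding ed_def gg_def by (simp add: ennreal_mult' ennreal_mult'' mult_ac)
      finally show ?thesis using True Lx by (simp add: lev_def)
    qed (auto simp: indicator_def)
  qed
  also have "\<dots> = ?c * EE ka ^ 2 * lsum (\<lambda>x. lsum (\<lambda>w1. indicator (lev n) x * (ennreal (w h w1) * (ed (w1 - x) * gg (w1 - x)))))"
  proof -
    have "lsum (\<lambda>x. lsum (\<lambda>w1. lsum (\<lambda>w2. lsum (\<lambda>y. c * P x w1 * gg (w2 - w1) * gg (y - w2)))))
       = c * EE ka ^ 2 * lsum (\<lambda>x. lsum (\<lambda>w1. P x w1))" for c and P :: "int ^ 'd \<Rightarrow> int ^ 'd \<Rightarrow> ennreal"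
      by (simp only: lsum_cmult lsum_multc lsum_gg power2_eq_square) (simp only: mult_ac)
    from this[of ?c "\<lambda>x w1. indicator (lev n) x * (ennreal (w h w1) * (ed (w1 - x) * gg (w1 - x)))"]
    show ?thesis .
  qed
  also have "\<dots> \<le> ?c * EE ka ^ 2 * (ennreal KK * Z h n * lsum gg)"
    by (intro mult_left_mono conv_bound[OF r n(1)]) auto
  also have "lsum gg = EE ka" by (simp add: gg_def[abs_def] EE_def)
  also have "?c * EE ka ^ 2 * (ennreal KK * Z h n * EE ka) = ennreal (KK\<^sup>2 * exp (- ka * R)) * EE ka ^ 3 * (Z h n * Z h m)"
    using KK by (simp add: ennreal_mult' ennreal_mult'' power2_eq_square power3_eq_cube mult_ac)
  finally show ?thesis .
qed

text \<open>Same scheme with \<open>exponent2\<close>. The fork w2 is summed inside the convolution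
  \<open>?G\<close>, whose total mass supplies two of the three factors
  \<open>EE ka\<close>.\<close>

lemma pairs_bound3:
  assumes r: "ratio KK h" and n: "0 \<le> n" "0 \<le> m" and A: "A \<subseteq> lev n" "sep R A"
  shows "lsum (\<lambda>z. lsum (\<lambda>x. lsum (\<lambda>y. lsum (\<lambda>w1. lsum (\<lambda>w2.
       indicator (lev (n + m)) z * (indicator A x * (indicator A y * indicator {y. y \<noteq> x} y)) * ennreal (tilt h z * T4 0 z x y w1 w2))))))
    \<le> ennreal (KK\<^sup>2 * exp (- ka * R)) * EE ka ^ 3 * (Z h n * Z h m)" (is "?lhs \<le> _")
proof -
  have KK: "1 \<le> KK" and h: "norm h \<le> th * c0 / 2" using r by (auto simp: ratio_def)
  let ?I = "\<lambda>x y. indicator A x * (indicator A y * indicator {y. y \<noteq> x} y) :: ennreal"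
  let ?c = "ennreal KK * ennreal (exp (- ka * R)) * Z h m"
  let ?G = "\<lambda>v. lsum (\<lambda>u. gg u * gg (- v - u))"
  have "?lhs = lsum (\<lambda>x. lsum (\<lambda>w1. lsum (\<lambda>w2. lsum (\<lambda>y. lsum (\<lambda>z.
       indicator (lev (n + m)) z * ?I x y * ennreal (tilt h z * T4 0 z x y w1 w2))))))"
    by (rule lsum_pull)
  also have "\<dots> = lsum (\<lambda>x. lsum (\<lambda>w1. lsum (\<lambda>w2. lsum (\<lambda>y.
       ?I x y * ennreal (w h w1 * (t (w2 - w1) * t (x - w2) * t (y - w2))) * Z h (n + m - L w1)))))"
  proof (intro nn_integral_cong)
    fix x w1 w2 y
    have nn: "0 \<le> w h w1 * (t (w2 - w1) * t (x - w2) * t (y - w2))"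
      using w_pos t_pos by (intro mult_nonneg_nonneg) (auto intro: less_imp_le)
    have "lsum (\<lambda>z. indicator (lev (n + m)) z * ?I x y * ennreal (tilt h z * T4 0 z x y w1 w2))
      = lsum (\<lambda>z. ?I x y * ennreal (w h w1 * (t (w2 - w1) * t (x - w2) * t (y - w2))) * (ennreal (w h (z - w1)) * indicator (lev (n + m)) z))"
      unfolding tilt_T4_3 ennreal_mult[OF nn w_nonneg] by (simp add: mult_ac)
    also have "\<dots> = ?I x y * ennreal (w h w1 * (t (w2 - w1) * t (x - w2) * t (y - w2))) * Z h (n + m - L w1)"
      by (simp only: lsum_cmult sum_lev_shift)
    finally show "lsum (\<lambda>z. indicator (lev (n + m)) z * ?I x y * ennreal (tilt h z * T4 0 z x y w1 w2))
      = ?I x y * ennreal (w h w1 * (t (w2 - w1) * t (x - w2) * t (y - w2))) * Z h (n + m - L w1)" .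
  qed
  also have "\<dots> \<le> lsum (\<lambda>x. lsum (\<lambda>w1. lsum (\<lambda>w2. lsum (\<lambda>y.
       ?c * (indicator (lev n) x * (ennreal (w h w1) * ed (w1 - x))) * (gg (w2 - w1) * gg (x - w2)) * gg (y - w2)))))"
  proof (intro lsum_mono)
    fix x w1 w2 y
    show "?I x y * ennreal (w h w1 * (t (w2 - w1) * t (x - w2) * t (y - w2))) * Z h (n + m - L w1)
      \<le> ?c * (indicator (lev n) x * (ennreal (w h w1) * ed (w1 - x))) * (gg (w2 - w1) * gg (x - w2)) * gg (y - w2)"
    proof (cases "x \<in> A \<and> y \<in> A \<and> y \<noteq> x")
      case True
      then have Lx: "L x = n" "L y = n" "R \<le> vnorm (x - y)" using A by (auto simp: lev_def sep_def)
      have R: "R \<le> vnorm (x - w2) + vnorm (y - w2)"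
        using vnorm_triangle[of "x - w2" "w2 - y"] vnorm_minus[of "y - w2"] Lx by simp
      have P0: "0 \<le> t (w2 - w1) * t (x - w2) * t (y - w2)"
        using t_pos by (intro mult_nonneg_nonneg) (auto intro: less_imp_le)
      have LV: "\<bar>L (w1 - x)\<bar> \<le> \<bar>L (w2 - w1)\<bar> + \<bar>L (x - w2)\<bar>" by (simp add: L_diff)
      have "\<bar>real_of_int (n + m - L w1 - m)\<bar> = \<bar>real_of_int (L (w1 - x))\<bar>" using Lx by (simp add: L_diff)
      then have "Z h (n + m - L w1) \<le> ennreal KK * (ennreal (exp (th * \<bar>real_of_int (L (w1 - x))\<bar>)) * Z h m)"
        using ratioD[OF r n(2), of "n + m - L w1"] by (simp only:)
      then have "ennreal (w h w1 * (t (w2 - w1) * t (x - w2) * t (y - w2))) * Z h (n + m - L w1)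
         \<le> ennreal (w h w1 * (t (w2 - w1) * t (x - w2) * t (y - w2))) * (ennreal KK * (ennreal (exp (th * \<bar>real_of_int (L (w1 - x))\<bar>)) * Z h m))"
        by (intro mult_left_mono) auto
      also have "\<dots> = ennreal KK * Z h m * ennreal (w h w1) * ennreal (t (w2 - w1) * t (x - w2) * t (y - w2) * exp (th * \<bar>real_of_int (L (w1 - x))\<bar>))"
        unfolding ennreal_mult[OF w_nonneg P0] ennreal_mult[OF P0 exp_ge_zero] by (simp only: mult_ac)
      also have "\<dots> \<le> ennreal KK * Z h m * ennreal (w h w1) * ennreal (exp (- ka * R) * (exp (- ka * vnorm (w2 - w1)) * exp (- ka * vnorm (x - w2)) * exp (- ka * vnorm (y - w2)) * exp (- th * \<bar>real_of_int (L (w1 - x))\<bar>)))"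
        by (intro mult_left_mono ennreal_leI exponent2[OF R LV]) auto
      also have "\<dots> = ?c * (ennreal (w h w1) * ed (w1 - x)) * (gg (w2 - w1) * gg (x - w2)) * gg (y - w2)"
        unfolding ed_def gg_def by (simp add: ennreal_mult' ennreal_mult'' mult_ac)
      finally show ?thesis using True Lx by (simp add: lev_def)
    qed (auto simp: indicator_def)
  qed
  also have "\<dots> = lsum (\<lambda>x. lsum (\<lambda>w1. ?c * EE ka * (indicator (lev n) x * (ennreal (w h w1) * (ed (w1 - x) * ?G (w1 - x))))))"
  proof (intro nn_integral_cong)
    fix x w1
    have eq: "lsum (\<lambda>w2. gg (w2 - w1) * gg (x - w2)) = ?G (w1 - x)"
      using lsum_shift'[of "\<lambda>u. gg u * gg (- (w1 - x) - u)" w1] by (simp add: algebra_simps)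
    show "lsum (\<lambda>w2. lsum (\<lambda>y. ?c * (indicator (lev n) x * (ennreal (w h w1) * ed (w1 - x))) * (gg (w2 - w1) * gg (x - w2)) * gg (y - w2)))
       = ?c * EE ka * (indicator (lev n) x * (ennreal (w h w1) * (ed (w1 - x) * ?G (w1 - x))))"
    proof -
      have "lsum (\<lambda>w2. lsum (\<lambda>y. c * (i * (u * e)) * (P w2) * gg (y - w2))) = c * EE ka * (i * (u * (e * lsum P)))"
        for c i u e and P :: "int ^ 'd \<Rightarrow> ennreal"
        by (simp only: lsum_cmult lsum_multc lsum_gg) (simp only: mult_ac)
      from this[of ?c "indicator (lev n) x" "ennreal (w h w1)" "ed (w1 - x)" "\<lambda>w2. gg (w2 - w1) * gg (x - w2)"]
      show ?thesis unfolding eq .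
    qed
  qed
  also have "\<dots> = ?c * EE ka * lsum (\<lambda>x. lsum (\<lambda>w1. indicator (lev n) x * (ennreal (w h w1) * (ed (w1 - x) * ?G (w1 - x)))))"
    by (simp only: lsum_cmult)
  also have "\<dots> \<le> ?c * EE ka * (ennreal KK * Z h n * lsum ?G)"
    by (intro mult_left_mono conv_bound[OF r n(1)]) auto
  also have "lsum ?G = EE ka ^ 2"
  proof -
    have "lsum ?G = lsum (\<lambda>u. lsum (\<lambda>v. gg u * gg (- v - u)))" by (rule lsum_swap)
    also have "\<dots> = lsum (\<lambda>u. gg u * EE ka)"
    proof (intro nn_integral_cong)
      fix u
      have "- v - u = - u - v" for v :: "int ^ 'd" by simp
      then have "lsum (\<lambda>v. gg (- v - u)) = EE ka" using lsum_gg(2)[of "- u"] by (simp only:)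
      then show "lsum (\<lambda>v. gg u * gg (- v - u)) = gg u * EE ka" by (simp only: lsum_cmult)
    qed
    also have "\<dots> = EE ka ^ 2" unfolding lsum_multc using lsum_gg(1)[of 0] by (simp add: power2_eq_square)
    finally show ?thesis .
  qed
  also have "?c * EE ka * (ennreal KK * Z h n * EE ka ^ 2) = ennreal (KK\<^sup>2 * exp (- ka * R)) * EE ka ^ 3 * (Z h n * Z h m)"
    using KK by (simp add: ennreal_mult' ennreal_mult'' power2_eq_square power3_eq_cube mult_ac)
  finally show ?thesis .
qed

end


lemma add3_eq_3_times: "d + (d + d) = 3 * (d :: 'a::comm_semiring_1)"
proof -
  have "(3 :: 'a) = 1 + (1 + 1)" by simp
  show ?thesis unfolding \<open>3 = _\<close> distrib_right mult_1_left ..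
qed

context face begin

definition splus :: "(int ^ 'd) set \<Rightarrow> (int ^ 'd) set \<Rightarrow> (int ^ 'd) set" where
  "splus A B = {x + y | x y. x \<in> A \<and> y \<in> B}"

lemma mu_prod:
  "mu h A * mu h B = lsum (\<lambda>z. lsum (\<lambda>x. ennreal (w h x * w h (z - x)) * (indicator A x * indicator B (z - x))))"
proof -
  have "mu h A * mu h B = lsum (\<lambda>x. ennreal (w h x) * indicator A x * mu h B)"
    unfolding lsum_multc by (simp add: mu_def)
  also have "\<dots> = lsum (\<lambda>x. lsum (\<lambda>z. ennreal (w h x * w h (z - x)) * (indicator A x * indicator B (z - x))))"
  proof (intro nn_integral_cong)
    fix x
    have "mu h B = lsum (\<lambda>z. ennreal (w h (z - x)) * indicator B (z - x))" unfolding mu_def by (rule lsum_shift'[symmetric])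
    then have "ennreal (w h x) * indicator A x * mu h B = lsum (\<lambda>z. ennreal (w h x) * indicator A x * (ennreal (w h (z - x)) * indicator B (z - x)))"
      by (simp only: lsum_cmult)
    also have "\<dots> = lsum (\<lambda>z. ennreal (w h x * w h (z - x)) * (indicator A x * indicator B (z - x)))"
      by (intro nn_integral_cong) (simp only: ennreal_mult[OF w_nonneg w_nonneg] mult_ac)
    finally show "ennreal (w h x) * indicator A x * mu h B = lsum (\<lambda>z. ennreal (w h x * w h (z - x)) * (indicator A x * indicator B (z - x)))" .
  qed
  also have "\<dots> = lsum (\<lambda>z. lsum (\<lambda>x. ennreal (w h x * w h (z - x)) * (indicator A x * indicator B (z - x))))"
    by (rule lsum_swap)
  finally show ?thesis .
qed

text \<open>Apply \<open>second_moment\<close> to the points x of A with z - x in B and bound the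
  four-point function by tree diagrams. Two of the three diagrams agree after exchanging x and y, so
  all three are covered by \<open>pairs_bound1\<close> and \<open>pairs_bound3\<close>.\<close>

lemma QM_sep:
  assumes r: "ratio KK h" and n: "0 \<le> n" "0 \<le> m" and A: "A \<subseteq> lev n" "sep R A" and B: "B \<subseteq> lev m"
  shows "mu h A * mu h B \<le> mu h (splus A B) + 3 * (ennreal (KK\<^sup>2 * exp (- ka * R)) * EE ka ^ 3 * (Z h n * Z h m))"
proof -
  let ?I = "\<lambda>x y. indicator A x * (indicator A y * indicator {y. y \<noteq> x} y) :: ennreal"
  let ?F = "\<lambda>q b c e z x y w1 w2. indicator (lev (n + m)) z * ?I x y * ennreal (tilt h z * T4 q b c e w1 w2)"
  let ?D = "ennreal (KK\<^sup>2 * exp (- ka * R)) * EE ka ^ 3 * (Z h n * Z h m)"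
  let ?LL = "\<lambda>G. lsum (\<lambda>z. lsum (\<lambda>x. lsum (\<lambda>y. lsum (\<lambda>w1. lsum (\<lambda>w2. G z x y w1 w2))))) :: ennreal"
  have step: "lsum (\<lambda>x. ennreal (w h x * w h (z - x)) * (indicator A x * indicator B (z - x)))
     \<le> ennreal (w h z) * indicator (splus A B) z
       + lsum (\<lambda>x. lsum (\<lambda>y. lsum (\<lambda>w1. lsum (\<lambda>w2. ?F 0 x z y z x y w1 w2 + (?F 0 y z x z x y w1 w2 + ?F 0 z x y z x y w1 w2)))))" for z
  proof -
    define X where "X = {x \<in> A. z - x \<in> B}"
    have XA: "X \<subseteq> A" by (auto simp: X_def)
    have lz: "z \<in> lev (n + m)" if "x \<in> X" for x
      using that A(1) B L_add[of x "z - x"] by (auto simp: X_def lev_def)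
    let ?i = "indicator (lev (n + m)) z :: ennreal"
    have "lsum (\<lambda>x. ennreal (w h x * w h (z - x)) * (indicator A x * indicator B (z - x)))
      = lsum (\<lambda>x. ?i * ennreal (tilt h z) * (ennreal (t x * t (z - x)) * indicator X x))"
    proof (intro nn_integral_cong)
      fix x
      have eq: "w h x * w h (z - x) = tilt h z * (t x * t (z - x))"
      proof -
        have "tilt h z = tilt h x * tilt h (z - x)"
          unfolding tilt_def exp_add[symmetric] inner_add_right[symmetric] vec_of_int_add[symmetric] by simp
        then show ?thesis by (simp add: w_tilt mult_ac)
      qed
      show "ennreal (w h x * w h (z - x)) * (indicator A x * indicator B (z - x)) = ?i * ennreal (tilt h z) * (ennreal (t x * t (z - x)) * indicator X x)"
      proof (cases "x \<in> X")
        case True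
        then show ?thesis using lz[OF True] tilt_pos[of h z] unfolding eq
          by (simp add: X_def ennreal_mult')
      qed (auto simp: X_def indicator_def)
    qed
    also have "\<dots> = ?i * ennreal (tilt h z) * lsum (\<lambda>x. ennreal (t x * t (z - x)) * indicator X x)"
      by (rule lsum_cmult)
    also have "\<dots> \<le> ?i * ennreal (tilt h z) * (ennreal (t z) * (if X = {} then 0 else 1) +
     lsum (\<lambda>x. lsum (\<lambda>y. ennreal (PP p (\<lambda>A. cn 0 x A \<and> cn 0 y A \<and> cn 0 z A)) * (indicator X x * (indicator X y * indicator {y. y \<noteq> x} y)))))"
      by (intro mult_left_mono second_moment) auto
    also have "\<dots> = ?i * ennreal (tilt h z) * (ennreal (t z) * (if X = {} then 0 else 1)) +
     lsum (\<lambda>x. lsum (\<lambda>y. ?i * ennreal (tilt h z) * (ennreal (PP p (\<lambda>A. cn 0 x A \<and> cn 0 y A \<and> cn 0 z A)) * (indicator X x * (indicator X y * indicator {y. y \<noteq> x} y)))))"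
      by (simp only: distrib_left lsum_cmult)
    also have "\<dots> \<le> ennreal (w h z) * indicator (splus A B) z
       + lsum (\<lambda>x. lsum (\<lambda>y. lsum (\<lambda>w1. lsum (\<lambda>w2. ?F 0 x z y z x y w1 w2 + (?F 0 y z x z x y w1 w2 + ?F 0 z x y z x y w1 w2)))))"
    proof (intro add_mono lsum_mono)
      show "?i * ennreal (tilt h z) * (ennreal (t z) * (if X = {} then 0 else 1)) \<le> ennreal (w h z) * indicator (splus A B) z"
      proof (cases "X = {}")
        case False
        then obtain x where x: "x \<in> A" "z - x \<in> B" by (auto simp: X_def)
        have "z = x + (z - x)" by simp
        then have "z \<in> splus A B" unfolding splus_def using x by blast
        moreover have "?i \<le> 1" by (simp add: indicator_def)
        then have "?i * (ennreal (tilt h z) * ennreal (t z)) \<le> 1 * (ennreal (tilt h z) * ennreal (t z))" by (intro mult_right_mono) auto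
        ultimately show ?thesis using False tilt_pos[of h z] t_pos[of z]
          by (simp add: w_tilt ennreal_mult mult_ac)
      qed simp
    next
      fix x y
      have ind: "indicator X x * (indicator X y * indicator {y. y \<noteq> x} y) \<le> ?I x y"
        using XA by (auto simp: indicator_def)
      have "?i * ennreal (tilt h z) * (ennreal (PP p (\<lambda>A. cn 0 x A \<and> cn 0 y A \<and> cn 0 z A)) * (indicator X x * (indicator X y * indicator {y. y \<noteq> x} y)))
         \<le> ?i * ennreal (tilt h z) * (lsum (\<lambda>w1. lsum (\<lambda>w2. ennreal (T4 0 x z y w1 w2) + (ennreal (T4 0 y z x w1 w2) + ennreal (T4 0 z x y w1 w2)))) * ?I x y)"
        by (intro mult_left_mono mult_mono tree4_sum_bound ind) auto
      also have "\<dots> = ?i * ?I x y * ennreal (tilt h z) * lsum (\<lambda>w1. lsum (\<lambda>w2. ennreal (T4 0 x z y w1 w2) + (ennreal (T4 0 y z x w1 w2) + ennreal (T4 0 z x y w1 w2))))"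
        by (simp only: mult_ac)
      also have "\<dots> = lsum (\<lambda>w1. lsum (\<lambda>w2. ?i * ?I x y * ennreal (tilt h z) * (ennreal (T4 0 x z y w1 w2) + (ennreal (T4 0 y z x w1 w2) + ennreal (T4 0 z x y w1 w2)))))"
        by (simp only: lsum_cmult)
      also have "\<dots> = lsum (\<lambda>w1. lsum (\<lambda>w2. ?F 0 x z y z x y w1 w2 + (?F 0 y z x z x y w1 w2 + ?F 0 z x y z x y w1 w2)))"
      proof (intro nn_integral_cong)
        fix w1 w2
        have *: "ennreal (tilt h z * r) = ennreal (tilt h z) * ennreal r" for r using tilt_pos[of h z] by (simp add: ennreal_mult')
        show "?i * ?I x y * ennreal (tilt h z) * (ennreal (T4 0 x z y w1 w2) + (ennreal (T4 0 y z x w1 w2) + ennreal (T4 0 z x y w1 w2)))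
          = ?F 0 x z y z x y w1 w2 + (?F 0 y z x z x y w1 w2 + ?F 0 z x y z x y w1 w2)"
          unfolding * by (simp only: distrib_left mult.assoc)
      qed
      finally show "?i * ennreal (tilt h z) * (ennreal (PP p (\<lambda>A. cn 0 x A \<and> cn 0 y A \<and> cn 0 z A)) * (indicator X x * (indicator X y * indicator {y. y \<noteq> x} y)))
        \<le> lsum (\<lambda>w1. lsum (\<lambda>w2. ?F 0 x z y z x y w1 w2 + (?F 0 y z x z x y w1 w2 + ?F 0 z x y z x y w1 w2)))" .
    qed
    finally show ?thesis .
  qed
  have "mu h A * mu h B \<le> lsum (\<lambda>z. ennreal (w h z) * indicator (splus A B) z
       + lsum (\<lambda>x. lsum (\<lambda>y. lsum (\<lambda>w1. lsum (\<lambda>w2. ?F 0 x z y z x y w1 w2 + (?F 0 y z x z x y w1 w2 + ?F 0 z x y z x y w1 w2))))))"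
    unfolding mu_prod by (intro lsum_mono step)
  also have "\<dots> = mu h (splus A B) + (?LL (\<lambda>z x y w1 w2. ?F 0 x z y z x y w1 w2) +
     (?LL (\<lambda>z x y w1 w2. ?F 0 y z x z x y w1 w2) + ?LL (\<lambda>z x y w1 w2. ?F 0 z x y z x y w1 w2)))"
    by (simp only: lsum_add mu_def)
  also have "?LL (\<lambda>z x y w1 w2. ?F 0 y z x z x y w1 w2) = ?LL (\<lambda>z x y w1 w2. ?F 0 x z y z x y w1 w2)"
  proof (rule nn_integral_cong)
    fix z
    have "lsum (\<lambda>x. lsum (\<lambda>y. lsum (\<lambda>w1. lsum (\<lambda>w2. ?F 0 y z x z x y w1 w2)))) = lsum (\<lambda>y. lsum (\<lambda>x. lsum (\<lambda>w1. lsum (\<lambda>w2. ?F 0 y z x z x y w1 w2))))"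
      by (rule lsum_swap)
    moreover have "?I x y = ?I y x" for x y by (auto simp: indicator_def)
    ultimately show "lsum (\<lambda>x. lsum (\<lambda>y. lsum (\<lambda>w1. lsum (\<lambda>w2. ?F 0 y z x z x y w1 w2)))) = lsum (\<lambda>x. lsum (\<lambda>y. lsum (\<lambda>w1. lsum (\<lambda>w2. ?F 0 x z y z x y w1 w2))))"
      by simp
  qed
  also have "mu h (splus A B) + (?LL (\<lambda>z x y w1 w2. ?F 0 x z y z x y w1 w2) +
     (?LL (\<lambda>z x y w1 w2. ?F 0 x z y z x y w1 w2) + ?LL (\<lambda>z x y w1 w2. ?F 0 z x y z x y w1 w2))) \<le> mu h (splus A B) + (?D + (?D + ?D))"
    by (intro add_mono order_refl pairs_bound1[OF r n A] pairs_bound3[OF r n A])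
  also have "?D + (?D + ?D) = 3 * ?D"
  proof -
    have "d + (d + d) = 3 * d" for d :: ennreal by (rule add3_eq_3_times)
    then show ?thesis .
  qed
  finally show ?thesis .
qed

text \<open>Split A into the residue classes of its coordinates modulo R + 1. Each class is
  R-separated, so the total error is the number of classes times exp (- ka R), which is small for
  large R.\<close>

lemma QM:
  assumes \<zeta>: "0 < \<zeta>"
  shows "\<exists>N0>0. \<forall>h n m A B. ratio KK h \<longrightarrow> 0 \<le> n \<longrightarrow> 0 \<le> m \<longrightarrow> A \<subseteq> lev n \<longrightarrow> B \<subseteq> lev m \<longrightarrow>
     mu h A * mu h B \<le> ennreal N0 * mu h (splus A B) + ennreal \<zeta> * (Z h n * Z h m)"
proof -
  let ?d = "CARD('d)"
  have "EE ka < \<infinity>" by (rule EE_finite) (rule ka)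
  then obtain E where E: "EE ka = ennreal E" "0 \<le> E" by (cases "EE ka") auto
  define D where "D = (4 * real ?d / ka) ^ ?d * exp (ka / 4) * 3 * KK\<^sup>2 * E ^ 3 + 1"
  have D: "D > 0" unfolding D_def using ka E by (intro add_nonneg_pos mult_nonneg_nonneg) auto
  obtain R :: nat where R: "real R > ln (D / \<zeta>) * 2 / ka" using reals_Archimedean2 by blast
  \<comment> \<open>Residues lie between 0 and R, so the box \<open>lbox R\<close> indexes all
    classes; some of the indices belong to empty classes.\<close>
  define N0 where "N0 = real (card (lbox R :: (int ^ 'd) set))"
  have N0: "0 < N0" unfolding N0_def using zero_in_lbox[of R] finite_lbox card_gt_0_iff by (metis empty_iff of_nat_0_less_iff)
  have small: "N0 * (3 * (KK\<^sup>2 * exp (- ka * real R) * E ^ 3)) \<le> \<zeta>"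
  proof -
    have "N0 \<le> (2 * real R + 1) ^ ?d"
    proof -
      have "N0 \<le> real ((2 * R + 1) ^ ?d)" unfolding N0_def using card_lbox[of R, where 'd = 'd] by (simp only: of_nat_le_iff)
      then show ?thesis by (simp add: add.commute)
    qed
    also have "\<dots> \<le> (4 * real ?d / ka) ^ ?d * exp (ka / 4 * (2 * real R + 1))" by (rule power_exp_bound) (use ka in auto)
    finally have "N0 * (3 * (KK\<^sup>2 * exp (- ka * real R) * E ^ 3)) \<le> (4 * real ?d / ka) ^ ?d * exp (ka / 4 * (2 * real R + 1)) * (3 * (KK\<^sup>2 * exp (- ka * real R) * E ^ 3))"
      by (rule mult_right_mono) (use E in auto)
    also have "\<dots> = (4 * real ?d / ka) ^ ?d * exp (ka / 4) * 3 * KK\<^sup>2 * E ^ 3 * exp (- (ka / 2) * real R)"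
    proof -
      have "exp (ka / 4 * (2 * real R + 1)) * exp (- ka * real R) = exp (ka / 4) * exp (- (ka / 2) * real R)"
        unfolding exp_add[symmetric] by (simp add: algebra_simps)
      moreover have "x * e1 * (3 * (k * e2 * y)) = x * e3 * 3 * k * y * e4" if "e1 * e2 = e3 * e4" for x e1 e2 e3 e4 k y :: real
      proof -
        have "x * e1 * (3 * (k * e2 * y)) = x * 3 * k * y * (e1 * e2)" by (simp only: mult_ac)
        then show ?thesis unfolding that by (simp only: mult_ac)
      qed
      ultimately show ?thesis by blast
    qed
    also have "\<dots> \<le> D * exp (- (ka / 2) * real R)" by (intro mult_right_mono) (auto simp: D_def)
    also have "\<dots> \<le> D * exp (- ln (D / \<zeta>))"
    proof -
      have "ln (D / \<zeta>) \<le> ka / 2 * real R" using R ka by (simp add: field_simps)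
      then show ?thesis using D by (intro mult_left_mono) auto
    qed
    also have "\<dots> = \<zeta>" using D \<zeta> by (simp add: exp_minus)
    finally show ?thesis .
  qed
  show ?thesis
  proof (intro exI[of _ N0] conjI allI impI N0)
    fix h n m A B
    assume r: "ratio KK h" and n: "0 \<le> n" "0 \<le> m" and A: "A \<subseteq> lev n" and B: "B \<subseteq> lev m"
    let ?cl = "\<lambda>x :: int ^ 'd. (\<chi> i. x $ i mod (int R + 1)) :: int ^ 'd"
    let ?A = "\<lambda>c. {x \<in> A. ?cl x = c}"
    have clb: "?cl x \<in> lbox R" for x
    proof -
      have "\<bar>x $ i mod (int R + 1)\<bar> \<le> int R" for i
        using pos_mod_bound[of "int R + 1" "x $ i"] pos_mod_sign[of "int R + 1" "x $ i"] by linarith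
      then show ?thesis by (simp add: lbox_def)
    qed
    have UN: "A = (\<Union>c\<in>lbox R. ?A c)" using clb by auto
    have sepA: "sep (real R) (?A c)" for c
      unfolding sep_def
    proof (intro ballI impI)
      fix x y assume x: "x \<in> ?A c" and y: "y \<in> ?A c" and "x \<noteq> y"
      then obtain i where i: "x $ i \<noteq> y $ i" by (auto simp: vec_eq_iff)
      have "?cl x $ i = ?cl y $ i" using x y by simp
      then have "(int R + 1) dvd (x $ i - y $ i)" by (simp add: mod_eq_dvd_iff)
      then have "int R + 1 \<le> \<bar>x $ i - y $ i\<bar>" using i by (intro zdvd_imp_le) auto
      then have "real R \<le> real_of_int \<bar>(x - y) $ i\<bar>" by simp
      also have "\<dots> \<le> vnorm (x - y)" using vnorm_component[of "x - y" i] by simp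
      finally show "real R \<le> vnorm (x - y)" .
    qed
    let ?D = "3 * (ennreal (KK\<^sup>2 * exp (- ka * real R)) * EE ka ^ 3 * (Z h n * Z h m))"
    have "mu h A = (\<Sum>c\<in>lbox R. mu h (?A c))"
      by (subst UN, rule mu_UN_disjoint) (auto simp: disjoint_family_on_def)
    then have "mu h A * mu h B = (\<Sum>c\<in>lbox R. mu h (?A c) * mu h B)" by (simp only: sum_distrib_right)
    also have "\<dots> \<le> (\<Sum>c\<in>(lbox R :: (int ^ 'd) set). mu h (splus A B) + ?D)"
    proof (rule sum_mono)
      fix c
      have "mu h (?A c) * mu h B \<le> mu h (splus (?A c) B) + ?D"
        by (rule QM_sep[OF r n _ sepA B]) (use A in auto)
      also have "\<dots> \<le> mu h (splus A B) + ?D"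
        by (intro add_right_mono mu_mono) (auto simp: splus_def)
      finally show "mu h (?A c) * mu h B \<le> mu h (splus A B) + ?D" .
    qed
    also have "\<dots> = ennreal N0 * (mu h (splus A B) + ?D)"
      by (simp add: N0_def ennreal_of_nat_eq_real_of_nat)
    also have "\<dots> = ennreal N0 * mu h (splus A B) + ennreal N0 * ?D" by (rule distrib_left)
    also have "ennreal N0 * ?D = ennreal (N0 * (3 * (KK\<^sup>2 * exp (- ka * real R) * E ^ 3))) * (Z h n * Z h m)"
    proof -
      have "ennreal (N0 * (3 * (KK\<^sup>2 * exp (- ka * real R) * E ^ 3))) = ennreal N0 * (3 * (ennreal (KK\<^sup>2 * exp (- ka * real R)) * EE ka ^ 3))"
        using N0 E by (simp add: ennreal_mult ennreal_power)
      then show ?thesis by (simp only: mult.assoc)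
    qed
    also have "\<dots> \<le> ennreal \<zeta> * (Z h n * Z h m)" by (intro mult_right_mono ennreal_leI small) auto
    finally show "mu h A * mu h B \<le> ennreal N0 * mu h (splus A B) + ennreal \<zeta> * (Z h n * Z h m)" by simp
  qed
qed

end


section \<open>Strict triangle inequality\<close>

text \<open>Both g and c - g are subadditive. Fekete's lemma applied to each gives opposite limits,
  and the two one-sided bounds valid for every n enclose g n.\<close>

lemma quasi_additive:
  fixes g :: "nat \<Rightarrow> real"
  assumes sub: "\<And>m n. g (m + n) \<le> g m + g n" and sup: "\<And>m n. g m + g n \<le> g (m + n) + c"
  shows "\<exists>l. \<forall>n. real n * l \<le> g n \<and> g n \<le> real n * l + c"
proof -
  have g0: "0 \<le> g 0" "g 0 \<le> c" using sub[of 0 0] sup[of 0 0] by simp_all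
  have low: "g 0 + real n * (g 1 - c) \<le> g n" for n
  proof (induction n)
    case (Suc n)
    then show ?case using sup[of n 1] by (simp add: algebra_simps)
  qed simp
  have up: "g n \<le> g 0 + real n * g 1" for n
  proof (induction n)
    case (Suc n)
    then show ?case using sub[of n 1] by (simp add: algebra_simps)
  qed simp
  obtain l where l: "(\<lambda>n. g n / real n) \<longlonglongrightarrow> l" "\<And>n. real n * l \<le> g n"
  proof (rule fekete[of g "c - g 1"])
    show "- (c - g 1) * real n \<le> g n" for n using low[of n] g0 by (simp add: algebra_simps)
  qed (use sub in auto)
  obtain l' where l': "(\<lambda>n. (c - g n) / real n) \<longlonglongrightarrow> l'" "\<And>n. real n * l' \<le> c - g n"
  proof (rule fekete[of "\<lambda>n. c - g n" "g 1"])
    show "c - g (m + n) \<le> c - g m + (c - g n)" for m n using sup[of m n] by simp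
    show "- g 1 * real n \<le> c - g n" for n using up[of n] g0 by (simp add: algebra_simps)
  qed auto
  have "(\<lambda>n. c / real n - g n / real n) \<longlonglongrightarrow> 0 - l" by (intro tendsto_diff l lim_const_over_n)
  then have "(\<lambda>n. (c - g n) / real n) \<longlonglongrightarrow> - l" by (simp add: diff_divide_distrib)
  with l'(1) have "l' = - l" by (rule LIMSEQ_unique)
  then show ?thesis using l(2) l'(2) by (intro exI[of _ l]) (auto simp: algebra_simps)
qed

context face begin

lemma w_shift: "w h x = w 0 x * exp (h \<bullet> vec_of_int x)"
  by (simp add: w_def inner_add_left exp_add)

lemma Z_pos: "0 < Z h (int n)"
proof -
  obtain v where v: "L v = int n" using face_points[OF f_va va, of 1] by auto
  have "0 < ennreal (w h v)" using w_pos by simp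
  also have "\<dots> \<le> Z h (int n)" unfolding Z_def by (rule mu_point) (simp add: lev_def v)
  finally show ?thesis .
qed

lemma splus_lev: "A \<subseteq> lev n \<Longrightarrow> B \<subseteq> lev m \<Longrightarrow> splus A B \<subseteq> lev (n + m)"
  unfolding splus_def lev_def by (auto simp: L_add dest!: subsetD)

text \<open>\<open>QM\<close> with error factor 1/2 can be absorbed on the left, so
  \<open>ln Z\<close> is additive up to c. The constant c comes from N0 and is common to all small
  tilts, while the rate l depends on \<open>h\<close>.\<close>

lemma growth_rate:
  "\<exists>KK c \<epsilon>. 0 \<le> c \<and> 0 < \<epsilon> \<and> ratio KK 0 \<and> (\<forall>h. norm h \<le> \<epsilon> \<longrightarrow> (\<exists>l. \<forall>n::nat.
     ennreal (exp (real n * l)) \<le> Z h (int n) \<and> Z h (int n) \<le> ennreal (exp c * exp (real n * l))))"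
proof -
  obtain KK \<epsilon>0 where KK: "1 \<le> KK" "0 < \<epsilon>0" and rat: "\<And>h n l. norm h \<le> \<epsilon>0 \<Longrightarrow> 0 \<le> n \<Longrightarrow>
     Z h l \<le> ennreal (KK * exp (th * \<bar>real_of_int (l - n)\<bar>)) * Z h n"
    using Z_ratio[OF th(1,2)] by blast
  obtain N0 where N0: "0 < N0" and qm: "\<And>h n m A B. ratio KK h \<Longrightarrow> 0 \<le> n \<Longrightarrow> 0 \<le> m \<Longrightarrow> A \<subseteq> lev n \<Longrightarrow> B \<subseteq> lev m \<Longrightarrow>
     mu h A * mu h B \<le> ennreal N0 * mu h (splus A B) + ennreal (1/2) * (Z h n * Z h m)"
    using QM[of "1/2" KK] by auto
  define \<epsilon> where "\<epsilon> = min \<epsilon>0 (th * c0 / 2)"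
  have \<epsilon>: "0 < \<epsilon>" using KK th c0(1) by (simp add: \<epsilon>_def)
  have r: "ratio KK h" if "norm h \<le> \<epsilon>" for h
    unfolding ratio_def using that KK rat by (auto simp: \<epsilon>_def)
  define c where "c = \<bar>ln (2 * N0)\<bar>"
  have "\<exists>l. \<forall>n::nat. ennreal (exp (real n * l)) \<le> Z h (int n) \<and> Z h (int n) \<le> ennreal (exp c * exp (real n * l))"
    if h: "norm h \<le> \<epsilon>" for h
  proof -
    have "th * c0 / 2 \<le> c0 / 2" using th c0(1) by simp
    then have fin: "Z h l < \<infinity>" for l using h by (intro Z_finite) (auto simp: \<epsilon>_def)
    define zz where "zz n = enn2real (Z h (int n))" for n :: nat
    have Zz: "Z h (int n) = ennreal (zz n)" for n using fin[of "int n"] by (simp add: zz_def)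
    have zpos: "0 < zz n" for n using Z_pos[of h n] by (simp add: Zz)
    have sub: "zz (m + n) \<le> zz m * zz n" for m n
    proof -
      have "Z h (int m + int n) \<le> Z h (int m) * Z h (int n)" by (rule Z_submult) auto
      then have "ennreal (zz (m + n)) \<le> ennreal (zz m * zz n)"
        using zpos by (simp add: Zz ennreal_mult' less_imp_le flip: of_nat_add)
      then show ?thesis using zpos[of m] zpos[of n] by (simp add: ennreal_le_iff)
    qed
    have sup: "zz m * zz n \<le> 2 * N0 * zz (m + n)" for m n
    proof -
      have "Z h (int m) * Z h (int n) \<le> ennreal N0 * mu h (splus (lev (int m)) (lev (int n))) + ennreal (1/2) * (Z h (int m) * Z h (int n))"
        unfolding Z_def by (rule qm[OF r[OF h], unfolded Z_def]) auto
      also have "\<dots> \<le> ennreal N0 * Z h (int m + int n) + ennreal (1/2) * (Z h (int m) * Z h (int n))"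
        unfolding Z_def by (intro add_right_mono mult_left_mono mu_mono splus_lev) auto
      also have "Z h (int m + int n) = ennreal (zz (m + n))" by (simp add: Zz flip: of_nat_add)
      finally have fin1: "Z h (int m) * Z h (int n) \<le> ennreal N0 * ennreal (zz (m + n)) + ennreal (1/2) * (Z h (int m) * Z h (int n))" .
      have "ennreal (zz m * zz n) \<le> ennreal (N0 * zz (m + n) + 1/2 * (zz m * zz n))"
      proof -
        have "ennreal (a * b + c * (d * e)) = ennreal a * ennreal b + ennreal c * (ennreal d * ennreal e)" if "0 \<le> a" "0 \<le> b" "0 \<le> c" "0 \<le> d" "0 \<le> e" for a b c d e :: real
          using that by (simp add: ennreal_mult)
        from this[of N0 "zz (m + n)" "1/2" "zz m" "zz n"] this[of 0 0 1 "zz m" "zz n"]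
        have eq: "ennreal (N0 * zz (m + n) + 1/2 * (zz m * zz n)) = ennreal N0 * ennreal (zz (m + n)) + ennreal (1/2) * (ennreal (zz m) * ennreal (zz n))"
          "ennreal (zz m * zz n) = ennreal (zz m) * ennreal (zz n)" using N0 zpos by (simp_all add: less_imp_le)
        show ?thesis unfolding eq using fin1 unfolding Zz .
      qed
      then have "zz m * zz n \<le> N0 * zz (m + n) + 1/2 * (zz m * zz n)"
        using N0 zpos by (subst (asm) ennreal_le_iff) (auto intro!: add_nonneg_nonneg mult_nonneg_nonneg intro: less_imp_le)
      then show ?thesis by simp
    qed
    have "\<exists>l. \<forall>n. real n * l \<le> ln (zz n) \<and> ln (zz n) \<le> real n * l + c"
    proof (rule quasi_additive)
      fix m n
      have "ln (zz (m + n)) \<le> ln (zz m * zz n)" using sub[of m n] zpos by (subst ln_le_cancel_iff) auto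
      then show "ln (zz (m + n)) \<le> ln (zz m) + ln (zz n)" using zpos[of m] zpos[of n] by (simp add: ln_mult)
      have "ln (zz m * zz n) \<le> ln (2 * N0 * zz (m + n))" using sup[of m n] zpos N0 by (subst ln_le_cancel_iff) auto
      then show "ln (zz m) + ln (zz n) \<le> ln (zz (m + n)) + c"
        using zpos[of m] zpos[of n] zpos[of "m + n"] N0 by (simp add: ln_mult c_def)
    qed
    then obtain l where l: "\<And>n. real n * l \<le> ln (zz n)" "\<And>n. ln (zz n) \<le> real n * l + c" by blast
    have "exp (real n * l) \<le> zz n" "zz n \<le> exp c * exp (real n * l)" for n
    proof -
      show "exp (real n * l) \<le> zz n" using l(1)[of n] zpos[of n] by (metis exp_le_cancel_iff exp_ln)
      have "exp (ln (zz n)) \<le> exp (real n * l + c)" using l(2)[of n] by simp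
      then show "zz n \<le> exp c * exp (real n * l)" using zpos[of n] by (simp add: exp_add mult.commute)
    qed
    then show ?thesis unfolding Zz by (intro exI[of _ l] allI conjI ennreal_leI)
  qed
  moreover have "ratio KK 0" using r[of 0] \<epsilon> by simp
  ultimately show ?thesis using \<epsilon> by (intro exI[of _ KK] exI[of _ c] exI[of _ \<epsilon>]) (auto simp: c_def)
qed

section \<open>Locating the mass of a level at a one-sided slope\<close>

text \<open>Here \<sigma> is the infimum of \<open>lam \<delta> / \<delta>\<close>, a one-sided
  slope at tilt 0. The tilt q / n gives total weight at least exp (q \<sigma>). Points with u . x
  well below n \<sigma> gain too little from it, and points well above are controlled by the double
  tilt 2 q / n, so a fixed fraction of the mass must sit in the window.\<close>

lemma window:
  fixes lam :: "real \<Rightarrow> real" and u :: "real ^ 'd"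
  assumes d0: "0 < d0" and C: "1 \<le> C" and \<omega>: "0 < \<omega>"
    and up: "\<And>\<delta> n. 0 < \<delta> \<Longrightarrow> \<delta> \<le> d0 \<Longrightarrow> Z (\<delta> *\<^sub>R u) (int n) \<le> ennreal (C * exp (real n * lam \<delta>))"
    and lo: "\<And>\<delta> n. 0 < \<delta> \<Longrightarrow> \<delta> \<le> d0 \<Longrightarrow> ennreal (exp (real n * lam \<delta>)) \<le> Z (\<delta> *\<^sub>R u) (int n)"
    and z0: "\<And>n. Z 0 (int n) \<le> ennreal C"
    and s1: "\<And>\<delta>. 0 < \<delta> \<Longrightarrow> \<delta> \<le> d0 \<Longrightarrow> \<sigma> * \<delta> \<le> lam \<delta>"
    and s2: "\<And>e. 0 < e \<Longrightarrow> \<exists>\<delta>. 0 < \<delta> \<and> \<delta> \<le> d0 \<and> lam \<delta> \<le> (\<sigma> + e) * \<delta>"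
  shows "\<exists>n0. \<forall>n\<ge>n0. ennreal (1 / (4 * ((1 + exp 2) * C))) \<le>
     mu 0 {x \<in> lev (int n). \<bar>u \<bullet> vec_of_int x - real n * \<sigma>\<bar> \<le> \<omega> * real n}"
proof -
  let ?k = "(1 + exp 2) * C"
  have k: "?k \<ge> 1" using C by (smt (verit) exp_ge_zero mult_le_cancel_right1)
  \<comment> \<open>Makes exp (- q \<omega>) cancel the constant (1 + exp 2) C up to a factor 1/2,
    so that both tails together take at most half of exp (q \<sigma>).\<close>
  define q where "q = ln (2 * ?k) / \<omega>"
  have q: "0 < q" using k \<omega> by (simp add: q_def)
  have eq: "exp (- (q * \<omega>)) = 1 / (2 * ?k)" using \<omega> k by (simp add: q_def exp_minus inverse_eq_divide)
  \<comment> \<open>The tolerance 1 / q becomes the harmless summand 2 in the exponent at the double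
    tilt.\<close>
  obtain \<delta>1 where d1: "0 < \<delta>1" "\<delta>1 \<le> d0" "lam \<delta>1 \<le> (\<sigma> + 1 / q) * \<delta>1" using s2[of "1 / q"] q by auto
  obtain n0 where n0: "real n0 > 2 * q / \<delta>1" using reals_Archimedean2 by blast
  show ?thesis
  proof (intro exI[of _ n0] allI impI)
    fix n assume "n0 \<le> n"
    then have nq: "2 * q / \<delta>1 < real n" using n0 by linarith
    then have n: "0 < real n" using q d1 by (meson divide_pos_pos less_trans mult_pos_pos zero_less_numeral)
    let ?W = "{x \<in> lev (int n). \<bar>u \<bullet> vec_of_int x - real n * \<sigma>\<bar> \<le> \<omega> * real n}"
    let ?Y = "\<lambda>x. u \<bullet> vec_of_int x"
    have qn: "0 < q / real n" "q / real n \<le> d0"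
    proof -
      show "0 < q / real n" using q n by simp
      have "2 * q < real n * \<delta>1" using nq d1 by (simp add: field_simps)
      then have "q < real n * d0" using d1 q n by (smt (verit) mult_left_mono)
      then show "q / real n \<le> d0" using n by (simp add: field_simps)
    qed
    \<comment> \<open>Writes the double tilt 2 q / n as the fraction b of the fixed tilt
      \<delta>1.\<close>
    define b where "b = 2 * q / (real n * \<delta>1)"
    have b: "0 \<le> b" "b \<le> 1" "b * \<delta>1 = 2 * q / real n"
      using nq d1 n q by (auto simp: b_def field_simps)
    let ?r = "real n * lam \<delta>1"
    have br: "b * ?r \<le> 2 * (q * \<sigma>) + 2"
    proof -
      have "b * ?r = 2 * q * (lam \<delta>1 / \<delta>1)" using n d1 by (simp add: b_def)
      also have "\<dots> \<le> 2 * q * (\<sigma> + 1 / q)"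
        using d1 q by (intro mult_left_mono) (auto simp: field_simps)
      also have "\<dots> = 2 * (q * \<sigma>) + 2" using q by (simp add: field_simps)
      finally show ?thesis .
    qed
    \<comment> \<open>The rate is controlled from above only at \<delta>1. Convexity of exp
      interpolates between tilt 0 and tilt \<delta>1; normalising by \<open>?r\<close> makes both
      ends contribute the same constant C.\<close>
    have M2: "Z ((2 * q / real n) *\<^sub>R u) (int n) \<le> ennreal (exp (2 * (q * \<sigma>) + 2) * C)"
    proof -
      have "Z ((2 * q / real n) *\<^sub>R u) (int n) \<le> lsum (\<lambda>x. ennreal (exp (b * ?r) * (1 - b)) * (ennreal (w 0 x) * indicator (lev (int n)) x)
          + ennreal (exp (b * ?r) * b * exp (- ?r)) * (ennreal (w (\<delta>1 *\<^sub>R u) x) * indicator (lev (int n)) x))"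
        unfolding Z_def mu_def
      proof (rule lsum_mono)
        fix x
        have cx: "exp (b * (\<delta>1 * ?Y x - ?r)) \<le> (1 - b) + b * exp (\<delta>1 * ?Y x - ?r)"
          using convex_onD[OF exp_convex, of b 0 "\<delta>1 * ?Y x - ?r"] b by simp
        have "w ((2 * q / real n) *\<^sub>R u) x = w 0 x * exp (b * ?r) * exp (b * (\<delta>1 * ?Y x - ?r))"
        proof -
          have "(2 * q / real n) * ?Y x = b * ?r + b * (\<delta>1 * ?Y x - ?r)"
            unfolding b(3)[symmetric] by (simp add: algebra_simps)
          then have "exp ((2 * q / real n) * ?Y x) = exp (b * ?r) * exp (b * (\<delta>1 * ?Y x - ?r))" by (simp only: exp_add)
          then show ?thesis by (subst w_shift) (simp only: inner_scaleR_left mult.assoc)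
        qed
        also have "\<dots> \<le> w 0 x * exp (b * ?r) * ((1 - b) + b * exp (\<delta>1 * ?Y x - ?r))"
          by (intro mult_left_mono cx mult_nonneg_nonneg w_nonneg exp_ge_zero)
        also have "\<dots> = exp (b * ?r) * (1 - b) * w 0 x + exp (b * ?r) * b * exp (- ?r) * w (\<delta>1 *\<^sub>R u) x"
          by (subst (2) w_shift) (simp add: algebra_simps exp_diff exp_minus inverse_eq_divide)
        finally have "ennreal (w ((2 * q / real n) *\<^sub>R u) x) \<le> ennreal (exp (b * ?r) * (1 - b)) * ennreal (w 0 x) + ennreal (exp (b * ?r) * b * exp (- ?r)) * ennreal (w (\<delta>1 *\<^sub>R u) x)"
          using b by (simp add: ennreal_leI w_nonneg flip: ennreal_mult ennreal_plus)
        then show "ennreal (w ((2 * q / real n) *\<^sub>R u) x) * indicator (lev (int n)) x \<le> ennreal (exp (b * ?r) * (1 - b)) * (ennreal (w 0 x) * indicator (lev (int n)) x)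
          + ennreal (exp (b * ?r) * b * exp (- ?r)) * (ennreal (w (\<delta>1 *\<^sub>R u) x) * indicator (lev (int n)) x)"
          by (simp add: indicator_def)
      qed
      also have "\<dots> = ennreal (exp (b * ?r) * (1 - b)) * Z 0 (int n) + ennreal (exp (b * ?r) * b * exp (- ?r)) * Z (\<delta>1 *\<^sub>R u) (int n)"
        by (simp only: lsum_add lsum_cmult Z_def mu_def)
      also have "\<dots> \<le> ennreal (exp (b * ?r) * (1 - b)) * ennreal C + ennreal (exp (b * ?r) * b * exp (- ?r)) * ennreal (C * exp ?r)"
        by (intro add_mono mult_left_mono z0 up d1) auto
      also have "\<dots> = ennreal (exp (b * ?r) * (1 - b) * C + exp (b * ?r) * b * exp (- ?r) * (C * exp ?r))"
        using b C by (simp add: ennreal_plus ennreal_mult)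
      also have "exp (b * ?r) * (1 - b) * C + exp (b * ?r) * b * exp (- ?r) * (C * exp ?r) = exp (b * ?r) * C"
        by (simp add: algebra_simps exp_minus field_simps)
      also have "ennreal (exp (b * ?r) * C) \<le> ennreal (exp (2 * (q * \<sigma>) + 2) * C)"
        using br C by (intro ennreal_leI mult_right_mono) auto
      finally show ?thesis .
    qed
    have "ennreal (exp (q * \<sigma>)) \<le> ennreal (exp (real n * lam (q / real n)))"
    proof (intro ennreal_leI)
      have "\<sigma> * (q / real n) \<le> lam (q / real n)" by (rule s1[OF qn])
      then show "exp (q * \<sigma>) \<le> exp (real n * lam (q / real n))" using n by (simp add: field_simps)
    qed
    also have "\<dots> \<le> Z ((q / real n) *\<^sub>R u) (int n)" by (rule lo[OF qn])
    \<comment> \<open>The three terms dominate, in this order, the points below the window, those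
      above it (exponential Markov bound with the double tilt) and those inside it.\<close>
    also have "\<dots> \<le> lsum (\<lambda>x. ennreal (exp (q * \<sigma> - q * \<omega>)) * (ennreal (w 0 x) * indicator (lev (int n)) x)
        + (ennreal (exp (- (q * \<sigma>) - q * \<omega>)) * (ennreal (w ((2 * q / real n) *\<^sub>R u) x) * indicator (lev (int n)) x)
        + ennreal (exp (q * \<sigma> + q * \<omega>)) * (ennreal (w 0 x) * indicator ?W x)))"
      unfolding Z_def mu_def
    proof (rule lsum_mono)
      fix x
      show "ennreal (w ((q / real n) *\<^sub>R u) x) * indicator (lev (int n)) x \<le> ennreal (exp (q * \<sigma> - q * \<omega>)) * (ennreal (w 0 x) * indicator (lev (int n)) x)
        + (ennreal (exp (- (q * \<sigma>) - q * \<omega>)) * (ennreal (w ((2 * q / real n) *\<^sub>R u) x) * indicator (lev (int n)) x)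
        + ennreal (exp (q * \<sigma> + q * \<omega>)) * (ennreal (w 0 x) * indicator ?W x))"
      proof (cases "x \<in> lev (int n)")
        case True
        have e: "w ((q / real n) *\<^sub>R u) x = w 0 x * exp (q * (?Y x / real n))"
          by (subst w_shift) (simp add: field_simps)
        have e2: "w ((2 * q / real n) *\<^sub>R u) x = w 0 x * exp (2 * (q * (?Y x / real n)))"
          by (subst w_shift) (simp add: field_simps)
        consider "x \<in> ?W" | "?Y x / real n < \<sigma> - \<omega>" | "?Y x / real n > \<sigma> + \<omega>"
          using True n by (fastforce simp: field_simps abs_le_iff)
        then show ?thesis
        proof cases
          case 1
          have "?Y x / real n \<le> \<sigma> + \<omega>" using 1 n by (auto simp: field_simps abs_le_iff)
          then have "q * (?Y x / real n) \<le> q * (\<sigma> + \<omega>)" using q by (intro mult_left_mono) auto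
          then have "w ((q / real n) *\<^sub>R u) x \<le> exp (q * \<sigma> + q * \<omega>) * w 0 x"
            unfolding e using w_nonneg[of 0 x] by (subst mult.commute, intro mult_right_mono) (auto simp: algebra_simps)
          then have "ennreal (w ((q / real n) *\<^sub>R u) x) \<le> ennreal (exp (q * \<sigma> + q * \<omega>)) * ennreal (w 0 x)"
            by (simp add: ennreal_leI flip: ennreal_mult')
          then show ?thesis using True 1 by (simp add: add_increasing)
        next
          case 2
          then have "q * (?Y x / real n) \<le> q * (\<sigma> - \<omega>)" using q by (intro mult_left_mono) auto
          then have "w ((q / real n) *\<^sub>R u) x \<le> exp (q * \<sigma> - q * \<omega>) * w 0 x"
            unfolding e using w_nonneg[of 0 x] by (subst mult.commute, intro mult_right_mono) (auto simp: algebra_simps)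
          then have "ennreal (w ((q / real n) *\<^sub>R u) x) \<le> ennreal (exp (q * \<sigma> - q * \<omega>)) * ennreal (w 0 x)"
            by (simp add: ennreal_leI flip: ennreal_mult')
          then show ?thesis using True by (simp add: add_increasing2)
        next
          case 3
          then have "q * (\<sigma> + \<omega>) \<le> q * (?Y x / real n)" using q by (intro mult_left_mono) auto
          then have "q * \<sigma> + q * \<omega> \<le> q * (?Y x / real n)" by (simp only: distrib_left)
          moreover have "y \<le> - s1 - s2 + 2 * y" if "s1 + s2 \<le> y" for s1 s2 y :: real using that by linarith
          ultimately have "q * (?Y x / real n) \<le> - (q * \<sigma>) - q * \<omega> + 2 * (q * (?Y x / real n))" by blast
          then have "exp (q * (?Y x / real n)) \<le> exp (- (q * \<sigma>) - q * \<omega> + 2 * (q * (?Y x / real n)))" by (simp only: exp_le_cancel_iff)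
          then have "w 0 x * exp (q * (?Y x / real n)) \<le> w 0 x * (exp (- (q * \<sigma>) - q * \<omega>) * exp (2 * (q * (?Y x / real n))))"
            unfolding exp_add by (intro mult_left_mono w_nonneg)
          then have "w ((q / real n) *\<^sub>R u) x \<le> exp (- (q * \<sigma>) - q * \<omega>) * w ((2 * q / real n) *\<^sub>R u) x"
            unfolding e e2 by (simp only: mult_ac)
          then have "ennreal (w ((q / real n) *\<^sub>R u) x) \<le> ennreal (exp (- (q * \<sigma>) - q * \<omega>)) * ennreal (w ((2 * q / real n) *\<^sub>R u) x)"
            by (simp add: ennreal_leI flip: ennreal_mult')
          then show ?thesis using True by (simp add: add_increasing add_increasing2)
        qed
      qed simp
    qed
    also have "\<dots> = ennreal (exp (q * \<sigma> - q * \<omega>)) * Z 0 (int n) + (ennreal (exp (- (q * \<sigma>) - q * \<omega>)) * Z ((2 * q / real n) *\<^sub>R u) (int n)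
        + ennreal (exp (q * \<sigma> + q * \<omega>)) * mu 0 ?W)"
      by (simp only: lsum_add lsum_cmult Z_def mu_def)
    also have "\<dots> \<le> ennreal (exp (q * \<sigma> - q * \<omega>)) * ennreal C + (ennreal (exp (- (q * \<sigma>) - q * \<omega>)) * ennreal (exp (2 * (q * \<sigma>) + 2) * C)
        + ennreal (exp (q * \<sigma> + q * \<omega>)) * mu 0 ?W)"
      by (intro add_mono mult_left_mono z0 M2 order_refl) auto
    also have "\<dots> = ennreal (exp (q * \<sigma> - q * \<omega>) * C + exp (- (q * \<sigma>) - q * \<omega>) * (exp (2 * (q * \<sigma>) + 2) * C)) + ennreal (exp (q * \<sigma> + q * \<omega>)) * mu 0 ?W"
      using C by (simp add: ennreal_plus ennreal_mult add.assoc)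
    also have "exp (q * \<sigma> - q * \<omega>) * C + exp (- (q * \<sigma>) - q * \<omega>) * (exp (2 * (q * \<sigma>) + 2) * C) = exp (q * \<sigma>) / 2"
    proof -
      have 1: "exp (q * \<sigma> - q * \<omega>) = exp (q * \<sigma>) * exp (- (q * \<omega>))" by (simp flip: exp_add)
      have "exp (- (q * \<sigma>) - q * \<omega>) * exp (2 * (q * \<sigma>) + 2) = exp (q * \<sigma>) * exp (- (q * \<omega>)) * exp 2"
        by (simp flip: exp_add)
      then have "exp (q * \<sigma> - q * \<omega>) * C + exp (- (q * \<sigma>) - q * \<omega>) * (exp (2 * (q * \<sigma>) + 2) * C) = exp (q * \<sigma>) * exp (- (q * \<omega>)) * ?k"
        unfolding 1 by (simp add: algebra_simps)
      also have "\<dots> = exp (q * \<sigma>) / 2"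
      proof -
        have "x * (1 / (2 * y)) * y = x / 2" if "1 \<le> y" for x y :: real using that by simp
        from this[OF k] show ?thesis unfolding eq .
      qed
      finally show ?thesis .
    qed
    finally have main: "ennreal (exp (q * \<sigma>)) \<le> ennreal (exp (q * \<sigma>) / 2) + ennreal (exp (q * \<sigma> + q * \<omega>)) * mu 0 ?W" .
    show "ennreal (1 / (4 * ?k)) \<le> mu 0 ?W"
    proof (cases "mu 0 ?W = \<top>")
      case False
      then obtain m where m: "mu 0 ?W = ennreal m" "0 \<le> m" by (cases "mu 0 ?W") auto
      have "ennreal (exp (q * \<sigma>)) \<le> ennreal (exp (q * \<sigma>) / 2 + exp (q * \<sigma> + q * \<omega>) * m)"
        using main m by (simp add: ennreal_plus ennreal_mult)
      then have "exp (q * \<sigma>) \<le> exp (q * \<sigma>) / 2 + exp (q * \<sigma> + q * \<omega>) * m"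
        using m by (subst (asm) ennreal_le_iff) auto
      moreover have "x * (1 / 2) \<le> x * (y * m)" if "x \<le> x / 2 + x * y * m" for x y :: real using that by (simp add: mult.assoc)
      ultimately have "exp (q * \<sigma>) * (1 / 2) \<le> exp (q * \<sigma>) * (exp (q * \<omega>) * m)" by (simp only: exp_add)
      then have "1 / 2 \<le> exp (q * \<omega>) * m" by (simp only: mult_le_cancel_left_pos exp_gt_zero)
      then have "exp (- (q * \<omega>)) * (1 / 2) \<le> exp (- (q * \<omega>)) * (exp (q * \<omega>) * m)" by (intro mult_left_mono) auto
      moreover have "exp (- (q * \<omega>)) * exp (q * \<omega>) = 1" by (simp flip: exp_add)
      ultimately have "exp (- (q * \<omega>)) * (1 / 2) \<le> m" by (simp only: mult.assoc[symmetric] mult_1_left)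
      then have "1 / (2 * ?k) * (1 / 2) \<le> m" unfolding eq .
      then show ?thesis unfolding m by (intro ennreal_leI) simp
    qed simp
  qed
qed

end


lemma linear_growth_le:
  fixes a b c :: real
  assumes "\<And>n::nat. real n * a \<le> real n * b + c"
  shows "a \<le> b"
proof (rule ccontr)
  assume "\<not> a \<le> b"
  then have p: "0 < a - b" by simp
  obtain n :: nat where "real n > c / (a - b)" using reals_Archimedean2 by blast
  then have "c < real n * (a - b)" using p by (simp add: field_simps)
  then show False using assms[of n] by (simp add: algebra_simps)
qed

context face begin

text \<open>The vertices of \<open>face_points\<close> near the ray of \<open>e\<close> alone make
  the tilted sum grow at this rate, up to an arbitrarily small \<eta>.\<close>

lemma rate_slope:
  assumes e: "f e = 0" "e \<noteq> 0" and l: "\<And>n::nat. Z h (int n) \<le> ennreal (exp c * exp (real n * l))"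
  shows "h \<bullet> e / LR e \<le> l"
proof (rule field_le_epsilon)
  fix \<eta> :: real assume \<eta>: "0 < \<eta>"
  obtain B C where BC: "0 \<le> B" "0 \<le> C" and pts: "\<And>k::nat. \<exists>v. L v = int k \<and> w 0 v \<ge> exp (- \<eta> * real k - C)
    \<and> norm (vec_of_int v - (real k / LR e) *\<^sub>R e) \<le> B"
    using face_points[OF e \<eta>] by blast
  show "h \<bullet> e / LR e \<le> l + \<eta>"
  proof (rule linear_growth_le)
    fix n :: nat
    obtain v where v: "L v = int n" "w 0 v \<ge> exp (- \<eta> * real n - C)" "norm (vec_of_int v - (real n / LR e) *\<^sub>R e) \<le> B"
      using pts by blast
    have "\<bar>h \<bullet> (vec_of_int v - (real n / LR e) *\<^sub>R e)\<bar> \<le> norm h * norm (vec_of_int v - (real n / LR e) *\<^sub>R e)"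
      by (rule Cauchy_Schwarz_ineq2)
    also have "\<dots> \<le> norm h * B" by (rule mult_left_mono[OF v(3)]) simp
    finally have hv: "real n * (h \<bullet> e / LR e) - norm h * B \<le> h \<bullet> vec_of_int v"
      by (simp add: inner_diff_right)
    have "exp (- \<eta> * real n - C) * exp (real n * (h \<bullet> e / LR e) - norm h * B) \<le> w 0 v * exp (h \<bullet> vec_of_int v)"
      using v(2) hv by (intro mult_mono w_nonneg) auto
    also have "\<dots> = w h v" by (rule w_shift[symmetric])
    finally have "ennreal (exp (- \<eta> * real n - C + (real n * (h \<bullet> e / LR e) - norm h * B))) \<le> ennreal (w h v)"
      by (intro ennreal_leI) (simp only: exp_add)
    also have "\<dots> \<le> Z h (int n)" unfolding Z_def by (rule mu_point) (simp add: lev_def v)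
    also have "\<dots> \<le> ennreal (exp (c + real n * l))" using l[of n] by (simp only: exp_add)
    finally have "- \<eta> * real n - C + (real n * (h \<bullet> e / LR e) - norm h * B) \<le> c + real n * l"
      by (simp add: ennreal_le_iff)
    then show "real n * (h \<bullet> e / LR e) \<le> real n * (l + \<eta>) + (c + C + norm h * B)"
      by (simp add: algebra_simps)
  qed
qed

text \<open>\<open>Z_upper\<close> allows growth of at most exp (\<theta> n) for every small
  \<theta>. With \<open>growth_rate\<close> this bounds the untilted sums by a constant.\<close>

lemma rate_zero:
  assumes l: "\<And>n::nat. ennreal (exp (real n * l)) \<le> Z 0 (int n)"
  shows "l \<le> 0"
proof (rule field_le_epsilon)
  fix e :: real assume e: "0 < e"
  define \<theta> where "\<theta> = min 1 e"
  have \<theta>: "0 < \<theta>" "\<theta> \<le> 1" "\<theta> \<le> e" using e by (auto simp: \<theta>_def)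
  have "EE (\<theta> * c0 / 2) < \<infinity>" using \<theta> c0(1) by (intro EE_finite) auto
  then obtain E where E: "EE (\<theta> * c0 / 2) = ennreal E" "0 \<le> E" by (cases "EE (\<theta> * c0 / 2)") auto
  have "l \<le> \<theta>"
  proof (rule linear_growth_le)
    fix n :: nat
    have "ennreal (exp (real n * l)) \<le> Z 0 (int n)" by (rule l)
    also have "\<dots> \<le> ennreal (exp (\<theta> * \<bar>real_of_int (int n)\<bar>)) * EE (\<theta> * c0 / 2)"
      by (rule Z_upper) (use \<theta> c0(1) in auto)
    also have "\<dots> \<le> ennreal (exp (real n * \<theta> + ln (E + 1)))"
      unfolding E(1) using E(2) by (subst ennreal_mult[symmetric]) (auto intro!: ennreal_leI mult_left_mono simp: exp_add mult.commute)
    finally show "real n * l \<le> real n * \<theta> + ln (E + 1)" by (simp add: ennreal_le_iff)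
  qed
  then show "l \<le> 0 + e" using \<theta> by simp
qed

text \<open>If the face had two directions, the tilted measure on level \<open>M n\<close> would charge, with a weight
  bounded below, each of the \<open>M - 1\<close> disjoint sets of endpoints reached by following one extreme slope
  up to level \<open>i n\<close> and the other one afterwards; but the total weight of a level is bounded.\<close>

lemma face_unique_direction:
  assumes vb: "f vb = 0" "vb \<noteq> 0"
  shows "va /\<^sub>R LR va = vb /\<^sub>R LR vb"
proof (rule ccontr)
  assume neq: "va /\<^sub>R LR va \<noteq> vb /\<^sub>R LR vb"
  \<comment> \<open>Tilting along the difference of the two normalised directions makes their slopes
    \<alpha> and \<beta> differ by |u|^2.\<close>
  define u where "u = va /\<^sub>R LR va - vb /\<^sub>R LR vb"
  have u: "u \<noteq> 0" using neq by (simp add: u_def)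
  obtain KK c \<epsilon> where c: "0 \<le> c" "0 < \<epsilon>" and rat: "ratio KK 0" and gr: "\<And>h. norm h \<le> \<epsilon> \<Longrightarrow> (\<exists>l. \<forall>n::nat.
     ennreal (exp (real n * l)) \<le> Z h (int n) \<and> Z h (int n) \<le> ennreal (exp c * exp (real n * l)))"
    using growth_rate by blast
  define lam where "lam h = (SOME l. \<forall>n::nat. ennreal (exp (real n * l)) \<le> Z h (int n) \<and> Z h (int n) \<le> ennreal (exp c * exp (real n * l)))" for h
  have lam: "ennreal (exp (real n * lam h)) \<le> Z h (int n)" "Z h (int n) \<le> ennreal (exp c * exp (real n * lam h))"
    if "norm h \<le> \<epsilon>" for h and n :: nat
    using someI_ex[OF gr[OF that]] unfolding lam_def by blast+
  define C where "C = exp c"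
  have C: "1 \<le> C" using c by (simp add: C_def)
  have z0: "Z 0 (int n) \<le> ennreal C" for n
  proof -
    have "lam 0 \<le> 0" by (rule rate_zero) (use lam c in simp)
    then have "real n * lam 0 \<le> 0" by (simp add: mult_nonneg_nonpos)
    then have le: "exp c * exp (real n * lam 0) \<le> C" by (simp add: C_def mult_left_le)
    have "Z 0 (int n) \<le> ennreal (exp c * exp (real n * lam 0))" by (rule lam(2)) (use c in simp)
    also have "\<dots> \<le> ennreal C" by (rule ennreal_leI[OF le])
    finally show ?thesis .
  qed
  define d0 where "d0 = \<epsilon> / norm u"
  have d0: "0 < d0" using u c by (simp add: d0_def)
  have small: "norm (\<delta> *\<^sub>R v) \<le> \<epsilon>" if "0 < \<delta>" "\<delta> \<le> d0" "v = u \<or> v = - u" for \<delta> v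
    using that u by (auto simp: d0_def field_simps)
  define \<alpha> where "\<alpha> = u \<bullet> va / LR va"
  define \<beta> where "\<beta> = u \<bullet> vb / LR vb"
  have ab: "\<alpha> - \<beta> > 0"
  proof -
    have "\<alpha> - \<beta> = u \<bullet> (va /\<^sub>R LR va - vb /\<^sub>R LR vb)"
      by (simp add: \<alpha>_def \<beta>_def inner_diff_right divide_inverse mult.commute)
    also have "\<dots> = u \<bullet> u" by (simp add: u_def)
    finally show ?thesis using u by simp
  qed
  have slope1: "\<delta> * \<alpha> \<le> lam (\<delta> *\<^sub>R u)" if "0 < \<delta>" "\<delta> \<le> d0" for \<delta>
  proof -
    have "(\<delta> *\<^sub>R u) \<bullet> va / LR va \<le> lam (\<delta> *\<^sub>R u)"
      by (rule rate_slope[OF f_va va]) (rule lam(2)[OF small[OF that]], simp)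
    then show ?thesis by (simp add: \<alpha>_def)
  qed
  have slope2: "\<delta> * (- \<beta>) \<le> lam (\<delta> *\<^sub>R - u)" if "0 < \<delta>" "\<delta> \<le> d0" for \<delta>
  proof -
    have "(\<delta> *\<^sub>R - u) \<bullet> vb / LR vb \<le> lam (\<delta> *\<^sub>R - u)"
      by (rule rate_slope[OF vb]) (rule lam(2)[OF small[OF that]], simp)
    then show ?thesis by (simp add: \<beta>_def)
  qed
  \<comment> \<open>The infimum of rate over tilt serves as one-sided derivative; it provides
    exactly the two slope hypotheses of \<open>window\<close>.\<close>
  have inf: "\<exists>\<sigma>. a \<le> \<sigma> \<and> (\<forall>\<delta>. 0 < \<delta> \<longrightarrow> \<delta> \<le> d0 \<longrightarrow> \<sigma> * \<delta> \<le> g \<delta>) \<and> (\<forall>e>0. \<exists>\<delta>. 0 < \<delta> \<and> \<delta> \<le> d0 \<and> g \<delta> \<le> (\<sigma> + e) * \<delta>)"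
    if *: "\<And>\<delta>. 0 < \<delta> \<Longrightarrow> \<delta> \<le> d0 \<Longrightarrow> \<delta> * a \<le> g \<delta>" for g and a :: real
  proof (rule exI[of _ "Inf ((\<lambda>\<delta>. g \<delta> / \<delta>) ` {0<..d0})"], intro conjI allI impI)
    let ?X = "(\<lambda>\<delta>. g \<delta> / \<delta>) ` {0<..d0}"
    have ne: "?X \<noteq> {}" using d0 by auto
    have lb: "x \<in> ?X \<Longrightarrow> a \<le> x" for x using * by (auto simp: field_simps)
    have bdd: "bdd_below ?X" using lb by (rule bdd_belowI)
    show "a \<le> Inf ?X" by (rule cInf_greatest[OF ne lb])
    show "Inf ?X * \<delta> \<le> g \<delta>" if "0 < \<delta>" "\<delta> \<le> d0" for \<delta>
    proof -
      have "Inf ?X \<le> g \<delta> / \<delta>" by (rule cInf_lower[OF _ bdd]) (use that in auto)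
      then show ?thesis using that by (simp add: field_simps)
    qed
    show "\<exists>\<delta>. 0 < \<delta> \<and> \<delta> \<le> d0 \<and> g \<delta> \<le> (Inf ?X + e) * \<delta>" if "0 < e" for e
    proof -
      have "\<exists>x\<in>?X. x < Inf ?X + e" using cInf_less_iff[OF ne bdd, of "Inf ?X + e"] that by simp
      then obtain \<delta> where "0 < \<delta>" "\<delta> \<le> d0" "g \<delta> / \<delta> < Inf ?X + e" by auto
      then show ?thesis by (intro exI[of _ \<delta>]) (auto simp: field_simps)
    qed
  qed
  obtain \<sigma> where s: "\<alpha> \<le> \<sigma>" "\<And>\<delta>. 0 < \<delta> \<Longrightarrow> \<delta> \<le> d0 \<Longrightarrow> \<sigma> * \<delta> \<le> lam (\<delta> *\<^sub>R u)"
    "\<And>e. 0 < e \<Longrightarrow> \<exists>\<delta>. 0 < \<delta> \<and> \<delta> \<le> d0 \<and> lam (\<delta> *\<^sub>R u) \<le> (\<sigma> + e) * \<delta>"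
    using inf[of \<alpha> "\<lambda>\<delta>. lam (\<delta> *\<^sub>R u)"] slope1 by blast
  obtain \<tau> where t: "- \<beta> \<le> \<tau>" "\<And>\<delta>. 0 < \<delta> \<Longrightarrow> \<delta> \<le> d0 \<Longrightarrow> \<tau> * \<delta> \<le> lam (\<delta> *\<^sub>R - u)"
    "\<And>e. 0 < e \<Longrightarrow> \<exists>\<delta>. 0 < \<delta> \<and> \<delta> \<le> d0 \<and> lam (\<delta> *\<^sub>R - u) \<le> (\<tau> + e) * \<delta>"
    using inf[of "- \<beta>" "\<lambda>\<delta>. lam (\<delta> *\<^sub>R - u)"] slope2 by blast
  \<comment> \<open>The extreme slopes are \<sigma> and - \<tau>; their gap is at least \<alpha> -
    \<beta>, hence positive.\<close>
  define \<Delta> where "\<Delta> = \<sigma> + \<tau>"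
  have \<Delta>: "0 < \<Delta>" using s(1) t(1) ab by (simp add: \<Delta>_def)
  define m0 where "m0 = 1 / (4 * ((1 + exp 2) * C))"
  have m0: "0 < m0" using C by (simp add: m0_def add_pos_pos)
  \<comment> \<open>The error parameter is chosen so that, with both level sums at most C, the error
    is half of m0^2.\<close>
  obtain N1 where N1: "0 < N1" and qm: "\<And>n m A B. 0 \<le> n \<Longrightarrow> 0 \<le> m \<Longrightarrow> A \<subseteq> lev n \<Longrightarrow> B \<subseteq> lev m \<Longrightarrow>
     mu 0 A * mu 0 B \<le> ennreal N1 * mu 0 (splus A B) + ennreal (m0\<^sup>2 / (2 * C\<^sup>2)) * (Z 0 n * Z 0 m)"
    using QM[of "m0\<^sup>2 / (2 * C\<^sup>2)" KK] rat m0 C by fastforce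
  define m1 where "m1 = m0\<^sup>2 / (2 * N1)"
  have m1: "0 < m1" using m0 N1 by (simp add: m1_def)
  \<comment> \<open>Enough wall positions for M - 1 masses of size m1 to exceed the bound C on a
    level.\<close>
  obtain M :: nat where M: "real M > C / m1 + 1" using reals_Archimedean2 by blast
  have M0: "0 < real M" using M C m1 by (smt (verit) divide_nonneg_pos)
  \<comment> \<open>Consecutive wall positions shift the centre by n \<Delta>, while two windows
    together have half-widths 2 \<omega> M n = n \<Delta> / 2; so they are disjoint.\<close>
  define \<omega> where "\<omega> = \<Delta> / (4 * real M)"
  have \<omega>: "0 < \<omega>" using \<Delta> M0 by (simp add: \<omega>_def)
  obtain na where na: "\<And>n. n \<ge> na \<Longrightarrow> ennreal m0 \<le> mu 0 {x \<in> lev (int n). \<bar>u \<bullet> vec_of_int x - real n * \<sigma>\<bar> \<le> \<omega> * real n}"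
  proof -
    have "\<exists>n0. \<forall>n\<ge>n0. ennreal (1 / (4 * ((1 + exp 2) * C))) \<le> mu 0 {x \<in> lev (int n). \<bar>u \<bullet> vec_of_int x - real n * \<sigma>\<bar> \<le> \<omega> * real n}"
      by (rule window[OF d0 C \<omega>, of u "\<lambda>\<delta>. lam (\<delta> *\<^sub>R u)" \<sigma>])
        (simp_all only: C_def lam small z0[unfolded C_def] s(2,3) simp_thms)
    then show ?thesis using that unfolding m0_def by blast
  qed
  obtain nb where nb: "\<And>n. n \<ge> nb \<Longrightarrow> ennreal m0 \<le> mu 0 {x \<in> lev (int n). \<bar>- u \<bullet> vec_of_int x - real n * \<tau>\<bar> \<le> \<omega> * real n}"
  proof -
    have "\<exists>n0. \<forall>n\<ge>n0. ennreal (1 / (4 * ((1 + exp 2) * C))) \<le> mu 0 {x \<in> lev (int n). \<bar>- u \<bullet> vec_of_int x - real n * \<tau>\<bar> \<le> \<omega> * real n}"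
      by (rule window[OF d0 C \<omega>, of "- u" "\<lambda>\<delta>. lam (\<delta> *\<^sub>R - u)" \<tau>])
        (simp_all only: C_def lam small z0[unfolded C_def] t(2,3) simp_thms)
    then show ?thesis using that unfolding m0_def by blast
  qed
  define n where "n = Suc (max na nb)"
  have n: "n \<ge> na" "n \<ge> nb" "n > 0" by (auto simp: n_def)
  let ?A = "\<lambda>i. {x \<in> lev (int (i * n)). \<bar>u \<bullet> vec_of_int x - real (i * n) * \<sigma>\<bar> \<le> \<omega> * real (i * n)}"
  let ?B = "\<lambda>i. {x \<in> lev (int ((M - i) * n)). \<bar>- u \<bullet> vec_of_int x - real ((M - i) * n) * \<tau>\<bar> \<le> \<omega> * real ((M - i) * n)}"
  have mass: "ennreal m1 \<le> mu 0 (splus (?A i) (?B i))" if i: "i \<in> {1..<M}" for i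
  proof -
    have ge: "n \<le> i * n" "n \<le> (M - i) * n" using i by auto
    have "ennreal m0 * ennreal m0 \<le> mu 0 (?A i) * mu 0 (?B i)"
      by (intro mult_mono na nb order_trans[OF n(1) ge(1)] order_trans[OF n(2) ge(2)]) auto
    also have "\<dots> \<le> ennreal N1 * mu 0 (splus (?A i) (?B i)) + ennreal (m0\<^sup>2 / (2 * C\<^sup>2)) * (Z 0 (int (i * n)) * Z 0 (int ((M - i) * n)))"
      by (rule qm) auto
    also have "\<dots> \<le> ennreal N1 * mu 0 (splus (?A i) (?B i)) + ennreal (m0\<^sup>2 / (2 * C\<^sup>2)) * (ennreal C * ennreal C)"
      by (intro add_left_mono mult_left_mono mult_mono z0) auto
    also have "ennreal (m0\<^sup>2 / (2 * C\<^sup>2)) * (ennreal C * ennreal C) = ennreal (m0\<^sup>2 / 2)"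
    proof -
      have "m0\<^sup>2 / (2 * C\<^sup>2) * (C * C) = m0\<^sup>2 / 2" using C by (simp add: power2_eq_square)
      then show ?thesis using C m0 by (subst ennreal_mult[symmetric], simp, simp)+ simp
    qed
    finally have le: "ennreal m0 * ennreal m0 \<le> ennreal N1 * mu 0 (splus (?A i) (?B i)) + ennreal (m0\<^sup>2 / 2)" .
    show ?thesis
    proof (cases "mu 0 (splus (?A i) (?B i)) = \<top>")
      case False
      then obtain m where m: "mu 0 (splus (?A i) (?B i)) = ennreal m" "0 \<le> m" by (cases "mu 0 (splus (?A i) (?B i))") auto
      have "ennreal (m0 * m0) \<le> ennreal (N1 * m + m0\<^sup>2 / 2)"
        using le m0 N1 m(2) unfolding m(1) by (subst ennreal_plus) (simp_all add: ennreal_mult)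
      then have "m0 * m0 \<le> N1 * m + m0\<^sup>2 / 2" using N1 m(2) by (subst (asm) ennreal_le_iff) auto
      then have "m1 \<le> m" using N1 by (simp add: m1_def field_simps power2_eq_square)
      then show ?thesis unfolding m(1) by (rule ennreal_leI)
    qed simp
  qed
  have loc: "\<bar>u \<bullet> vec_of_int z - (real (i * n) * \<sigma> - real ((M - i) * n) * \<tau>)\<bar> \<le> \<omega> * real (M * n)"
    if i: "i \<in> {1..<M}" and z: "z \<in> splus (?A i) (?B i)" for i z
  proof -
    obtain x y where xy: "z = x + y" "\<bar>u \<bullet> vec_of_int x - real (i * n) * \<sigma>\<bar> \<le> \<omega> * real (i * n)"
      "\<bar>- u \<bullet> vec_of_int y - real ((M - i) * n) * \<tau>\<bar> \<le> \<omega> * real ((M - i) * n)" using z by (auto simp: splus_def)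
    have "i * n + (M - i) * n = M * n" using i by (simp flip: distrib_right)
    then have "real (i * n) + real ((M - i) * n) = real (M * n)" by (simp only: of_nat_add[symmetric])
    then have "\<omega> * real (i * n) + \<omega> * real ((M - i) * n) = \<omega> * real (M * n)" by (simp only: distrib_left[symmetric])
    moreover have "u \<bullet> vec_of_int z = u \<bullet> vec_of_int x + u \<bullet> vec_of_int y" by (simp add: xy vec_of_int_add inner_add_right)
    moreover have "- u \<bullet> vec_of_int y = - (u \<bullet> vec_of_int y)" by simp
    ultimately show ?thesis using xy(2,3) by linarith
  qed
  have center: "real (i * n) * \<sigma> - real ((M - i) * n) * \<tau> = real i * real n * \<Delta> - real (M * n) * \<tau>" if "i \<in> {1..<M}" for i
    using that by (simp add: \<Delta>_def of_nat_diff algebra_simps)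
  have disj: "disjoint_family_on (\<lambda>i. splus (?A i) (?B i)) {1..<M}"
    unfolding disjoint_family_on_def
  proof (intro ballI impI, rule ccontr)
    fix i j assume ij: "i \<in> {1..<M}" "j \<in> {1..<M}" "i \<noteq> j" and "splus (?A i) (?B i) \<inter> splus (?A j) (?B j) \<noteq> {}"
    then obtain z where z: "z \<in> splus (?A i) (?B i)" "z \<in> splus (?A j) (?B j)" by auto
    have "\<bar>real i * real n * \<Delta> - real j * real n * \<Delta>\<bar> \<le> 2 * (\<omega> * real (M * n))"
      using loc[OF ij(1) z(1)] loc[OF ij(2) z(2)] center[OF ij(1)] center[OF ij(2)] by linarith
    also have "2 * (\<omega> * real (M * n)) = \<Delta> * real n / 2" using M0 by (simp add: \<omega>_def)
    also have "real i * real n * \<Delta> - real j * real n * \<Delta> = (real i - real j) * (real n * \<Delta>)" by (simp add: algebra_simps)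
    finally have "\<bar>real i - real j\<bar> * (real n * \<Delta>) \<le> real n * \<Delta> / 2" using \<Delta> by (simp add: abs_mult mult.commute)
    moreover have "1 * (real n * \<Delta>) \<le> \<bar>real i - real j\<bar> * (real n * \<Delta>)"
      using ij(3) \<Delta> by (intro mult_right_mono) auto
    moreover have "0 < real n * \<Delta>" using n \<Delta> by simp
    ultimately show False by linarith
  qed
  have "ennreal (real (M - 1) * m1) = (\<Sum>i\<in>{1..<M}. ennreal m1)"
    by (simp add: ennreal_mult' ennreal_of_nat_eq_real_of_nat)
  also have "\<dots> \<le> (\<Sum>i\<in>{1..<M}. mu 0 (splus (?A i) (?B i)))" by (rule sum_mono) (rule mass)
  also have "\<dots> = mu 0 (\<Union>i\<in>{1..<M}. splus (?A i) (?B i))" by (rule mu_UN_disjoint[symmetric]) (use disj in auto)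
  also have "\<dots> \<le> Z 0 (int (M * n))"
    unfolding Z_def
  proof (intro mu_mono UN_least)
    fix i assume i: "i \<in> {1..<M}"
    have "splus (?A i) (?B i) \<subseteq> lev (int (i * n) + int ((M - i) * n))" by (rule splus_lev) auto
    also have "int (i * n) + int ((M - i) * n) = int (M * n)" using i by (simp flip: distrib_right of_nat_add)
    finally show "splus (?A i) (?B i) \<subseteq> lev (int (M * n))" .
  qed
  also have "\<dots> \<le> ennreal C" by (rule z0)
  finally have "real (M - 1) * m1 \<le> C" using C by (simp add: ennreal_le_iff)
  moreover have "C / m1 < real (M - 1)" using M by (simp add: of_nat_diff)
  then have "C < real (M - 1) * m1" using m1 by (simp add: field_simps)
  ultimately show False by simp
qed

end

section \<open>From faces to the strict triangle inequality\<close>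

context subcrit begin

text \<open>Separate \<open>v\<close> from the convex set of points of smaller norm, then rescale
  the normal so that it equals \<open>xi v\<close> at \<open>v\<close>.\<close>

lemma supporting_functional:
  assumes "v \<noteq> 0"
  shows "\<exists>s. s \<bullet> v = xi v \<and> (\<forall>z. s \<bullet> z \<le> xi z)"
proof -
  obtain c where c: "c > 0" "\<And>x :: real ^ 'd. c * norm x \<le> xi x" using xi_lower by blast
  have pos: "0 < xi z" if "z \<noteq> 0" for z using c(2)[of z] c(1) that by (smt (verit) mult_pos_pos zero_less_norm_iff)
  let ?S = "{z. xi z < xi v}"
  have "convex ?S"
    unfolding convex_def
  proof (intro ballI allI impI, clarify)
    fix x y and a b :: real
    assume *: "xi x < xi v" "xi y < xi v" "0 \<le> a" "0 \<le> b" "a + b = 1"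
    have "xi (a *\<^sub>R x + b *\<^sub>R y) \<le> a * xi x + b * xi y"
      using xi_triangle[of "a *\<^sub>R x" "b *\<^sub>R y"] * by (simp add: xi_scale)
    also have "\<dots> < xi v" by (rule convex_bound_lt[of _ _ _ a b]) (use * in auto)
    finally show "xi (a *\<^sub>R x + b *\<^sub>R y) < xi v" .
  qed
  moreover have S0: "0 \<in> ?S" using pos[OF assms] by simp
  ultimately obtain q b where q: "q \<noteq> 0" "\<And>x. xi x < xi v \<Longrightarrow> q \<bullet> x \<le> b" "b \<le> q \<bullet> v"
    using separating_hyperplane_sets[of ?S "{v}"] by auto
  \<comment> \<open>Test the separation at a multiple of the normal itself that is short enough to
    lie in the set.\<close>
  have qv: "0 < q \<bullet> v"
  proof -
    let ?r = "xi v / (2 * xi q)"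
    have "xi (?r *\<^sub>R q) = xi v / 2" using pos[OF q(1)] pos[OF assms] by (subst xi_scale) auto
    then have "q \<bullet> (?r *\<^sub>R q) \<le> q \<bullet> v" using q(2)[of "?r *\<^sub>R q"] q(3) pos[OF assms] by linarith
    moreover have "0 < q \<bullet> (?r *\<^sub>R q)" using pos[OF q(1)] pos[OF assms] q(1) by simp
    ultimately show ?thesis by linarith
  qed
  define s where "s = (xi v / (q \<bullet> v)) *\<^sub>R q"
  have "s \<bullet> z \<le> xi z" for z
  proof (cases "z = 0")
    case False
    have "q \<bullet> z * xi v \<le> (q \<bullet> v) * xi z"
    \<comment> \<open>The separated set is defined by a strict inequality, so z is scaled to norm r
      \<open>xi v\<close> with r < 1 and r tends to 1.\<close>
    proof (rule field_le_mult_one_interval)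
      fix r :: real assume r: "0 < r" "r < 1"
      let ?z = "(r * xi v / xi z) *\<^sub>R z"
      have "xi ?z = r * xi v" using pos[OF False] pos[OF assms] r by (subst xi_scale) auto
      also have "\<dots> < xi v" using r pos[OF assms] by simp
      finally have "q \<bullet> ?z \<le> q \<bullet> v" using q(2,3) by fastforce
      then show "r * (q \<bullet> z * xi v) \<le> q \<bullet> v * xi z" using pos[OF False] by (simp add: field_simps)
    qed
    then show ?thesis using qv by (simp add: s_def field_simps)
  qed simp
  moreover have "s \<bullet> v = xi v" using qv by (simp add: s_def)
  ultimately show ?thesis by blast
qed

text \<open>A supporting functional at x + y must touch \<open>xi\<close> at x and at y as well when
  equality holds, so both lie on one face, and that face has a single direction.\<close>

theorem xi_strict:
  assumes eq: "xi (x + y) = xi x + xi y" and "x \<noteq> 0" "y \<noteq> 0"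
  shows "\<exists>r>0. y = r *\<^sub>R x"
proof -
  obtain c where c: "c > 0" "\<And>x :: real ^ 'd. c * norm x \<le> xi x" using xi_lower by blast
  have "xi x > 0" using c(2)[of x] c(1) assms by (smt (verit) mult_pos_pos zero_less_norm_iff)
  then have "x + y \<noteq> 0" using eq xi_nonneg[of y] by auto
  then obtain s where s: "s \<bullet> (x + y) = xi (x + y)" "\<And>z. s \<bullet> z \<le> xi z" using supporting_functional by blast
  have sx: "s \<bullet> x = xi x" "s \<bullet> y = xi y" using s(1) s(2)[of x] s(2)[of y] eq by (simp_all add: inner_add_right)
  interpret face p dd s x by unfold_locales (use s(2) sx assms in auto)
  have fy: "f y = 0" using sx by (simp add: f_def)
  have L: "0 < LR x" "0 < LR y" using LR_va f_zero_LR[OF fy assms(3)] by auto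
  have "x /\<^sub>R LR x = y /\<^sub>R LR y" by (rule face_unique_direction[OF fy assms(3)])
  then have "LR y *\<^sub>R (x /\<^sub>R LR x) = LR y *\<^sub>R (y /\<^sub>R LR y)" by simp
  then have "y = (LR y / LR x) *\<^sub>R x" using L by (simp add: divide_inverse)
  then show ?thesis using L by (intro exI[of _ "LR y / LR x"]) auto
qed

end


section \<open>The minimizer\<close>

context subcrit begin

lemma phi_continuous: "continuous_on UNIV (phi p x :: real ^ 'd \<Rightarrow> real)"
proof -
  have "continuous_on UNIV (\<lambda>y :: real ^ 'd. xi (y - x $ i))" for i
    by (rule continuous_on_compose2[OF continuous_on_xi[of UNIV]]) (auto intro!: continuous_intros)
  then show ?thesis unfolding phi_def[abs_def] by (intro continuous_on_sum) auto
qed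

text \<open>Outside the ball of radius \<open>R\<close> the first summand alone exceeds the value of
  \<open>phi\<close> at 0, so the minimum over the ball is global.\<close>

lemma phi_minimum_exists:
  fixes x :: "(real ^ 'd) ^ 3"
  shows "\<exists>y. \<forall>z. phi p x y \<le> phi p x z"
proof -
  obtain c where c: "c > 0" "\<And>x :: real ^ 'd. c * norm x \<le> xi x" using xi_lower by blast
  define R where "R = phi p x 0 / c + norm (x $ 1)"
  have phi0: "0 \<le> phi p x y" for y unfolding phi_def by (intro sum_nonneg xi_nonneg)
  have R: "0 \<le> R" using phi0[of 0] c by (simp add: R_def)
  obtain y where y: "y \<in> cball 0 R" "\<And>z. z \<in> cball 0 R \<Longrightarrow> phi p x y \<le> phi p x z"
    using continuous_attains_inf[of "cball 0 R" "phi p x"] R continuous_on_subset[OF phi_continuous] by auto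
  have "phi p x y \<le> phi p x z" for z
  proof (cases "z \<in> cball 0 R")
    case False
    have "c * (norm z - norm (x $ 1)) \<le> c * norm (z - x $ 1)"
      using c(1) norm_triangle_ineq2[of z "x $ 1"] by (intro mult_left_mono) auto
    also have "\<dots> \<le> xi (z - x $ 1)" by (rule c(2))
    also have "\<dots> \<le> phi p x z" unfolding phi_def by (rule member_le_sum) (auto intro: xi_nonneg)
    finally have "c * (norm z - norm (x $ 1)) \<le> phi p x z" .
    moreover have "phi p x 0 < c * (norm z - norm (x $ 1))" using False c(1) by (simp add: R_def field_simps)
    moreover have "phi p x y \<le> phi p x 0" using y(2)[of 0] R by simp
    ultimately show ?thesis by linarith
  qed (use y in auto)
  then show ?thesis by blast
qed

text \<open>If two minimizers differed by \<open>e\<close>, equality in the triangle inequality at their midpoint would force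
  \<open>xi (z - x\<^sub>i) - xi (y - x\<^sub>i) = \<plusminus> xi e\<close> for each \<open>i\<close>; an odd number of such terms cannot sum to \<open>0\<close>.\<close>

lemma phi_minimum_unique:
  fixes x :: "(real ^ 'd) ^ 3"
  assumes y: "\<And>v. phi p x y \<le> phi p x v" and z: "\<And>v. phi p x z \<le> phi p x v"
  shows "y = z"
proof (rule ccontr)
  assume "y \<noteq> z"
  obtain c where c: "c > 0" "\<And>x :: real ^ 'd. c * norm x \<le> xi x" using xi_lower by blast
  define e where "e = z - y"
  have e: "e \<noteq> 0" using \<open>y \<noteq> z\<close> by (simp add: e_def)
  have xe: "0 < xi e" using c(2)[of e] c(1) e by (smt (verit) mult_pos_pos zero_less_norm_iff)
  let ?m = "(1/2) *\<^sub>R (y + z)"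
  have mid: "xi (?m - x $ i) = 1/2 * xi ((y - x $ i) + (z - x $ i))" for i
  proof -
    have "?m - x $ i = (1/2) *\<^sub>R ((y - x $ i) + (z - x $ i))"
      by (simp add: vec_eq_iff field_simps)
    then show ?thesis by (simp only: xi_scale)
  qed
  have eq: "xi ((y - x $ i) + (z - x $ i)) = xi (y - x $ i) + xi (z - x $ i)" for i
  proof (rule ccontr)
    assume ne: "\<not> ?thesis"
    have le: "xi (?m - x $ j) \<le> 1/2 * (xi (y - x $ j) + xi (z - x $ j))" for j
      unfolding mid using xi_triangle[of "y - x $ j" "z - x $ j"] by simp
    have "phi p x ?m < (\<Sum>j\<in>UNIV. 1/2 * (xi (y - x $ j) + xi (z - x $ j)))"
      unfolding phi_def
    proof (rule sum_strict_mono_ex1)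
      show "\<exists>j\<in>UNIV. xi (?m - x $ j) < 1/2 * (xi (y - x $ j) + xi (z - x $ j))"
        using ne xi_triangle[of "y - x $ i" "z - x $ i"] unfolding mid by (intro bexI[of _ i]) auto
    qed (use le in auto)
    also have "\<dots> = 1/2 * (phi p x y + phi p x z)" by (simp only: phi_def sum_distrib_left[symmetric] sum.distrib)
    also have "\<dots> \<le> phi p x ?m" using y[of ?m] z[of ?m] by simp
    finally show False by simp
  qed
  have pm: "xi (z - x $ i) - xi (y - x $ i) = xi e \<or> xi (z - x $ i) - xi (y - x $ i) = - xi e" for i
  proof -
    have ze: "z - x $ i = (y - x $ i) + e" by (simp add: e_def)
    consider "y - x $ i = 0" | "z - x $ i = 0" | "y - x $ i \<noteq> 0" "z - x $ i \<noteq> 0" by blast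
    then show ?thesis
    proof cases
      case 1
      then show ?thesis using ze by simp
    next
      case 2
      then have "y - x $ i = - e" using ze by (simp add: add_eq_0_iff2)
      then show ?thesis using 2 by simp
    next
      case 3
      obtain r where r: "0 < r" "z - x $ i = r *\<^sub>R (y - x $ i)" using xi_strict[OF eq 3] by blast
      then have "e = r *\<^sub>R (y - x $ i) - (y - x $ i)" using ze by (metis add_diff_cancel_left')
      then have "e = (r - 1) *\<^sub>R (y - x $ i)" by (simp add: scaleR_left_diff_distrib)
      moreover have ab: "xi ((r - 1) *\<^sub>R (y - x $ i)) = \<bar>r - 1\<bar> * xi (y - x $ i)"
      proof (cases "1 \<le> r")
        case False
        have "xi ((r - 1) *\<^sub>R (y - x $ i)) = xi ((1 - r) *\<^sub>R (y - x $ i))"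
          using xi_minus[of "(1 - r) *\<^sub>R (y - x $ i)"] by (simp flip: scaleR_minus_left)
        then show ?thesis using False by (simp add: xi_scale)
      qed (simp add: xi_scale)
      ultimately have xe': "xi e = \<bar>r - 1\<bar> * xi (y - x $ i)" by (simp only:)
      have xz: "xi (z - x $ i) = r * xi (y - x $ i)" using r by (simp add: xi_scale)
      show ?thesis unfolding xe' xz by (cases "1 \<le> r") (simp_all add: algebra_simps)
    qed
  qed
  have "phi p x z - phi p x y = (\<Sum>i\<in>UNIV. xi (z - x $ i) - xi (y - x $ i))" by (simp add: phi_def sum_subtractf)
  also have "\<dots> = (xi (z - x $ 1) - xi (y - x $ 1)) + (xi (z - x $ 2) - xi (y - x $ 2)) + (xi (z - x $ 3) - xi (y - x $ 3))"
    by (rule sum_3)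
  also have "\<dots> \<noteq> 0" using pm[of 1] pm[of 2] pm[of 3] xe by auto
  finally show False using y[of z] z[of y] by simp
qed

text \<open>Resolves the definite description: existence and uniqueness together make
  \<open>minimizer\<close> an actual minimiser.\<close>

lemma minimizer_le: "phi p x (minimizer p x) \<le> phi p x (y :: real ^ 'd)"
proof -
  obtain y0 where y0: "\<And>z. phi p x y0 \<le> phi p x z" using phi_minimum_exists by blast
  have "minimizer p x = y0"
    unfolding minimizer_def
  proof (rule the_equality)
    show "is_arg_min (phi p x) (\<lambda>_. True) y0" using y0 by (auto simp: is_arg_min_def not_less)
    fix y assume "is_arg_min (phi p x) (\<lambda>_. True) y"
    then show "y = y0" using y0 by (intro phi_minimum_unique) (auto simp: is_arg_min_def not_less)
  qed
  then show ?thesis using y0 by simp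
qed

end

section \<open>Two branching points force an additional long connection\<close>

text \<open>Stop at the first end of the edge that is met; a path containing only one of the two
  ends does not use the edge.\<close>

lemma conn_avoid_edge:
  assumes "conn B u x" "x \<noteq> y"
  shows "conn (B - {{x, y}}) u x \<or> conn (B - {{x, y}}) u y"
proof -
  have "x \<in> {x, y}" by simp
  from conn_hit[OF assms(1) this] obtain w \<gamma> where \<gamma>: "w \<in> {x, y}" "spath u w \<gamma>" "pe \<gamma> \<subseteq> B" "set \<gamma> \<inter> {x, y} = {w}" .
  have "{x, y} \<notin> pe \<gamma>"
  proof
    assume "{x, y} \<in> pe \<gamma>"
    then have "{x, y} \<subseteq> set \<gamma>" by (rule pe_subset)
    then show False using \<gamma>(4) assms(2) by auto
  qed
  then have "conn (B - {{x, y}}) u w" using \<gamma> by (intro spath_conn'[OF \<gamma>(2)]) auto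
  then show ?thesis using \<gamma>(1) by auto
qed

text \<open>Walk from y towards u off the edge and stop at the first vertex w on either path. The
  path through w is followed to w and then to y; the other one goes to x and across the
  edge.\<close>

lemma two_disjoint_extend:
  assumes \<alpha>: "spath u x \<alpha>1" "spath u x \<alpha>2" "pe \<alpha>1 \<subseteq> A" "pe \<alpha>2 \<subseteq> A" "pe \<alpha>1 \<inter> pe \<alpha>2 = {}"
    and e: "{x, y} \<in> A" "{x, y} \<notin> pe \<alpha>1" "{x, y} \<notin> pe \<alpha>2" and c: "conn (A - {{x, y}}) y u"
  shows "\<exists>B1 B2. B1 \<subseteq> A \<and> B2 \<subseteq> A \<and> B1 \<inter> B2 = {} \<and> conn B1 u y \<and> conn B2 u y"
proof -
  have "u \<in> set \<alpha>1 \<union> set \<alpha>2" using spath_ends[OF \<alpha>(1)] by auto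
  from conn_hit[OF c this] obtain w \<delta> where \<delta>: "w \<in> set \<alpha>1 \<union> set \<alpha>2" "spath y w \<delta>" "pe \<delta> \<subseteq> A - {{x, y}}" "set \<delta> \<inter> (set \<alpha>1 \<union> set \<alpha>2) = {w}" .
  have d: "pe \<delta> \<inter> pe \<alpha>1 = {}" "pe \<delta> \<inter> pe \<alpha>2 = {}"
    by ((rule pe_disjoint'[of _ _ w]; use \<delta> in \<open>auto simp: spath_def\<close>)+)
  have *: "\<exists>B1 B2. B1 \<subseteq> A \<and> B2 \<subseteq> A \<and> B1 \<inter> B2 = {} \<and> conn B1 u y \<and> conn B2 u y"
    if w: "w \<in> set \<beta>1" and \<beta>: "spath u x \<beta>1" "spath u x \<beta>2" "pe \<beta>1 \<subseteq> A" "pe \<beta>2 \<subseteq> A" "pe \<beta>1 \<inter> pe \<beta>2 = {}"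
      "{x, y} \<notin> pe \<beta>1" "{x, y} \<notin> pe \<beta>2" "pe \<delta> \<inter> pe \<beta>1 = {}" "pe \<delta> \<inter> pe \<beta>2 = {}" for \<beta>1 \<beta>2
  proof (intro exI conjI)
    show "conn (pe \<beta>1 \<union> pe \<delta>) u y"
    proof (rule conn_trans)
      show "conn (pe \<beta>1 \<union> pe \<delta>) u w" using spath_conn[OF \<beta>(1) w] by (rule conn_mono) auto
      show "conn (pe \<beta>1 \<union> pe \<delta>) w y" by (rule conn_sym, rule spath_conn'[OF \<delta>(2)]) auto
    qed
    show "conn (insert {x, y} (pe \<beta>2)) u y"
    proof (rule conn_trans)
      show "conn (insert {x, y} (pe \<beta>2)) u x" by (rule spath_conn'[OF \<beta>(2)]) auto
      show "conn (insert {x, y} (pe \<beta>2)) x y" by (rule conn_edge) auto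
    qed
  qed (use \<beta> \<delta>(3) e in auto)
  from \<delta>(1) show ?thesis
    using *[of \<alpha>1 \<alpha>2] *[of \<alpha>2 \<alpha>1] \<alpha> e d by (auto simp: Int_commute)
qed

text \<open>Induction along a path without bridges: two edge-disjoint connections to x are prolonged
  across the next edge to y.\<close>

lemma menger_two_path:
  assumes "spath u v \<gamma>" "pe \<gamma> \<subseteq> A" "\<And>x y. {x, y} \<in> pe \<gamma> \<Longrightarrow> conn (A - {{x, y}}) x y"
  shows "\<exists>B1 B2. B1 \<subseteq> A \<and> B2 \<subseteq> A \<and> B1 \<inter> B2 = {} \<and> conn B1 u v \<and> conn B2 u v"
  using assms
proof (induction \<gamma> arbitrary: v rule: rev_induct)
  case (snoc y \<gamma>)
  then have v: "v = y" by (simp add: spath_def)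
  show ?case
  proof (cases "\<gamma> = []")
    case True
    then have "u = y" using snoc.prems(1) by (simp add: spath_def)
    then show ?thesis unfolding v by (intro exI[of _ "{}"]) auto
  next
    case False
    define x where "x = last \<gamma>"
    obtain \<gamma>' where \<gamma>': "\<gamma> = \<gamma>' @ [x]" using False by (metis append_butlast_last_id x_def)
    have pe: "pe (\<gamma> @ [y]) = insert {x, y} (pe \<gamma>)" unfolding \<gamma>' using pe_append[of \<gamma>' x "[y]"] by simp
    have sp: "spath u x \<gamma>" using snoc.prems(1) False by (auto simp: spath_def x_def)
    have xy: "x \<noteq> y" using snoc.prems(1) by (auto simp: spath_def \<gamma>')
    let ?e = "{x, y}"
    have eA: "?e \<in> A" using snoc.prems(2) pe by auto
    have cxy: "conn (A - {?e}) x y" using snoc.prems(3) pe by auto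
    obtain B1 B2 where B: "B1 \<subseteq> A" "B2 \<subseteq> A" "B1 \<inter> B2 = {}" "conn B1 u x" "conn B2 u x"
      using snoc.IH[OF sp] snoc.prems(2,3) pe by auto
    \<comment> \<open>At most one of the two connections uses the edge; C2 is one that does not. If
      C1 reaches x without the edge, \<open>two_disjoint_extend\<close> applies; otherwise C1
      reaches y without it, and C2 may take the edge.\<close>
    have *: "\<exists>B1 B2. B1 \<subseteq> A \<and> B2 \<subseteq> A \<and> B1 \<inter> B2 = {} \<and> conn B1 u y \<and> conn B2 u y"
      if C: "C1 \<subseteq> A" "C2 \<subseteq> A" "C1 \<inter> C2 = {}" "conn C1 u x" "conn C2 u x" "?e \<notin> C2" for C1 C2
    proof -
      consider "conn (C1 - {?e}) u x" | "conn (C1 - {?e}) u y" using conn_avoid_edge[OF C(4) xy] by auto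
      then show ?thesis
      proof cases
        case 1
        obtain \<alpha>1 where a1: "spath u x \<alpha>1" "pe \<alpha>1 \<subseteq> C1 - {?e}" using conn_spath[OF 1] .
        obtain \<alpha>2 where a2: "spath u x \<alpha>2" "pe \<alpha>2 \<subseteq> C2" using conn_spath[OF C(5)] .
        have "conn (A - {?e}) u x" using 1 by (rule conn_mono) (use C in auto)
        then have c: "conn (A - {?e}) y u" using cxy by (meson conn_sym conn_trans)
        show ?thesis
          by (rule two_disjoint_extend[OF a1(1) a2(1) _ _ _ eA _ _ c]) (use a1(2) a2(2) C in auto)
      next
        case 2
        have "conn (insert ?e C2) u y"
        proof (rule conn_trans)
          show "conn (insert ?e C2) u x" using C(5) by (rule conn_mono) auto
          show "conn (insert ?e C2) x y" by (rule conn_edge) auto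
        qed
        then show ?thesis using 2 C eA by (intro exI[of _ "C1 - {?e}"] exI[of _ "insert ?e C2"]) auto
      qed
    qed
    show ?thesis unfolding v
    proof (cases "?e \<in> B2")
      case True
      then have "?e \<notin> B1" using B(3) by auto
      then show "\<exists>B1 B2. B1 \<subseteq> A \<and> B2 \<subseteq> A \<and> B1 \<inter> B2 = {} \<and> conn B1 u y \<and> conn B2 u y"
        by (intro *[of B2 B1]) (use B in auto)
    qed (intro *[of B1 B2], use B in auto)
  qed
qed (simp add: spath_def)

lemma menger_two:
  assumes "\<And>e. conn (A - {e}) u v"
  shows "\<exists>B1 B2. B1 \<subseteq> A \<and> B2 \<subseteq> A \<and> B1 \<inter> B2 = {} \<and> conn B1 u v \<and> conn B2 u v"
proof -
  have "conn A u v" using assms[of "{}"] by (rule conn_mono) auto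
  then obtain \<gamma> where \<gamma>: "spath u v \<gamma>" "pe \<gamma> \<subseteq> A" using conn_spath by metis
  show ?thesis
  proof (rule menger_two_path[OF \<gamma>])
    fix x y assume e: "{x, y} \<in> pe \<gamma>"
    have d: "distinct \<gamma>" using \<gamma>(1) by (simp add: spath_def)
    have xy: "x \<noteq> y" using pe_distinct_edge[OF d e] by (metis doubleton_eq_iff insert_absorb2)
    \<comment> \<open>An end of the edge cuts \<gamma> into two pieces, at most one of which uses
      the edge; so it remains joined to u or to v, and these two are joined by assumption.\<close>
    have ends: "conn (A - {{x, y}}) u z \<or> conn (A - {{x, y}}) z v" if "z \<in> {x, y}" for z
    proof -
      have z: "z \<in> set \<gamma>" using pe_subset[OF e] that by auto
      obtain \<alpha> \<beta> where s: "spath u z \<alpha>" "spath z v \<beta>" "set \<alpha> \<inter> set \<beta> = {z}" "pe \<gamma> = pe \<alpha> \<union> pe \<beta>"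
        using spath_split[OF \<gamma>(1) z] by metis
      have "pe \<alpha> \<inter> pe \<beta> = {}" by (rule pe_disjoint'[of _ _ z]; use s in \<open>auto simp: spath_def\<close>)
      then consider "{x, y} \<notin> pe \<alpha>" | "{x, y} \<notin> pe \<beta>" by auto
      then show ?thesis
      proof cases
        case 1
        then have "conn (A - {{x, y}}) u z" using s \<gamma>(2) by (intro spath_conn'[OF s(1)]) auto
        then show ?thesis ..
      next
        case 2
        then have "conn (A - {{x, y}}) z v" using s \<gamma>(2) by (intro spath_conn'[OF s(2)]) auto
        then show ?thesis ..
      qed
    qed
    have uv: "conn (A - {{x, y}}) u v" by (rule assms)
    have u: "conn (A - {{x, y}}) u z" if "z \<in> {x, y}" for z
      using ends[OF that] uv by (meson conn_sym conn_trans)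
    show "conn (A - {{x, y}}) x y" using u[of x] u[of y] by (meson conn_sym conn_trans insertI1 insertI2)
  qed
qed

lemma three_majority:
  fixes P :: "3 \<Rightarrow> bool"
  shows "(\<exists>i0. \<forall>i. i \<noteq> i0 \<longrightarrow> P i) \<or> (\<exists>i0. \<forall>i. i \<noteq> i0 \<longrightarrow> \<not> P i)"
proof -
  have "(\<forall>i. i \<noteq> 1 \<longrightarrow> P i) \<or> (\<forall>i. i \<noteq> 2 \<longrightarrow> P i) \<or> (\<forall>i. i \<noteq> 3 \<longrightarrow> P i) \<or>
     (\<forall>i. i \<noteq> 1 \<longrightarrow> \<not> P i) \<or> (\<forall>i. i \<noteq> 2 \<longrightarrow> \<not> P i) \<or> (\<forall>i. i \<noteq> 3 \<longrightarrow> \<not> P i)"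
    by (simp add: forall_3) blast
  then show ?thesis by blast
qed

text \<open>At least two legs end on \<open>\<alpha>1\<close> and survive the removal of edges of
  \<open>\<alpha>2\<close>. If the third ends in the interior of \<open>\<alpha>2\<close>, its foot
  cuts \<open>\<alpha>2\<close> in two; the part with the larger displacement becomes B, and the
  other part, with \<open>\<alpha>1\<close> if needed, keeps the third leg attached.\<close>

lemma long_detour_aux:
  fixes n :: "3 \<Rightarrow> int ^ 'd::finite"
  assumes \<alpha>: "spath k1 k2 \<alpha>1" "spath k1 k2 \<alpha>2" "pe \<alpha>1 \<subseteq> A" "pe \<alpha>2 \<subseteq> A" "pe \<alpha>1 \<inter> pe \<alpha>2 = {}"
    and \<delta>: "\<And>i. spath (n i) (w i) (\<delta> i)" "\<And>i. pe (\<delta> i) \<subseteq> A" "\<And>i. pe (\<delta> i) \<inter> pe \<alpha>2 = {}"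
    and w: "\<And>i. i \<noteq> i0 \<Longrightarrow> w i \<in> set \<alpha>1" "w i0 \<in> set \<alpha>1 \<union> set \<alpha>2"
  shows "\<exists>v1 v2 B. B \<subseteq> A \<and> conn A k1 v1 \<and> conn B v1 v2 \<and> vnorm (k1 - k2) / 2 \<le> vnorm (v1 - v2) \<and> (\<forall>i. conn (A - B) k1 (n i))"
proof -
  have main: "\<forall>i. conn (A - B) k1 (n i)" if B: "B \<subseteq> pe \<alpha>2" and w0: "conn (A - B) k1 (w i0)" for B
  proof
    fix i
    have "conn (A - B) k1 (w i)"
    proof (cases "i = i0")
      case False
      have "conn (pe \<alpha>1) k1 (w i)" by (rule spath_conn[OF \<alpha>(1) w(1)[OF False]])
      then show ?thesis by (rule conn_mono) (use B \<alpha> in auto)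
    qed (use w0 in simp)
    moreover have "conn (A - B) (n i) (w i)"
      by (rule spath_conn'[OF \<delta>(1)]) (use \<delta>(2,3)[of i] B in auto)
    ultimately show "conn (A - B) k1 (n i)" by (meson conn_sym conn_trans)
  qed
  have k12: "conn (pe \<alpha>1) k1 k2" using spath_conn'[OF \<alpha>(1)] by auto
  show ?thesis
  proof (cases "w i0 \<in> set \<alpha>1")
    case True
    have "conn (A - pe \<alpha>2) k1 (w i0)"
      using spath_conn[OF \<alpha>(1) True] by (rule conn_mono) (use \<alpha> in auto)
    then have "\<forall>i. conn (A - pe \<alpha>2) k1 (n i)" by (intro main) auto
    moreover have "conn (pe \<alpha>2) k1 k2" using spath_conn'[OF \<alpha>(2)] by auto
    ultimately show ?thesis using \<alpha>(4) by (intro exI[of _ k1] exI[of _ k2] exI[of _ "pe \<alpha>2"]) auto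
  next
    case False
    then have w2: "w i0 \<in> set \<alpha>2" using w(2) by auto
    obtain \<beta>1 \<beta>2 where s: "spath k1 (w i0) \<beta>1" "spath (w i0) k2 \<beta>2" "set \<beta>1 \<inter> set \<beta>2 = {w i0}" "pe \<alpha>2 = pe \<beta>1 \<union> pe \<beta>2"
      using spath_split[OF \<alpha>(2) w2] by metis
    have d: "pe \<beta>1 \<inter> pe \<beta>2 = {}" by (rule pe_disjoint'[of _ _ "w i0"]; use s in \<open>auto simp: spath_def\<close>)
    have "vnorm (k1 - k2) \<le> vnorm (k1 - w i0) + vnorm (w i0 - k2)" using vnorm_triangle[of "k1 - w i0" "w i0 - k2"] by simp
    then consider "vnorm (k1 - k2) / 2 \<le> vnorm (k1 - w i0)" | "vnorm (k1 - k2) / 2 \<le> vnorm (w i0 - k2)" by linarith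
    then show ?thesis
    proof cases
      case 1
      have "conn (A - pe \<beta>1) k1 (w i0)"
      proof (rule conn_trans)
        show "conn (A - pe \<beta>1) k1 k2" using k12 by (rule conn_mono) (use \<alpha> s in auto)
        show "conn (A - pe \<beta>1) k2 (w i0)" by (rule conn_sym, rule spath_conn'[OF s(2)]) (use d s \<alpha> in auto)
      qed
      then have "\<forall>i. conn (A - pe \<beta>1) k1 (n i)" by (intro main) (use s in auto)
      moreover have "conn (pe \<beta>1) k1 (w i0)" using spath_conn'[OF s(1)] by auto
      ultimately show ?thesis using 1 \<alpha>(4) s(4) by (intro exI[of _ k1] exI[of _ "w i0"] exI[of _ "pe \<beta>1"]) auto
    next
      case 2
      have "conn (A - pe \<beta>2) k1 (w i0)" by (rule spath_conn'[OF s(1)]) (use d s \<alpha> in auto)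
      then have "\<forall>i. conn (A - pe \<beta>2) k1 (n i)" by (intro main) (use s in auto)
      moreover have "conn A k1 (w i0)" by (rule spath_conn'[OF s(1)]) (use s \<alpha> in auto)
      moreover have "conn (pe \<beta>2) (w i0) k2" using spath_conn'[OF s(2)] by auto
      ultimately show ?thesis using 2 \<alpha>(4) s(4) by (intro exI[of _ "w i0"] exI[of _ k2] exI[of _ "pe \<beta>2"]) auto
    qed
  qed
qed

lemma long_detour:
  fixes n :: "3 \<Rightarrow> int ^ 'd::finite"
  assumes P: "\<And>i. spath k1 (n i) (P i)" "\<And>i. pe (P i) \<subseteq> A" "\<And>i j. i \<noteq> j \<Longrightarrow> pe (P i) \<inter> pe (P j) = {}"
    and Q: "\<And>i. spath k2 (n i) (Q i)" "\<And>i. pe (Q i) \<subseteq> A" "\<And>i j. i \<noteq> j \<Longrightarrow> pe (Q i) \<inter> pe (Q j) = {}"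
  shows "\<exists>v1 v2. vnorm (k1 - k2) / 2 \<le> vnorm (v1 - v2) \<and> (\<exists>B\<subseteq>A. conn A k1 v1 \<and> conn B v1 v2 \<and> (\<forall>i. conn (A - B) k1 (n i)))"
proof -
  have "conn (A - {e}) k1 k2" for e
  proof -
    \<comment> \<open>The legs of each tripod are edge-disjoint, so e lies on at most one leg of
      each; among three indices one is unaffected.\<close>
    have "\<exists>i. e \<notin> pe (P i) \<and> e \<notin> pe (Q i)"
    proof (rule ccontr)
      assume "\<not> ?thesis"
      then have "e \<in> pe (P i) \<or> e \<in> pe (Q i)" for i by blast
      moreover have "(1::3) \<noteq> 2" "(1::3) \<noteq> 3" "(2::3) \<noteq> 3" by simp_all
      ultimately show False using P(3)[of 1 2] P(3)[of 1 3] P(3)[of 2 3] Q(3)[of 1 2] Q(3)[of 1 3] Q(3)[of 2 3]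
        by (metis IntI empty_iff)
    qed
    then obtain i where i: "e \<notin> pe (P i)" "e \<notin> pe (Q i)" by blast
    have "conn (A - {e}) k1 (n i)" by (rule spath_conn'[OF P(1)]) (use P(2)[of i] i in auto)
    moreover have "conn (A - {e}) k2 (n i)" by (rule spath_conn'[OF Q(1)]) (use Q(2)[of i] i in auto)
    ultimately show ?thesis by (meson conn_sym conn_trans)
  qed
  from menger_two[OF this] obtain B1 B2 where B: "B1 \<subseteq> A" "B2 \<subseteq> A" "B1 \<inter> B2 = {}" "conn B1 k1 k2" "conn B2 k1 k2" by blast
  obtain \<alpha>1 where a1: "spath k1 k2 \<alpha>1" "pe \<alpha>1 \<subseteq> B1" using conn_spath[OF B(4)] .
  obtain \<alpha>2 where a2: "spath k1 k2 \<alpha>2" "pe \<alpha>2 \<subseteq> B2" using conn_spath[OF B(5)] .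
  have A: "pe \<alpha>1 \<subseteq> A" "pe \<alpha>2 \<subseteq> A" "pe \<alpha>1 \<inter> pe \<alpha>2 = {}" using a1 a2 B by auto
  have "\<exists>w \<delta>. w \<in> set \<alpha>1 \<union> set \<alpha>2 \<and> spath (n i) w \<delta> \<and> pe \<delta> \<subseteq> A \<and> set \<delta> \<inter> (set \<alpha>1 \<union> set \<alpha>2) = {w}" for i
  proof -
    have c: "conn A (n i) k1" using spath_conn'[OF P(1,2)] conn_sym by metis
    have "k1 \<in> set \<alpha>1 \<union> set \<alpha>2" using spath_ends[OF a1(1)] by auto
    from conn_hit[OF c this] show ?thesis by metis
  qed
  then obtain w \<delta> where \<delta>: "\<And>i. w i \<in> set \<alpha>1 \<union> set \<alpha>2" "\<And>i. spath (n i) (w i) (\<delta> i)" "\<And>i. pe (\<delta> i) \<subseteq> A"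
    "\<And>i. set (\<delta> i) \<inter> (set \<alpha>1 \<union> set \<alpha>2) = {w i}" by metis
  have dist: "distinct (\<delta> i)" for i using \<delta>(2)[of i] by (simp add: spath_def)
  have d: "pe (\<delta> i) \<inter> pe \<alpha>1 = {}" "pe (\<delta> i) \<inter> pe \<alpha>2 = {}" for i
    using \<delta>(4)[of i] by (intro pe_disjoint'[OF dist, of _ _ "w i"]; blast)+
  have "\<exists>v1 v2 B. B \<subseteq> A \<and> conn A k1 v1 \<and> conn B v1 v2 \<and> vnorm (k1 - k2) / 2 \<le> vnorm (v1 - v2) \<and> (\<forall>i. conn (A - B) k1 (n i))"
    using three_majority[of "\<lambda>i. w i \<in> set \<alpha>1"]
  proof (elim disjE exE)
    fix i0 assume "\<forall>i. i \<noteq> i0 \<longrightarrow> w i \<in> set \<alpha>1"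
    then show ?thesis by (intro long_detour_aux[OF a1(1) a2(1) A \<delta>(2,3) d(2), of i0]) (use \<delta>(1) in auto)
  next
    fix i0 assume "\<forall>i. i \<noteq> i0 \<longrightarrow> w i \<notin> set \<alpha>1"
    then have "w i \<in> set \<alpha>2" if "i \<noteq> i0" for i using \<delta>(1)[of i] that by auto
    then show ?thesis by (intro long_detour_aux[OF a2(1) a1(1) A(2,1) _ \<delta>(2,3) d(1), of i0]) (use \<delta>(1)[of i0] A(3) in auto)
  qed
  then show ?thesis by blast
qed


section \<open>The main estimate\<close>

lemma poly_times_stretched_exp:
  fixes a b k \<beta> :: real and m :: nat
  assumes "0 < a" "0 < b" "0 < k" "0 < \<beta>" "0 < C"
  shows "\<forall>\<^sub>F N :: nat in sequentially. C * (a * real N + b) ^ m * exp (- k * real N powr \<beta>) \<le> 1/2"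
proof -
  have 1: "((\<lambda>x. ln (a * x + b) / x powr \<beta>) \<longlongrightarrow> 0) at_top" using assms by real_asymp
  have 2: "((\<lambda>x. ln (2 * C) / x powr \<beta>) \<longlongrightarrow> 0) at_top" using assms by real_asymp
  have "((\<lambda>x. ln (2 * C) / x powr \<beta> + real m * (ln (a * x + b) / x powr \<beta>)) \<longlongrightarrow> 0 + real m * 0) at_top"
    by (intro tendsto_add tendsto_mult tendsto_const 1 2)
  then have "((\<lambda>x. ln (2 * C) / x powr \<beta> + real m * (ln (a * x + b) / x powr \<beta>)) \<longlongrightarrow> 0) at_top" by simp
  then have "\<forall>\<^sub>F x in at_top. ln (2 * C) / x powr \<beta> + real m * (ln (a * x + b) / x powr \<beta>) < k"
    using assms(3) by (rule order_tendstoD(2))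
  then have "\<forall>\<^sub>F x in at_top. C * (a * x + b) ^ m * exp (- k * x powr \<beta>) \<le> 1/2"
    using eventually_gt_at_top[of 0]
  proof eventually_elim
    case (elim x)
    have p: "0 < x powr \<beta>" and q: "0 < a * x + b" using elim assms by (auto intro: add_pos_pos)
    have "ln (2 * C) / x powr \<beta> + real m * (ln (a * x + b) / x powr \<beta>) = (ln (2 * C) + real m * ln (a * x + b)) / x powr \<beta>"
      by (simp add: add_divide_distrib)
    then have "ln (2 * C) + real m * ln (a * x + b) < k * x powr \<beta>" using elim p by (simp add: field_simps)
    then have "exp (ln (2 * C) + real m * ln (a * x + b) - k * x powr \<beta>) \<le> exp 0" by (subst exp_le_cancel_iff) simp
    moreover have "exp (ln (2 * C) + real m * ln (a * x + b) - k * x powr \<beta>) = 2 * C * (a * x + b) ^ m * exp (- k * x powr \<beta>)"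
      using assms(5) q by (simp add: exp_add exp_diff exp_minus exp_of_nat_mult divide_inverse)
    ultimately show ?case by simp
  qed
  then show ?thesis by (rule eventually_compose_filterlim[OF _ filterlim_real_sequentially])
qed

lemma F_event_paths:
  assumes "\<omega> \<in> F_event p k n"
  obtains P where "\<And>i. spath k (n $ i) (P i)" "\<And>i. pe (P i) \<subseteq> opn \<omega>" "\<And>i j. i \<noteq> j \<Longrightarrow> pe (P i) \<inter> pe (P j) = {}"
proof -
  obtain \<gamma> :: "3 \<Rightarrow> (int ^ 'a) list" where \<gamma>: "\<And>i. open_path \<omega> k (n $ i) (\<gamma> i)" "\<And>i. distinct (\<gamma> i)"
    "\<And>i j. i \<noteq> j \<Longrightarrow> set (\<gamma> i) \<inter> set (\<gamma> j) = {k}"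
    using assms unfolding F_event_def by auto
  show ?thesis
  proof (rule that[of \<gamma>])
    show "spath k (n $ i) (\<gamma> i)" for i using \<gamma>(1,2)[of i] unfolding open_path_def spath_def by auto
    show "pe (\<gamma> i) \<subseteq> opn \<omega>" for i
      using \<gamma>(1)[of i] unfolding open_path_def successively_pe[symmetric] by (simp add: opn_def)
    show "pe (\<gamma> i) \<inter> pe (\<gamma> j) = {}" if "i \<noteq> j" for i j
      by (rule pe_disjoint'[OF \<gamma>(2), of _ _ k]) (use \<gamma>(3)[OF that] in auto)
  qed
qed

context subcrit begin

definition tripod :: "(int ^ 'd) ^ 3 \<Rightarrow> int ^ 'd \<Rightarrow> (int ^ 'd) set set \<Rightarrow> bool" where
  "tripod n w = dj (cn (n $ 1) w) (dj (cn w (n $ 2)) (cn (n $ 3) w))"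

lemma fin_incr_tripod [simp]: "fin_incr (tripod n w)" by (simp add: tripod_def)

lemma PP_detour:
  "PP p (dj (cn v1 v2) (tripod n w)) \<le> t (v2 - v1) * (\<Prod>i\<in>UNIV. t (w - n $ i))"
proof -
  have *: "PP p (dj (cn u v) R) \<le> t (v - u) * r" if "PP p R \<le> r" "fin_incr R" for u v :: "int ^ 'd" and R r
  proof -
    have "PP p (dj (cn u v) R) \<le> PP p (cn u v) * PP p R" by (rule PP_BK) (use that p01 in auto)
    also have "\<dots> \<le> t (v - u) * r"
      using that(1) tau_t[of u v] t_pos[of "v - u"] by (intro mult_mono) (auto simp: tau_def PP_nonneg)
    finally show ?thesis .
  qed
  have "PP p (dj (cn v1 v2) (tripod n w)) \<le> t (v2 - v1) * (t (w - n $ 1) * (t (n $ 2 - w) * t (w - n $ 3)))"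
    unfolding tripod_def by (intro *) (use tau_t[of "n $ 3" w] in \<open>auto simp: tau_def\<close>)
  moreover have "t (n $ 2 - w) = t (w - n $ 2)" using t_minus[of "w - n $ 2"] by simp
  moreover have "(\<Prod>i\<in>UNIV. t (w - n $ i)) = t (w - n $ 1) * t (w - n $ 2) * t (w - n $ 3)"
    unfolding UNIV_3 by simp
  ultimately show ?thesis by (simp add: mult.assoc)
qed

text \<open>\<open>long_detour\<close> gives a set B joining v1 to v2, off which the three endpoints
  stay connected; \<open>conn_tripod\<close> then finds a tripod disjoint from B. Either w, v1, v2
  all lie in S, or some vertex outside S is joined to the first endpoint.\<close>

lemma F_events_bound:
  fixes n :: "(int ^ 'd) ^ 3" and S :: "(int ^ 'd) set"
  assumes S: "finite S"
  shows "measure (percolation p) (F_event p k1 n \<inter> F_event p k2 n)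
    \<le> (\<Sum>(w, v1, v2)\<in>S \<times> S \<times> S. if vnorm (k1 - k2) / 2 \<le> vnorm (v1 - v2) then t (v2 - v1) * (\<Prod>i\<in>UNIV. t (w - n $ i)) else 0)
      + PP p (\<lambda>A. \<exists>z. z \<notin> S \<and> cn (n $ 1) z A)"
proof -
  interpret prob_space "percolation p :: ((int ^ 'd) set \<Rightarrow> bool) measure" by (rule prob_space_percolation)
  let ?D = "vnorm (k1 - k2) / 2"
  let ?R = "\<lambda>(w, v1, v2). \<lambda>A. ?D \<le> vnorm (v1 - v2) \<and> dj (cn v1 v2) (tripod n w) A"
  let ?O = "\<lambda>A. \<exists>z. z \<notin> S \<and> cn (n $ 1) z A"
  have fR: "fin_incr (?R x)" for x by (cases x) (auto intro: fin_incr_conj_const)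
  have fO: "fin_incr ?O" by (intro fin_incr_Ex fin_incr_conj_const) simp
  have mR: "ev p (?R x) \<in> events" for x by (intro sets_ev fR p01)
  have mO: "ev p ?O \<in> events" by (intro sets_ev fO p01)
  have "F_event p k1 n \<inter> F_event p k2 n \<subseteq> (\<Union>x\<in>S \<times> S \<times> S. ev p (?R x)) \<union> ev p ?O"
  proof
    fix \<omega> assume \<omega>: "\<omega> \<in> F_event p k1 n \<inter> F_event p k2 n"
    then have sp: "\<omega> \<in> space (percolation p)" by (auto simp: F_event_def)
    obtain P where P: "\<And>i. spath k1 (n $ i) (P i)" "\<And>i. pe (P i) \<subseteq> opn \<omega>" "\<And>i j. i \<noteq> j \<Longrightarrow> pe (P i) \<inter> pe (P j) = {}"
      using F_event_paths[of \<omega> p k1 n] \<omega> by auto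
    obtain Q where Q: "\<And>i. spath k2 (n $ i) (Q i)" "\<And>i. pe (Q i) \<subseteq> opn \<omega>" "\<And>i j. i \<noteq> j \<Longrightarrow> pe (Q i) \<inter> pe (Q j) = {}"
      using F_event_paths[of \<omega> p k2 n] \<omega> by auto
    obtain v1 v2 B where v: "?D \<le> vnorm (v1 - v2)" "B \<subseteq> opn \<omega>" "conn (opn \<omega>) k1 v1" "conn B v1 v2" "\<And>i. conn (opn \<omega> - B) k1 (n $ i)"
      using long_detour[of k1 "\<lambda>i. n $ i" P "opn \<omega>" k2 Q, OF P Q] by blast
    have c12: "conn (opn \<omega> - B) (n $ 1) (n $ 2)" "conn (opn \<omega> - B) (n $ 3) (n $ 1)"
      using v(5) by (meson conn_sym conn_trans)+
    from conn_tripod[OF this] obtain w where w: "tripod n w (opn \<omega> - B)" unfolding tripod_def by blast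
    then have R: "?R (w, v1, v2) (opn \<omega>)" using v(1,2,4) unfolding dj_def cn_def by auto
    show "\<omega> \<in> (\<Union>x\<in>S \<times> S \<times> S. ev p (?R x)) \<union> ev p ?O"
    proof (cases "w \<in> S \<and> v1 \<in> S \<and> v2 \<in> S")
      case True
      then show ?thesis using R sp by (auto simp: ev_def intro!: bexI[of _ "(w, v1, v2)"])
    next
      case False
      have cw: "conn (opn \<omega>) (n $ 1) w"
      proof -
        obtain C where C: "C \<subseteq> opn \<omega> - B" "conn C (n $ 1) w" using w unfolding tripod_def dj_def cn_def by blast
        show ?thesis by (rule conn_mono[OF C(2)]) (use C(1) in auto)
      qed
      have k: "conn (opn \<omega>) (n $ 1) k1" by (rule conn_sym, rule conn_mono[OF v(5)]) auto
      have c1: "conn (opn \<omega>) (n $ 1) v1" using conn_trans[OF k v(3)] .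
      have c2: "conn (opn \<omega>) (n $ 1) v2" using conn_trans[OF c1 conn_mono[OF v(4,2)]] .
      have "?O (opn \<omega>)" using False cw c1 c2 unfolding cn_def by blast
      then show ?thesis using sp by (simp add: ev_def)
    qed
  qed
  then have "measure (percolation p) (F_event p k1 n \<inter> F_event p k2 n) \<le> measure (percolation p) ((\<Union>x\<in>S \<times> S \<times> S. ev p (?R x)) \<union> ev p ?O)"
    by (rule finite_measure_mono) (use mR mO S in auto)
  also have "\<dots> \<le> measure (percolation p) (\<Union>x\<in>S \<times> S \<times> S. ev p (?R x)) + PP p ?O"
    unfolding PP_def by (rule measure_Un_le) (use mR mO S in auto)
  also have "measure (percolation p) (\<Union>x\<in>S \<times> S \<times> S. ev p (?R x)) \<le> (\<Sum>x\<in>S \<times> S \<times> S. PP p (?R x))"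
    unfolding PP_def by (rule finite_measure_subadditive_finite) (use mR S in auto)
  also have "\<dots> \<le> (\<Sum>(w, v1, v2)\<in>S \<times> S \<times> S. if ?D \<le> vnorm (v1 - v2) then t (v2 - v1) * (\<Prod>i\<in>UNIV. t (w - n $ i)) else 0)"
  proof (rule sum_mono, clarify)
    fix w v1 v2
    show "PP p (\<lambda>A. ?D \<le> vnorm (v1 - v2) \<and> dj (cn v1 v2) (tripod n w) A) \<le> (if ?D \<le> vnorm (v1 - v2) then t (v2 - v1) * (\<Prod>i\<in>UNIV. t (w - n $ i)) else 0)"
    proof (cases "?D \<le> vnorm (v1 - v2)")
      case True
      then show ?thesis using PP_detour[of v1 v2 n w] by simp
    next
      case False
      have "PP p (\<lambda>A :: (int ^ 'd) set set. False) = 0" by (simp add: PP_def ev_def)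
      then show ?thesis using False by (simp only: simp_thms if_False)
    qed
  qed
  finally show ?thesis by simp
qed

text \<open>Half of the decay rate pays for the radius, the other half for the sum over z.\<close>

lemma outside_bound:
  fixes n1 :: "int ^ 'd"
  assumes c: "0 < c" "\<And>x :: real ^ 'd. c * norm x \<le> xi x" and r: "0 \<le> r"
    and E: "lsum (\<lambda>x :: int ^ 'd. ennreal (exp (- (c / 2) * vnorm x))) = ennreal E" "0 \<le> E"
  shows "PP p (\<lambda>A. \<exists>z. z \<notin> {z. vnorm (z - n1) \<le> r} \<and> cn n1 z A) \<le> exp (- (c / 2) * r) * E"
proof -
  have td: "t x \<le> exp (- c * vnorm x)" for x
    using t_le_exp_xi[of x] c(2)[of "vec_of_int x"] by (simp add: vnorm_def order_trans)
  have "ennreal (PP p (\<lambda>A. \<exists>z. z \<notin> {z. vnorm (z - n1) \<le> r} \<and> cn n1 z A))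
    \<le> lsum (\<lambda>z. ennreal (PP p (\<lambda>A. z \<notin> {z. vnorm (z - n1) \<le> r} \<and> cn n1 z A)))"
    by (rule PP_union[OF p01]) (auto intro!: fin_incr_Ex fin_incr_conj_const)
  also have "\<dots> \<le> lsum (\<lambda>z. ennreal (exp (- (c / 2) * r)) * ennreal (exp (- (c / 2) * vnorm (z - n1))))"
  proof (rule lsum_mono)
    fix z
    show "ennreal (PP p (\<lambda>A. z \<notin> {z. vnorm (z - n1) \<le> r} \<and> cn n1 z A)) \<le> ennreal (exp (- (c / 2) * r)) * ennreal (exp (- (c / 2) * vnorm (z - n1)))"
    proof (cases "vnorm (z - n1) \<le> r")
      case False
      then have "PP p (\<lambda>A. z \<notin> {z. vnorm (z - n1) \<le> r} \<and> cn n1 z A) = t (z - n1)"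
        using tau_t[of n1 z] by (simp add: tau_def)
      also have "\<dots> \<le> exp (- c * vnorm (z - n1))" by (rule td)
      also have "\<dots> \<le> exp (- (c / 2) * r + - (c / 2) * vnorm (z - n1))"
      proof -
        have "c / 2 * r \<le> c / 2 * vnorm (z - n1)" using False c(1) by (intro mult_left_mono) auto
        then show ?thesis by simp
      qed
      finally show ?thesis unfolding exp_add by (subst ennreal_mult[symmetric]) (simp_all only: exp_ge_zero ennreal_leI)
    next
      case True
      have "PP p (\<lambda>A :: (int ^ 'd) set set. False) = 0" by (simp add: PP_def ev_def)
      with True show ?thesis by simp
    qed
  qed
  also have "\<dots> = ennreal (exp (- (c / 2) * r)) * lsum (\<lambda>z. (\<lambda>x. ennreal (exp (- (c / 2) * vnorm x))) (z - n1))"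
    by (simp only: lsum_cmult)
  also have "\<dots> = ennreal (exp (- (c / 2) * r)) * ennreal E"
    by (subst lsum_shift') (simp only: E(1))
  finally show ?thesis using E(2) by (simp add: ennreal_le_iff flip: ennreal_mult)
qed

text \<open>By homogeneity the exponents add up to N times \<open>phi\<close> at w / N, which is at
  least its minimum. The prefactor accounts for rounding the three endpoints.\<close>

lemma product_bound:
  fixes x :: "(real ^ 'd) ^ 3"
  assumes N: "0 < N"
  shows "(\<Prod>i\<in>UNIV. t (w - int_part3 (real N *\<^sub>R x) $ i)) \<le> exp (3 * (K * real CARD('d) * real CARD('d))) * exp (- real N * phi p x (minimizer p x))"
proof -
  let ?C = "K * real CARD('d) * real CARD('d)"
  have 1: "t (w - int_part3 (real N *\<^sub>R x) $ i) \<le> exp (?C - real N * xi (vec_of_int w /\<^sub>R real N - x $ i))" for i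
  proof -
    let ?n = "int_part (real N *\<^sub>R x $ i)"
    have "xi (vec_of_int w - real N *\<^sub>R x $ i) \<le> xi (vec_of_int (w - ?n)) + xi (vec_of_int ?n - real N *\<^sub>R x $ i)"
      using xi_triangle[of "vec_of_int (w - ?n)" "vec_of_int ?n - real N *\<^sub>R x $ i"] by (simp add: vec_of_int_diff)
    also have "xi (vec_of_int ?n - real N *\<^sub>R x $ i) \<le> ?C"
    proof -
      have "0 \<le> K * real CARD('d)" using K_pos by simp
      from xi_upper[of "vec_of_int ?n - real N *\<^sub>R x $ i"] mult_left_mono[OF vec_int_part[of "real N *\<^sub>R x $ i"] this]
      show ?thesis by linarith
    qed
    finally have "xi (vec_of_int w - real N *\<^sub>R x $ i) \<le> xi (vec_of_int (w - ?n)) + ?C" by simp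
    moreover have "vec_of_int w - real N *\<^sub>R x $ i = real N *\<^sub>R (vec_of_int w /\<^sub>R real N - x $ i)"
      using N by (simp add: scaleR_diff_right)
    then have "xi (vec_of_int w - real N *\<^sub>R x $ i) = real N * xi (vec_of_int w /\<^sub>R real N - x $ i)"
      by (simp only: xi_scale[OF of_nat_0_le_iff])
    ultimately have "- xi (vec_of_int (w - ?n)) \<le> ?C - real N * xi (vec_of_int w /\<^sub>R real N - x $ i)" by simp
    then have "exp (- xi (vec_of_int (w - ?n))) \<le> exp (?C - real N * xi (vec_of_int w /\<^sub>R real N - x $ i))"
      by (simp only: exp_le_cancel_iff)
    with t_le_exp_xi[of "w - ?n"] have "t (w - ?n) \<le> exp (?C - real N * xi (vec_of_int w /\<^sub>R real N - x $ i))"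
      by (rule order_trans)
    moreover have "int_part3 (real N *\<^sub>R x) $ i = ?n" by (simp add: int_part3_def)
    ultimately show ?thesis by (simp only:)
  qed
  have "(\<Prod>i\<in>UNIV. t (w - int_part3 (real N *\<^sub>R x) $ i)) \<le> (\<Prod>i\<in>UNIV. exp (?C - real N * xi (vec_of_int w /\<^sub>R real N - x $ i)))"
    using 1 t_pos by (intro prod_mono) (auto intro: less_imp_le)
  also have "\<dots> = exp (\<Sum>i\<in>UNIV. ?C - real N * xi (vec_of_int w /\<^sub>R real N - x $ i))" by (rule exp_sum[symmetric]) simp
  also have "(\<Sum>i\<in>UNIV. ?C - real N * xi (vec_of_int w /\<^sub>R real N - x $ i)) = 3 * ?C - real N * phi p x (vec_of_int w /\<^sub>R real N)"
    by (simp add: phi_def sum_subtractf sum_distrib_left)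
  also have "exp (3 * ?C - real N * phi p x (vec_of_int w /\<^sub>R real N)) \<le> exp (3 * ?C + - real N * phi p x (minimizer p x))"
    using minimizer_le[of x "vec_of_int w /\<^sub>R real N"] by (simp add: mult_left_mono)
  finally show ?thesis by (simp only: exp_add)
qed

lemma card_ball_bound:
  assumes "0 \<le> r"
  shows "finite {z :: int ^ 'd. vnorm (z - n1) \<le> r}" "real (card {z :: int ^ 'd. vnorm (z - n1) \<le> r}) \<le> (2 * r + 3) ^ CARD('d)"
proof -
  let ?m = "nat \<lceil>r\<rceil>"
  have sub: "{z :: int ^ 'd. vnorm (z - n1) \<le> r} \<subseteq> (\<lambda>y. y + n1) ` lbox ?m"
  proof
    fix z :: "int ^ 'd" assume z: "z \<in> {z. vnorm (z - n1) \<le> r}"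
    have "\<bar>(z - n1) $ i\<bar> \<le> int ?m" for i
    proof -
      have "real_of_int \<bar>(z - n1) $ i\<bar> \<le> r" using vnorm_component[of "z - n1" i] z by simp
      then have "\<bar>(z - n1) $ i\<bar> \<le> \<lceil>r\<rceil>" by linarith
      then show ?thesis by linarith
    qed
    then have "z - n1 \<in> lbox ?m" by (simp add: lbox_def)
    then show "z \<in> (\<lambda>y. y + n1) ` lbox ?m" by (rule rev_image_eqI) simp
  qed
  show "finite {z :: int ^ 'd. vnorm (z - n1) \<le> r}" by (rule finite_subset[OF sub]) simp
  have "card {z :: int ^ 'd. vnorm (z - n1) \<le> r} \<le> card (lbox ?m :: (int ^ 'd) set)"
    using card_mono[OF _ sub] card_image_le[of "lbox ?m" "\<lambda>y. y + n1"] by fastforce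
  also have "\<dots> \<le> (2 * ?m + 1) ^ CARD('d)" by (rule card_lbox)
  finally have "real (card {z :: int ^ 'd. vnorm (z - n1) \<le> r}) \<le> real ((2 * ?m + 1) ^ CARD('d))" by (simp only: of_nat_le_iff)
  also have "\<dots> = (2 * real ?m + 1) ^ CARD('d)" by (simp add: add.commute)
  also have "\<dots> \<le> (2 * r + 3) ^ CARD('d)"
  proof (rule power_mono)
    have "real ?m \<le> r + 1" using assms by linarith
    then show "2 * real ?m + 1 \<le> 2 * r + 3" by simp
  qed simp
  finally show "real (card {z :: int ^ 'd. vnorm (z - n1) \<le> r}) \<le> (2 * r + 3) ^ CARD('d)" .
qed

text \<open>The triple sum has polynomially many terms, each gaining exp (- (c/2) N^\<beta>) from
  the detour over the minimal tripod cost; half of this gain absorbs the number of terms.\<close>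

lemma two_branching_points:
  fixes x :: "(real ^ 'd) ^ 3"
  assumes \<beta>: "0 < \<beta>" and m: "0 < m" "m \<le> \<beta>" "m \<le> 1"
  shows "\<exists>c>0. \<forall>\<^sub>F N::nat in sequentially. \<forall>k1 k2 :: int ^ 'd. vnorm (k1 - k2) > real N powr \<beta> \<longrightarrow>
    measure (percolation p) (F_event p k1 (int_part3 (real N *\<^sub>R x)) \<inter> F_event p k2 (int_part3 (real N *\<^sub>R x)))
      \<le> exp (- real N * phi p x (minimizer p x) - c * real N powr m)"
proof -
  obtain c where c: "c > 0" "\<And>x :: real ^ 'd. c * norm x \<le> xi x" using xi_lower by blast
  define \<Phi> where "\<Phi> = phi p x (minimizer p x)"
  have \<Phi>: "0 \<le> \<Phi>" unfolding \<Phi>_def phi_def by (intro sum_nonneg xi_nonneg)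
  \<comment> \<open>Chosen so that (c / 2) \<rho> N = N \<Phi> + N: leaving the ball costs an
    additional factor exp (- N).\<close>
  define \<rho> where "\<rho> = 2 / c * (\<Phi> + 1)"
  have \<rho>: "0 < \<rho>" using c \<Phi> by (simp add: \<rho>_def)
  have "lsum (\<lambda>x :: int ^ 'd. ennreal (exp (- (c / 2) * vnorm x))) < \<infinity>" by (rule exp_sum_finite) (use c in simp)
  then obtain E where E: "lsum (\<lambda>x :: int ^ 'd. ennreal (exp (- (c / 2) * vnorm x))) = ennreal E" "0 \<le> E"
    by (cases "lsum (\<lambda>x :: int ^ 'd. ennreal (exp (- (c / 2) * vnorm x)))") auto
  define C where "C = exp (3 * (K * real CARD('d) * real CARD('d)))"
  \<comment> \<open>c / 4 is what is left of the detour gain after the polynomial, and 1 / 2 what is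
    left of exp (- N) after the constant E.\<close>
  define c' where "c' = min (c / 4) (1 / 2)"
  have c': "0 < c'" using c by (simp add: c'_def)
  let ?M = "3 * CARD('d)"
  have ev1: "\<forall>\<^sub>F N :: nat in sequentially. C * ((2 * \<rho>) * real N + 3) ^ ?M * exp (- (c / 4) * real N powr \<beta>) \<le> 1/2"
    by (rule poly_times_stretched_exp) (use \<rho> c \<beta> in \<open>auto simp: C_def\<close>)
  \<comment> \<open>Degree 0: only a constant is absorbed, and E + 1 replaces E because the lemma
    asks for a positive one.\<close>
  have ev2: "\<forall>\<^sub>F N :: nat in sequentially. (E + 1) * (1 * real N + 1) ^ 0 * exp (- (1/2) * real N powr 1) \<le> 1/2"
    by (rule poly_times_stretched_exp) (use E in auto)
  show ?thesis
  proof (intro exI[of _ c'] conjI c')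
    show "\<forall>\<^sub>F N::nat in sequentially. \<forall>k1 k2 :: int ^ 'd. vnorm (k1 - k2) > real N powr \<beta> \<longrightarrow>
      measure (percolation p) (F_event p k1 (int_part3 (real N *\<^sub>R x)) \<inter> F_event p k2 (int_part3 (real N *\<^sub>R x)))
      \<le> exp (- real N * phi p x (minimizer p x) - c' * real N powr m)"
      using ev1 ev2 eventually_gt_at_top[of 0]
    proof eventually_elim
      case (elim N)
      have N: "1 \<le> real N" using elim by simp
      show ?case
      proof (intro allI impI)
        fix k1 k2 :: "int ^ 'd" assume k: "real N powr \<beta> < vnorm (k1 - k2)"
        let ?n = "int_part3 (real N *\<^sub>R x)"
        let ?S = "{z. vnorm (z - ?n $ 1) \<le> \<rho> * real N}"
        have r0: "0 \<le> \<rho> * real N" using \<rho> by simp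
        note S = card_ball_bound[OF r0, of "?n $ 1"]
        let ?b = "exp (- (c / 2) * real N powr \<beta>) * (C * exp (- real N * \<Phi>))"
        have b0: "0 \<le> ?b" by (simp add: C_def)
        have trm: "(if vnorm (k1 - k2) / 2 \<le> vnorm (v1 - v2) then t (v2 - v1) * (\<Prod>i\<in>UNIV. t (w - ?n $ i)) else 0) \<le> ?b" for w v1 v2
        proof (cases "vnorm (k1 - k2) / 2 \<le> vnorm (v1 - v2)")
          case True
          have v: "real N powr \<beta> / 2 \<le> vnorm (v2 - v1)" using True k vnorm_minus[of "v1 - v2"] by simp
          have "t (v2 - v1) \<le> exp (- c * vnorm (v2 - v1))"
            using t_le_exp_xi[of "v2 - v1"] c(2)[of "vec_of_int (v2 - v1)"] by (simp add: vnorm_def order_trans)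
          also have "\<dots> \<le> exp (- (c / 2) * real N powr \<beta>)" using mult_left_mono[OF v, of c] c(1) by simp
          finally have "t (v2 - v1) \<le> exp (- (c / 2) * real N powr \<beta>)" .
          moreover have "(\<Prod>i\<in>UNIV. t (w - ?n $ i)) \<le> C * exp (- real N * \<Phi>)"
            unfolding C_def \<Phi>_def by (rule product_bound) (use elim in simp)
          ultimately have "t (v2 - v1) * (\<Prod>i\<in>UNIV. t (w - ?n $ i)) \<le> ?b"
            by (intro mult_mono prod_nonneg) (auto intro: less_imp_le t_pos)
          then show ?thesis using True by simp
        qed (use b0 in simp)
        have "measure (percolation p) (F_event p k1 ?n \<inter> F_event p k2 ?n)
          \<le> (\<Sum>(w, v1, v2)\<in>?S \<times> ?S \<times> ?S. if vnorm (k1 - k2) / 2 \<le> vnorm (v1 - v2) then t (v2 - v1) * (\<Prod>i\<in>UNIV. t (w - ?n $ i)) else 0)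
            + PP p (\<lambda>A. \<exists>z. z \<notin> ?S \<and> cn (?n $ 1) z A)"
          by (rule F_events_bound[OF S(1)])
        also have "\<dots> \<le> (\<Sum>(w, v1, v2)\<in>?S \<times> ?S \<times> ?S. ?b) + exp (- (c / 2) * (\<rho> * real N)) * E"
          by (intro add_mono sum_mono outside_bound[OF c r0 E]) (use trm in auto)
        also have "(\<Sum>(w, v1, v2)\<in>?S \<times> ?S \<times> ?S. ?b) = real (card ?S) ^ 3 * ?b"
          by (simp add: case_prod_unfold card_cartesian_product power3_eq_cube)
        also have "\<dots> \<le> ((2 * (\<rho> * real N) + 3) ^ CARD('d)) ^ 3 * ?b"
          by (intro mult_right_mono power_mono S(2) b0) simp
        also have "((2 * (\<rho> * real N) + 3) ^ CARD('d)) ^ 3 * ?b =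
          (C * ((2 * \<rho>) * real N + 3) ^ ?M * exp (- (c / 4) * real N powr \<beta>)) * (exp (- (c / 4) * real N powr \<beta>) * exp (- real N * \<Phi>))"
        proof -
          have "exp (- (c / 2) * real N powr \<beta>) = exp (- (c / 4) * real N powr \<beta>) * exp (- (c / 4) * real N powr \<beta>)"
            by (simp flip: exp_add)
          moreover have "((2 * (\<rho> * real N) + 3) ^ CARD('d)) ^ 3 = ((2 * \<rho>) * real N + 3) ^ ?M"
            by (simp only: power_mult[symmetric] mult.assoc mult.commute[of 3])
          ultimately show ?thesis by (simp only: mult_ac)
        qed
        also have "\<dots> \<le> 1/2 * (exp (- c' * real N powr m) * exp (- real N * \<Phi>))"
        proof (intro mult_mono elim mult_right_mono)
          have "c' * real N powr m \<le> c / 4 * real N powr \<beta>"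
            using c N m by (intro mult_mono powr_mono) (auto simp: c'_def)
          then show "exp (- (c / 4) * real N powr \<beta>) \<le> exp (- c' * real N powr m)" by simp
        qed auto
        also have "exp (- (c / 2) * (\<rho> * real N)) * E \<le> 1/2 * (exp (- c' * real N powr m) * exp (- real N * \<Phi>))"
        proof -
          have "- (c / 2) * (\<rho> * real N) = - (1/2) * real N powr 1 + (- (real N / 2) + - real N * \<Phi>)"
            using c N by (simp add: \<rho>_def field_simps)
          then have "exp (- (c / 2) * (\<rho> * real N)) * E = (E * exp (- (1/2) * real N powr 1)) * (exp (- (real N / 2)) * exp (- real N * \<Phi>))"
            by (simp only: exp_add mult_ac)
          also have "\<dots> \<le> 1/2 * (exp (- c' * real N powr m) * exp (- real N * \<Phi>))"
          proof (intro mult_mono mult_right_mono)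
            have "E * exp (- (1/2) * real N powr 1) \<le> (E + 1) * exp (- (1/2) * real N powr 1)" by (intro mult_right_mono) auto
            moreover have "(E + 1) * exp (- (1/2) * real N powr 1) \<le> 1/2" using elim(2) by (simp only: power_0 mult_1_right)
            ultimately show "E * exp (- (1/2) * real N powr 1) \<le> 1/2" by (rule order_trans)
            have "c' * real N powr m \<le> 1/2 * real N powr 1"
              using c N m by (intro mult_mono powr_mono) (auto simp: c'_def)
            then show "exp (- (real N / 2)) \<le> exp (- c' * real N powr m)" using N by simp
          qed auto
          finally show ?thesis .
        qed
        finally have "measure (percolation p) (F_event p k1 ?n \<inter> F_event p k2 ?n) \<le> exp (- c' * real N powr m) * exp (- real N * \<Phi>)"
          by (simp add: mult.commute)
        also have "\<dots> = exp (- real N * phi p x (minimizer p x) - c' * real N powr m)"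
          by (simp add: \<Phi>_def flip: exp_add)
        finally show "measure (percolation p) (F_event p k1 ?n \<inter> F_event p k2 ?n) \<le> exp (- real N * phi p x (minimizer p x) - c' * real N powr m)" .
      qed
    qed
  qed
qed

end

theorem mainTheorem2:
  fixes p \<epsilon> \<beta> :: real and x :: "(real ^ 'd::finite) ^ 3"
  assumes "CARD('d) \<ge> 2"
    and "0 < p" and "p < critical_prob TYPE('d)"
    and "x \<in> X3' p"
    and "0 < \<epsilon>" and "\<epsilon> < 1/2"
    and "0 < \<beta>" and "\<beta> < 1/2"
  shows "\<exists>c>0. \<forall>\<^sub>F N::nat in sequentially. \<forall>k1 k2 :: int ^ 'd.
           inv_conn_length p (vec_of_int k1 - real N *\<^sub>R minimizer p x) \<le> real N powr (1/2 + \<epsilon>) \<longrightarrow>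
           inv_conn_length p (vec_of_int k2 - real N *\<^sub>R minimizer p x) \<le> real N powr (1/2 + \<epsilon>) \<longrightarrow>
           norm (vec_of_int k1 - vec_of_int k2) > real N powr \<beta> \<longrightarrow>
           measure (percolation p)
             (F_event p k1 (int_part3 (real N *\<^sub>R x)) \<inter> F_event p k2 (int_part3 (real N *\<^sub>R x)))
           \<le> exp (- real N * phi p x (minimizer p x) - c * real N powr (min \<beta> (2 * \<epsilon>)))"
proof -
  interpret subcrit p "TYPE('d)" by unfold_locales (use assms in auto)
  obtain c where "c > 0" and c: "\<forall>\<^sub>F N::nat in sequentially. \<forall>k1 k2 :: int ^ 'd. vnorm (k1 - k2) > real N powr \<beta> \<longrightarrow>
    measure (percolation p) (F_event p k1 (int_part3 (real N *\<^sub>R x)) \<inter> F_event p k2 (int_part3 (real N *\<^sub>R x)))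
      \<le> exp (- real N * phi p x (minimizer p x) - c * real N powr (min \<beta> (2 * \<epsilon>)))"
  proof -
    have "0 < min \<beta> (2 * \<epsilon>)" "min \<beta> (2 * \<epsilon>) \<le> \<beta>" "min \<beta> (2 * \<epsilon>) \<le> 1" using assms by auto
    from two_branching_points[OF \<open>0 < \<beta>\<close> this, of x] show ?thesis using that by blast
  qed
  from c show ?thesis
    by (intro exI[of _ c] conjI \<open>c > 0\<close>) (auto elim!: eventually_mono simp: vnorm_def vec_of_int_diff)
qed

end
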